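(* Let $\alpha=\{\alpha_t:D_{t^{-1}}\to D_t\}_{t\in G}$ be a partial C*-dynamical system of a discrete group $G$ on a C*-algebra $A$, and write $\mathcal{A}_\alpha=\{A_t\}_{t\in G}$ for the associated Fell bundle. (1) The action $\alpha$ is RFD if and only if the bundle $\mathcal{A}_\alpha$ is RFD. (2) If the partial reduced crossed product $A\rtimes_\lambda^\alpha G$ is RFD, so is the action $\alpha$. (3) If $A$ is separable, $G$ is countable, and if $\alpha$ and $C^*_\lambda(G)$ are RFD, then the reduced crossed product $A\rtimes_\lambda^\alpha G$ is RFD.
   Context: Groups are discrete with neutral element $e$; $C^*_\lambda(G)$ is the reduced group C*-algebra; $M_d$ is the algebra of complex $d\times d$ matrices. A partial C*-dynamical system consists of closed two-sided ideals $D_t\subseteq A$ and $*$-isomorphisms $\alpha_t:D_{t^{-1}}\to D_t$ ($t\in G$) with $D_e=A$, $\alpha_e=\mathrm{id}_A$, and $\alpha_{st}$ extending $\alpha_s\circ\alpha_t$ for all $s,t$ (if $a\in D_{t^{-1}}$ and $\alpha_t(a)\in D_{s^{-1}}$, then $a\in D_{(st)^{-1}}$ and $\alpha_{st}(a)=\alpha_s(\alpha_t(a))$). A partial $*$-representation of $G$ in a unital $*$-algebra $B$ is a map $v:G\to B$, $t\mapsto v_t$, with $v_e=1$, $v_{t^{-1}}=v_t^*$, $v_{s^{-1}}v_sv_t=v_{s^{-1}}v_{st}$ for all $s,t$. A covariant representation $(\varphi,v):(A,G,\alpha)\to B$ is a $*$-homomorphism $\varphi:A\to B$ together with a partial $*$-representation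 $v:G\to B$ such that $v_t\varphi(a)v_t^*=\varphi(\alpha_t(a))$ for all $t\in G$, $a\in D_{t^{-1}}$. The action $\alpha$ is RFD if for every $\varepsilon>0$ and finite $\Omega\subseteq A$ there are $d\in\mathbb{N}$ and a covariant representation $(\varphi,v):(A,G,\alpha)\to M_d$ with $\|\varphi(a)\|\ge\|a\|-\varepsilon$ for all $a\in\Omega$. The Fell bundle $\mathcal{A}_\alpha$ has fibers $A_s=D_s\times\{s\}$ with linear structure and norm of $D_s$, product $(a,s)(b,t)=(\alpha_s(\alpha_{s^{-1}}(a)b),st)$, involution $(a,s)^*=(\alpha_{s^{-1}}(a^* ),s^{-1})$. A representation of a Fell bundle $\mathcal{B}=\{B_t\}_{t\in G}$ in a $*$-algebra $C$ is a family of linear maps $\pi_t:B_t\to C$ with $\pi_s(a)\pi_t(b)=\pi_{st}(ab)$ and $\pi_s(a)^*=\pi_{s^{-1}}(a^* )$ for $a\in B_s$, $b\in B_t$. A Fell bundle $\mathcal{B}$ with total space $B=\bigsqcup_tB_t$ is RFD if for every $\varepsilon>0$ and finite $\Omega\subseteq B$ there are $d\in\mathbb{N}$ and a representation $\pi:\mathcal{B}\to M_d$ with $\|\pi_t(b)\|\ge\|b\|-\varepsilon$ for all $t\in G$, $b\in\Omega\cap B_t$. $A\rtimes_\lambda^\alpha G:=C^*_\lambda(\mathcal{A}_\alpha)$, where for a Fell bundle $\mathcal{B}$, $C_c(\mathcal{B})$ is the $*$-algebra of finitely supported sections ($x(t)\in B_t$) with $(xy)(s)=\sum_t x(t)y(t^{-1}s)$,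 $x^*(s)=x(s^{-1})^*$; $\ell_2(\mathcal{B})$ is the Hilbert $B_e$-module completion of $C_c(\mathcal{B})$ with $(\xi\cdot b)(s)=\xi(s)b$, $\langle\xi,\eta\rangle=\sum_t\xi(t)^*\eta(t)$; for $b\in B_s$, $\lambda_s(b)$ is the adjointable operator $(\lambda_s(b)\xi)(t)=b\,\xi(s^{-1}t)$; and $C^*_\lambda(\mathcal{B})$ is the completion of $C_c(\mathcal{B})$ in the norm $\|x\|_\lambda=\|\sum_t\lambda_t(x(t))\|$. A C*-algebra $A$ is RFD if for every $\varepsilon>0$ and finite $\Omega\subseteq A$ there are $d\in\mathbb{N}$ and a $*$-homomorphism $\varphi:A\to M_d$ with $\|\varphi(a)\|\ge\|a\|-\varepsilon$ for all $a\in\Omega$. *)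

theory Defs
  imports "HOL-Analysis.Analysis" "Jordan_Normal_Form.Schur_Decomposition"
begin

section \<open>C*-algebras\<close>

class complex_normed_space = real_normed_vector +
  fixes scaleC :: "complex \<Rightarrow> 'a \<Rightarrow> 'a"  (infixr "*C" 75)
  assumes scaleC_add_right: "c *C (x + y) = c *C x + c *C y"
    and scaleC_add_left: "(c + c') *C x = c *C x + c' *C x"
    and scaleC_scaleC: "c *C (c' *C x) = (c * c') *C x"
    and scaleC_of_real: "complex_of_real r *C x = r *\<^sub>R x"
    and norm_scaleC: "norm (c *C x) = cmod c * norm x"

text \<open>Not necessarily unital.\<close>

class cstar_algebra = complex_normed_space + real_normed_algebra + banach +
  fixes cstar :: "'a \<Rightarrow> 'a"
  assumes mult_scaleC_left: "(c *C x) * y = c *C (x * y)"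
    and mult_scaleC_right: "x * (c *C y) = c *C (x * y)"
    and cstar_add: "cstar (x + y) = cstar x + cstar y"
    and cstar_scaleC: "cstar (c *C x) = cnj c *C cstar x"
    and cstar_mult: "cstar (x * y) = cstar y * cstar x"
    and cstar_cstar: "cstar (cstar x) = x"
    and cstar_identity: "norm (cstar x * x) = (norm x)\<^sup>2"

text \<open>
  Algebras that depend on parameters (such as crossed products) cannot be types, so they are
  represented by records with an explicit carrier. The norm field may be only a seminorm;
  the elements of norm zero are divided out by the completion below.
\<close>

record 'v normed_space =
  nv_carrier :: "'v set"
  nv_add :: "'v \<Rightarrow> 'v \<Rightarrow> 'v"
  nv_scale :: "complex \<Rightarrow> 'v \<Rightarrow> 'v"
  nv_norm :: "'v \<Rightarrow> real"

record 'v star_alg = "'v normed_space" +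
  sa_mult :: "'v \<Rightarrow> 'v \<Rightarrow> 'v"
  sa_star :: "'v \<Rightarrow> 'v"

definition type_star_alg :: "'a::cstar_algebra star_alg" where
  "type_star_alg = \<lparr>nv_carrier = UNIV, nv_add = (+), nv_scale = scaleC, nv_norm = norm,
     sa_mult = (*), sa_star = cstar\<rparr>"

definition operator_norm :: "('v, 'm) normed_space_scheme \<Rightarrow> ('v \<Rightarrow> 'v) \<Rightarrow> real" where
  "operator_norm V T = (SUP x \<in> {x \<in> nv_carrier V. nv_norm V x \<le> 1}. nv_norm V (T x))"

subsection \<open>Completion by classes of Cauchy sequences\<close>

definition nv_dist :: "('v, 'm) normed_space_scheme \<Rightarrow> 'v \<Rightarrow> 'v \<Rightarrow> real" where
  "nv_dist V x y = nv_norm V (nv_add V x (nv_scale V (-1) y))"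

definition cauchy_seqs :: "('v, 'm) normed_space_scheme \<Rightarrow> (nat \<Rightarrow> 'v) set" where
  "cauchy_seqs V = {u. (\<forall>n. u n \<in> nv_carrier V) \<and>
     (\<forall>e>0. \<exists>N. \<forall>m\<ge>N. \<forall>n\<ge>N. nv_dist V (u m) (u n) < e)}"

definition cauchy_class :: "('v, 'm) normed_space_scheme \<Rightarrow> (nat \<Rightarrow> 'v) \<Rightarrow> (nat \<Rightarrow> 'v) set" where
  "cauchy_class V u = {w \<in> cauchy_seqs V. (\<lambda>n. nv_dist V (u n) (w n)) \<longlonglongrightarrow> 0}"

definition class_rep :: "(nat \<Rightarrow> 'v) set \<Rightarrow> nat \<Rightarrow> 'v" where
  "class_rep P = (SOME u. u \<in> P)"

definition completion :: "('v, 'm) normed_space_scheme \<Rightarrow> (nat \<Rightarrow> 'v) set normed_space" where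
  "completion V = \<lparr>nv_carrier = cauchy_class V ` cauchy_seqs V,
     nv_add = (\<lambda>P Q. cauchy_class V (\<lambda>n. nv_add V (class_rep P n) (class_rep Q n))),
     nv_scale = (\<lambda>c P. cauchy_class V (\<lambda>n. nv_scale V c (class_rep P n))),
     nv_norm = (\<lambda>P. lim (\<lambda>n. nv_norm V (class_rep P n)))\<rparr>"

text \<open>The continuous extension to the completion of a bounded operator.\<close>

definition extend_op ::
    "('v, 'm) normed_space_scheme \<Rightarrow> ('v \<Rightarrow> 'v) \<Rightarrow> (nat \<Rightarrow> 'v) set \<Rightarrow> (nat \<Rightarrow> 'v) set" where
  "extend_op V T P = cauchy_class V (\<lambda>n. T (class_rep P n))"

definition star_completion :: "'v star_alg \<Rightarrow> (nat \<Rightarrow> 'v) set star_alg" where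
  "star_completion X = normed_space.extend (completion X)
     \<lparr>sa_mult = (\<lambda>P Q. cauchy_class X (\<lambda>n. sa_mult X (class_rep P n) (class_rep Q n))),
      sa_star = (\<lambda>P. cauchy_class X (\<lambda>n. sa_star X (class_rep P n)))\<rparr>"

section \<open>Matrix algebras and residual finite-dimensionality\<close>

definition euclid_norm :: "complex Matrix.vec \<Rightarrow> real" where
  "euclid_norm u = sqrt (\<Sum>i<dim_vec u. (cmod (vec_index u i))\<^sup>2)"

definition mat_norm :: "complex mat \<Rightarrow> real" where
  "mat_norm M = (SUP u \<in> {u \<in> carrier_vec (dim_col M). euclid_norm u \<le> 1}.
     euclid_norm (mult_mat_vec M u))"

definition star_hom_mat :: "'v star_alg \<Rightarrow> nat \<Rightarrow> ('v \<Rightarrow> complex mat) \<Rightarrow> bool" where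
  "star_hom_mat X d \<phi> \<longleftrightarrow>
     (\<forall>a\<in>nv_carrier X. \<phi> a \<in> carrier_mat d d) \<and>
     (\<forall>a\<in>nv_carrier X. \<forall>b\<in>nv_carrier X. \<phi> (nv_add X a b) = \<phi> a + \<phi> b) \<and>
     (\<forall>c. \<forall>a\<in>nv_carrier X. \<phi> (nv_scale X c a) = c \<cdot>\<^sub>m \<phi> a) \<and>
     (\<forall>a\<in>nv_carrier X. \<forall>b\<in>nv_carrier X. \<phi> (sa_mult X a b) = \<phi> a * \<phi> b) \<and>
     (\<forall>a\<in>nv_carrier X. \<phi> (sa_star X a) = mat_adjoint (\<phi> a))"

definition rfd_algebra :: "'v star_alg \<Rightarrow> bool" where
  "rfd_algebra X \<longleftrightarrow> (\<forall>e>0. \<forall>\<Omega>. finite \<Omega> \<and> \<Omega> \<subseteq> nv_carrier X \<longrightarrow>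
     (\<exists>d>0. \<exists>\<phi>. star_hom_mat X d \<phi> \<and> (\<forall>a\<in>\<Omega>. mat_norm (\<phi> a) \<ge> nv_norm X a - e)))"

section \<open>Partial actions\<close>

text \<open>
  Groups are the types of class \<open>group_add\<close>: written additively, but not assumed commutative.
  The map \<open>\<alpha> t\<close> is a total function of which only the restriction to \<open>D (- t)\<close> matters.
\<close>

definition closed_ideal :: "'a::cstar_algebra set \<Rightarrow> bool" where
  "closed_ideal I \<longleftrightarrow> closed I \<and> 0 \<in> I \<and> (\<forall>a\<in>I. \<forall>b\<in>I. a + b \<in> I) \<and>
     (\<forall>c. \<forall>a\<in>I. c *C a \<in> I) \<and> (\<forall>x. \<forall>a\<in>I. x * a \<in> I \<and> a * x \<in> I)"

definition star_iso_on ::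
    "'a::cstar_algebra set \<Rightarrow> 'a set \<Rightarrow> ('a \<Rightarrow> 'a) \<Rightarrow> bool" where
  "star_iso_on I J f \<longleftrightarrow> bij_betw f I J \<and>
     (\<forall>a\<in>I. \<forall>b\<in>I. f (a + b) = f a + f b \<and> f (a * b) = f a * f b) \<and>
     (\<forall>a\<in>I. (\<forall>c. f (c *C a) = c *C f a) \<and> f (cstar a) = cstar (f a))"

definition partial_dynamical_system ::
    "('g::group_add \<Rightarrow> 'a::cstar_algebra set) \<Rightarrow> ('g \<Rightarrow> 'a \<Rightarrow> 'a) \<Rightarrow> bool" where
  "partial_dynamical_system D \<alpha> \<longleftrightarrow>
     (\<forall>t. closed_ideal (D t)) \<and>
     (\<forall>t. star_iso_on (D (- t)) (D t) (\<alpha> t)) \<and>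
     D 0 = UNIV \<and> (\<forall>a. \<alpha> 0 a = a) \<and>
     (\<forall>s t. \<forall>a\<in>D (- t). \<alpha> t a \<in> D (- s) \<longrightarrow>
        a \<in> D (- (s + t)) \<and> \<alpha> (s + t) a = \<alpha> s (\<alpha> t a))"

definition partial_star_rep :: "nat \<Rightarrow> ('g::group_add \<Rightarrow> complex mat) \<Rightarrow> bool" where
  "partial_star_rep d v \<longleftrightarrow>
     (\<forall>t. v t \<in> carrier_mat d d) \<and> v 0 = 1\<^sub>m d \<and> (\<forall>t. v (- t) = mat_adjoint (v t)) \<and>
     (\<forall>s t. v (- s) * v s * v t = v (- s) * v (s + t))"

definition covariant_rep ::
    "('g::group_add \<Rightarrow> 'a::cstar_algebra set) \<Rightarrow> ('g \<Rightarrow> 'a \<Rightarrow> 'a) \<Rightarrow> nat \<Rightarrow>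
     ('a \<Rightarrow> complex mat) \<Rightarrow> ('g \<Rightarrow> complex mat) \<Rightarrow> bool" where
  "covariant_rep D \<alpha> d \<phi> v \<longleftrightarrow> star_hom_mat type_star_alg d \<phi> \<and> partial_star_rep d v \<and>
     (\<forall>t. \<forall>a\<in>D (- t). v t * \<phi> a * mat_adjoint (v t) = \<phi> (\<alpha> t a))"

definition rfd_action ::
    "('g::group_add \<Rightarrow> 'a::cstar_algebra set) \<Rightarrow> ('g \<Rightarrow> 'a \<Rightarrow> 'a) \<Rightarrow> bool" where
  "rfd_action D \<alpha> \<longleftrightarrow> (\<forall>e>0. \<forall>\<Omega>. finite \<Omega> \<longrightarrow>
     (\<exists>d>0. \<exists>\<phi> v. covariant_rep D \<alpha> d \<phi> v \<and> (\<forall>a\<in>\<Omega>. mat_norm (\<phi> a) \<ge> norm a - e)))"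

section \<open>Fell bundles\<close>

text \<open>
  The data of a Fell bundle. The fibres are subspaces of one ambient normed space, which
  provides their linear structure and norm. They need not be disjoint there: a point of the
  total space is a pair \<open>(t, b)\<close> with \<open>b \<in> fibre B t\<close>, and \<open>fb_mult B s t\<close>, \<open>fb_star B s\<close> are
  the product of the fibres over \<open>s\<close> and \<open>t\<close> into the one over \<open>s + t\<close> and the involution of
  the fibre over \<open>s\<close> into the one over \<open>- s\<close>.
\<close>

record ('g, 'b) fell_bundle =
  fibre :: "'g \<Rightarrow> 'b set"
  fb_mult :: "'g \<Rightarrow> 'g \<Rightarrow> 'b \<Rightarrow> 'b \<Rightarrow> 'b"
  fb_star :: "'g \<Rightarrow> 'b \<Rightarrow> 'b"

definition action_bundle ::
    "('g::group_add \<Rightarrow> 'a::cstar_algebra set) \<Rightarrow> ('g \<Rightarrow> 'a \<Rightarrow> 'a) \<Rightarrow> ('g, 'a) fell_bundle" where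
  "action_bundle D \<alpha> = \<lparr>fibre = D, fb_mult = (\<lambda>s t a b. \<alpha> s (\<alpha> (- s) a * b)),
     fb_star = (\<lambda>s a. \<alpha> (- s) (cstar a))\<rparr>"

definition bundle_rep ::
    "('g::group_add, 'b::complex_normed_space) fell_bundle \<Rightarrow> nat \<Rightarrow> ('g \<Rightarrow> 'b \<Rightarrow> complex mat) \<Rightarrow> bool" where
  "bundle_rep B d \<pi> \<longleftrightarrow>
     (\<forall>t. \<forall>a\<in>fibre B t. \<pi> t a \<in> carrier_mat d d) \<and>
     (\<forall>t. \<forall>a\<in>fibre B t. \<forall>b\<in>fibre B t. \<pi> t (a + b) = \<pi> t a + \<pi> t b) \<and>
     (\<forall>t c. \<forall>a\<in>fibre B t. \<pi> t (c *C a) = c \<cdot>\<^sub>m \<pi> t a) \<and>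
     (\<forall>s t. \<forall>a\<in>fibre B s. \<forall>b\<in>fibre B t. \<pi> s a * \<pi> t b = \<pi> (s + t) (fb_mult B s t a b)) \<and>
     (\<forall>s. \<forall>a\<in>fibre B s. mat_adjoint (\<pi> s a) = \<pi> (- s) (fb_star B s a))"

definition rfd_bundle :: "('g::group_add, 'b::complex_normed_space) fell_bundle \<Rightarrow> bool" where
  "rfd_bundle B \<longleftrightarrow> (\<forall>e>0. \<forall>\<Omega>. finite \<Omega> \<and> \<Omega> \<subseteq> Sigma UNIV (fibre B) \<longrightarrow>
     (\<exists>d>0. \<exists>\<pi>. bundle_rep B d \<pi> \<and> (\<forall>(t, b)\<in>\<Omega>. mat_norm (\<pi> t b) \<ge> norm b - e)))"

subsection \<open>The reduced C*-algebra of a Fell bundle\<close>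

definition supp :: "('g \<Rightarrow> 'b::zero) \<Rightarrow> 'g set" where
  "supp x = {t. x t \<noteq> 0}"

definition finite_sections :: "('g, 'b::zero) fell_bundle \<Rightarrow> ('g \<Rightarrow> 'b) set" where
  "finite_sections B = {x. finite (supp x) \<and> (\<forall>t. x t \<in> fibre B t)}"

definition section_inner ::
    "('g::group_add, 'b::complex_normed_space) fell_bundle \<Rightarrow> ('g \<Rightarrow> 'b) \<Rightarrow> ('g \<Rightarrow> 'b) \<Rightarrow> 'b" where
  "section_inner B \<xi> \<eta> = (\<Sum>t\<in>supp \<xi>. fb_mult B (- t) t (fb_star B t (\<xi> t)) (\<eta> t))"

text \<open>Finitely supported sections with their Hilbert module norm, and the completion of this
  space. The module operations play no role for the operator norm and are not recorded.\<close>

definition pre_l2 ::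
    "('g::group_add, 'b::complex_normed_space) fell_bundle \<Rightarrow> ('g \<Rightarrow> 'b) normed_space" where
  "pre_l2 B = \<lparr>nv_carrier = finite_sections B, nv_add = (\<lambda>\<xi> \<eta> t. \<xi> t + \<eta> t),
     nv_scale = (\<lambda>c \<xi> t. c *C \<xi> t), nv_norm = (\<lambda>\<xi>. sqrt (norm (section_inner B \<xi> \<xi>)))\<rparr>"

definition l2_bundle ::
    "('g::group_add, 'b::complex_normed_space) fell_bundle \<Rightarrow> (nat \<Rightarrow> 'g \<Rightarrow> 'b) set normed_space" where
  "l2_bundle B = completion (pre_l2 B)"

definition lambda_op ::
    "('g::group_add, 'b::complex_normed_space) fell_bundle \<Rightarrow> 'g \<Rightarrow> 'b \<Rightarrow> ('g \<Rightarrow> 'b) \<Rightarrow> 'g \<Rightarrow> 'b" where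
  "lambda_op B s b \<xi> = (\<lambda>t. fb_mult B s (- s + t) b (\<xi> (- s + t)))"

definition reduced_norm ::
    "('g::group_add, 'b::complex_normed_space) fell_bundle \<Rightarrow> ('g \<Rightarrow> 'b) \<Rightarrow> real" where
  "reduced_norm B x = operator_norm (l2_bundle B)
     (extend_op (pre_l2 B) (\<lambda>\<xi> r. \<Sum>t\<in>supp x. lambda_op B t (x t) \<xi> r))"

definition section_algebra ::
    "('g::group_add, 'b::complex_normed_space) fell_bundle \<Rightarrow> ('g \<Rightarrow> 'b) star_alg" where
  "section_algebra B = \<lparr>nv_carrier = finite_sections B, nv_add = (\<lambda>x y t. x t + y t),
     nv_scale = (\<lambda>c x t. c *C x t), nv_norm = reduced_norm B,
     sa_mult = (\<lambda>x y s. \<Sum>t\<in>supp x. fb_mult B t (- t + s) (x t) (y (- t + s))),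
     sa_star = (\<lambda>x s. fb_star B (- s) (x (- s)))\<rparr>"

definition reduced_bundle_algebra ::
    "('g::group_add, 'b::complex_normed_space) fell_bundle \<Rightarrow> (nat \<Rightarrow> 'g \<Rightarrow> 'b) set star_alg" where
  "reduced_bundle_algebra B = star_completion (section_algebra B)"

definition reduced_crossed_product ::
    "('g::group_add \<Rightarrow> 'a::cstar_algebra set) \<Rightarrow> ('g \<Rightarrow> 'a \<Rightarrow> 'a) \<Rightarrow>
     (nat \<Rightarrow> 'g \<Rightarrow> 'a) set star_alg" where
  "reduced_crossed_product D \<alpha> = reduced_bundle_algebra (action_bundle D \<alpha>)"

section \<open>The reduced group C*-algebra\<close>

definition l2_group :: "('g \<Rightarrow> complex) normed_space" where
  "l2_group = \<lparr>nv_carrier = {\<xi>. (\<lambda>t. (cmod (\<xi> t))\<^sup>2) summable_on UNIV},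
     nv_add = (\<lambda>\<xi> \<eta> t. \<xi> t + \<eta> t), nv_scale = (\<lambda>c \<xi> t. c * \<xi> t),
     nv_norm = (\<lambda>\<xi>. sqrt (\<Sum>\<^sub>\<infinity>t. (cmod (\<xi> t))\<^sup>2))\<rparr>"

definition convolve :: "('g::group_add \<Rightarrow> complex) \<Rightarrow> ('g \<Rightarrow> complex) \<Rightarrow> 'g \<Rightarrow> complex" where
  "convolve x \<xi> = (\<lambda>s. \<Sum>t\<in>supp x. x t * \<xi> (- t + s))"

text \<open>The group algebra with the norm of its left regular representation \<open>convolve\<close> on
  the Hilbert space of square summable functions.\<close>

definition group_algebra :: "('g::group_add \<Rightarrow> complex) star_alg" where
  "group_algebra = \<lparr>nv_carrier = {x. finite (supp x)}, nv_add = (\<lambda>x y t. x t + y t),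
     nv_scale = (\<lambda>c x t. c * x t), nv_norm = (\<lambda>x. operator_norm l2_group (convolve x)),
     sa_mult = convolve, sa_star = (\<lambda>x s. cnj (x (- s)))\<rparr>"

definition reduced_group_algebra :: "(nat \<Rightarrow> 'g::group_add \<Rightarrow> complex) set star_alg" where
  "reduced_group_algebra = star_completion group_algebra"

end

theory Submission
  imports Defs "HOL-Library.Function_Algebras" "Jordan_Normal_Form.Spectral_Radius"
begin

text \<open>
  Part (1): a representation \<open>\<pi>\<close> of the bundle in matrices gives the covariant representation
  \<open>(\<pi>\<^sub>0, v)\<close>, where \<open>v\<^sub>t = \<pi>\<^sub>t(e\<^sub>t)\<close> for an \<open>e\<^sub>t \<in> D\<^sub>t\<close> that \<open>\<pi>\<^sub>0\<close> maps to the unit of the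
  finite-dimensional algebra \<open>\<pi>\<^sub>0(D\<^sub>t)\<close>; conversely \<open>\<pi>\<^sub>t(a) = \<phi>(a) v\<^sub>t\<close>.
  Part (2): restrict representations of the crossed product to the fibres.

  Part (3): a representation \<open>\<pi>\<close> of the bundle on \<open>\<complex>\<^sup>d\<close> turns a finitely supported section \<open>x\<close> into
  the matrix \<open>E(x)\<close> of functions \<open>E\<^sub>i\<^sub>j(x)(t) = \<pi>\<^sub>t(x(t))\<^sub>i\<^sub>j\<close> on \<open>G\<close>, and \<open>E\<close> is multiplicative. With
  \<open>h = x\<^sup>* x\<close> the sequence of norms of \<open>E(h)\<^sup>n F\<close> is logarithmically convex for every vector \<open>F\<close> of
  functions. As the 2-norm of a section dominates that of its entries, this gives
  \<open>\<parallel>E(x)\<parallel> \<le> \<parallel>x\<parallel>\<close>. It also shows that \<open>\<parallel>E(x) F\<parallel> > c \<parallel>F\<parallel>\<close> forces an entry of \<open>E(h\<^sup>n)\<close> to have norm at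
  least \<open>c\<^sup>2\<^sup>n / d\<^sup>2\<close>, and such an \<open>F\<close> exists with \<open>c\<close> close to \<open>\<parallel>x\<parallel>\<close> if \<open>\<pi>\<close> is nearly isometric on
  \<open>\<langle>x \<xi>, x \<xi>\<rangle>\<close> for a suitable \<open>\<xi>\<close>. A representation of the group algebra in matrices that nearly preserves the
  norms of the entries of \<open>E(h\<^sup>n)\<close> is then applied entrywise to \<open>E\<close>; for large \<open>n\<close> the factor \<open>d\<^sup>2\<close>
  does not matter.
\<close>

section \<open>C*-algebras\<close>

text \<open>Part (3) depends on the order of its choices: first a test vector \<open>\<xi>\<close>
  for each \<open>x\<close>, then \<open>\<pi>\<close> and with it \<open>d\<close>, then the
  exponent \<open>n\<close>, which has to beat a factor \<open>2 d^2\<close>, and only then the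
  representation of the group algebra, which has to nearly preserve the entries of that one power.
  The powers are there because control of the entries controls the norm of a \<open>d\<close> by
  \<open>d\<close> matrix only up to a factor depending on \<open>d\<close>, and \<open>d\<close>
  cannot be bounded in advance.

  Positivity means being the square of a selfadjoint element: square roots come from an iteration,
  and norm inequalities from identities that write an element as a sum of squares. Neither spectra
  nor states of C*-algebras occur. Eigenvalues occur only for matrices, where they show that a
  homomorphism of a completed algebra into matrices is contractive, although its definition does not
  ask for continuity.\<close>

lemma scaleC_zero_left [simp]: "0 *C (x::'a::complex_normed_space) = 0"
  using scaleC_of_real[of 0 x] by simp

lemma scaleC_zero_right [simp]: "c *C (0::'a::complex_normed_space) = 0"
  using scaleC_add_right[of c 0 "0::'a"] by simp

lemma scaleC_one [simp]: "1 *C (x::'a::complex_normed_space) = x"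
  using scaleC_of_real[of 1 x] by simp

lemma scaleC_minus_one [simp]: "(-1) *C (x::'a::complex_normed_space) = - x"
  using scaleC_of_real[of "-1" x] by simp

lemma scaleC_minus_right [simp]: "c *C (- x) = - (c *C (x::'a::complex_normed_space))"
  by (metis add.right_inverse add_eq_0_iff scaleC_add_right scaleC_zero_right)

lemma scaleC_diff_right: "c *C (x - y) = c *C x - c *C (y::'a::complex_normed_space)"
  using scaleC_add_right[of c x "- y"] by simp

lemma scaleC_sum_right: "c *C (\<Sum>i\<in>I. f i) = (\<Sum>i\<in>I. c *C (f i::'a::complex_normed_space))"
  by (induction I rule: infinite_finite_induct) (auto simp: scaleC_add_right)

lemma cstar_zero [simp]: "cstar (0::'a::cstar_algebra) = 0"
  using cstar_add[of 0 "0::'a"] by simp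

lemma cstar_minus [simp]: "cstar (- x) = - cstar (x::'a::cstar_algebra)"
  by (metis add.right_inverse add_eq_0_iff cstar_add cstar_zero)

lemma cstar_diff: "cstar (x - y) = cstar x - cstar (y::'a::cstar_algebra)"
  using cstar_add[of x "- y"] by simp

lemma cstar_scaleR [simp]: "cstar (r *\<^sub>R x) = r *\<^sub>R cstar (x::'a::cstar_algebra)"
  by (metis complex_cnj_complex_of_real cstar_scaleC scaleC_of_real)

lemma cstar_sum: "cstar (\<Sum>i\<in>I. f i) = (\<Sum>i\<in>I. cstar (f i::'a::cstar_algebra))"
  by (induction I rule: infinite_finite_induct) (auto simp: cstar_add)

lemma norm_cstar_le: "norm x \<le> norm (cstar (x::'a::cstar_algebra))"
proof (cases "x = 0")
  case False
  have "norm x * norm x \<le> norm (cstar x) * norm x"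
    using norm_mult_ineq[of "cstar x" x] cstar_identity[of x] by (simp add: power2_eq_square)
  then show ?thesis using False by simp
qed simp

lemma norm_cstar [simp]: "norm (cstar x) = norm (x::'a::cstar_algebra)"
  by (metis antisym cstar_cstar norm_cstar_le)

lemma cstar_mult_self_eq_0: "cstar x * x = 0 \<Longrightarrow> (x::'a::cstar_algebra) = 0"
  using cstar_identity[of x] by simp

lemma bounded_linear_cstar: "bounded_linear (cstar :: 'a::cstar_algebra \<Rightarrow> 'a)"
  by (rule bounded_linear_intro[where K = 1]) (auto simp: cstar_add)

text \<open>A square root of \<open>1 - h\<close>, in the form \<open>1 - z\<close> so that no unit is needed.\<close>

lemma quasi_sqrt:
  fixes h :: "'a::cstar_algebra"
  assumes h: "cstar h = h" "norm h \<le> 1"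
  obtains z where "cstar z = z" "z + z - z * z = h"
    "\<And>c. c * h = h * c \<Longrightarrow> c * z = z * c"
    "\<And>I. closed I \<Longrightarrow> 0 \<in> I \<Longrightarrow> (\<And>y. y \<in> I \<Longrightarrow> (1/2) *\<^sub>R (h + y * y) \<in> I) \<Longrightarrow> z \<in> I"
proof -
  \<comment> \<open>The equation \<open>z + z - z * z = h\<close> is the fixed point equation
    \<open>z = (1/2) *\<^sub>R (h + z * z)\<close>, and \<open>y\<close> iterates it from
    \<open>0\<close>. The sequence \<open>s\<close> is the same iteration with the number 1 in place
    of \<open>h\<close>. It increases, stays below 1 and majorizes both \<open>y\<close> and its
    increments, so \<open>y\<close> converges even if \<open>norm h = 1\<close>.\<close>
  define y where "y = rec_nat 0 (\<lambda>_ y. (1/2) *\<^sub>R (h + y * y))"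
  define s where "s = rec_nat (0::real) (\<lambda>_ s. (1 + s * s) / 2)"
  have y0: "y 0 = 0" and yS: "y (Suc n) = (1/2) *\<^sub>R (h + y n * y n)" for n
    by (auto simp: y_def)
  have s0: "s 0 = 0" and sS: "s (Suc n) = (1 + s n * s n) / 2" for n
    by (auto simp: s_def)
  have s01: "0 \<le> s n \<and> s n \<le> 1" for n
    by (induction n) (auto simp: s0 sS mult_le_one)
  have smono: "s n \<le> s (Suc n)" for n
    using zero_le_square[of "1 - s n"] by (simp add: sS algebra_simps)
  have ysa: "cstar (y n) = y n" for n
    by (induction n) (auto simp: y0 yS cstar_add cstar_mult h)
  have ycom: "c * y n = y n * c" if "c * h = h * c" for c n
  proof (induction n)
    case (Suc n)
    have "c * (y n * y n) = y n * y n * c"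
      by (metis Suc mult.assoc)
    then show ?case by (simp add: yS distrib_left distrib_right that)
  qed (simp add: y0)
  have yy: "y m * y n = y n * y m" for m n
    by (rule ycom, rule ycom[symmetric], simp)
  have ys: "norm (y n) \<le> s n" for n
  proof (induction n)
    case (Suc n)
    have "norm (h + y n * y n) \<le> 1 + s n * s n"
      by (intro norm_triangle_le add_mono h order.trans[OF norm_mult_ineq] mult_mono Suc)
         (use s01[of n] in auto)
    then show ?case by (simp add: yS sS)
  qed (simp add: y0 s0)
  have ydiff: "norm (y (Suc n) - y n) \<le> s (Suc n) - s n" for n
  proof (induction n)
    case 0
    show ?case using h by (simp add: y0 s0 yS sS)
  next
    case (Suc n)
    \<comment> \<open>A difference of two squares factors here because the iterates commute with
      each other, by \<open>yy\<close>.\<close>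
    have "y (Suc (Suc n)) - y (Suc n) = (1/2) *\<^sub>R ((y (Suc n) - y n) * (y (Suc n) + y n))"
      unfolding yS[of "Suc n"] yS[of n] scaleR_diff_right[symmetric]
      unfolding yS[of n, symmetric]
      using yy[of "Suc n" n] by (simp add: algebra_simps)
    also have "norm \<dots> \<le> (1/2) * ((s (Suc n) - s n) * (s (Suc n) + s n))"
      using order.trans[OF norm_mult_ineq mult_mono[OF Suc norm_triangle_le[OF add_mono[OF ys ys]]]]
        smono[of n] by simp
    also have "\<dots> = s (Suc (Suc n)) - s (Suc n)"
      using sS[of n] sS[of "Suc n"] by (simp add: field_simps)
    finally show ?case .
  qed
  have ydist: "norm (y (n + k) - y n) \<le> s (n + k) - s n" for n k
  proof (induction k)
    case (Suc k)
    have "norm (y (n + Suc k) - y n) \<le> norm (y (Suc (n + k)) - y (n + k)) + norm (y (n + k) - y n)"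
      using norm_triangle_ineq[of "y (Suc (n + k)) - y (n + k)" "y (n + k) - y n"] by simp
    then show ?case using Suc ydiff[of "n + k"] by simp
  qed simp
  have "convergent s"
    by (rule Bseq_monoseq_convergent) (use s01 smono in \<open>auto intro!: BseqI'[where K = 1] simp: monoseq_Suc\<close>)
  then have sC: "Cauchy s" by (rule convergent_Cauchy)
  have "Cauchy y"
  proof (rule metric_CauchyI)
    fix e :: real assume "e > 0"
    then obtain N where N: "\<And>m n. m \<ge> N \<Longrightarrow> n \<ge> N \<Longrightarrow> \<bar>s m - s n\<bar> < e"
      using sC unfolding Cauchy_def dist_real_def by metis
    have le: "dist (y m) (y n) < e" if "N \<le> n" "n \<le> m" for m n
      using ydist[of n "m - n"] N[of m n] that by (auto simp: dist_norm)
    show "\<exists>M. \<forall>m\<ge>M. \<forall>n\<ge>M. dist (y m) (y n) < e"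
      by (metis le dist_commute linear)
  qed
  then obtain z where z: "y \<longlonglongrightarrow> z"
    using Cauchy_convergent convergent_def by blast
  show thesis
  proof
    show "cstar z = z"
      using LIMSEQ_unique[OF bounded_linear.tendsto[OF bounded_linear_cstar z]] z ysa by simp
    have "(\<lambda>n. y (Suc n)) \<longlonglongrightarrow> (1/2) *\<^sub>R (h + z * z)"
      unfolding yS by (intro tendsto_intros z)
    then have "z = (1/2) *\<^sub>R (h + z * z)"
      using LIMSEQ_unique LIMSEQ_Suc[OF z] by blast
    then have "2 *\<^sub>R z = 2 *\<^sub>R (1/2) *\<^sub>R (h + z * z)" by (rule arg_cong)
    then show "z + z - z * z = h" by (simp add: scaleR_2)
  next
    fix c assume c: "c * h = h * c"
    have "(\<lambda>n. c * y n) \<longlonglongrightarrow> c * z" "(\<lambda>n. y n * c) \<longlonglongrightarrow> z * c"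
      by (intro tendsto_intros z)+
    then show "c * z = z * c" using LIMSEQ_unique ycom[OF c] by auto
  next
    fix I assume I: "closed I" "0 \<in> I" "\<And>y. y \<in> I \<Longrightarrow> (1/2) *\<^sub>R (h + y * y) \<in> I"
    have "y n \<in> I" for n by (induction n) (auto simp: y0 yS I simp del: scaleR_add_right)
    then show "z \<in> I" using closed_sequentially[OF I(1)] z by blast
  qed
qed

subsection \<open>The unitization\<close>

datatype 'a unitization = Unitization (algebra_part: 'a) (scalar_part: complex)

text \<open>Left multiplication by \<open>a + c 1\<close>. It makes sense in an algebra without
  unit, and its operator norm is the source of the C*-norm on the unitization.\<close>

definition unit_op :: "'a::cstar_algebra unitization \<Rightarrow> 'a \<Rightarrow> 'a" where
  "unit_op u x = algebra_part u * x + scalar_part u *C x"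

lemma bounded_linear_scaleC: "bounded_linear ((*C) c :: 'a::complex_normed_space \<Rightarrow> 'a)"
  by (rule bounded_linear_intro[where K = "cmod c"])
     (auto simp: norm_scaleC scaleC_add_right scaleC_scaleC mult.commute simp flip: scaleC_of_real)

lemma bounded_linear_unit_op: "bounded_linear (unit_op (u :: 'a::cstar_algebra unitization))"
  unfolding unit_op_def
  by (intro bounded_linear_add bounded_linear_mult_right bounded_linear_scaleC)

instantiation unitization :: (cstar_algebra) "{ring_1, complex_normed_space}"
begin

definition zero_unitization :: "'a unitization" where "0 = Unitization 0 0"
definition one_unitization :: "'a unitization" where "1 = Unitization 0 1"
definition plus_unitization :: "'a unitization \<Rightarrow> 'a unitization \<Rightarrow> 'a unitization" where
  "u + v = Unitization (algebra_part u + algebra_part v) (scalar_part u + scalar_part v)"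
definition minus_unitization :: "'a unitization \<Rightarrow> 'a unitization \<Rightarrow> 'a unitization" where
  "u - v = Unitization (algebra_part u - algebra_part v) (scalar_part u - scalar_part v)"
definition uminus_unitization :: "'a unitization \<Rightarrow> 'a unitization" where
  "- u = Unitization (- algebra_part u) (- scalar_part u)"
definition times_unitization :: "'a unitization \<Rightarrow> 'a unitization \<Rightarrow> 'a unitization" where
  "u * v = Unitization (algebra_part u * algebra_part v + scalar_part u *C algebra_part v
     + scalar_part v *C algebra_part u) (scalar_part u * scalar_part v)"
definition scaleC_unitization :: "complex \<Rightarrow> 'a unitization \<Rightarrow> 'a unitization" where
  "c *C u = Unitization (c *C algebra_part u) (c * scalar_part u)"
definition scaleR_unitization :: "real \<Rightarrow> 'a unitization \<Rightarrow> 'a unitization" where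
  "r *\<^sub>R u = Unitization (r *\<^sub>R algebra_part u) (r *\<^sub>R scalar_part u)"

text \<open>The operator norm alone would vanish at \<open>1 - e\<close> if the algebra has a unit \<open>e\<close>.\<close>

definition norm_unitization :: "'a unitization \<Rightarrow> real" where
  "norm u = max (onorm (unit_op u)) (cmod (scalar_part u))"
definition sgn_unitization :: "'a unitization \<Rightarrow> 'a unitization" where
  "sgn_unitization u = inverse (norm u) *\<^sub>R u"
definition dist_unitization :: "'a unitization \<Rightarrow> 'a unitization \<Rightarrow> real" where
  "dist_unitization u v = norm (u - v)"
definition [code del]:
  "(uniformity :: ('a unitization \<times> 'a unitization) filter) = (INF e\<in>{0<..}. principal {(x, y). dist x y < e})"
definition [code del]:
  "open_unitization (U :: 'a unitization set) = (\<forall>x\<in>U. \<forall>\<^sub>F (x', y) in uniformity. x' = x \<longrightarrow> y \<in> U)"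

lemmas unitization_ops = zero_unitization_def one_unitization_def plus_unitization_def
  minus_unitization_def uminus_unitization_def times_unitization_def scaleC_unitization_def
  scaleR_unitization_def

lemma unit_op_le: "norm (unit_op (u :: 'a unitization) x) \<le> norm u * norm x"
proof -
  have "norm (unit_op u x) \<le> onorm (unit_op u) * norm x"
    by (rule onorm[OF bounded_linear_unit_op])
  also have "\<dots> \<le> norm u * norm x"
    by (intro mult_right_mono) (auto simp: norm_unitization_def)
  finally show ?thesis .
qed

lemma norm_unitization_leI:
  assumes "\<And>x. norm (unit_op (u :: 'a unitization) x) \<le> B * norm x" "cmod (scalar_part u) \<le> B"
  shows "norm u \<le> B"
  using onorm_bound[OF order.trans[OF norm_ge_zero assms(2)] assms(1)] assms(2)
  by (auto simp: norm_unitization_def)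

lemma cmod_scalar_part_le: "cmod (scalar_part (u :: 'a unitization)) \<le> norm u"
  by (simp add: norm_unitization_def)

text \<open>Testing the operator at \<open>cstar a\<close> recovers the algebra part
  \<open>a\<close>: the product \<open>a * cstar a\<close> is the value there minus a scalar
  multiple of \<open>cstar a\<close>. Together with \<open>cmod_scalar_part_le\<close> this gives
  definiteness of the norm and, later, completeness.\<close>

lemma norm_algebra_part_le: "norm (algebra_part (u :: 'a unitization)) \<le> 2 * norm u"
proof (cases "algebra_part u = 0")
  case True
  then show ?thesis using order.trans[OF norm_ge_zero cmod_scalar_part_le[of u]] by simp
next
  case False
  let ?a = "algebra_part u"
  have "norm (?a * cstar ?a) \<le> norm (unit_op u (cstar ?a)) + norm (scalar_part u *C cstar ?a)"
    using norm_triangle_ineq4[of "unit_op u (cstar ?a)" "scalar_part u *C cstar ?a"]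
    by (simp add: unit_op_def)
  also have "\<dots> \<le> norm u * norm ?a + norm u * norm ?a"
    using unit_op_le[of u "cstar ?a"] cmod_scalar_part_le[of u]
    by (intro add_mono) (auto simp: norm_scaleC intro: mult_right_mono)
  finally have "norm ?a * norm ?a \<le> (2 * norm u) * norm ?a"
    using cstar_identity[of "cstar ?a"] by (simp add: cstar_cstar power2_eq_square)
  then show ?thesis using False by simp
qed

instance
proof
  fix u v w :: "'a unitization" and c c' :: complex and r r' :: real
  show "u * v * w = u * (v * w)"
    by (simp add: unitization_ops algebra_simps mult_scaleC_left mult_scaleC_right
        scaleC_add_right scaleC_add_left scaleC_scaleC mult.commute)
  show "(u + v) * w = u * w + v * w" "u * (v + w) = u * v + u * w"
    by (simp_all add: unitization_ops algebra_simps scaleC_add_right scaleC_add_left)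
  show "1 * u = u" "u * 1 = u"
    by (simp_all add: unitization_ops)
  show "(0::'a unitization) \<noteq> 1" by (simp add: unitization_ops)
  show "u + v + w = u + (v + w)" "u + v = v + u" "0 + u = u" "- u + u = 0" "u - v = u + - v"
    by (simp_all add: unitization_ops algebra_simps)
  show "r *\<^sub>R (u + v) = r *\<^sub>R u + r *\<^sub>R v" "(r + r') *\<^sub>R u = r *\<^sub>R u + r' *\<^sub>R u"
    "r *\<^sub>R r' *\<^sub>R u = (r * r') *\<^sub>R u" "1 *\<^sub>R u = u"
    by (simp_all add: unitization_ops algebra_simps)
  show "c *C (u + v) = c *C u + c *C v" "(c + c') *C u = c *C u + c' *C u"
    "c *C c' *C u = (c * c') *C u" "complex_of_real r *C u = r *\<^sub>R u"
    by (simp_all add: unitization_ops algebra_simps scaleC_add_right scaleC_add_left scaleC_scaleC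
        scaleC_of_real scaleR_conv_of_real)
  show "sgn u = inverse (norm u) *\<^sub>R u" by (rule sgn_unitization_def)
  show "dist u v = norm (u - v)" by (rule dist_unitization_def)
  show "uniformity = (INF e\<in>{0<..}. principal {(x, y). dist x (y::'a unitization) < e})"
    by (rule uniformity_unitization_def)
  show "open U = (\<forall>x\<in>U. \<forall>\<^sub>F (x', y) in uniformity. x' = x \<longrightarrow> y \<in> U)"
    for U :: "'a unitization set" by (rule open_unitization_def)
  have n0: "0 \<le> norm u" by (auto simp: norm_unitization_def intro: max.coboundedI2)
  show "norm u = 0 \<longleftrightarrow> u = 0"
  proof
    assume "norm u = 0"
    then show "u = 0"
      using norm_algebra_part_le[of u] cmod_scalar_part_le[of u]
      by (cases u) (simp add: unitization_ops)
  next
    assume "u = 0"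
    then have "norm u \<le> 0"
      by (intro norm_unitization_leI) (auto simp: unitization_ops unit_op_def)
    then show "norm u = 0" using n0 by simp
  qed
  show "norm (u + v) \<le> norm u + norm v"
  proof (rule norm_unitization_leI)
    fix x
    have "unit_op (u + v) x = unit_op u x + unit_op v x"
      by (simp add: unit_op_def unitization_ops algebra_simps scaleC_add_left)
    then show "norm (unit_op (u + v) x) \<le> (norm u + norm v) * norm x"
      using norm_triangle_ineq[of "unit_op u x" "unit_op v x"] unit_op_le[of u x] unit_op_le[of v x]
      by (simp add: algebra_simps)
  next
    show "cmod (scalar_part (u + v)) \<le> norm u + norm v"
      using norm_triangle_ineq[of "scalar_part u" "scalar_part v"]
        cmod_scalar_part_le[of u] cmod_scalar_part_le[of v] by (simp add: unitization_ops)
  qed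
  have scale_le: "norm (c *C u) \<le> cmod c * norm u" for c and u :: "'a unitization"
  proof (rule norm_unitization_leI)
    fix x
    have "unit_op (c *C u) x = c *C unit_op u x"
      by (simp add: unit_op_def unitization_ops mult_scaleC_left scaleC_add_right scaleC_scaleC)
    then show "norm (unit_op (c *C u) x) \<le> cmod c * norm u * norm x"
      using mult_left_mono[OF unit_op_le[of u x], of "cmod c"] by (simp add: norm_scaleC mult.assoc)
  next
    show "cmod (scalar_part (c *C u)) \<le> cmod c * norm u"
      using mult_left_mono[OF cmod_scalar_part_le[of u], of "cmod c"]
      by (simp add: unitization_ops norm_mult)
  qed
  show norm_scale: "norm (c *C u) = cmod c * norm u" for c
  proof (cases "c = 0")
    case True
    then show ?thesis using scale_le[of 0 u]
        order.trans[OF norm_ge_zero cmod_scalar_part_le[of "0 *C u"]] by simp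
  next
    case False
    have "inverse c *C c *C u = u"
      using False by (cases u) (simp add: unitization_ops scaleC_scaleC)
    then have "cmod c * norm u \<le> cmod c * (cmod (inverse c) * norm (c *C u))"
      using scale_le[of "inverse c" "c *C u"] by (intro mult_left_mono) auto
    also have "\<dots> = norm (c *C u)" using False by (simp add: norm_inverse)
    finally show ?thesis using scale_le[of c u] by simp
  qed
  show "norm (r *\<^sub>R u) = \<bar>r\<bar> * norm u"
    using norm_scale[of "complex_of_real r"]
    by (simp add: unitization_ops scaleC_of_real scaleR_conv_of_real)
qed

end

lemma unit_op_mult: "unit_op (u * v) x = unit_op u (unit_op v x)"
  by (simp add: unit_op_def unitization_ops algebra_simps mult_scaleC_left mult_scaleC_right
      scaleC_add_right scaleC_scaleC)

instantiation unitization :: (cstar_algebra) "{cstar_algebra, real_normed_algebra_1}"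
begin

definition cstar_unitization :: "'a unitization \<Rightarrow> 'a unitization" where
  "cstar u = Unitization (cstar (algebra_part u)) (cnj (scalar_part u))"

instance
proof
  fix u v w :: "'a unitization" and c :: complex and r :: real
  show scale: "c *C u * v = c *C (u * v)" "u * c *C v = c *C (u * v)" for c
    by (simp_all add: unitization_ops mult_scaleC_left mult_scaleC_right scaleC_add_right
        scaleC_scaleC mult.commute mult.left_commute)
  show "r *\<^sub>R u * v = r *\<^sub>R (u * v)" "u * r *\<^sub>R v = r *\<^sub>R (u * v)"
    using scale[of "complex_of_real r"] by (simp_all add: scaleC_of_real)
  show "cstar (u + v) = cstar u + cstar v" "cstar (c *C u) = cnj c *C cstar u"
    "cstar (u * v) = cstar v * cstar u" and star_star: "\<And>u. cstar (cstar u) = (u :: 'a unitization)"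
    by (simp_all add: cstar_unitization_def unitization_ops cstar_add cstar_scaleC cstar_mult
        cstar_cstar algebra_simps)
  show mult_le: "norm (u * v) \<le> norm u * norm v" for u v :: "'a unitization"
  proof (rule norm_unitization_leI)
    fix x
    show "norm (unit_op (u * v) x) \<le> norm u * norm v * norm x"
      unfolding unit_op_mult mult.assoc
      by (intro order.trans[OF unit_op_le] mult_left_mono unit_op_le) auto
  next
    show "cmod (scalar_part (u * v)) \<le> norm u * norm v"
      by (simp add: unitization_ops norm_mult mult_mono cmod_scalar_part_le)
  qed
  show "norm (1 :: 'a unitization) = 1"
  proof (rule antisym)
    show "norm (1 :: 'a unitization) \<le> 1"
      by (rule norm_unitization_leI) (auto simp: unit_op_def unitization_ops)
    show "1 \<le> norm (1 :: 'a unitization)"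
      using cmod_scalar_part_le[of "1 :: 'a unitization"] by (simp add: unitization_ops)
  qed
  \<comment> \<open>The argument for operators on a Hilbert space, with the algebra as a module over
    itself: the square of \<open>u x\<close> is \<open>cstar x\<close> times the value of
    \<open>cstar u * u\<close> at \<open>x\<close>.\<close>
  have sq_le: "(norm u)\<^sup>2 \<le> norm (cstar u * u)" for u :: "'a unitization"
  proof -
    define N where "N = norm (cstar u * u)"
    have N: "0 \<le> N" by (simp add: N_def)
    have "norm u \<le> sqrt N"
    proof (rule norm_unitization_leI)
      fix x
      have "cstar (unit_op u x) * unit_op u x = cstar x * unit_op (cstar u * u) x"
        by (simp add: unit_op_def unitization_ops cstar_unitization_def cstar_add cstar_mult
            cstar_scaleC algebra_simps mult_scaleC_left mult_scaleC_right scaleC_add_right scaleC_scaleC)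
      then have "(norm (unit_op u x))\<^sup>2 = norm (cstar x * unit_op (cstar u * u) x)"
        using cstar_identity[of "unit_op u x"] by simp
      also have "\<dots> \<le> norm x * (N * norm x)"
        unfolding N_def
        by (rule order.trans[OF norm_mult_ineq]) (simp add: mult_left_mono unit_op_le)
      also have "\<dots> = (sqrt N * norm x)\<^sup>2" using N by (simp add: power2_eq_square)
      finally show "norm (unit_op u x) \<le> sqrt N * norm x"
        by (rule power2_le_imp_le) (use N in auto)
    next
      have "(cmod (scalar_part u))\<^sup>2 \<le> N"
        unfolding N_def using cmod_scalar_part_le[of "cstar u * u"]
        by (simp add: unitization_ops cstar_unitization_def norm_mult power2_eq_square)
      then show "cmod (scalar_part u) \<le> sqrt N" by (rule real_le_rsqrt)
    qed
    then have "(norm u)\<^sup>2 \<le> (sqrt N)\<^sup>2" by (intro power_mono) auto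
    then show ?thesis using N by (simp add: N_def)
  qed
  have star_le: "norm u \<le> norm (cstar u)" for u :: "'a unitization"
  proof (cases "u = 0")
    case False
    have "norm u * norm u \<le> norm (cstar u) * norm u"
      using sq_le[of u] mult_le[of "cstar u" u] by (simp add: power2_eq_square)
    then show ?thesis using False by simp
  qed simp
  have "norm (cstar u) = norm u"
    using star_le[of u] star_le[of "cstar u"] by (simp add: star_star)
  then show "norm (cstar u * u) = (norm u)\<^sup>2"
    using sq_le[of u] mult_le[of "cstar u" u] by (simp add: power2_eq_square)
next
  fix X :: "nat \<Rightarrow> 'a unitization"
  assume X: "Cauchy X"
  \<comment> \<open>Both components are Lipschitz with constant 2 and inherit the Cauchy property.
    Conversely the norm is at most the sum of the norms of the components, so limits of the
    components give a limit in the unitization.\<close>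
  have part: "Cauchy (\<lambda>n. f (X n))"
    if f: "\<And>u v. norm (f u - f v) \<le> 2 * norm (u - v)" for f :: "'a unitization \<Rightarrow> 'b::real_normed_vector"
  proof (rule metric_CauchyI)
    fix e :: real assume "e > 0"
    then have "e / 2 > 0" by simp
    then obtain M where M: "\<forall>m\<ge>M. \<forall>n\<ge>M. dist (X m) (X n) < e / 2"
      using X unfolding Cauchy_def by blast
    have "dist (f (X m)) (f (X n)) < e" if "m \<ge> M" "n \<ge> M" for m n
      using M that f[of "X m" "X n"] by (fastforce simp: dist_norm)
    then show "\<exists>M. \<forall>m\<ge>M. \<forall>n\<ge>M. dist (f (X m)) (f (X n)) < e" by blast
  qed
  have "Cauchy (\<lambda>n. algebra_part (X n))"
  proof (rule part)
    show "norm (algebra_part u - algebra_part v) \<le> 2 * norm (u - v)" for u v :: "'a unitization"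
      using norm_algebra_part_le[of "u - v"] by (simp add: minus_unitization_def)
  qed
  moreover have "Cauchy (\<lambda>n. scalar_part (X n))"
  proof (rule part)
    show "cmod (scalar_part u - scalar_part v) \<le> 2 * norm (u - v)" for u v :: "'a unitization"
      using cmod_scalar_part_le[of "u - v"] norm_ge_zero[of "u - v"]
      by (simp add: minus_unitization_def del: norm_ge_zero)
  qed
  ultimately obtain a c where a: "(\<lambda>n. algebra_part (X n)) \<longlonglongrightarrow> a"
    and c: "(\<lambda>n. scalar_part (X n)) \<longlonglongrightarrow> c"
    using Cauchy_convergent convergent_def by metis
  have "norm (X n - Unitization a c) \<le> norm (algebra_part (X n) - a) + norm (scalar_part (X n) - c)" for n
  proof (rule norm_unitization_leI)
    fix x
    show "norm (unit_op (X n - Unitization a c) x)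
        \<le> (norm (algebra_part (X n) - a) + norm (scalar_part (X n) - c)) * norm x"
      unfolding unit_op_def distrib_right
      by (rule norm_triangle_le, rule add_mono)
         (auto simp: minus_unitization_def norm_scaleC norm_mult_ineq)
  qed (simp add: minus_unitization_def)
  moreover have "(\<lambda>n. norm (algebra_part (X n) - a) + norm (scalar_part (X n) - c)) \<longlonglongrightarrow> 0"
    using tendsto_add[OF tendsto_norm_zero[OF LIM_zero[OF a]] tendsto_norm_zero[OF LIM_zero[OF c]]]
    by simp
  ultimately have "(\<lambda>n. X n - Unitization a c) \<longlonglongrightarrow> 0"
    by (intro Lim_null_comparison[of "\<lambda>n. X n - Unitization a c"] always_eventually allI)
  then have "X \<longlonglongrightarrow> Unitization a c"
    by (rule LIM_zero_cancel)
  then show "convergent X" by (auto simp: convergent_def)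
qed

end

subsection \<open>Positive elements\<close>

lemma cstar_one [simp]: "cstar (1 :: 'u::{cstar_algebra, ring_1}) = 1"
proof -
  have "cstar (1::'u) = cstar 1 * cstar (cstar 1)" by (simp add: cstar_cstar)
  also have "\<dots> = cstar (cstar 1 * 1)" by (simp only: cstar_mult)
  finally show ?thesis by (simp add: cstar_cstar)
qed

lemma cstar_power: "cstar (x ^ n) = cstar x ^ n" for x :: "'u::{cstar_algebra, ring_1}"
  by (induction n) (auto simp: cstar_mult power_commutes)

text \<open>Positivity of \<open>x\<close>. In a unital algebra it is equivalent to a norm
  condition, \<open>norm (r *\<^sub>R 1 - x) \<le> r\<close> for a selfadjoint \<open>x\<close> of
  norm at most \<open>r\<close>, and the two forms are played against each other: sums are easy in
  the second, conclusions are drawn from the first.\<close>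

definition square_of_selfadjoint :: "'u::cstar_algebra \<Rightarrow> bool" where
  "square_of_selfadjoint x \<longleftrightarrow> (\<exists>q. cstar q = q \<and> x = q * q)"

text \<open>\<open>quasi_sqrt\<close> for \<open>h / r\<close>, with
  \<open>q = sqrt r (1 - z)\<close>. The commutation clause is carried along because
  \<open>norm_diff_squares_le\<close> only applies to commuting roots.\<close>

lemma sqrt_scalar_minus:
  fixes h :: "'u::{cstar_algebra, real_normed_algebra_1}"
  assumes "cstar h = h" "norm h \<le> r" "0 < r"
  obtains q where "cstar q = q" "q * q = r *\<^sub>R 1 - h" "\<And>c. c * h = h * c \<Longrightarrow> c * q = q * c"
proof -
  have "cstar ((1/r) *\<^sub>R h) = (1/r) *\<^sub>R h" "norm ((1/r) *\<^sub>R h) \<le> 1" using assms by auto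
  then obtain z where z: "cstar z = z" "z + z - z * z = (1/r) *\<^sub>R h"
    "\<And>c. c * ((1/r) *\<^sub>R h) = ((1/r) *\<^sub>R h) * c \<Longrightarrow> c * z = z * c"
    using quasi_sqrt by metis
  show thesis
  proof (rule that[of "sqrt r *\<^sub>R (1 - z)"])
    have "(sqrt r *\<^sub>R (1 - z)) * (sqrt r *\<^sub>R (1 - z)) = r *\<^sub>R (1 - (z + z - z * z))"
      using assms(3) by (simp add: algebra_simps)
    then show "(sqrt r *\<^sub>R (1 - z)) * (sqrt r *\<^sub>R (1 - z)) = r *\<^sub>R 1 - h"
      using assms(3) by (simp add: z(2) scaleR_diff_right)
    show "cstar (sqrt r *\<^sub>R (1 - z)) = sqrt r *\<^sub>R (1 - z)" by (simp add: cstar_diff z(1))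
    fix c assume c: "c * h = h * c"
    have "c * z = z * c" by (rule z(3)) (simp add: c)
    then show "c * sqrt r *\<^sub>R (1 - z) = sqrt r *\<^sub>R (1 - z) * c" by (simp add: algebra_simps)
  qed
qed

text \<open>The element \<open>u = p + \<i> q\<close> is normal with \<open>u\<^sup>* u = p\<^sup>2 + q\<^sup>2\<close>, and \<open>p\<^sup>2 - q\<^sup>2\<close> is the real part
  of \<open>u\<^sup>2\<close>.\<close>

lemma norm_diff_squares_le:
  fixes p q :: "'u::{cstar_algebra, real_normed_algebra_1}"
  assumes "cstar p = p" "cstar q = q" "p * q = q * p"
  shows "norm (p * p - q * q) \<le> norm (p * p + q * q)"
proof -
  define u where "u = p + \<i> *C q"
  have su: "cstar u = p - \<i> *C q"
    using scaleC_scaleC[of "-1" \<i> q] by (simp add: u_def assms cstar_add cstar_scaleC)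
  have "cstar u * u = p * p + q * q"
    unfolding su unfolding u_def
    by (simp add: algebra_simps mult_scaleC_left mult_scaleC_right scaleC_scaleC scaleC_diff_right
        scaleC_add_right assms)
  then have n: "(norm u)\<^sup>2 = norm (p * p + q * q)"
    using cstar_identity[of u] by simp
  have "u * u + cstar u * cstar u = 2 *\<^sub>R (p * p - q * q)"
    unfolding su unfolding u_def
    by (simp add: algebra_simps mult_scaleC_left mult_scaleC_right scaleC_scaleC scaleC_diff_right
        scaleC_add_right assms scaleR_2)
  then have "2 * norm (p * p - q * q) = norm (u * u + cstar u * cstar u)" by simp
  also have "\<dots> \<le> norm u * norm u + norm u * norm u"
    using norm_mult_ineq[of u u] norm_mult_ineq[of "cstar u" "cstar u"]
    by (intro norm_triangle_le) auto
  finally show ?thesis using n by (simp add: power2_eq_square)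
qed

lemma square_root_if_norm:
  fixes x :: "'u::{cstar_algebra, real_normed_algebra_1}"
  assumes "cstar x = x" "norm (r *\<^sub>R 1 - x) \<le> r" "0 < r"
  obtains q where "cstar q = q" "q * q = x" "\<And>c. c * x = x * c \<Longrightarrow> c * q = q * c"
proof -
  have "cstar (r *\<^sub>R 1 - x) = r *\<^sub>R 1 - x" using assms(1) by (simp add: cstar_diff)
  from sqrt_scalar_minus[OF this assms(2,3)]
  obtain q where q: "cstar q = q" "q * q = r *\<^sub>R 1 - (r *\<^sub>R 1 - x)"
    "\<And>c. c * (r *\<^sub>R 1 - x) = (r *\<^sub>R 1 - x) * c \<Longrightarrow> c * q = q * c" by blast
  have "q * q = x" using q(2) by simp
  then show thesis
    by (rule that[OF q(1)]) (rule q(3), simp add: algebra_simps)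
qed

lemma square_of_selfadjointI:
  fixes x :: "'u::{cstar_algebra, real_normed_algebra_1}"
  assumes "cstar x = x" "norm (r *\<^sub>R 1 - x) \<le> r" "0 < r"
  shows "square_of_selfadjoint x"
proof -
  obtain q where "cstar q = q" "q * q = x"
    by (rule square_root_if_norm[OF assms]) (erule (1) that)
  then show ?thesis unfolding square_of_selfadjoint_def by (intro exI[of _ q]) simp
qed

text \<open>Take commuting roots \<open>p\<close> of \<open>x\<close> and \<open>q\<close> of
  \<open>r 1 - x\<close>. The sum of their squares is \<open>r 1\<close>, so the difference has norm
  at most \<open>r\<close> by \<open>norm_diff_squares_le\<close>, and twice \<open>q * q\<close> is
  the sum of these two elements.\<close>

lemma norm_scalar_minus_square_le:
  fixes x :: "'u::{cstar_algebra, real_normed_algebra_1}"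
  assumes "square_of_selfadjoint x" "norm x \<le> r" "0 < r"
  shows "norm (r *\<^sub>R 1 - x) \<le> r"
proof -
  obtain p where p: "cstar p = p" "x = p * p"
    using assms by (auto simp: square_of_selfadjoint_def)
  obtain q where q: "cstar q = q" "q * q = r *\<^sub>R 1 - x" "\<And>c. c * x = x * c \<Longrightarrow> c * q = q * c"
  proof -
    have "cstar x = x" by (simp add: p cstar_mult)
    from sqrt_scalar_minus[OF this assms(2,3)] show thesis using that by blast
  qed
  have "p * q = q * p" by (rule q) (simp add: p mult.assoc)
  moreover have sum: "q * q + p * p = r *\<^sub>R 1" using q(2) p(2) by simp
  ultimately have "norm (q * q - p * p) \<le> r"
    using norm_diff_squares_le[OF q(1) p(1)] assms(3) by simp
  moreover note sum
  moreover have "2 * norm (q * q) \<le> norm (q * q - p * p) + norm (q * q + p * p)"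
    using norm_triangle_ineq[of "q * q - p * p" "q * q + p * p"]
    by (simp add: algebra_simps flip: scaleR_2)
  ultimately show ?thesis using q(2) assms(3) by simp
qed

text \<open>A root supplied by the definition need not commute with everything that commutes with
  \<open>x\<close> (every selfadjoint unitary is a root of 1). The norm condition leads back to the
  iteration, whose limit does.\<close>

lemma commuting_square_root:
  fixes x :: "'u::{cstar_algebra, real_normed_algebra_1}"
  assumes "square_of_selfadjoint x"
  obtains q where "cstar q = q" "q * q = x" "\<And>c. c * x = x * c \<Longrightarrow> c * q = q * c"
proof -
  have sa: "cstar x = x" using assms by (auto simp: square_of_selfadjoint_def cstar_mult)
  have pos: "0 < norm x + 1" by (rule add_nonneg_pos) auto
  have "norm ((norm x + 1) *\<^sub>R 1 - x) \<le> norm x + 1"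
    by (rule norm_scalar_minus_square_le[OF assms _ pos]) simp
  from square_root_if_norm[OF sa this pos] show thesis
    using that by blast
qed

text \<open>The norm condition is stable under adding the elements together with their
  radii.\<close>

lemma square_of_selfadjoint_add:
  fixes x y :: "'u::{cstar_algebra, real_normed_algebra_1}"
  assumes "square_of_selfadjoint x" "square_of_selfadjoint y"
  shows "square_of_selfadjoint (x + y)"
proof -
  define r s where "r = norm x + 1" and "s = norm y + 1"
  have pos: "0 < r" "0 < s" "norm x \<le> r" "norm y \<le> s"
    by (auto simp: r_def s_def intro: add_nonneg_pos)
  have "norm ((r *\<^sub>R 1 - x) + (s *\<^sub>R 1 - y)) \<le> r + s"
    by (intro norm_triangle_le add_mono norm_scalar_minus_square_le assms pos)
  then have "norm ((r + s) *\<^sub>R 1 - (x + y)) \<le> r + s" by (simp add: algebra_simps)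
  moreover have "cstar (x + y) = x + y"
    using assms by (auto simp: square_of_selfadjoint_def cstar_mult cstar_add)
  ultimately show ?thesis
    using square_of_selfadjointI[of "x + y" "r + s"] pos by simp
qed

lemma square_of_selfadjoint_scaleR:
  fixes x :: "'u::{cstar_algebra, real_normed_algebra_1}"
  assumes "square_of_selfadjoint x" "0 \<le> r"
  shows "square_of_selfadjoint (r *\<^sub>R x)"
proof -
  obtain q where "cstar q = q" "x = q * q" using assms by (auto simp: square_of_selfadjoint_def)
  then show ?thesis
    using assms(2) unfolding square_of_selfadjoint_def
    by (intro exI[of _ "sqrt r *\<^sub>R q"]) auto
qed

lemma square_of_selfadjoint_zero: "square_of_selfadjoint (0 :: 'u::{cstar_algebra, real_normed_algebra_1})"
  unfolding square_of_selfadjoint_def by (intro exI[of _ 0]) auto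

lemma square_of_selfadjoint_sum:
  fixes f :: "'i \<Rightarrow> 'u::{cstar_algebra, real_normed_algebra_1}"
  assumes "\<And>i. i \<in> I \<Longrightarrow> square_of_selfadjoint (f i)"
  shows "square_of_selfadjoint (\<Sum>i\<in>I. f i)"
  using assms by (induction I rule: infinite_finite_induct)
    (auto intro: square_of_selfadjoint_add square_of_selfadjoint_zero)

text \<open>The two roots can be chosen to commute. The difference of their squares is
  \<open>2 h\<close> and the sum is \<open>2 r\<close>, so this is again
  \<open>norm_diff_squares_le\<close>.\<close>

lemma norm_le_if_squares:
  fixes h :: "'u::{cstar_algebra, real_normed_algebra_1}"
  assumes "square_of_selfadjoint (r *\<^sub>R 1 + h)" "square_of_selfadjoint (r *\<^sub>R 1 - h)" "0 < r"
  shows "norm h \<le> r"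
proof -
  let ?x = "r *\<^sub>R 1 + h" and ?y = "r *\<^sub>R 1 - h"
  obtain p where p: "cstar p = p" "p * p = ?x" "\<And>c. c * ?x = ?x * c \<Longrightarrow> c * p = p * c"
    using commuting_square_root[OF assms(1)] by blast
  obtain q where q: "cstar q = q" "q * q = ?y" "\<And>c. c * ?y = ?y * c \<Longrightarrow> c * q = q * c"
    using commuting_square_root[OF assms(2)] by blast
  have "?x * q = q * ?x" by (rule q(3)) (simp add: algebra_simps)
  then have "q * p = p * q" by (intro p(3)) simp
  then have "norm (p * p - q * q) \<le> norm (p * p + q * q)"
    by (intro norm_diff_squares_le p(1) q(1)) simp
  then have "norm (2 *\<^sub>R h) \<le> norm ((2 * r) *\<^sub>R (1::'u))"
    by (simp add: p q scaleR_2 flip: scaleR_left_distrib)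
  then show ?thesis using assms(3) by simp
qed

lemma square_of_selfadjoint_norm_minus:
  fixes x :: "'u::{cstar_algebra, real_normed_algebra_1}"
  assumes "cstar x = x" "norm x \<le> r" "0 < r"
  shows "square_of_selfadjoint (r *\<^sub>R 1 - x)"
proof -
  obtain q where "cstar q = q" "q * q = r *\<^sub>R 1 - x"
    by (rule sqrt_scalar_minus[OF assms]) (erule (1) that)
  then show ?thesis unfolding square_of_selfadjoint_def by (intro exI[of _ q]) simp
qed

text \<open>The C*-identity settles exponents that are powers of two. For general \<open>n\<close>
  the power is filled up to the exponent \<open>2 ^ n\<close> and submultiplicativity is applied to
  the remaining factor.\<close>

lemma norm_power_selfadjoint:
  fixes x :: "'u::{cstar_algebra, real_normed_algebra_1}"
  assumes "cstar x = x"
  shows "norm (x ^ n) = norm x ^ n"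
proof (rule antisym[OF norm_power_ineq])
  have two: "norm (x ^ 2 ^ k) = norm x ^ 2 ^ k" for k
  proof (induction k)
    case (Suc k)
    have "norm (x ^ 2 ^ Suc k) = (norm (x ^ 2 ^ k))\<^sup>2"
      using cstar_identity[of "x ^ 2 ^ k"] by (simp add: cstar_power assms mult_2 power_add)
    then show ?case by (simp add: Suc power_mult[symmetric] mult.commute)
  qed simp
  have n: "n + (2 ^ n - n) = 2 ^ n" by (simp add: less_imp_le)
  show "norm x ^ n \<le> norm (x ^ n)"
  proof (cases "x = 0")
    case False
    have "norm x ^ n * norm x ^ (2 ^ n - n) = norm (x ^ n * x ^ (2 ^ n - n))"
      unfolding power_add[symmetric] n two ..
    also have "\<dots> \<le> norm (x ^ n) * norm x ^ (2 ^ n - n)"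
      by (intro order.trans[OF norm_mult_ineq] mult_left_mono norm_power_ineq) auto
    finally show ?thesis using False by simp
  qed (cases n, auto)
qed

text \<open>A norm form of the fact that \<open>y y\<^sup>*\<close> and \<open>y\<^sup>* y\<close> have the same spectrum away from \<open>0\<close>, read off
  from \<open>y\<^sup>* (C - y y\<^sup>*)\<^sup>n y = (C - y\<^sup>* y)\<^sup>n y\<^sup>* y\<close>.\<close>

lemma norm_scalar_minus_swap:
  fixes y :: "'u::{cstar_algebra, real_normed_algebra_1}"
  assumes "0 \<le> C" "C \<le> D" "norm (C *\<^sub>R 1 - y * cstar y) \<le> D"
  shows "norm (C *\<^sub>R 1 - cstar y * y) \<le> D"
proof (rule ccontr)
  define Z where "Z = C *\<^sub>R 1 - cstar y * y"
  define W where "W = C *\<^sub>R 1 - y * cstar y"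
  define B where "B = norm Z"
  assume "\<not> ?thesis"
  then have BD: "D < B" by (simp add: B_def Z_def)
  have Zsa: "cstar Z = Z" by (simp add: Z_def cstar_diff cstar_mult cstar_cstar)
  have ZW: "cstar y * W ^ n = Z ^ n * cstar y" for n
  proof (induction n)
    case (Suc n)
    have "cstar y * W = Z * cstar y" by (simp add: W_def Z_def algebra_simps)
    then have "cstar y * W ^ Suc n = Z * (cstar y * W ^ n)" by (simp add: mult.assoc[symmetric])
    then show ?case by (simp add: Suc mult.assoc)
  qed simp
  \<comment> \<open>The power \<open>Z ^ Suc n\<close> differs from \<open>C\<close> times
    \<open>Z ^ n\<close> by a term with \<open>W ^ n\<close>, whose norm is at most
    \<open>D ^ n\<close> up to a constant. After division by \<open>B ^ n\<close> this term tends to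
    0, because \<open>D < B\<close>, and leaves \<open>B \<le> C\<close>, a contradiction.\<close>
  have le: "B - C \<le> (norm y * norm y) * (D / B) ^ n" for n
  proof -
    have "Z ^ n * Z = C *\<^sub>R Z ^ n - cstar y * W ^ n * y"
      by (simp add: ZW) (simp add: Z_def algebra_simps)
    then have "B ^ Suc n = norm (C *\<^sub>R Z ^ n - cstar y * W ^ n * y)"
      by (metis B_def Zsa norm_power_selfadjoint power_Suc2)
    also have "\<dots> \<le> norm (C *\<^sub>R Z ^ n) + norm (cstar y * W ^ n * y)" by (rule norm_triangle_ineq4)
    also have "\<dots> \<le> C * B ^ n + norm y * D ^ n * norm y"
    proof (rule add_mono)
      show "norm (C *\<^sub>R Z ^ n) \<le> C * B ^ n"
        using assms(1) norm_power_selfadjoint[OF Zsa] by (simp add: B_def)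
      have "norm (W ^ n) \<le> D ^ n"
        using order.trans[OF norm_power_ineq power_mono[OF assms(3)]] by (simp add: W_def)
      then show "norm (cstar y * W ^ n * y) \<le> norm y * D ^ n * norm y"
        by (metis (no_types, opaque_lifting) mult_left_mono mult_right_mono norm_cstar norm_ge_zero
            norm_mult_ineq order.trans)
    qed
    finally show ?thesis
      using BD assms by (simp add: field_simps power_divide)
  qed
  have "(\<lambda>n. (norm y * norm y) * (D / B) ^ n) \<longlonglongrightarrow> (norm y * norm y) * 0"
    using BD assms by (intro tendsto_intros LIMSEQ_realpow_zero) auto
  then have "B - C \<le> 0"
    by (intro LIMSEQ_le_const[of _ _ "B - C"]) (use le in auto)
  then show False using BD assms by simp
qed

text \<open>A one-sided bound suffices, although positivity of \<open>cstar y * y\<close> is not yet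
  available. With \<open>y = a + \<i> b\<close> for selfadjoint \<open>a\<close>, \<open>b\<close>
  the sum of \<open>y * cstar y\<close> and \<open>cstar y * y\<close> is
  \<open>2 (a a + b b)\<close>; adding it to the hypothesis shows that
  \<open>r 1 + y * cstar y\<close> is positive. The swap lemma carries this lower bound over to
  \<open>cstar y * y\<close>, and \<open>norm_le_if_squares\<close> combines the two bounds.\<close>

lemma norm_star_mult_le:
  fixes y :: "'u::{cstar_algebra, real_normed_algebra_1}"
  assumes "square_of_selfadjoint (r *\<^sub>R 1 - cstar y * y)" "0 < r"
  shows "norm (cstar y * y) \<le> r"
proof -
  define a where "a = (1/2) *\<^sub>R (y + cstar y)"
  define b where "b = (- \<i> / 2) *C (y - cstar y)"
  have sa: "cstar a = a" "cstar b = b"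
    by (simp_all add: a_def b_def cstar_add cstar_diff cstar_scaleC cstar_cstar add.commute
        scaleC_diff_right)
       (metis minus_diff_eq scaleC_diff_right scaleC_minus_one scaleC_minus_right scaleC_scaleC
          mult_minus1 minus_divide_left)
  have "b * b = (-1/4) *\<^sub>R ((y - cstar y) * (y - cstar y))"
    using scaleC_of_real[of "-1/4" "(y - cstar y) * (y - cstar y)"]
    by (simp add: b_def mult_scaleC_left mult_scaleC_right scaleC_scaleC)
  moreover have "a * a = (1/4) *\<^sub>R ((y + cstar y) * (y + cstar y))"
    by (simp add: a_def)
  ultimately have "4 *\<^sub>R (a * a + b * b) = (y + cstar y) * (y + cstar y) - (y - cstar y) * (y - cstar y)"
    by (simp add: scaleR_add_right scaleR_diff_right)
  also have "\<dots> = 2 *\<^sub>R (y * cstar y + cstar y * y)"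
    by (simp add: algebra_simps scaleR_2)
  finally have "(1/2) *\<^sub>R 4 *\<^sub>R (a * a + b * b) = (1/2) *\<^sub>R 2 *\<^sub>R (y * cstar y + cstar y * y)"
    by (rule arg_cong)
  then have ab: "y * cstar y + cstar y * y = 2 *\<^sub>R (a * a + b * b)"
    by (simp only: scaleR_scaleR) simp
  have "square_of_selfadjoint (2 *\<^sub>R (a * a + b * b))"
    by (intro square_of_selfadjoint_scaleR square_of_selfadjoint_add)
       (use sa in \<open>auto simp: square_of_selfadjoint_def\<close>)
  from square_of_selfadjoint_add[OF assms(1) this]
  have pos: "square_of_selfadjoint (r *\<^sub>R 1 + y * cstar y)"
    unfolding ab[symmetric] by (simp add: algebra_simps)
  \<comment> \<open>Any radius that dominates the positive element \<open>r 1 + y * cstar y\<close>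
    and also \<open>r\<close> would do. The swap lemma is applied with \<open>C = R - r\<close> and
    \<open>D = R\<close>, which is why it distinguishes the two constants.\<close>
  define R where "R = norm (r *\<^sub>R 1 + y * cstar y) + r"
  have R: "r \<le> R" "0 < R" "norm (r *\<^sub>R 1 + y * cstar y) \<le> R"
    using assms(2) by (auto simp: R_def intro: add_nonneg_pos)
  have "norm (R *\<^sub>R 1 - (r *\<^sub>R 1 + y * cstar y)) \<le> R"
    by (rule norm_scalar_minus_square_le[OF pos R(3,2)])
  then have "norm ((R - r) *\<^sub>R 1 - y * cstar y) \<le> R"
    by (simp add: algebra_simps)
  then have "norm ((R - r) *\<^sub>R 1 - cstar y * y) \<le> R"
    by (intro norm_scalar_minus_swap) (use R assms in auto)
  then have "norm (R *\<^sub>R 1 - (r *\<^sub>R 1 + cstar y * y)) \<le> R"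
    by (simp add: algebra_simps)
  then have "square_of_selfadjoint (r *\<^sub>R 1 + cstar y * y)"
    by (intro square_of_selfadjointI[of _ R] R(2)) (simp_all add: cstar_add cstar_mult cstar_cstar)
  then show ?thesis by (rule norm_le_if_squares[OF _ assms])
qed

text \<open>The summands of the two telescoping identities below, in
  \<open>square_of_selfadjoint_star_mult\<close> and in \<open>closed_ideal_star\<close>. All
  factors are polynomials in \<open>q\<close> and commute.\<close>

lemma square_of_selfadjoint_power_terms:
  fixes q :: "'u::{cstar_algebra, real_normed_algebra_1}"
  assumes q: "cstar q = q" and T: "T = q * q"
  shows "square_of_selfadjoint (T ^ j)" "square_of_selfadjoint ((T - 1) * (T - 1) * T ^ j)"
proof -
  have Tj: "T ^ j = q ^ j * q ^ j"
    unfolding T power2_eq_square[symmetric] power_mult[symmetric] by (simp add: mult.commute)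
  show "square_of_selfadjoint (T ^ j)"
    unfolding square_of_selfadjoint_def using Tj q by (intro exI[of _ "q ^ j"]) (simp add: cstar_power)
  have com: "q ^ j * (T - 1) = (T - 1) * q ^ j"
    by (rule power_commuting_commutes) (simp add: T algebra_simps)
  have "(T - 1) * (T - 1) * T ^ j = ((T - 1) * q ^ j) * ((T - 1) * q ^ j)"
    unfolding Tj by (metis com mult.assoc)
  moreover have "cstar ((T - 1) * q ^ j) = (T - 1) * q ^ j"
    by (simp add: cstar_mult cstar_power cstar_diff q com) (simp add: T cstar_mult q com[unfolded T])
  ultimately show "square_of_selfadjoint ((T - 1) * (T - 1) * T ^ j)"
    unfolding square_of_selfadjoint_def by blast
qed

text \<open>If \<open>T = 1 - x\<^sup>* x\<close> had norm greater than \<open>1\<close>, then the elements \<open>y = x T\<^sup>N\<close>, with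
  \<open>y\<^sup>* y = T\<^sup>M - T\<^sup>M\<^sup>+\<^sup>1\<close> for \<open>M = 2 N\<close>, would be unbounded, although \<open>1 - y\<^sup>* y\<close> is a sum of squares.\<close>

lemma square_of_selfadjoint_star_mult: "square_of_selfadjoint (cstar x * x)" for x :: "'u::{cstar_algebra, real_normed_algebra_1}"
proof -
  have small: "square_of_selfadjoint (cstar x * x)" if "norm x \<le> 1" for x :: 'u
  proof -
    define T where "T = 1 - cstar x * x"
    have "cstar (cstar x * x) = cstar x * x" "norm (cstar x * x) \<le> 1" "0 < (1::real)"
      using that by (simp_all add: cstar_identity power_le_one cstar_mult cstar_cstar)
    then obtain q where q: "cstar q = q" "q * q = 1 *\<^sub>R 1 - cstar x * x"
      by (rule sqrt_scalar_minus) (erule (1) that)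
    have qT: "T = q * q" using q(2) by (simp add: T_def)
    have Tsa: "cstar T = T" by (simp add: T_def cstar_diff cstar_mult cstar_cstar)
    note pos = square_of_selfadjoint_power_terms[OF q(1) qT]
    have bound: "norm T ^ (2 * N) * (norm T - 1) \<le> 1" for N
    proof -
      define y where "y = x * T ^ N"
      have yy: "cstar y * y = T ^ (2 * N) - T ^ Suc (2 * N)"
      proof -
        have "cstar y * y = T ^ N * (cstar x * x) * T ^ N"
          by (simp add: y_def cstar_mult cstar_power Tsa mult.assoc)
        also have "cstar x * x = 1 - T" by (simp add: T_def)
        also have "T ^ N * (1 - T) * T ^ N = T ^ N * T ^ N - T * (T ^ N * T ^ N)"
          by (simp add: algebra_simps power_commutes)
        finally show ?thesis by (simp add: mult_2 power_add)
      qed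
      \<comment> \<open>The left side is \<open>T\<close> for \<open>M = 0\<close>, and passing from
        \<open>M\<close> to \<open>Suc M\<close> adds
        \<open>(T - 1) * (T - 1) * T ^ M\<close>.\<close>
      have "1 - T ^ M + T ^ Suc M = T + (\<Sum>j<M. (T - 1) * (T - 1) * T ^ j)" for M
      proof (induction M)
        case (Suc M)
        then have "T + (\<Sum>j<Suc M. (T - 1) * (T - 1) * T ^ j)
            = 1 - T ^ M + T ^ Suc M + (T - 1) * (T - 1) * T ^ M" by simp
        also have "\<dots> = 1 - T ^ Suc M + T ^ Suc (Suc M)"
          by (simp add: algebra_simps)
        finally show ?case ..
      qed simp
      from this[of "2 * N"] have "1 *\<^sub>R 1 - cstar y * y = T ^ 1 + (\<Sum>j<2*N. (T - 1) * (T - 1) * T ^ j)"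
        unfolding yy by (simp add: algebra_simps)
      then have "square_of_selfadjoint (1 *\<^sub>R 1 - cstar y * y)"
        by (simp only:) (intro square_of_selfadjoint_add square_of_selfadjoint_sum pos)
      then have "norm (T ^ Suc (2 * N)) - norm (T ^ (2 * N)) \<le> 1"
        using norm_star_mult_le[of 1 y] norm_triangle_ineq2[of "T ^ Suc (2 * N)" "T ^ (2 * N)"]
        by (simp add: yy norm_minus_commute)
      then show ?thesis
        unfolding norm_power_selfadjoint[OF Tsa] by (simp add: algebra_simps)
    qed
    have "norm T \<le> 1"
    proof (rule ccontr)
      assume "\<not> norm T \<le> 1"
      then have t: "1 < norm T" by simp
      then have "1 < norm T ^ 2" by (simp add: one_less_power)
      from real_arch_pow[OF this] obtain N where "1 / (norm T - 1) < (norm T ^ 2) ^ N" by blast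
      then have "1 < (norm T ^ 2) ^ N * (norm T - 1)" using t by (simp add: pos_divide_less_eq)
      then show False using bound[of N] by (simp add: power_mult)
    qed
    then show ?thesis
      by (intro square_of_selfadjointI[of _ 1]) (simp_all add: T_def cstar_mult cstar_cstar)
  qed
  have "cstar x * x = (norm x)\<^sup>2 *\<^sub>R (cstar ((1 / norm x) *\<^sub>R x) * ((1 / norm x) *\<^sub>R x))"
    by (cases "x = 0") (auto simp: power2_eq_square)
  moreover have "square_of_selfadjoint \<dots>"
    by (intro square_of_selfadjoint_scaleR small) (cases "x = 0", auto)
  ultimately show ?thesis by simp
qed

text \<open>For \<open>r\<close> above \<open>norm (x + y)\<close> the element
  \<open>r 1 - x\<close> is the sum of the positive elements \<open>r 1 - (x + y)\<close> and
  \<open>y\<close>, and \<open>r 1 + x\<close> is positive too.\<close>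

lemma norm_mono_squares:
  fixes x y :: "'u::{cstar_algebra, real_normed_algebra_1}"
  assumes "square_of_selfadjoint x" "square_of_selfadjoint y"
  shows "norm x \<le> norm (x + y)"
proof (rule dense_ge)
  fix r assume r: "norm (x + y) < r"
  then have "0 < r" using norm_ge_zero[of "x + y"] by linarith
  have "cstar (x + y) = x + y"
    using assms by (auto simp: square_of_selfadjoint_def cstar_add cstar_mult)
  then have "square_of_selfadjoint (r *\<^sub>R 1 - (x + y))"
    using r \<open>0 < r\<close> by (intro square_of_selfadjoint_norm_minus) auto
  from square_of_selfadjoint_add[OF this assms(2)]
  have "square_of_selfadjoint (r *\<^sub>R 1 - x)" by (simp add: algebra_simps)
  moreover have "square_of_selfadjoint (r *\<^sub>R 1 + x)"
    using square_of_selfadjoint_add[OF square_of_selfadjoint_scaleR[of "1 * 1" r] assms(1)] \<open>0 < r\<close>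
    unfolding square_of_selfadjoint_def by (metis cstar_one less_imp_le mult_1)
  ultimately show "norm x \<le> r" using \<open>0 < r\<close> norm_le_if_squares by blast
qed

text \<open>The Cauchy-Schwarz inequality of the standard Hilbert module, by completing the square:
  for \<open>r\<close> above the norm of \<open>H\<close>, the element
  \<open>r K - cstar c * c\<close> is the sum of all \<open>cstar (g i) * g i\<close> and of
  \<open>cstar c * (r 1 - H) * c\<close> divided by \<open>r\<close>, hence positive.\<close>

lemma norm_sum_star_mult_unital:
  fixes a b :: "'i \<Rightarrow> 'u::{cstar_algebra, real_normed_algebra_1}"
  shows "(norm (\<Sum>i\<in>S. cstar (a i) * b i))\<^sup>2
    \<le> norm (\<Sum>i\<in>S. cstar (a i) * a i) * norm (\<Sum>i\<in>S. cstar (b i) * b i)"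
proof -
  define c where "c = (\<Sum>i\<in>S. cstar (a i) * b i)"
  define H where "H = (\<Sum>i\<in>S. cstar (a i) * a i)"
  define K where "K = (\<Sum>i\<in>S. cstar (b i) * b i)"
  have Hsa: "cstar H = H" by (simp add: H_def cstar_sum cstar_mult cstar_cstar)
  have sc: "cstar c = (\<Sum>i\<in>S. cstar (b i) * a i)" by (simp add: c_def cstar_sum cstar_mult cstar_cstar)
  have le: "(norm c)\<^sup>2 \<le> (norm H + e) * norm K" if "0 < e" for e
  proof -
    \<comment> \<open>The summand \<open>e\<close> keeps \<open>r\<close> positive if
      \<open>H = 0\<close>; it is sent to 0 at the end.\<close>
    define r where "r = norm H + e"
    have r: "0 < r" "norm H \<le> r" using that norm_ge_zero[of H] by (auto simp: r_def simp del: norm_ge_zero)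
    obtain q where q: "cstar q = q" "q * q = r *\<^sub>R 1 - H"
      using sqrt_scalar_minus[OF Hsa r(2,1)] by blast
    define g where "g i = sqrt r *\<^sub>R b i - (1 / sqrt r) *\<^sub>R (a i * c)" for i
    have gi: "cstar (g i) * g i = r *\<^sub>R (cstar (b i) * b i) - (cstar (b i) * a i) * c
        - cstar c * (cstar (a i) * b i) + (1/r) *\<^sub>R (cstar c * (cstar (a i) * a i) * c)" for i
      using r(1) by (simp add: g_def cstar_diff cstar_mult algebra_simps)
    have "(\<Sum>i\<in>S. cstar (g i) * g i) = r *\<^sub>R K - cstar c * c - cstar c * c + (1/r) *\<^sub>R (cstar c * H * c)"
      unfolding gi
      by (simp add: sum.distrib sum_subtractf K_def H_def sc c_def[symmetric]
          scaleR_sum_right[symmetric] sum_distrib_left[symmetric] sum_distrib_right[symmetric])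
    moreover have "(1/r) *\<^sub>R (cstar (q * c) * (q * c)) = cstar c * c - (1/r) *\<^sub>R (cstar c * H * c)"
    proof -
      have "cstar (q * c) * (q * c) = cstar c * (q * q) * c" by (simp add: cstar_mult q(1) mult.assoc)
      also have "\<dots> = r *\<^sub>R (cstar c * c) - cstar c * H * c" by (simp add: q(2) algebra_simps)
      finally show ?thesis using r(1) by (simp add: scaleR_diff_right)
    qed
    ultimately have "r *\<^sub>R K - cstar c * c
        = (\<Sum>i\<in>S. cstar (g i) * g i) + (1/r) *\<^sub>R (cstar (q * c) * (q * c))"
      by simp
    then have "square_of_selfadjoint (r *\<^sub>R K - cstar c * c)"
      using r(1) by (auto intro!: square_of_selfadjoint_add square_of_selfadjoint_sum
          square_of_selfadjoint_scaleR square_of_selfadjoint_star_mult)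
    from norm_mono_squares[OF square_of_selfadjoint_star_mult[of c] this]
    show ?thesis using r(1) by (simp add: cstar_identity r_def)
  qed
  have "(norm c)\<^sup>2 \<le> norm H * norm K"
  proof (rule field_le_epsilon)
    fix e :: real assume "e > 0"
    have "0 < norm K + 1" by (rule add_nonneg_pos) auto
    then have "(norm c)\<^sup>2 \<le> (norm H + e / (norm K + 1)) * norm K"
      using \<open>e > 0\<close> by (intro le) simp
    also have "\<dots> \<le> norm H * norm K + e"
      using \<open>e > 0\<close> \<open>0 < norm K + 1\<close> by (simp add: field_simps)
    finally show "(norm c)\<^sup>2 \<le> norm H * norm K + e" .
  qed
  then show ?thesis by (simp add: c_def H_def K_def)
qed

subsection \<open>Consequences for algebras without unit\<close>

definition embed_unit :: "'a::cstar_algebra \<Rightarrow> 'a unitization" where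
  "embed_unit a = Unitization a 0"

lemma embed_unit_simps:
  "embed_unit (a + b) = embed_unit a + embed_unit b"
  "embed_unit (a - b) = embed_unit a - embed_unit b"
  "embed_unit (a * b) = embed_unit a * embed_unit b"
  "embed_unit (r *\<^sub>R a) = r *\<^sub>R embed_unit a"
  "embed_unit (cstar a) = cstar (embed_unit a)"
  "embed_unit 0 = 0"
  by (simp_all add: embed_unit_def unitization_ops cstar_unitization_def)

lemma embed_unit_sum: "embed_unit (\<Sum>i\<in>I. f i) = (\<Sum>i\<in>I. embed_unit (f i))"
  by (induction I rule: infinite_finite_induct) (auto simp: embed_unit_simps)

lemma norm_embed_unit [simp]: "norm (embed_unit a) = norm a"
proof (rule antisym)
  show "norm (embed_unit a) \<le> norm a"
    by (rule norm_unitization_leI) (auto simp: embed_unit_def unit_op_def norm_mult_ineq)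
  have "norm a * norm a \<le> norm (embed_unit a) * norm a"
    using unit_op_le[of "embed_unit a" "cstar a"] cstar_identity[of "cstar a"]
    by (simp add: unit_op_def embed_unit_def cstar_cstar power2_eq_square)
  then show "norm a \<le> norm (embed_unit a)" by (cases "a = 0") auto
qed

lemma norm_sum_star_mult:
  fixes a b :: "'i \<Rightarrow> 'a::cstar_algebra"
  shows "(norm (\<Sum>i\<in>S. cstar (a i) * b i))\<^sup>2
    \<le> norm (\<Sum>i\<in>S. cstar (a i) * a i) * norm (\<Sum>i\<in>S. cstar (b i) * b i)"
  using norm_sum_star_mult_unital[where S = S and a = "\<lambda>i. embed_unit (a i)" and b = "\<lambda>i. embed_unit (b i)"]
  by (simp flip: embed_unit_simps embed_unit_sum)

lemma norm_sum_squares_mono: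
  fixes a :: "'i \<Rightarrow> 'a::cstar_algebra" and b :: "'j \<Rightarrow> 'a"
  shows "norm (\<Sum>i\<in>I. cstar (a i) * a i)
    \<le> norm ((\<Sum>i\<in>I. cstar (a i) * a i) + (\<Sum>j\<in>J. cstar (b j) * b j))"
proof -
  have "norm (\<Sum>i\<in>I. cstar (embed_unit (a i)) * embed_unit (a i))
    \<le> norm ((\<Sum>i\<in>I. cstar (embed_unit (a i)) * embed_unit (a i))
       + (\<Sum>j\<in>J. cstar (embed_unit (b j)) * embed_unit (b j)))"
    by (intro norm_mono_squares square_of_selfadjoint_sum square_of_selfadjoint_star_mult)
  then show ?thesis by (simp flip: embed_unit_simps embed_unit_sum)
qed

section \<open>Closed ideals and homomorphisms defined on them\<close>

text \<open>Invariance under the involution is not part of \<open>closed_ideal\<close>. With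
  \<open>h = a * cstar a\<close> the elements \<open>z n\<close>, which are \<open>cstar a\<close>
  times the \<open>n\<close>-th power of \<open>1 - h\<close>, differ from \<open>cstar a\<close> by
  elements of \<open>I\<close>, as \<open>h\<close> lies in \<open>I\<close>. They tend to 0, since
  \<open>T ^ m * (1 - T)\<close> has norm at most \<open>1 / m\<close> for \<open>T = 1 - h\<close>.
  Closedness of \<open>I\<close> concludes.\<close>

lemma closed_ideal_star:
  assumes I: "closed_ideal I" and "a \<in> I"
  shows "cstar a \<in> I"
proof -
  have small: "cstar a \<in> I" if "norm a \<le> 1" "a \<in> I" for a
  proof -
    define h where "h = a * cstar a"
    define z where "z = rec_nat (cstar a) (\<lambda>_ z. z - z * h)"
    have z0: "z 0 = cstar a" and zS: "z (Suc n) = z n - z n * h" for n by (auto simp: z_def)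
    have hI: "h \<in> I" using I that by (auto simp: closed_ideal_def h_def)
    have zI: "cstar a - z n \<in> I" for n
    proof (induction n)
      case 0
      then show ?case using I by (simp add: z0 closed_ideal_def)
    next
      case (Suc n)
      have "cstar a - z (Suc n) = (cstar a - z n) + z n * h" by (simp add: zS)
      then show ?case using I Suc hI by (metis closed_ideal_def)
    qed
    define T where "T = 1 - embed_unit h"
    have Tsa: "cstar T = T"
      by (simp add: T_def h_def cstar_diff cstar_mult cstar_cstar flip: embed_unit_simps)
    have "cstar (embed_unit h) = embed_unit h" "norm (embed_unit h) \<le> 1" "0 < (1::real)"
      using that(1) cstar_identity[of "cstar a"]
      by (simp_all add: h_def cstar_cstar cstar_mult power_le_one flip: embed_unit_simps)
    then obtain q where q: "cstar q = q" "q * q = 1 *\<^sub>R 1 - embed_unit h"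
      by (rule sqrt_scalar_minus) (erule (1) that)
    have qT: "T = q * q" using q(2) by (simp add: T_def)
    note pos = square_of_selfadjoint_power_terms[OF q(1) qT]
    have ez: "embed_unit (z n) = cstar (embed_unit a) * T ^ n" for n
      by (induction n) (auto simp: z0 zS embed_unit_simps T_def algebra_simps power_commutes
          simp del: power_Suc simp add: power_Suc2)
    have zn: "(norm (z n))\<^sup>2 * real (2 * n) \<le> 1" for n
    proof -
      define m where "m = 2 * n"
      define y where "y = sqrt m *\<^sub>R embed_unit (z n)"
      have "cstar y * y = m *\<^sub>R (T ^ n * (embed_unit a * cstar (embed_unit a)) * T ^ n)"
        unfolding y_def ez by (simp add: cstar_mult cstar_cstar cstar_power Tsa mult.assoc)
      also have "embed_unit a * cstar (embed_unit a) = 1 - T"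
        by (simp add: T_def h_def embed_unit_simps)
      also have "T ^ n * (1 - T) * T ^ n = T ^ m - T ^ Suc m"
        unfolding m_def mult_2 power_add power_Suc by (simp add: algebra_simps power_commutes)
      finally have yy: "cstar y * y = m *\<^sub>R (T ^ m - T ^ Suc m)" .
      \<comment> \<open>For numbers in the unit interval this is the bound
        \<open>m t ^ m (1 - t) \<le> 1\<close>, written with an explicit nonnegative remainder. The
        weights \<open>Suc j\<close> come from differentiating the geometric sum.\<close>
      have "1 - real m *\<^sub>R (T ^ m - T ^ Suc m)
          = T ^ m + (\<Sum>j<m. real (Suc j) *\<^sub>R ((T - 1) * (T - 1) * T ^ j))" for m
      proof (induction m)
        case (Suc m)
        have "T ^ Suc m + (\<Sum>j<Suc m. real (Suc j) *\<^sub>R ((T - 1) * (T - 1) * T ^ j))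
            = 1 - real m *\<^sub>R (T ^ m - T ^ Suc m) - T ^ m + T ^ Suc m
              + real (Suc m) *\<^sub>R ((T - 1) * (T - 1) * T ^ m)"
          unfolding Suc by simp
        also have "\<dots> = 1 - real (Suc m) *\<^sub>R (T ^ Suc m - T ^ Suc (Suc m))"
          by (simp add: algebra_simps)
        finally show ?case ..
      qed simp
      then have "square_of_selfadjoint (1 *\<^sub>R 1 - cstar y * y)"
        using pos by (auto simp: yy intro!: square_of_selfadjoint_add square_of_selfadjoint_sum
            square_of_selfadjoint_scaleR)
      then have "norm (cstar y * y) \<le> 1" by (rule norm_star_mult_le) simp
      then show ?thesis
        unfolding cstar_identity by (simp add: y_def m_def power_mult_distrib mult.commute)
    qed
    have "(\<lambda>n. z n) \<longlonglongrightarrow> 0"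
    proof (rule Lim_null_comparison)
      show "(\<lambda>n. sqrt (1 / real n)) \<longlonglongrightarrow> 0"
        using tendsto_real_sqrt[OF lim_1_over_n] by simp
      have "norm (z n) \<le> sqrt (1 / real n)" if "n > 0" for n
        using zn[of n] that by (intro real_le_rsqrt) (simp add: field_simps)
      then show "\<forall>\<^sub>F n in sequentially. norm (z n) \<le> sqrt (1 / real n)"
        by (intro eventually_mono[OF eventually_gt_at_top[of 0]])
    qed
    then have "(\<lambda>n. cstar a - z n) \<longlonglongrightarrow> cstar a - 0" by (intro tendsto_intros)
    then show "cstar a \<in> I"
      using I zI closed_sequentially[of I "\<lambda>n. cstar a - z n"] by (auto simp: closed_ideal_def)
  qed
  have scale: "r *\<^sub>R x \<in> I" if "x \<in> I" for r x
    using I that by (metis closed_ideal_def scaleC_of_real)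
  show ?thesis
  proof (cases "a = 0")
    case True
    then show ?thesis using assms by simp
  next
    case False
    have "cstar ((1 / norm a) *\<^sub>R a) \<in> I" using False assms by (intro small scale) auto
    then have "norm a *\<^sub>R cstar ((1 / norm a) *\<^sub>R a) \<in> I" by (rule scale)
    then show ?thesis using False by simp
  qed
qed

lemma closed_idealD:
  assumes "closed_ideal I"
  shows "closed I" "0 \<in> I" "a \<in> I \<Longrightarrow> b \<in> I \<Longrightarrow> a + b \<in> I" "a \<in> I \<Longrightarrow> c *C a \<in> I"
    "a \<in> I \<Longrightarrow> x * a \<in> I" "a \<in> I \<Longrightarrow> a * x \<in> I" "a \<in> I \<Longrightarrow> cstar a \<in> I" "a \<in> I \<Longrightarrow> - a \<in> I"
    "a \<in> I \<Longrightarrow> b \<in> I \<Longrightarrow> a - b \<in> I" "a \<in> I \<Longrightarrow> r *\<^sub>R a \<in> I"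
proof -
  show "closed I" "0 \<in> I" "a \<in> I \<Longrightarrow> b \<in> I \<Longrightarrow> a + b \<in> I" and scale: "\<And>a c. a \<in> I \<Longrightarrow> c *C a \<in> I"
    and "a \<in> I \<Longrightarrow> x * a \<in> I" "a \<in> I \<Longrightarrow> a * x \<in> I"
    using assms by (auto simp: closed_ideal_def)
  show "a \<in> I \<Longrightarrow> cstar a \<in> I" by (rule closed_ideal_star[OF assms])
  show minus: "a \<in> I \<Longrightarrow> - a \<in> I" for a using scale[of a "-1"] by simp
  show "a \<in> I \<Longrightarrow> r *\<^sub>R a \<in> I" using scale[of a "complex_of_real r"] by (simp add: scaleC_of_real)
  show "a \<in> I \<Longrightarrow> b \<in> I \<Longrightarrow> a - b \<in> I"
    using assms minus[of b] unfolding closed_ideal_def by (metis diff_conv_add_uminus)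
qed

text \<open>The iteration starts at 0 and never leaves the ideal. Formally
  \<open>1 - cstar a * a\<close> is the square of \<open>1 - z\<close>, and contraction estimates
  are read off by mapping this identity forward.\<close>

lemma quasi_sqrt_ideal:
  assumes I: "closed_ideal I" and "a \<in> I" "norm a \<le> 1"
  obtains z where "z \<in> I" "cstar z = z" "z + z - z * z = cstar a * a"
proof -
  note ideal = closed_idealD[OF I]
  have "cstar (cstar a * a) = cstar a * a" "norm (cstar a * a) \<le> 1"
    using assms(3) by (simp_all add: cstar_mult cstar_cstar cstar_identity power_le_one)
  then show thesis
  proof (rule quasi_sqrt)
    fix z
    assume z: "cstar z = z" "z + z - z * z = cstar a * a"
      and "\<And>I. closed I \<Longrightarrow> 0 \<in> I \<Longrightarrow> (\<And>y. y \<in> I \<Longrightarrow> (1/2) *\<^sub>R (cstar a * a + y * y) \<in> I) \<Longrightarrow> z \<in> I"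
    from this(3)[OF ideal(1,2)] have "z \<in> I" by (simp add: ideal assms(2))
    then show thesis by (rule that[OF _ z])
  qed
qed

text \<open>The relation between \<open>z\<close> and \<open>cstar a * a\<close> lies inside the
  ideal and is preserved by \<open>f\<close>. In the unitization of the target it says that
  \<open>1 - cstar (f a) * f a\<close> is the square of \<open>1 - f z\<close>, so
  \<open>norm_star_mult_le\<close> bounds \<open>f a\<close>. No extension of \<open>f\<close> to a
  unit is involved.\<close>

lemma star_hom_contractive:
  fixes f :: "'a::cstar_algebra \<Rightarrow> 'b::cstar_algebra"
  assumes I: "closed_ideal I" and "a \<in> I"
    and add: "\<And>a b. a \<in> I \<Longrightarrow> b \<in> I \<Longrightarrow> f (a + b) = f a + f b"
    and mult: "\<And>a b. a \<in> I \<Longrightarrow> b \<in> I \<Longrightarrow> f (a * b) = f a * f b"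
    and scale: "\<And>c a. a \<in> I \<Longrightarrow> f (c *C a) = c *C f a"
    and star: "\<And>a. a \<in> I \<Longrightarrow> f (cstar a) = cstar (f a)"
  shows "norm (f a) \<le> norm a"
proof -
  note ideal = closed_idealD[OF I]
  have scaleR: "f (r *\<^sub>R a) = r *\<^sub>R f a" if "a \<in> I" for r a
    using scale[OF that, of "complex_of_real r"] by (simp add: scaleC_of_real)
  have small: "norm (f a) \<le> 1" if a: "a \<in> I" "norm a \<le> 1" for a
  proof -
    obtain z where z: "z \<in> I" "cstar z = z" "z + z - z * z = cstar a * a"
      using quasi_sqrt_ideal[OF I a] by blast
    have "cstar (f a) * f a = f (cstar a * a)" using a ideal star mult by simp
    also have "\<dots> = f z + f z - f z * f z"
    proof -
      have "f (cstar a * a) = f (z + z + (-1) *\<^sub>R (z * z))" by (simp add: z(3))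
      also have "\<dots> = f z + f z + (-1) *\<^sub>R (f z * f z)"
        by (simp only: add ideal z(1) scaleR mult)
      finally show ?thesis by simp
    qed
    finally have "embed_unit (cstar (f a) * f a) = embed_unit (f z + f z - f z * f z)"
      by (rule arg_cong)
    then have "1 *\<^sub>R 1 - cstar (embed_unit (f a)) * embed_unit (f a)
        = (1 - embed_unit (f z)) * (1 - embed_unit (f z))"
      unfolding embed_unit_simps by (simp add: algebra_simps)
    moreover have "cstar (1 - embed_unit (f z)) = 1 - embed_unit (f z)"
      using star[OF z(1)] z(2) by (simp add: cstar_diff flip: embed_unit_simps)
    ultimately have "square_of_selfadjoint (1 *\<^sub>R 1 - cstar (embed_unit (f a)) * embed_unit (f a))"
      unfolding square_of_selfadjoint_def by blast
    then have "(norm (f a))\<^sup>2 \<le> 1\<^sup>2"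
      using norm_star_mult_le[of 1 "embed_unit (f a)"] by (simp add: cstar_identity)
    then show ?thesis by (rule power2_le_imp_le) simp
  qed
  show ?thesis
  proof (cases "a = 0")
    case True
    then show ?thesis using scale[OF ideal(2), of 0] by simp
  next
    case False
    have "norm (f ((1 / norm a) *\<^sub>R a)) \<le> 1" using False assms(2) ideal by (intro small) auto
    then show ?thesis using False assms(2) by (simp add: scaleR field_simps)
  qed
qed

section \<open>Matrices\<close>

lemma mat_adjoint_dim [simp]: "dim_row (mat_adjoint A) = dim_col A" "dim_col (mat_adjoint A) = dim_row A"
  by (simp_all add: mat_adjoint_def)

lemma mat_adjoint_carrier [simp]: "A \<in> carrier_mat n m \<Longrightarrow> mat_adjoint A \<in> carrier_mat m n"
  by (intro carrier_matI) (auto dest: carrier_matD)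

lemma mat_adjoint_index [simp]:
  "i < dim_col A \<Longrightarrow> j < dim_row A \<Longrightarrow> mat_adjoint A $$ (i, j) = cnj ((A :: complex mat) $$ (j, i))"
  by (simp add: mat_adjoint_def mat_of_rows_index)

lemma index_mult_mat_sum:
  assumes "A \<in> carrier_mat n d" "B \<in> carrier_mat d m" "i < n" "j < m"
  shows "(A * B) $$ (i, j) = (\<Sum>k<d. A $$ (i, k) * B $$ (k, j))"
  using assms by (simp add: scalar_prod_def atLeast0LessThan)

lemma index_mult_mat_vec_sum:
  assumes "A \<in> carrier_mat n d" "u \<in> carrier_vec d" "i < n"
  shows "vec_index (mult_mat_vec A u) i = (\<Sum>k<d. A $$ (i, k) * vec_index u k)"
  using assms by (simp add: scalar_prod_def atLeast0LessThan)

lemma mat_adjoint_mult: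
  assumes "(A :: complex mat) \<in> carrier_mat n d" "B \<in> carrier_mat d m"
  shows "mat_adjoint (A * B) = mat_adjoint B * mat_adjoint A"
proof (rule eq_matI)
  fix i j assume "i < dim_row (mat_adjoint B * mat_adjoint A)" "j < dim_col (mat_adjoint B * mat_adjoint A)"
  then have ij: "i < m" "j < n" using assms by auto
  have "mat_adjoint (A * B) $$ (i, j) = cnj ((A * B) $$ (j, i))"
    using ij assms by (intro mat_adjoint_index) auto
  also have "\<dots> = (\<Sum>k<d. cnj (B $$ (k, i)) * cnj (A $$ (j, k)))"
    using ij by (simp add: index_mult_mat_sum[OF assms] mult.commute)
  also have "\<dots> = (\<Sum>k<d. mat_adjoint B $$ (i, k) * mat_adjoint A $$ (k, j))"
    using ij assms by (intro sum.cong) auto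
  also have "\<dots> = (mat_adjoint B * mat_adjoint A) $$ (i, j)"
    using ij assms by (intro index_mult_mat_sum[symmetric]) auto
  finally show "mat_adjoint (A * B) $$ (i, j) = (mat_adjoint B * mat_adjoint A) $$ (i, j)" .
qed (use assms in auto)

lemma mat_adjoint_mult_square:
  "(A :: complex mat) \<in> carrier_mat d d \<Longrightarrow> B \<in> carrier_mat d d \<Longrightarrow>
    mat_adjoint (A * B) = mat_adjoint B * mat_adjoint A"
  by (rule mat_adjoint_mult)

lemma smult_mat_mult_mat_vec:
  assumes "A \<in> carrier_mat n m" "u \<in> carrier_vec m"
  shows "mult_mat_vec (c \<cdot>\<^sub>m A) u = smult_vec c (mult_mat_vec A u)"
  using assms by (intro eq_vecI) (auto simp: scalar_prod_def sum_distrib_left mult.assoc)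

lemma mat_adjoint_adjoint [simp]: "mat_adjoint (mat_adjoint (A :: complex mat)) = A"
  by (rule eq_matI) auto

lemma mat_adjoint_one [simp]: "mat_adjoint (1\<^sub>m d :: complex mat) = 1\<^sub>m d"
  by (rule eq_matI) auto

lemma mat_adjoint_zero [simp]: "mat_adjoint (0\<^sub>m n m :: complex mat) = 0\<^sub>m m n"
  by (rule eq_matI) auto

lemma mat_adjoint_minus:
  "A \<in> carrier_mat n m \<Longrightarrow> B \<in> carrier_mat n m \<Longrightarrow>
    mat_adjoint (A - B :: complex mat) = mat_adjoint A - mat_adjoint B"
  by (rule eq_matI) auto

lemma euclid_norm_L2: "euclid_norm u = L2_set (\<lambda>i. cmod (vec_index u i)) {..<dim_vec u}"
  by (simp add: euclid_norm_def L2_set_def)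

lemma euclid_norm_nonneg [simp]: "0 \<le> euclid_norm u"
  by (simp add: euclid_norm_def sum_nonneg)

lemma euclid_norm_sq: "u \<in> carrier_vec n \<Longrightarrow> (euclid_norm u)\<^sup>2 = (\<Sum>i<n. (cmod (vec_index u i))\<^sup>2)"
  by (simp add: euclid_norm_def sum_nonneg)

lemma euclid_norm_index_le: "i < dim_vec u \<Longrightarrow> cmod (vec_index u i) \<le> euclid_norm u"
  unfolding euclid_norm_L2 by (rule member_le_L2_set) auto

lemma euclid_norm_add: "dim_vec u = dim_vec v \<Longrightarrow> euclid_norm (u + v) \<le> euclid_norm u + euclid_norm v"
proof -
  assume d: "dim_vec u = dim_vec v"
  then have "euclid_norm (u + v) = L2_set (\<lambda>i. cmod (vec_index u i + vec_index v i)) {..<dim_vec v}"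
    unfolding euclid_norm_L2 by (intro L2_set_cong) auto
  also have "\<dots> \<le> L2_set (\<lambda>i. cmod (vec_index u i) + cmod (vec_index v i)) {..<dim_vec v}"
    by (intro L2_set_mono) (auto simp: norm_triangle_ineq)
  finally show ?thesis
    unfolding euclid_norm_L2 d by (rule order.trans[OF _ L2_set_triangle_ineq])
qed

lemma euclid_norm_smult: "euclid_norm (smult_vec c u) = cmod c * euclid_norm u"
  unfolding euclid_norm_L2 by (simp add: L2_set_right_distrib) (rule L2_set_cong, auto simp: norm_mult)

lemma euclid_norm_mult_mat_vec_le:
  assumes "A \<in> carrier_mat n m" "u \<in> carrier_vec m"
  shows "euclid_norm (mult_mat_vec A u) \<le> (\<Sum>i<n. \<Sum>j<m. cmod (A $$ (i, j))) * euclid_norm u"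
proof -
  have "euclid_norm (mult_mat_vec A u) \<le> (\<Sum>i<n. cmod (vec_index (mult_mat_vec A u) i))"
    using assms L2_set_le_sum[of "{..<n}" "\<lambda>i. cmod (vec_index (mult_mat_vec A u) i)"]
    by (auto simp: euclid_norm_L2)
  also have "\<dots> \<le> (\<Sum>i<n. \<Sum>j<m. cmod (A $$ (i, j)) * euclid_norm u)"
  proof (intro sum_mono)
    fix i assume "i \<in> {..<n}"
    then have "cmod (vec_index (mult_mat_vec A u) i) \<le> (\<Sum>j<m. cmod (A $$ (i, j) * vec_index u j))"
      by (simp add: index_mult_mat_vec_sum[OF assms] norm_sum del: index_mult_mat_vec)
    also have "\<dots> \<le> (\<Sum>j<m. cmod (A $$ (i, j)) * euclid_norm u)"
      using assms by (intro sum_mono) (auto simp: norm_mult intro!: mult_left_mono euclid_norm_index_le)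
    finally show "cmod (vec_index (mult_mat_vec A u) i) \<le> \<dots>" .
  qed
  finally show ?thesis by (simp add: sum_distrib_right)
qed

lemma bdd_above_mat_norm:
  "bdd_above ((\<lambda>u. euclid_norm (mult_mat_vec A u)) ` {u \<in> carrier_vec (dim_col A). euclid_norm u \<le> 1})"
proof (intro bdd_aboveI2)
  fix u :: "complex Matrix.vec" assume "u \<in> {u \<in> carrier_vec (dim_col A). euclid_norm u \<le> 1}"
  then have u: "u \<in> carrier_vec (dim_col A)" "euclid_norm u \<le> 1" by auto
  have "(\<Sum>i<dim_row A. \<Sum>j<dim_col A. cmod (A $$ (i, j))) * euclid_norm u
      \<le> (\<Sum>i<dim_row A. \<Sum>j<dim_col A. cmod (A $$ (i, j)))"
    by (intro mult_left_le u sum_nonneg) auto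
  then show "euclid_norm (mult_mat_vec A u) \<le> (\<Sum>i<dim_row A. \<Sum>j<dim_col A. cmod (A $$ (i, j)))"
    using euclid_norm_mult_mat_vec_le[of A "dim_row A" "dim_col A" u] u(1) by simp
qed

lemma mult_mat_vec_mat_norm_le:
  assumes "A \<in> carrier_mat n m" "u \<in> carrier_vec m"
  shows "euclid_norm (mult_mat_vec A u) \<le> mat_norm A * euclid_norm u"
proof (cases "euclid_norm u = 0")
  case True
  then show ?thesis using euclid_norm_mult_mat_vec_le[OF assms] by simp
next
  case False
  then have pos: "0 < euclid_norm u" using euclid_norm_nonneg[of u] by linarith
  define w where "w = smult_vec (complex_of_real (1 / euclid_norm u)) u"
  have w: "w \<in> carrier_vec m" "euclid_norm w = 1"
    using assms pos by (auto simp: w_def euclid_norm_smult simp del: of_real_divide)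
  have "euclid_norm (mult_mat_vec A w) \<le> mat_norm A"
    unfolding mat_norm_def using w bdd_above_mat_norm assms by (intro cSUP_upper) auto
  moreover have "mult_mat_vec A w = smult_vec (complex_of_real (1 / euclid_norm u)) (mult_mat_vec A u)"
    unfolding w_def by (rule mult_mat_vec[OF assms])
  ultimately show ?thesis using pos by (simp add: euclid_norm_smult norm_divide field_simps)
qed

lemma mat_norm_leI:
  assumes "A \<in> carrier_mat n m" "0 \<le> C"
    and "\<And>u. u \<in> carrier_vec m \<Longrightarrow> euclid_norm (mult_mat_vec A u) \<le> C * euclid_norm u"
  shows "mat_norm A \<le> C"
  unfolding mat_norm_def
proof (rule cSUP_least)
  have "euclid_norm (0\<^sub>v (dim_col A) :: complex Matrix.vec) = 0" by (simp add: euclid_norm_def)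
  then have "0\<^sub>v (dim_col A) \<in> {u \<in> carrier_vec (dim_col A). euclid_norm u \<le> 1}" by simp
  then show "{u \<in> carrier_vec (dim_col A). euclid_norm u \<le> 1} \<noteq> {}" by blast
next
  fix u :: "complex Matrix.vec" assume "u \<in> {u \<in> carrier_vec (dim_col A). euclid_norm u \<le> 1}"
  then have "euclid_norm (mult_mat_vec A u) \<le> C * euclid_norm u" "C * euclid_norm u \<le> C"
    using assms by (auto intro: mult_left_le)
  then show "euclid_norm (mult_mat_vec A u) \<le> C" by simp
qed

lemma mat_norm_nonneg [simp]: "0 \<le> mat_norm A"
proof -
  have *: "euclid_norm (mult_mat_vec A (0\<^sub>v (dim_col A))) = 0"
    using euclid_norm_mult_mat_vec_le[of A "dim_row A" "dim_col A" "0\<^sub>v (dim_col A)"]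
      euclid_norm_nonneg[of "mult_mat_vec A (0\<^sub>v (dim_col A))"]
    by (auto simp: euclid_norm_def)
  have "euclid_norm (mult_mat_vec A (0\<^sub>v (dim_col A))) \<le> mat_norm A"
    unfolding mat_norm_def using bdd_above_mat_norm by (intro cSUP_upper) (auto simp: euclid_norm_def)
  then show ?thesis using * by simp
qed

lemma mat_norm_le_sum:
  assumes "A \<in> carrier_mat n m"
  shows "mat_norm A \<le> (\<Sum>i<n. \<Sum>j<m. cmod (A $$ (i, j)))"
  by (intro mat_norm_leI[OF assms] euclid_norm_mult_mat_vec_le assms sum_nonneg) auto

lemma mat_entry_le_norm:
  assumes "A \<in> carrier_mat n m" "i < n" "j < m"
  shows "cmod (A $$ (i, j)) \<le> mat_norm A"
proof -
  let ?u = "unit_vec m j :: complex Matrix.vec"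
  have "(euclid_norm ?u)\<^sup>2 = (\<Sum>i<m. if i = j then 1 else 0)"
    unfolding euclid_norm_sq[OF unit_vec_carrier] by (intro sum.cong) (auto simp: unit_vec_def)
  then have u: "euclid_norm ?u = 1" using assms(3) euclid_norm_nonneg[of ?u] by (auto simp: power2_eq_1_iff)
  have "vec_index (mult_mat_vec A ?u) i = (\<Sum>k<m. if k = j then A $$ (i, k) else 0)"
    unfolding index_mult_mat_vec_sum[OF assms(1) unit_vec_carrier assms(2)]
    by (intro sum.cong) (auto simp: unit_vec_def)
  then have "A $$ (i, j) = vec_index (mult_mat_vec A ?u) i" using assms(3) by simp
  also have "cmod \<dots> \<le> euclid_norm (mult_mat_vec A ?u)"
    using assms by (intro euclid_norm_index_le) auto
  also have "\<dots> \<le> mat_norm A"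
    using mult_mat_vec_mat_norm_le[OF assms(1) unit_vec_carrier, of j] by (simp add: u)
  finally show ?thesis .
qed

lemma mat_norm_mult:
  assumes "A \<in> carrier_mat n d" "B \<in> carrier_mat d m"
  shows "mat_norm (A * B) \<le> mat_norm A * mat_norm B"
proof (rule mat_norm_leI)
  fix u :: "complex Matrix.vec" assume u: "u \<in> carrier_vec m"
  have "euclid_norm (mult_mat_vec (A * B) u) \<le> mat_norm A * euclid_norm (mult_mat_vec B u)"
    using mult_mat_vec_mat_norm_le[OF assms(1)] assms u by simp
  also have "\<dots> \<le> mat_norm A * (mat_norm B * euclid_norm u)"
    by (intro mult_left_mono mult_mat_vec_mat_norm_le[OF assms(2) u]) simp
  finally show "euclid_norm (mult_mat_vec (A * B) u) \<le> mat_norm A * mat_norm B * euclid_norm u"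
    by (simp add: mult.assoc)
qed (use assms in auto)

lemma mat_norm_triangle:
  assumes "A \<in> carrier_mat n m" "B \<in> carrier_mat n m"
  shows "mat_norm (A + B) \<le> mat_norm A + mat_norm B"
proof (rule mat_norm_leI)
  fix u :: "complex Matrix.vec" assume u: "u \<in> carrier_vec m"
  have "euclid_norm (mult_mat_vec (A + B) u) \<le> euclid_norm (mult_mat_vec A u) + euclid_norm (mult_mat_vec B u)"
    using assms u by (simp add: add_mult_distrib_mat_vec[of A n m] euclid_norm_add)
  then show "euclid_norm (mult_mat_vec (A + B) u) \<le> (mat_norm A + mat_norm B) * euclid_norm u"
    using mult_mat_vec_mat_norm_le[OF assms(1) u] mult_mat_vec_mat_norm_le[OF assms(2) u]
    by (simp add: distrib_right)
qed (use assms in auto)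

lemma mult_mat_vec_adjoint:
  assumes "A \<in> carrier_mat n m" "u \<in> carrier_vec m" "w \<in> carrier_vec n"
  shows "(\<Sum>i<n. cnj (vec_index w i) * vec_index (mult_mat_vec A u) i)
    = (\<Sum>j<m. cnj (vec_index (mult_mat_vec (mat_adjoint A) w) j) * vec_index u j)"
proof -
  have "(\<Sum>i<n. cnj (vec_index w i) * vec_index (mult_mat_vec A u) i)
      = (\<Sum>i<n. \<Sum>j<m. cnj (vec_index w i) * (A $$ (i, j) * vec_index u j))"
    by (intro sum.cong) (simp_all add: index_mult_mat_vec_sum[OF assms(1,2)] sum_distrib_left)
  also have "\<dots> = (\<Sum>j<m. \<Sum>i<n. cnj (vec_index w i) * (A $$ (i, j) * vec_index u j))"
    by (rule sum.swap)
  also have "\<dots> = (\<Sum>j<m. cnj (vec_index (mult_mat_vec (mat_adjoint A) w) j) * vec_index u j)"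
    using assms
    by (intro sum.cong refl, subst index_mult_mat_vec_sum[OF mat_adjoint_carrier[OF assms(1)] assms(3)])
       (auto simp: sum_distrib_right intro!: sum.cong)
  finally show ?thesis .
qed

lemma mat_norm_adjoint_mult:
  assumes A: "A \<in> carrier_mat n m"
  shows "(mat_norm A)\<^sup>2 \<le> mat_norm (mat_adjoint A * A)"
proof -
  let ?N = "mat_norm (mat_adjoint A * A)"
  have "mat_norm A \<le> sqrt ?N"
  proof (rule mat_norm_leI[OF A])
    fix u :: "complex Matrix.vec" assume u: "u \<in> carrier_vec m"
    let ?w = "mult_mat_vec (mat_adjoint A * A) u"
    have Au: "mult_mat_vec A u \<in> carrier_vec n" using A u by simp
    have w: "?w \<in> carrier_vec m" "?w = mult_mat_vec (mat_adjoint A) (mult_mat_vec A u)"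
      using A u by (auto simp: assoc_mult_mat_vec[OF mat_adjoint_carrier[OF A] A u]
          intro!: mult_mat_vec_carrier[OF mat_adjoint_carrier[OF A]])
    have dw: "dim_vec ?w = m" using w(1) by (rule carrier_vecD)
    have "of_real ((euclid_norm (mult_mat_vec A u))\<^sup>2)
        = (\<Sum>i<n. cnj (vec_index (mult_mat_vec A u) i) * vec_index (mult_mat_vec A u) i)"
      unfolding euclid_norm_sq[OF Au] by (simp add: complex_norm_square mult.commute del: of_real_power)
    also have "\<dots> = (\<Sum>j<m. cnj (vec_index ?w j) * vec_index u j)"
      using mult_mat_vec_adjoint[OF A u Au] w(2) by simp
    finally have "cmod (of_real ((euclid_norm (mult_mat_vec A u))\<^sup>2)) = cmod (\<Sum>j<m. cnj (vec_index ?w j) * vec_index u j)"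
      by (rule arg_cong)
    then have "(euclid_norm (mult_mat_vec A u))\<^sup>2 = cmod (\<Sum>j<m. cnj (vec_index ?w j) * vec_index u j)"
      unfolding norm_of_real by simp
    also have "\<dots> \<le> (\<Sum>j<m. cmod (vec_index ?w j) * cmod (vec_index u j))"
      by (rule order.trans[OF norm_sum]) (simp add: norm_mult)
    also have "\<dots> \<le> euclid_norm ?w * euclid_norm u"
      using L2_set_mult_ineq[of "\<lambda>j. cmod (vec_index ?w j)" "\<lambda>j. cmod (vec_index u j)" "{..<m}"] u dw
      unfolding euclid_norm_L2 by (simp del: index_mult_mat_vec dim_mult_mat_vec)
    also have "\<dots> \<le> (?N * euclid_norm u) * euclid_norm u"
      by (intro mult_right_mono mult_mat_vec_mat_norm_le[of _ m m]) (use A u in auto)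
    also have "\<dots> = (sqrt ?N * euclid_norm u)\<^sup>2"
      by (simp add: power_mult_distrib power2_eq_square)
    finally show "euclid_norm (mult_mat_vec A u) \<le> sqrt ?N * euclid_norm u"
      by (rule power2_le_imp_le) simp
  qed simp
  then have "(mat_norm A)\<^sup>2 \<le> (sqrt ?N)\<^sup>2" by (intro power_mono) auto
  then show ?thesis by simp
qed

lemma mat_norm_adjoint:
  assumes A: "A \<in> carrier_mat n m"
  shows "mat_norm (mat_adjoint A) = mat_norm A"
proof -
  have le: "mat_norm A \<le> mat_norm (mat_adjoint A)" if "A \<in> carrier_mat n m" for A n m
  proof (cases "mat_norm A = 0")
    case False
    have "mat_norm A * mat_norm A \<le> mat_norm (mat_adjoint A) * mat_norm A"
      using mat_norm_adjoint_mult[OF that] mat_norm_mult[OF mat_adjoint_carrier[OF that] that]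
      by (simp add: power2_eq_square)
    then show ?thesis using False mat_norm_nonneg[of A] by simp
  qed simp
  show ?thesis using le[OF A] le[OF mat_adjoint_carrier[OF A]] by simp
qed

lemma adjoint_mult_self_eq_0:
  assumes A: "(A :: complex mat) \<in> carrier_mat n m" and "mat_adjoint A * A = 0\<^sub>m m m"
  shows "A = 0\<^sub>m n m"
proof (rule eq_matI)
  have "mat_norm (0\<^sub>m m m) \<le> 0" using mat_norm_le_sum[of "0\<^sub>m m m" m m] by simp
  then have "(mat_norm A)\<^sup>2 \<le> 0" using mat_norm_adjoint_mult[OF A] unfolding assms(2) by linarith
  then have "mat_norm A = 0" by simp
  then show "A $$ (i, j) = 0\<^sub>m n m $$ (i, j)" if "i < dim_row (0\<^sub>m n m)" "j < dim_col (0\<^sub>m n m)" for i j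
    using mat_entry_le_norm[OF A, of i j] that by simp
qed (use A in auto)

text \<open>The hypothesis splits the square of the length of \<open>u\<close> into those of
  \<open>A u\<close> and \<open>Z u\<close>. \<open>Z\<close> will be the image of
  \<open>1 - z\<close> for the \<open>z\<close> of \<open>quasi_sqrt_ideal\<close>.\<close>

lemma mat_norm_le_1_if_complement:
  assumes "A \<in> carrier_mat d d" "Z \<in> carrier_mat d d"
    and "mat_adjoint A * A + mat_adjoint Z * Z = 1\<^sub>m d"
  shows "mat_norm A \<le> 1"
proof (rule mat_norm_leI[OF assms(1)])
  fix u :: "complex Matrix.vec" assume u: "u \<in> carrier_vec d"
  have sq: "(\<Sum>j<d. cnj (vec_index (mult_mat_vec (mat_adjoint M * M) u) j) * vec_index u j)
      = of_real ((euclid_norm (mult_mat_vec M u))\<^sup>2)" if M: "M \<in> carrier_mat d d" for M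
  proof -
    have Mu: "mult_mat_vec M u \<in> carrier_vec d" using M u by simp
    show ?thesis
      unfolding euclid_norm_sq[OF Mu] using mult_mat_vec_adjoint[OF M u Mu] M u
      by (simp add: complex_norm_square mult.commute assoc_mult_mat_vec[OF mat_adjoint_carrier[OF M] M u]
          del: of_real_power index_mult_mat_vec)
  qed
  have "vec_index u j = vec_index (mult_mat_vec (mat_adjoint A * A) u) j
      + vec_index (mult_mat_vec (mat_adjoint Z * Z) u) j" if "j < d" for j
  proof -
    have "u = mult_mat_vec (mat_adjoint A * A + mat_adjoint Z * Z) u"
      using assms u by simp
    also have "\<dots> = mult_mat_vec (mat_adjoint A * A) u + mult_mat_vec (mat_adjoint Z * Z) u"
      using assms u by (intro add_mult_distrib_mat_vec[of _ d d]) auto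
    finally have "vec_index u j = vec_index (mult_mat_vec (mat_adjoint A * A) u + mult_mat_vec (mat_adjoint Z * Z) u) j"
      by (rule arg_cong)
    also have "\<dots> = vec_index (mult_mat_vec (mat_adjoint A * A) u) j + vec_index (mult_mat_vec (mat_adjoint Z * Z) u) j"
      using that assms by (intro index_add_vec(1)) simp
    finally show ?thesis .
  qed
  then have "(\<Sum>j<d. cnj (vec_index u j) * vec_index u j)
      = of_real ((euclid_norm (mult_mat_vec A u))\<^sup>2) + of_real ((euclid_norm (mult_mat_vec Z u))\<^sup>2)"
    unfolding sq[OF assms(1), symmetric] sq[OF assms(2), symmetric] sum.distrib[symmetric]
    by (intro sum.cong refl) (simp add: distrib_right del: index_mult_mat_vec)
  moreover have "(\<Sum>j<d. cnj (vec_index u j) * vec_index u j) = of_real ((euclid_norm u)\<^sup>2)"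
    unfolding euclid_norm_sq[OF u] by (simp add: complex_norm_square mult.commute del: of_real_power)
  ultimately have "complex_of_real ((euclid_norm u)\<^sup>2)
      = of_real ((euclid_norm (mult_mat_vec A u))\<^sup>2 + (euclid_norm (mult_mat_vec Z u))\<^sup>2)"
    by (simp only: of_real_add)
  then have "(euclid_norm u)\<^sup>2 = (euclid_norm (mult_mat_vec A u))\<^sup>2 + (euclid_norm (mult_mat_vec Z u))\<^sup>2"
    by (simp only: of_real_eq_iff)
  then have "(euclid_norm (mult_mat_vec A u))\<^sup>2 \<le> (euclid_norm u)\<^sup>2" by simp
  then show "euclid_norm (mult_mat_vec A u) \<le> 1 * euclid_norm u"
    unfolding mult_1 by (rule power2_le_imp_le) simp
qed simp

text \<open>The function \<open>e\<close> is the orthogonal projection of \<open>u\<close> onto the subspace \<open>J\<close>, with values outside \<open>S\<close> ignored.\<close>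

lemma orthogonal_projection_exists:
  fixes J :: "('s \<Rightarrow> complex) set"
  assumes "finite S" "(\<lambda>_. 0) \<in> J" and "\<And>x y. x \<in> J \<Longrightarrow> y \<in> J \<Longrightarrow> (\<lambda>s. x s + y s) \<in> J"
    and "\<And>x c. x \<in> J \<Longrightarrow> (\<lambda>s. c * x s) \<in> J"
  shows "\<exists>e\<in>J. \<forall>x\<in>J. (\<Sum>s\<in>S. cnj (x s) * (u s - e s)) = 0"
  using assms
proof (induction S arbitrary: J u rule: finite_induct)
  case empty
  show ?case by (intro bexI[OF _ empty(1)]) simp
next
  case (insert k S)
  define J0 where "J0 = {x \<in> J. x k = 0}"
  have J0: "(\<lambda>_. 0) \<in> J0" "\<And>x y. x \<in> J0 \<Longrightarrow> y \<in> J0 \<Longrightarrow> (\<lambda>s. x s + y s) \<in> J0"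
    "\<And>x c. x \<in> J0 \<Longrightarrow> (\<lambda>s. c * x s) \<in> J0"
    using insert.prems by (auto simp: J0_def)
  \<comment> \<open>On \<open>J0\<close> the coordinate \<open>k\<close> contributes nothing to the
    sum, so the induction hypothesis for \<open>S\<close> serves for \<open>insert k S\<close> as
    well.\<close>
  have proj: "\<exists>e\<in>J0. \<forall>x\<in>J0. (\<Sum>s\<in>insert k S. cnj (x s) * (u s - e s)) = 0" for u
    using insert.IH[OF J0, of u] insert.hyps by (auto simp: J0_def)
  show ?case
  proof (cases "J0 = J")
    case True
    then show ?thesis using proj by simp
  next
    case False
    then obtain b where b: "b \<in> J" "b k \<noteq> 0" by (auto simp: J0_def)
    define b' where "b' = (\<lambda>s. inverse (b k) * b s)"
    have b': "b' \<in> J" "b' k = 1" using b insert.prems by (auto simp: b'_def)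
    obtain b0 where b0: "b0 \<in> J0" "\<And>x. x \<in> J0 \<Longrightarrow> (\<Sum>s\<in>insert k S. cnj (x s) * (b' s - b0 s)) = 0"
      using proj[of b'] by blast
    \<comment> \<open>A Gram-Schmidt step: \<open>g\<close> is orthogonal to \<open>J0\<close>, and
      \<open>g k = 1\<close> because \<open>b0\<close> vanishes at \<open>k\<close>. Hence every
      \<open>x\<close> in \<open>J\<close> is an element of \<open>J0\<close> plus
      \<open>x k\<close> times \<open>g\<close>, and the projection onto \<open>J\<close> is that
      onto \<open>J0\<close> plus the one onto the line of \<open>g\<close>.\<close>
    define g where "g s = b' s - b0 s" for s
    have "(\<lambda>s. b' s + (-1) * b0 s) \<in> J"
      by (intro insert.prems(2)[OF b'(1)] insert.prems(3)) (use b0 in \<open>auto simp: J0_def\<close>)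
    then have gJ: "g \<in> J" and gk: "g k = 1"
      using b' b0 by (auto simp: g_def[abs_def] J0_def)
    obtain e0 where e0: "e0 \<in> J0" "\<And>x. x \<in> J0 \<Longrightarrow> (\<Sum>s\<in>insert k S. cnj (x s) * (u s - e0 s)) = 0"
      using proj[of u] by blast
    define G where "G = (\<Sum>s\<in>insert k S. cnj (g s) * g s)"
    define l where "l = (\<Sum>s\<in>insert k S. cnj (g s) * (u s - e0 s)) / G"
    have "G = of_real (\<Sum>s\<in>insert k S. (cmod (g s))\<^sup>2)"
      unfolding G_def of_real_sum by (intro sum.cong refl) (simp add: complex_norm_square mult.commute del: of_real_power)
    moreover have "(\<Sum>s\<in>insert k S. (cmod (g s))\<^sup>2) \<ge> 1"
      using insert.hyps by (simp add: gk sum_nonneg)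
    ultimately have G: "G \<noteq> 0" by (simp only: of_real_eq_0_iff)
    define e where "e s = e0 s + l * g s" for s
    have "e \<in> J" using e0 gJ insert.prems by (auto simp: e_def[abs_def] J0_def)
    moreover have "(\<Sum>s\<in>insert k S. cnj (x s) * (u s - e s)) = 0" if x: "x \<in> J" for x
    proof -
      define y where "y s = x s + (- x k) * g s" for s
      have y: "y \<in> J0"
      proof -
        have "y \<in> J"
          unfolding y_def[abs_def] by (intro insert.prems(2)[OF x] insert.prems(3) gJ)
        then show ?thesis by (simp add: J0_def y_def gk)
      qed
      have "(\<Sum>s\<in>insert k S. cnj (x s) * (u s - e s))
          = (\<Sum>s\<in>insert k S. cnj (y s) * (u s - e0 s)) - l * (\<Sum>s\<in>insert k S. cnj (y s) * g s)
            + cnj (x k) * ((\<Sum>s\<in>insert k S. cnj (g s) * (u s - e0 s)) - l * G)"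
        unfolding G_def sum_distrib_left sum_subtractf[symmetric] sum.distrib[symmetric]
        by (intro sum.cong refl) (simp add: y_def e_def algebra_simps)
      also have "\<dots> = 0"
        using e0(2)[OF y] b0(2)[OF y] G by (simp add: g_def l_def del: sum.insert)
      finally show ?thesis .
    qed
    ultimately show ?thesis by (intro bexI[of _ e] ballI)
  qed
qed

lemma cmod_sum_cnj_le:
  assumes "u \<in> carrier_vec n" "w \<in> carrier_vec n"
  shows "cmod (\<Sum>i<n. cnj (vec_index u i) * vec_index w i) \<le> euclid_norm u * euclid_norm w"
proof -
  have "cmod (\<Sum>i<n. cnj (vec_index u i) * vec_index w i) \<le> (\<Sum>i<n. \<bar>cmod (vec_index u i)\<bar> * \<bar>cmod (vec_index w i)\<bar>)"
    by (rule order.trans[OF norm_sum]) (simp add: norm_mult)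
  also have "\<dots> \<le> euclid_norm u * euclid_norm w"
    unfolding euclid_norm_L2 carrier_vecD[OF assms(1)] carrier_vecD[OF assms(2)] by (rule L2_set_mult_ineq)
  finally show ?thesis .
qed

subsection \<open>Block matrices\<close>

definition block_mat :: "nat \<Rightarrow> nat \<Rightarrow> (nat \<Rightarrow> nat \<Rightarrow> complex mat) \<Rightarrow> complex mat" where
  "block_mat d k M = mat (d * k) (d * k) (\<lambda>(I, J). M (I div k) (J div k) $$ (I mod k, J mod k))"

lemma block_mat_carrier [simp]: "block_mat d k M \<in> carrier_mat (d * k) (d * k)"
  by (simp add: block_mat_def)

lemma block_mat_dim [simp]: "dim_row (block_mat d k M) = d * k" "dim_col (block_mat d k M) = d * k"
  by (simp_all add: block_mat_def)

lemma block_mat_index: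
  "I < d * k \<Longrightarrow> J < d * k \<Longrightarrow> block_mat d k M $$ (I, J) = M (I div k) (J div k) $$ (I mod k, J mod k)"
  by (simp add: block_mat_def)

lemma block_index:
  assumes "I < d * k" shows "I div k < d" "I mod k < (k :: nat)"
proof -
  have "0 < k" using assms by (cases k) auto
  then show "I div k < d" "I mod k < k" using assms by (simp_all add: less_mult_imp_div_less)
qed

lemma block_index_less: "i < d \<Longrightarrow> a < k \<Longrightarrow> i * k + a < d * (k :: nat)"
  using mult_le_mono1[of "Suc i" d k] by simp

lemma sum_blocks:
  fixes d k :: nat
  shows "(\<Sum>J<d * k. g J) = (\<Sum>l<d. \<Sum>b<k. g (l * k + b) :: 'c::comm_monoid_add)"
proof -
  have "(\<Sum>J<d * k. g J) = (\<Sum>l<d. sum g {l * k..<l * k + k})"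
    by (rule sum.nat_group[symmetric])
  also have "\<dots> = (\<Sum>l<d. \<Sum>b<k. g (l * k + b))"
  proof (rule sum.cong[OF refl])
    fix l
    have "sum g {0 + l * k..<k + l * k} = (\<Sum>b = 0..<k. g (b + l * k))"
      by (rule sum.shift_bounds_nat_ivl)
    then show "sum g {l * k..<l * k + k} = (\<Sum>b<k. g (l * k + b))"
      by (simp add: add.commute atLeast0LessThan)
  qed
  finally show ?thesis .
qed

lemma block_mat_eqI:
  assumes "A \<in> carrier_mat (d * k) (d * k)"
    and "\<And>I J. I < d * k \<Longrightarrow> J < d * k \<Longrightarrow> M (I div k) (J div k) $$ (I mod k, J mod k) = A $$ (I, J)"
  shows "block_mat d k M = A"
  by (rule eq_matI) (use assms in \<open>auto simp: block_mat_index\<close>)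

lemma block_mat_mult:
  assumes M: "\<And>i j. i < d \<Longrightarrow> j < d \<Longrightarrow> M i j \<in> carrier_mat k k"
    and N: "\<And>i j. i < d \<Longrightarrow> j < d \<Longrightarrow> N i j \<in> carrier_mat k k"
    and R: "\<And>i j a b. i < d \<Longrightarrow> j < d \<Longrightarrow> a < k \<Longrightarrow> b < k \<Longrightarrow>
      R i j $$ (a, b) = (\<Sum>l<d. (M i l * N l j) $$ (a, b))"
  shows "block_mat d k R = block_mat d k M * block_mat d k N"
proof (rule block_mat_eqI)
  show "block_mat d k M * block_mat d k N \<in> carrier_mat (d * k) (d * k)"
    by (rule mult_carrier_mat[OF block_mat_carrier block_mat_carrier])
  fix I J assume I: "I < d * k" and J: "J < d * k"
  note bI = block_index[OF I] and bJ = block_index[OF J]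
  have "(block_mat d k M * block_mat d k N) $$ (I, J)
      = (\<Sum>L<d * k. block_mat d k M $$ (I, L) * block_mat d k N $$ (L, J))"
    by (rule index_mult_mat_sum[OF block_mat_carrier block_mat_carrier I J])
  also have "\<dots> = (\<Sum>l<d. \<Sum>b<k. block_mat d k M $$ (I, l * k + b) * block_mat d k N $$ (l * k + b, J))"
    by (rule sum_blocks)
  also have "\<dots> = (\<Sum>l<d. \<Sum>b<k. M (I div k) l $$ (I mod k, b) * N l (J div k) $$ (b, J mod k))"
    by (intro sum.cong refl) (simp add: block_mat_index I J block_index_less)
  also have "\<dots> = (\<Sum>l<d. (M (I div k) l * N l (J div k)) $$ (I mod k, J mod k))"
    by (intro sum.cong refl index_mult_mat_sum[symmetric, of _ k k _ k] M N) (simp_all add: bI bJ)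
  finally show "R (I div k) (J div k) $$ (I mod k, J mod k) = (block_mat d k M * block_mat d k N) $$ (I, J)"
    using R[OF bI(1) bJ(1) bI(2) bJ(2)] by simp
qed

text \<open>Extending \<open>u\<close> by zero to the block \<open>l\<close> preserves its length,
  and the block \<open>i\<close> of the image is \<open>M i l\<close> applied to
  \<open>u\<close>.\<close>

lemma mat_norm_block_le:
  assumes M: "M i l \<in> carrier_mat k k" and il: "i < d" "l < d"
  shows "mat_norm (M i l) \<le> mat_norm (block_mat d k M)"
proof (rule mat_norm_leI[OF M])
  fix u :: "complex Matrix.vec" assume u: "u \<in> carrier_vec k"
  define v where "v = Matrix.vec (d * k) (\<lambda>J. if J div k = l then vec_index u (J mod k) else 0)"
  have v: "v \<in> carrier_vec (d * k)" by (simp add: v_def)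
  have v_index: "vec_index v (j * k + b) = (if j = l then vec_index u b else 0)" if "j < d" "b < k" for j b
    using that by (simp add: v_def block_index_less)
  have "(euclid_norm v)\<^sup>2 = (\<Sum>j<d. \<Sum>b<k. (cmod (vec_index v (j * k + b)))\<^sup>2)"
    unfolding euclid_norm_sq[OF v] by (rule sum_blocks)
  also have "\<dots> = (\<Sum>j<d. if j = l then (euclid_norm u)\<^sup>2 else 0)"
    unfolding euclid_norm_sq[OF u] by (intro sum.cong refl) (auto simp: v_index)
  also have "\<dots> = (euclid_norm u)\<^sup>2" using il by simp
  finally have nv: "euclid_norm v = euclid_norm u" by simp
  let ?w = "mult_mat_vec (block_mat d k M) v"
  have w: "?w \<in> carrier_vec (d * k)" by (rule mult_mat_vec_carrier[OF block_mat_carrier v])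
  have Mu: "mult_mat_vec (M i l) u \<in> carrier_vec k" by (rule mult_mat_vec_carrier[OF M u])
  have w_index: "vec_index ?w (i * k + a) = vec_index (mult_mat_vec (M i l) u) a" if a: "a < k" for a
  proof -
    have "vec_index ?w (i * k + a) = (\<Sum>J<d * k. block_mat d k M $$ (i * k + a, J) * vec_index v J)"
      by (rule index_mult_mat_vec_sum[OF block_mat_carrier v block_index_less[OF il(1) a]])
    also have "\<dots> = (\<Sum>j<d. \<Sum>b<k. block_mat d k M $$ (i * k + a, j * k + b) * vec_index v (j * k + b))"
      by (rule sum_blocks)
    also have "\<dots> = (\<Sum>j<d. if j = l then \<Sum>b<k. M i l $$ (a, b) * vec_index u b else 0)"
      using a il(1) by (intro sum.cong refl) (auto simp: v_index block_mat_index block_index_less intro!: sum.cong)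
    also have "\<dots> = (\<Sum>b<k. M i l $$ (a, b) * vec_index u b)" using il by simp
    also have "\<dots> = vec_index (mult_mat_vec (M i l) u) a"
      by (rule index_mult_mat_vec_sum[OF M u a, symmetric])
    finally show ?thesis .
  qed
  have "(euclid_norm (mult_mat_vec (M i l) u))\<^sup>2 = (\<Sum>a<k. (cmod (vec_index ?w (i * k + a)))\<^sup>2)"
    unfolding euclid_norm_sq[OF Mu] by (rule sum.cong[OF refl]) (simp only: w_index lessThan_iff)
  also have "\<dots> \<le> (\<Sum>j<d. \<Sum>a<k. (cmod (vec_index ?w (j * k + a)))\<^sup>2)"
    by (rule member_le_sum[of i "{..<d}" "\<lambda>j. \<Sum>a<k. (cmod (vec_index ?w (j * k + a)))\<^sup>2"])
       (use il in \<open>auto intro!: sum_nonneg\<close>)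
  also have "\<dots> = (euclid_norm ?w)\<^sup>2" unfolding euclid_norm_sq[OF w] by (rule sum_blocks[symmetric])
  finally have "euclid_norm (mult_mat_vec (M i l) u) \<le> euclid_norm ?w" by (rule power2_le_imp_le) simp
  also have "\<dots> \<le> mat_norm (block_mat d k M) * euclid_norm v"
    by (rule mult_mat_vec_mat_norm_le[OF block_mat_carrier v])
  finally show "euclid_norm (mult_mat_vec (M i l) u) \<le> mat_norm (block_mat d k M) * euclid_norm u"
    unfolding nv .
qed simp

text \<open>The constant is crude on purpose: it only serves to extend a homomorphism to a
  completion, after which contractivity is automatic.\<close>

lemma mat_norm_block_le_sum:
  assumes M: "\<And>i j. i < d \<Longrightarrow> j < d \<Longrightarrow> M i j \<in> carrier_mat k k \<and> mat_norm (M i j) \<le> K"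
  shows "mat_norm (block_mat d k M) \<le> (real (d * k))\<^sup>2 * K"
proof -
  have "mat_norm (block_mat d k M) \<le> (\<Sum>I<d * k. \<Sum>J<d * k. cmod (block_mat d k M $$ (I, J)))"
    by (rule mat_norm_le_sum[OF block_mat_carrier])
  also have "\<dots> \<le> (\<Sum>I<d * k. \<Sum>J<d * k. K)"
  proof (intro sum_mono)
    fix I J assume "I \<in> {..<d * k}" "J \<in> {..<d * k}"
    then have IJ: "I < d * k" "J < d * k" by simp_all
    note b = block_index[OF IJ(1)] block_index[OF IJ(2)]
    have "cmod (M (I div k) (J div k) $$ (I mod k, J mod k)) \<le> mat_norm (M (I div k) (J div k))"
      by (rule mat_entry_le_norm[OF conjunct1[OF M[OF b(1,3)]] b(2,4)])
    then show "cmod (block_mat d k M $$ (I, J)) \<le> K"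
      using M[OF b(1,3)] by (simp add: block_mat_index IJ)
  qed
  also have "\<dots> = (real (d * k))\<^sup>2 * K" by (simp add: power2_eq_square)
  finally show ?thesis .
qed

section \<open>Partial actions\<close>

locale partial_system =
  fixes D :: "'g::group_add \<Rightarrow> 'a::cstar_algebra set" and \<alpha> :: "'g \<Rightarrow> 'a \<Rightarrow> 'a"
  assumes system: "partial_dynamical_system D \<alpha>"
begin

lemma ideal: "closed_ideal (D t)"
  using system by (simp add: partial_dynamical_system_def)

lemmas ideal_simps = closed_idealD(2-10)[OF ideal]

lemma D_zero [simp]: "D 0 = UNIV" and alpha_zero_index [simp]: "\<alpha> 0 a = a"
  using system by (simp_all add: partial_dynamical_system_def)

lemma star_iso: "star_iso_on (D (- t)) (D t) (\<alpha> t)"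
  using system by (simp add: partial_dynamical_system_def)

lemma alpha_in: "a \<in> D (- t) \<Longrightarrow> \<alpha> t a \<in> D t"
  using star_iso[of t] by (auto simp: star_iso_on_def bij_betw_def)

lemma alpha_in': "a \<in> D t \<Longrightarrow> \<alpha> (- t) a \<in> D (- t)"
  using alpha_in[of a "- t"] by simp

lemma
  assumes "a \<in> D (- t)"
  shows alpha_add: "b \<in> D (- t) \<Longrightarrow> \<alpha> t (a + b) = \<alpha> t a + \<alpha> t b"
    and alpha_mult: "b \<in> D (- t) \<Longrightarrow> \<alpha> t (a * b) = \<alpha> t a * \<alpha> t b"
    and alpha_scale: "\<alpha> t (c *C a) = c *C \<alpha> t a"
    and alpha_star: "\<alpha> t (cstar a) = cstar (\<alpha> t a)"
  using star_iso[of t] assms by (auto simp: star_iso_on_def)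

lemma
  assumes "a \<in> D t"
  shows alpha_add': "b \<in> D t \<Longrightarrow> \<alpha> (- t) (a + b) = \<alpha> (- t) a + \<alpha> (- t) b"
    and alpha_mult': "b \<in> D t \<Longrightarrow> \<alpha> (- t) (a * b) = \<alpha> (- t) a * \<alpha> (- t) b"
    and alpha_scale': "\<alpha> (- t) (c *C a) = c *C \<alpha> (- t) a"
    and alpha_star': "\<alpha> (- t) (cstar a) = cstar (\<alpha> (- t) a)"
  using star_iso[of "- t"] assms by (auto simp: star_iso_on_def)

lemma alpha_zero [simp]: "\<alpha> t 0 = 0"
  using alpha_scale[of 0 t 0] ideal_simps(1) by simp

lemma alpha_comp:
  assumes "a \<in> D (- t)" "\<alpha> t a \<in> D (- s)"
  shows "a \<in> D (- (s + t))" "\<alpha> (s + t) a = \<alpha> s (\<alpha> t a)"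
  using system assms unfolding partial_dynamical_system_def by blast+

lemma alpha_inv: "a \<in> D (- t) \<Longrightarrow> \<alpha> (- t) (\<alpha> t a) = a"
  using alpha_comp(2)[of a t "- t"] alpha_in[of a t] by simp

lemma alpha_inv': "a \<in> D t \<Longrightarrow> \<alpha> t (\<alpha> (- t) a) = a"
  using alpha_inv[of a "- t"] by simp

text \<open>The extension axiom for \<open>- t\<close> and \<open>- s\<close> at the point
  \<open>\<alpha> s x\<close>, which \<open>\<alpha> (- s)\<close> sends back to \<open>x\<close>.
  Most memberships in the fibres of the bundle come from here.\<close>

lemma alpha_cross:
  assumes "x \<in> D (- s)" "x \<in> D t"
  shows "\<alpha> s x \<in> D (s + t)" "\<alpha> (- t + - s) (\<alpha> s x) = \<alpha> (- t) x"
  using alpha_comp[of "\<alpha> s x" "- s" "- t"] alpha_in[OF assms(1)] alpha_inv[OF assms(1)] assms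
  by (simp_all add: minus_add)

lemma alpha_norm: "a \<in> D (- t) \<Longrightarrow> norm (\<alpha> t a) = norm a"
proof -
  have le: "norm (\<alpha> t a) \<le> norm a" if "a \<in> D (- t)" for t a
    by (rule star_hom_contractive[OF ideal that]) (auto simp: alpha_add alpha_mult alpha_scale alpha_star)
  assume a: "a \<in> D (- t)"
  show ?thesis
    using le[OF a] le[of "\<alpha> t a" "- t"] alpha_in[OF a] alpha_inv[OF a] by simp
qed

abbreviation bundle_mult :: "'g \<Rightarrow> 'g \<Rightarrow> 'a \<Rightarrow> 'a \<Rightarrow> 'a" where
  "bundle_mult s t a b \<equiv> \<alpha> s (\<alpha> (- s) a * b)"

lemma bundle_mult_in: "a \<in> D s \<Longrightarrow> b \<in> D t \<Longrightarrow> bundle_mult s t a b \<in> D (s + t)"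
  by (intro alpha_cross ideal_simps alpha_in')

text \<open>Left multiplication by \<open>a' = \<alpha>\<^sub>-\<^sub>s a\<close> commutes on \<open>D\<^sub>t\<close> with the right multiplier
  \<open>M b = \<alpha>\<^sub>t (\<alpha>\<^sub>-\<^sub>t b c)\<close>: the difference \<open>E = a' M b - M (a' b)\<close> satisfies \<open>d E = 0\<close> for all
  \<open>d \<in> D\<^sub>t\<close>, in particular for \<open>d = E\<^sup>*\<close>.\<close>

lemma bundle_mult_assoc:
  assumes a: "a \<in> D s" and b: "b \<in> D t"
  shows "bundle_mult (s + t) r (bundle_mult s t a b) c = bundle_mult s (t + r) a (bundle_mult t r b c)"
proof -
  define a' where "a' = \<alpha> (- s) a"
  have a': "a' \<in> D (- s)" using a by (simp add: a'_def alpha_in')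
  define M where "M b = \<alpha> t (\<alpha> (- t) b * c)" for b
  have M: "M b \<in> D t" if "b \<in> D t" for b
    unfolding M_def by (intro alpha_in ideal_simps alpha_in' that)
  have dM: "d * M b = M (d * b)" if "d \<in> D t" "b \<in> D t" for d b
  proof -
    have "M (d * b) = \<alpha> t (\<alpha> (- t) d * (\<alpha> (- t) b * c))"
      by (simp add: M_def alpha_mult' that mult.assoc)
    also have "\<dots> = \<alpha> t (\<alpha> (- t) d) * M b"
      unfolding M_def by (intro alpha_mult ideal_simps alpha_in' that)
    finally show ?thesis using that by (simp add: alpha_inv')
  qed
  define E where "E = a' * M b - M (a' * b)"
  have ED: "E \<in> D t" unfolding E_def by (intro ideal_simps M b)
  have "d * E = 0" if d: "d \<in> D t" for d
  proof -
    have "d * E = (d * a') * M b - d * M (a' * b)" by (simp add: E_def algebra_simps)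
    also have "\<dots> = 0"
      using dM[of "d * a'" b] dM[of d "a' * b"] d b by (simp add: ideal_simps mult.assoc)
    finally show ?thesis .
  qed
  then have "cstar E * E = 0" using ED by (simp add: ideal_simps)
  then have comm: "a' * M b = M (a' * b)" using cstar_mult_self_eq_0[of E] by (simp add: E_def)
  define y where "y = \<alpha> (- t) (a' * b) * c"
  have ab: "a' * b \<in> D (- s)" "a' * b \<in> D t" using a' b by (simp_all add: ideal_simps)
  have y: "y \<in> D (- t)" unfolding y_def by (intro ideal_simps alpha_in' ab)
  have "\<alpha> (- t) (a' * b) \<in> D (- t + - s)" using alpha_cross(1)[of "a' * b" "- t" "- s"] ab by simp
  then have y': "y \<in> D (- t + - s)" by (simp add: y_def ideal_simps)
  then have ty: "\<alpha> t y \<in> D (- s)" using alpha_cross(1)[OF y y'] by (simp only: add_minus_cancel)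
  have "bundle_mult (s + t) r (bundle_mult s t a b) c = \<alpha> (s + t) y"
    using alpha_cross(2)[OF ab] by (simp add: y_def a'_def minus_add)
  also have "\<dots> = \<alpha> s (M (a' * b))" using alpha_comp(2)[OF y ty] by (simp add: y_def M_def)
  also have "\<dots> = bundle_mult s (t + r) a (bundle_mult t r b c)"
    unfolding comm[symmetric] by (simp add: M_def a'_def)
  finally show ?thesis .
qed

lemma bundle_mult_star:
  assumes a: "a \<in> D s" and b: "b \<in> D t"
  shows "\<alpha> (- (s + t)) (cstar (bundle_mult s t a b))
    = bundle_mult (- t) (- s) (\<alpha> (- t) (cstar b)) (\<alpha> (- s) (cstar a))"
proof -
  have ab: "cstar b * \<alpha> (- s) (cstar a) \<in> D (- s)" "cstar b * \<alpha> (- s) (cstar a) \<in> D t"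
    using a b by (simp_all add: ideal_simps alpha_in')
  have "cstar (bundle_mult s t a b) = \<alpha> s (cstar b * \<alpha> (- s) (cstar a))"
    unfolding alpha_star'[OF a] cstar_mult[symmetric]
    by (intro alpha_star[symmetric] ideal_simps alpha_in' a)
  then show ?thesis
    using alpha_cross(2)[OF ab] b by (simp add: minus_add alpha_inv' ideal_simps)
qed

lemma action_bundle_simps [simp]:
  "fibre (action_bundle D \<alpha>) = D"
  "fb_mult (action_bundle D \<alpha>) s t a b = \<alpha> s (\<alpha> (- s) a * b)"
  "fb_star (action_bundle D \<alpha>) s a = \<alpha> (- s) (cstar a)"
  by (simp_all add: action_bundle_def)

subsection \<open>Covariant representations and representations of the bundle\<close>

text \<open>The matrix \<open>v s * v (- s)\<close> acts as a unit on the image of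
  \<open>D s\<close>. This lets it be inserted and removed at will, which is what the
  multiplicativity of \<open>\<phi> a * v s\<close> and the norm bound both need.\<close>

lemma bundle_rep_if_covariant_rep:
  assumes "covariant_rep D \<alpha> d \<phi> v"
  shows "bundle_rep (action_bundle D \<alpha>) d (\<lambda>t a. \<phi> a * v t)"
    and "a \<in> D t \<Longrightarrow> mat_norm (\<phi> a) \<le> mat_norm (\<phi> a * v t)"
proof -
  have \<phi> [simp]: "\<phi> a \<in> carrier_mat d d" "\<phi> (a + b) = \<phi> a + \<phi> b" "\<phi> (c *C a) = c \<cdot>\<^sub>m \<phi> a"
    "\<phi> (a * b) = \<phi> a * \<phi> b" "\<phi> (cstar a) = mat_adjoint (\<phi> a)" for a b c
    using assms by (simp_all add: covariant_rep_def star_hom_mat_def type_star_alg_def)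
  have v [simp]: "v t \<in> carrier_mat d d" "v 0 = 1\<^sub>m d" "v (- t) = mat_adjoint (v t)"
    and vvv: "v (- s) * v s * v t = v (- s) * v (s + t)"
    and cov': "b \<in> D (- t) \<Longrightarrow> v t * \<phi> b * mat_adjoint (v t) = \<phi> (\<alpha> t b)" for s t b
    using assms unfolding covariant_rep_def partial_star_rep_def by blast+
  have cov: "v t * \<phi> b * v (- t) = \<phi> (\<alpha> t b)" if "b \<in> D (- t)" for t b
    using cov'[OF that] by simp
  have assoc: "A * B * C = A * (B * C)"
    if "A \<in> carrier_mat d d" "B \<in> carrier_mat d d" "C \<in> carrier_mat d d" for A B C :: "complex mat"
    by (rule assoc_mult_mat[OF that])
  have carr [simp]: "A * B \<in> carrier_mat d d"
    if "A \<in> carrier_mat d d" "B \<in> carrier_mat d d" for A B :: "complex mat"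
    using that by auto
  \<comment> \<open>The relation of a partial representation for an element and its inverse, with
    \<open>v 0\<close> the unit matrix: every \<open>v s\<close> is a partial isometry.\<close>
  have vv: "v s * v (- s) * v s = v s" for s
  proof -
    have "v s * v (- s) * v s = v s * v 0"
      using vvv[of "- s" s] by (simp only: minus_minus add.left_inverse)
    then show ?thesis using right_mult_one_mat[OF v(1)] by (simp only: v(2))
  qed
  have in_form: "\<exists>b\<in>D (- s). a = \<alpha> s b \<and> b = \<alpha> (- s) a" if "a \<in> D s" for a s
    using that by (intro bexI[of _ "\<alpha> (- s) a"]) (simp_all add: alpha_inv' alpha_in')
  \<comment> \<open>Elements of \<open>D s\<close> have the form \<open>\<alpha> s b\<close>, so
    their images start with \<open>v s\<close> and end with \<open>v (- s)\<close> by covariance;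
    \<open>vv\<close> then absorbs the range projection on either side.\<close>
  have left: "v s * v (- s) * \<phi> a = \<phi> a" and right: "\<phi> a * (v s * v (- s)) = \<phi> a"
    if "a \<in> D s" for a s
  proof -
    obtain b where b: "b \<in> D (- s)" "a = \<alpha> s b" using in_form[OF \<open>a \<in> D s\<close>] by blast
    have a: "\<phi> a = v s * \<phi> b * v (- s)" using cov[OF b(1)] b(2) by simp
    have "v s * v (- s) * (v s * \<phi> b * v (- s)) = (v s * v (- s) * v s) * (\<phi> b * v (- s))"
      by (simp add: assoc del: v(3))
    then show "v s * v (- s) * \<phi> a = \<phi> a"
      unfolding a vv by (simp add: assoc)
    have "v s * \<phi> b * v (- s) * (v s * v (- s)) = v s * \<phi> b * (v (- s) * v s * v (- s))"
      by (simp add: assoc)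
    also have "v (- s) * v s * v (- s) = v (- s)" using vv[of "- s"] by (simp only: minus_minus)
    finally show "\<phi> a * (v s * v (- s)) = \<phi> a" unfolding a by (simp add: assoc)
  qed
  have swap: "\<phi> a * v s = v s * \<phi> (\<alpha> (- s) a)" if a: "a \<in> D s" for a s
  proof -
    have "v (- s) * \<phi> a * v s = \<phi> (\<alpha> (- s) a)"
      using cov[of a "- s"] a by (simp only: minus_minus)
    then have "v s * \<phi> (\<alpha> (- s) a) = v s * (v (- s) * \<phi> a * v s)" by simp
    also have "\<dots> = v s * v (- s) * \<phi> a * v s" by (simp add: assoc)
    finally show ?thesis using left[OF a] by simp
  qed
  have mult: "\<phi> a * v s * (\<phi> b * v t) = \<phi> (bundle_mult s t a b) * v (s + t)"
    if a: "a \<in> D s" and b: "b \<in> D t" for a b s t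
  proof -
    define c where "c = \<alpha> (- s) a * b"
    have c: "c \<in> D (- s)" using a by (simp add: c_def ideal_simps alpha_in')
    have cs: "\<alpha> s c \<in> D s" by (rule alpha_in[OF c])
    have "\<phi> a * v s * (\<phi> b * v t) = v s * \<phi> (\<alpha> (- s) a) * (\<phi> b * v t)" by (simp add: swap[OF a])
    also have "\<dots> = v s * \<phi> c * v t" by (simp add: c_def assoc)
    also have "v s * \<phi> c = \<phi> (\<alpha> s c) * v s" using swap[OF cs] c by (simp add: alpha_inv)
    \<comment> \<open>The relation for \<open>v\<close> only rewrites \<open>v s * v t\<close> after
      multiplication by \<open>v (- s)\<close>; the missing factor is supplied by the projection
      that the element of \<open>D s\<close> absorbs.\<close>
    also have "\<phi> (\<alpha> s c) * v s * v t = \<phi> (\<alpha> s c) * (v s * v (- s)) * v s * v t"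
      by (simp only: right[OF cs])
    also have "\<dots> = \<phi> (\<alpha> s c) * (v s * (v (- s) * v s * v t))" by (simp add: assoc)
    also have "\<dots> = \<phi> (\<alpha> s c) * (v s * (v (- s) * v (s + t)))" by (simp only: vvv)
    also have "\<dots> = \<phi> (\<alpha> s c) * (v s * v (- s)) * v (s + t)" by (simp add: assoc)
    finally show ?thesis by (simp only: right[OF cs]) (simp add: c_def)
  qed
  have star: "mat_adjoint (\<phi> a * v s) = \<phi> (\<alpha> (- s) (cstar a)) * v (- s)" if a: "a \<in> D s" for a s
  proof -
    have "\<phi> (\<alpha> (- s) (cstar a)) * v (- s) = v (- s) * \<phi> (\<alpha> s (\<alpha> (- s) (cstar a)))"
      using swap[of "\<alpha> (- s) (cstar a)" "- s"] a alpha_in'[of "cstar a" s]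
      by (simp only: minus_minus ideal_simps)
    then show ?thesis using a by (simp add: alpha_inv' ideal_simps mat_adjoint_mult_square[of _ d])
  qed
  show "bundle_rep (action_bundle D \<alpha>) d (\<lambda>t a. \<phi> a * v t)"
    unfolding bundle_rep_def action_bundle_simps
  proof (intro conjI allI ballI)
    fix s t a b c
    show "\<phi> a * v t \<in> carrier_mat d d" by simp
    show "\<phi> (a + b) * v t = \<phi> a * v t + \<phi> b * v t"
      unfolding \<phi>(2) by (rule add_mult_distrib_mat[OF \<phi>(1) \<phi>(1) v(1)])
    show "\<phi> (c *C a) * v t = c \<cdot>\<^sub>m (\<phi> a * v t)"
      unfolding \<phi>(3) by (rule mult_smult_assoc_mat[OF \<phi>(1) v(1)])
    show "\<phi> a * v s * (\<phi> b * v t) = \<phi> (bundle_mult s t a b) * v (s + t)" if "a \<in> D s" "b \<in> D t"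
      by (rule mult[OF that])
    show "mat_adjoint (\<phi> a * v s) = \<phi> (\<alpha> (- s) (cstar a)) * v (- s)" if "a \<in> D s"
      by (rule star[OF that])
  qed
  assume a: "a \<in> D t"
  let ?M = "\<phi> a * v t"
  \<comment> \<open>The projection disappears in the middle, so multiplication by \<open>v t\<close>
    does not lower the norm of the image of an element of \<open>D t\<close>.\<close>
  have "?M * mat_adjoint ?M = \<phi> a * (v t * v (- t)) * mat_adjoint (\<phi> a)"
    by (simp add: mat_adjoint_mult_square[of _ d] assoc)
  then have MM: "?M * mat_adjoint ?M = \<phi> a * mat_adjoint (\<phi> a)" by (simp only: right[OF a])
  have "(mat_norm (\<phi> a))\<^sup>2 = (mat_norm (mat_adjoint (\<phi> a)))\<^sup>2"
    by (simp add: mat_norm_adjoint[of _ d d])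
  also have "\<dots> \<le> mat_norm (?M * mat_adjoint ?M)"
    unfolding MM using mat_norm_adjoint_mult[of "mat_adjoint (\<phi> a)" d d] by simp
  also have "\<dots> \<le> mat_norm ?M * mat_norm (mat_adjoint ?M)"
    by (intro mat_norm_mult[of _ d d _ d]) simp_all
  also have "\<dots> = (mat_norm ?M)\<^sup>2"
    by (simp add: mat_norm_adjoint[of _ d d] power2_eq_square)
  finally show "mat_norm (\<phi> a) \<le> mat_norm ?M"
    by (rule power2_le_imp_le) simp
qed

end

locale partial_system_rep = partial_system D \<alpha>
  for D :: "'g::group_add \<Rightarrow> 'a::cstar_algebra set" and \<alpha> :: "'g \<Rightarrow> 'a \<Rightarrow> 'a" +
  fixes d :: nat and \<pi> :: "'g \<Rightarrow> 'a \<Rightarrow> complex mat"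
  assumes rep: "bundle_rep (action_bundle D \<alpha>) d \<pi>"
begin

lemma rep_carrier: "a \<in> D t \<Longrightarrow> \<pi> t a \<in> carrier_mat d d"
  and rep_add: "a \<in> D t \<Longrightarrow> b \<in> D t \<Longrightarrow> \<pi> t (a + b) = \<pi> t a + \<pi> t b"
  and rep_scale: "a \<in> D t \<Longrightarrow> \<pi> t (c *C a) = c \<cdot>\<^sub>m \<pi> t a"
  and rep_mult: "a \<in> D s \<Longrightarrow> b \<in> D t \<Longrightarrow> \<pi> s a * \<pi> t b = \<pi> (s + t) (bundle_mult s t a b)"
  and rep_star: "a \<in> D s \<Longrightarrow> mat_adjoint (\<pi> s a) = \<pi> (- s) (\<alpha> (- s) (cstar a))"
  using rep by (simp_all add: bundle_rep_def)

lemma rep0 [simp]: "\<pi> 0 a \<in> carrier_mat d d"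
  by (rule rep_carrier) simp

lemma rep0_dim [simp]: "dim_row (\<pi> 0 a) = d" "dim_col (\<pi> 0 a) = d"
  using carrier_matD[OF rep0[of a]] .

lemma rep0_mult: "b \<in> D t \<Longrightarrow> \<pi> 0 a * \<pi> t b = \<pi> t (a * b)"
  using rep_mult[of a 0 b t] by simp

lemma rep0_star: "mat_adjoint (\<pi> 0 a) = \<pi> 0 (cstar a)"
  using rep_star[of a 0] by simp

lemma rep_zero: "\<pi> t 0 = 0\<^sub>m d d"
proof (rule eq_matI)
  fix i j assume "i < dim_row (0\<^sub>m d d :: complex mat)" "j < dim_col (0\<^sub>m d d :: complex mat)"
  then show "\<pi> t 0 $$ (i, j) = 0\<^sub>m d d $$ (i, j)"
    using rep_scale[of 0 t 0] rep_carrier[of 0 t] ideal_simps(1) by (metis scaleC_zero_right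
        carrier_matD index_smult_mat(1) index_zero_mat mult_zero_left)
qed (use rep_carrier[of 0 t] ideal_simps(1) in auto)

lemma rep_minus: "a \<in> D t \<Longrightarrow> b \<in> D t \<Longrightarrow> \<pi> t (a - b) = \<pi> t a - \<pi> t b"
proof -
  assume ab: "a \<in> D t" "b \<in> D t"
  have "\<pi> t a = \<pi> t (a - b) + \<pi> t b"
    using rep_add[of "a - b" t b] ab by (simp add: ideal_simps)
  then show ?thesis
    using rep_carrier[OF ab(1)] rep_carrier[OF ab(2)] rep_carrier[of "a - b" t] ab
    by (intro eq_matI) (auto simp: ideal_simps)
qed

text \<open>The argument of \<open>star_hom_contractive\<close> with matrices as target. The
  representation of the unit fibre may be degenerate, so the complement is formed with the unit
  matrix and not with an image of a unit.\<close>

lemma rep_contractive: "mat_norm (\<pi> 0 a) \<le> norm a"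
proof -
  have small: "mat_norm (\<pi> 0 a) \<le> 1" if a1: "norm a \<le> 1" for a
  proof -
    have "a \<in> D 0" by simp
    from ideal this a1 obtain z where "z \<in> D 0" and z: "cstar z = z" "z + z - z * z = cstar a * a"
      by (rule quasi_sqrt_ideal)
    let ?Z = "1\<^sub>m d - \<pi> 0 z"
    have Zc: "?Z \<in> carrier_mat d d" by (rule minus_carrier_mat) simp
    have Z: "mat_adjoint ?Z = ?Z"
      using rep0_star[of z] z(1) by (subst mat_adjoint_minus[of _ d d]) simp_all
    have "mat_adjoint (\<pi> 0 a) * \<pi> 0 a = \<pi> 0 (z + z - z * z)"
      unfolding rep0_star z(2) by (rule rep0_mult) simp
    also have "\<dots> = \<pi> 0 z + \<pi> 0 z - \<pi> 0 z * \<pi> 0 z"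
      by (simp add: rep_minus rep_add rep0_mult)
    also have "\<dots> + ?Z * ?Z = 1\<^sub>m d"
    proof -
      have "?Z * ?Z = 1\<^sub>m d * ?Z - \<pi> 0 z * ?Z"
        by (rule minus_mult_distrib_mat[OF one_carrier_mat rep0 Zc])
      also have "\<pi> 0 z * ?Z = \<pi> 0 z * 1\<^sub>m d - \<pi> 0 z * \<pi> 0 z"
        by (rule mult_minus_distrib_mat[OF rep0 one_carrier_mat rep0])
      finally have ZZ: "?Z * ?Z = ?Z - (\<pi> 0 z - \<pi> 0 z * \<pi> 0 z)"
        using left_mult_one_mat[OF Zc] right_mult_one_mat[OF rep0] by simp
      have "\<pi> 0 z * \<pi> 0 z \<in> carrier_mat d d" by (rule mult_carrier_mat[OF rep0 rep0])
      then show ?thesis unfolding ZZ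
        using carrier_matD[OF rep0[of z]] by (intro eq_matI) (auto simp del: index_mult_mat(1))
    qed
    finally show ?thesis
      using Z by (intro mat_norm_le_1_if_complement[OF rep0 Zc]) simp
  qed
  show ?thesis
  proof (cases "a = 0")
    case True
    then show ?thesis using mat_norm_le_sum[of "0\<^sub>m d d" d d] by (simp add: rep_zero)
  next
    case False
    let ?a = "complex_of_real (1 / norm a) *C a"
    have "mat_norm (\<pi> 0 ?a) \<le> 1" using False by (intro small) (simp add: norm_scaleC norm_divide)
    have "\<pi> 0 a = complex_of_real (norm a) \<cdot>\<^sub>m \<pi> 0 ?a"
      using rep_scale[of ?a 0 "complex_of_real (norm a)"] False by (simp add: scaleC_scaleC)
    also have "mat_norm \<dots> \<le> norm a * 1"
    proof (rule mat_norm_leI[of _ d d])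
      fix u :: "complex Matrix.vec" assume u: "u \<in> carrier_vec d"
      have "euclid_norm (mult_mat_vec (complex_of_real (norm a) \<cdot>\<^sub>m \<pi> 0 ?a) u)
          = norm a * euclid_norm (mult_mat_vec (\<pi> 0 ?a) u)"
        using u rep0[of ?a] by (simp add: smult_mat_mult_mat_vec[OF rep0] euclid_norm_smult)
      also have "\<dots> \<le> norm a * (1 * euclid_norm u)"
        using mult_mat_vec_mat_norm_le[OF rep0 u, of ?a] \<open>mat_norm (\<pi> 0 ?a) \<le> 1\<close>
        by (intro mult_left_mono order.trans[OF mult_mat_vec_mat_norm_le[OF rep0 u]] mult_right_mono) auto
      finally show "euclid_norm (mult_mat_vec (complex_of_real (norm a) \<cdot>\<^sub>m \<pi> 0 ?a) u) \<le> norm a * 1 * euclid_norm u"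
        by simp
    qed (use rep0[of ?a] in auto)
    finally show ?thesis by simp
  qed
qed

text \<open>The kernel of \<open>\<pi> 0\<close> is compatible with the whole bundle: for
  \<open>c\<close> in \<open>D t\<close> the product of \<open>\<pi> t c\<close> with its adjoint is
  \<open>\<pi> 0 (c * cstar c)\<close>, and the adjoint of \<open>\<pi> 0 (\<alpha> (- t) c)\<close>
  times that matrix is the adjoint of \<open>\<pi> t c\<close> times \<open>\<pi> t c\<close>. So
  one may compute with elements that have the desired property only after applying
  \<open>\<pi> 0\<close>.\<close>

lemma rep_eq_if_rep0_eq:
  assumes xy: "x \<in> D t" "y \<in> D t" and eq: "\<pi> 0 x = \<pi> 0 y"
  shows "\<pi> t x = \<pi> t y" and "\<pi> 0 (\<alpha> (- t) x) = \<pi> 0 (\<alpha> (- t) y)"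
proof -
  define c where "c = x - y"
  have c: "c \<in> D t" using xy by (simp add: c_def ideal_simps)
  have ac: "\<alpha> (- t) x - \<alpha> (- t) y = \<alpha> (- t) c"
    using alpha_add'[of c t y] c xy by (simp add: c_def)
  have c0: "\<pi> 0 c = 0\<^sub>m d d"
    using rep_minus[of x 0 y] eq by (simp add: c_def)
  have tc: "\<pi> t c \<in> carrier_mat d d" by (rule rep_carrier[OF c])
  have "mat_adjoint (mat_adjoint (\<pi> t c)) * mat_adjoint (\<pi> t c) = \<pi> t c * mat_adjoint (\<pi> t c)"
    by simp
  also have "\<dots> = \<pi> t c * \<pi> (- t) (\<alpha> (- t) (cstar c))"
    by (simp only: rep_star[OF c])
  also have "\<dots> = \<pi> 0 (c * cstar c)"
    using rep_mult[OF c alpha_in'[of "cstar c" t]] c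
    by (simp add: ideal_simps alpha_mult'[symmetric] alpha_inv')
  also have "\<dots> = \<pi> 0 c * \<pi> 0 (cstar c)" by (rule rep0_mult[symmetric]) simp
  also have "\<dots> = 0\<^sub>m d d" unfolding c0 by (rule left_mult_zero_mat[OF rep0])
  finally have "mat_adjoint (\<pi> t c) = 0\<^sub>m d d"
    by (rule adjoint_mult_self_eq_0[of _ d d, rotated]) (use tc in auto)
  then have "mat_adjoint (mat_adjoint (\<pi> t c)) = mat_adjoint (0\<^sub>m d d)" by simp
  then have tc0: "\<pi> t c = 0\<^sub>m d d" by simp
  then show "\<pi> t x = \<pi> t y"
    using rep_add[of c t y] c xy rep_carrier[of y t] by (simp add: c_def)
  have "mat_adjoint (\<pi> 0 (\<alpha> (- t) c)) * \<pi> 0 (\<alpha> (- t) c) = \<pi> 0 (\<alpha> (- t) (cstar c * c))"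
    using c by (simp add: rep0_star rep0_mult alpha_star'[symmetric] alpha_mult' ideal_simps)
  also have "\<dots> = mat_adjoint (\<pi> t c) * \<pi> t c"
    unfolding rep_star[OF c] using rep_mult[OF alpha_in'[of "cstar c" t] c] c
    by (simp add: ideal_simps alpha_inv')
  also have "\<dots> = 0\<^sub>m d d" unfolding tc0 mat_adjoint_zero by (rule left_mult_zero_mat) simp
  finally have "\<pi> 0 (\<alpha> (- t) c) = 0\<^sub>m d d"
    by (rule adjoint_mult_self_eq_0[of _ d d, rotated]) simp
  then show "\<pi> 0 (\<alpha> (- t) x) = \<pi> 0 (\<alpha> (- t) y)"
    using rep_add[of "\<alpha> (- t) c" 0 "\<alpha> (- t) y"] by (simp flip: ac)
qed

text \<open>The unit of the finite-dimensional algebra \<open>\<pi>\<^sub>0(D\<^sub>t)\<close> is the orthogonal projection of the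
  identity matrix onto it, for the Hilbert-Schmidt inner product.\<close>

lemma fibre_unit:
  "\<exists>e. e \<in> D t \<and> (\<forall>b\<in>D t. \<pi> 0 e * \<pi> 0 b = \<pi> 0 b \<and> \<pi> 0 b * \<pi> 0 e = \<pi> 0 b)
      \<and> mat_adjoint (\<pi> 0 e) = \<pi> 0 e"
proof -
  \<comment> \<open>Matrices are viewed as functions on pairs of indices, with arbitrary values
    outside the \<open>d\<close> by \<open>d\<close> square, to fit
    \<open>orthogonal_projection_exists\<close>.\<close>
  define J where "J = {x. \<exists>a\<in>D t. \<forall>i<d. \<forall>j<d. x (i, j) = \<pi> 0 a $$ (i, j)}"
  have entry_add: "\<pi> 0 (a + b) $$ (i, j) = \<pi> 0 a $$ (i, j) + \<pi> 0 b $$ (i, j)"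
    and entry_scale: "\<pi> 0 (c *C a) $$ (i, j) = c * \<pi> 0 a $$ (i, j)" if "i < d" "j < d" for a b i j c
    using that rep_add[of a 0 b] rep_scale[of a 0 c] rep0[of a] rep0[of b] by auto
  have "\<exists>e\<in>J. \<forall>x\<in>J. (\<Sum>s\<in>{..<d} \<times> {..<d}. cnj (x s) * ((case s of (i, j) \<Rightarrow> if i = j then 1 else 0) - e s)) = 0"
  proof (rule orthogonal_projection_exists)
    show "(\<lambda>_. 0) \<in> J"
      unfolding J_def by (intro CollectI bexI[of _ 0]) (auto simp: rep_zero ideal_simps)
    show "(\<lambda>s. x s + y s) \<in> J" if xy: "x \<in> J" "y \<in> J" for x y
    proof -
      obtain a b where "a \<in> D t" "b \<in> D t" "\<forall>i<d. \<forall>j<d. x (i, j) = \<pi> 0 a $$ (i, j)"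
        "\<forall>i<d. \<forall>j<d. y (i, j) = \<pi> 0 b $$ (i, j)" using xy unfolding J_def by blast
      then show ?thesis unfolding J_def
        by (intro CollectI bexI[of _ "a + b"]) (simp_all add: entry_add ideal_simps)
    qed
    show "(\<lambda>s. c * x s) \<in> J" if x: "x \<in> J" for x c
    proof -
      obtain a where "a \<in> D t" "\<forall>i<d. \<forall>j<d. x (i, j) = \<pi> 0 a $$ (i, j)"
        using x unfolding J_def by blast
      then show ?thesis unfolding J_def
        by (intro CollectI bexI[of _ "c *C a"]) (simp_all add: entry_scale ideal_simps)
    qed
  qed auto
  then obtain x0 where x0: "x0 \<in> J"
    "\<And>x. x \<in> J \<Longrightarrow> (\<Sum>s\<in>{..<d} \<times> {..<d}. cnj (x s) * ((case s of (i, j) \<Rightarrow> if i = j then 1 else 0) - x0 s)) = 0"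
    by blast
  then obtain e where e: "e \<in> D t" "\<And>i j. i < d \<Longrightarrow> j < d \<Longrightarrow> x0 (i, j) = \<pi> 0 e $$ (i, j)"
    unfolding J_def by blast
  define N where "N = 1\<^sub>m d - \<pi> 0 e"
  have N: "N \<in> carrier_mat d d" unfolding N_def by (intro minus_carrier_mat) simp
  have orth: "(\<Sum>i<d. \<Sum>j<d. cnj (\<pi> 0 b $$ (i, j)) * N $$ (i, j)) = 0" if "b \<in> D t" for b
  proof -
    have "(\<lambda>(i, j). \<pi> 0 b $$ (i, j)) \<in> J" unfolding J_def using that by auto
    then have "(\<Sum>s\<in>{..<d} \<times> {..<d}. cnj ((\<lambda>(i, j). \<pi> 0 b $$ (i, j)) s)
        * ((case s of (i, j) \<Rightarrow> if i = j then 1 else 0) - x0 s)) = 0"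
      by (rule x0(2))
    then have "(\<Sum>i<d. \<Sum>j<d. cnj (\<pi> 0 b $$ (i, j)) * ((if i = j then 1 else 0) - x0 (i, j))) = 0"
      by (simp add: sum.cartesian_product case_prod_unfold)
    moreover have "N $$ (i, j) = (if i = j then 1 else 0) - x0 (i, j)" if "i < d" "j < d" for i j
      using that rep0[of e] e(2) by (auto simp: N_def)
    ultimately show ?thesis by simp
  qed
  \<comment> \<open>With \<open>N = 1 - \<pi> 0 e\<close> and \<open>w = b - b * e\<close> the
    matrix \<open>W = \<pi> 0 w\<close> equals \<open>\<pi> 0 b * N\<close>. Its Hilbert-Schmidt
    norm squared is the inner product of \<open>\<pi> 0 (cstar b * w)\<close> with \<open>N\<close>,
    which vanishes because \<open>cstar b * w\<close> lies in \<open>D t\<close>.\<close>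
  have right: "\<pi> 0 b * \<pi> 0 e = \<pi> 0 b" if b: "b \<in> D t" for b
  proof -
    let ?x = "cstar b"
    have x: "?x \<in> D t" using b by (simp add: ideal_simps)
    define w where "w = b - b * e"
    define W where "W = \<pi> 0 w"
    have W: "W \<in> carrier_mat d d" by (simp add: W_def)
    have w: "w \<in> D t" using b by (simp add: w_def ideal_simps)
    have W_eq: "W = \<pi> 0 b * N"
    proof -
      have "\<pi> 0 b * N = \<pi> 0 b * 1\<^sub>m d - \<pi> 0 b * \<pi> 0 e"
        unfolding N_def by (rule mult_minus_distrib_mat[of _ d d]) auto
      then show ?thesis using rep0[of b] by (simp add: W_def w_def rep_minus rep0_mult)
    qed
    have "(\<Sum>i<d. \<Sum>j<d. cnj (\<pi> 0 (?x * w) $$ (i, j)) * N $$ (i, j)) = 0"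
      by (rule orth) (use w in \<open>simp add: ideal_simps\<close>)
    also have "(\<Sum>i<d. \<Sum>j<d. cnj (\<pi> 0 (?x * w) $$ (i, j)) * N $$ (i, j))
        = (\<Sum>i<d. \<Sum>j<d. \<Sum>k<d. cnj (\<pi> 0 ?x $$ (i, k)) * cnj (W $$ (k, j)) * N $$ (i, j))"
      using index_mult_mat_sum[OF rep0 W, of _ _ ?x] w
      by (intro sum.cong refl) (simp add: W_def rep0_mult sum_distrib_right cnj_sum)
    also have "\<dots> = (\<Sum>k<d. \<Sum>j<d. \<Sum>i<d. cnj (\<pi> 0 ?x $$ (i, k)) * cnj (W $$ (k, j)) * N $$ (i, j))"
      by (subst sum.swap, subst (2) sum.swap, subst sum.swap) simp
    also have "\<dots> = (\<Sum>k<d. \<Sum>j<d. cnj (W $$ (k, j)) * W $$ (k, j))"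
    proof (intro sum.cong refl)
      fix k j assume kj: "k \<in> {..<d}" "j \<in> {..<d}"
      have "W $$ (k, j) = (\<Sum>i<d. \<pi> 0 b $$ (k, i) * N $$ (i, j))"
        unfolding W_eq using kj N by (intro index_mult_mat_sum[of _ d d]) auto
      also have "\<dots> = (\<Sum>i<d. cnj (\<pi> 0 ?x $$ (i, k)) * N $$ (i, j))"
        using kj rep0[of b] by (intro sum.cong refl) (simp flip: rep0_star)
      finally show "(\<Sum>i<d. cnj (\<pi> 0 ?x $$ (i, k)) * cnj (W $$ (k, j)) * N $$ (i, j)) = cnj (W $$ (k, j)) * W $$ (k, j)"
        using sum_distrib_left[of "cnj (W $$ (k, j))" "\<lambda>i. cnj (\<pi> 0 ?x $$ (i, k)) * N $$ (i, j)" "{..<d}"]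
        by (simp only: mult_ac)
    qed
    also have "\<dots> = of_real (\<Sum>k<d. \<Sum>j<d. (cmod (W $$ (k, j)))\<^sup>2)"
      unfolding of_real_sum by (intro sum.cong refl) (simp add: complex_norm_square mult.commute del: of_real_power)
    finally have "(\<Sum>k<d. \<Sum>j<d. (cmod (W $$ (k, j)))\<^sup>2) = 0" by (simp only: of_real_eq_0_iff)
    then have W0: "W $$ (k, j) = 0" if "k < d" "j < d" for k j
      using that by (simp add: sum_nonneg_eq_0_iff sum_nonneg)
    have "\<pi> 0 b - \<pi> 0 b * \<pi> 0 e = W" by (simp add: W_def w_def rep_minus rep0_mult)
    then have "(\<pi> 0 b - \<pi> 0 b * \<pi> 0 e) $$ (k, j) = 0" if "k < d" "j < d" for k j
      using W0 that by simp
    moreover have "\<pi> 0 b * \<pi> 0 e \<in> carrier_mat d d" by (rule mult_carrier_mat[OF rep0 rep0])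
    ultimately show ?thesis
      using rep0[of b] by (intro eq_matI) (auto simp del: index_mult_mat(1))
  qed
  have left: "mat_adjoint (\<pi> 0 e) * \<pi> 0 b = \<pi> 0 b" if b: "b \<in> D t" for b
  proof -
    have "mat_adjoint (\<pi> 0 (cstar b) * \<pi> 0 e) = mat_adjoint (\<pi> 0 (cstar b))"
      using right[of "cstar b"] b by (simp add: ideal_simps)
    then show ?thesis by (simp add: mat_adjoint_mult_square[of _ d] rep0_star cstar_cstar)
  qed
  \<comment> \<open>The adjoint of a right unit is a left unit, and a left unit coincides with a
    right unit; hence selfadjointness.\<close>
  have "mat_adjoint (\<pi> 0 e) * \<pi> 0 e = mat_adjoint (\<pi> 0 e)"
    using right[of "cstar e"] e(1) by (simp add: rep0_star ideal_simps)
  then have sa: "mat_adjoint (\<pi> 0 e) = \<pi> 0 e" using left[OF e(1)] by simp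
  show ?thesis
  proof (intro exI[of _ e] conjI ballI e(1) sa right)
    fix b assume "b \<in> D t"
    then show "\<pi> 0 e * \<pi> 0 b = \<pi> 0 b" using left unfolding sa by blast
  qed
qed

text \<open>The elements \<open>e t\<close> behave like units of \<open>D t\<close> only modulo the
  kernel of \<open>\<pi> 0\<close>, so every identity for \<open>V t\<close> goes through
  \<open>rep_eq_if_rep0_eq\<close>. The matrices \<open>p t\<close> are the units of the images of
  the ideals, and \<open>V t\<close> is a partial isometry with range projection
  \<open>p t\<close>.\<close>

lemma covariant_rep_exists: "\<exists>v. covariant_rep D \<alpha> d (\<pi> 0) v"
proof -
  have "\<forall>t. \<exists>e. e \<in> D t \<and> (\<forall>b\<in>D t. \<pi> 0 e * \<pi> 0 b = \<pi> 0 b \<and> \<pi> 0 b * \<pi> 0 e = \<pi> 0 b)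
      \<and> mat_adjoint (\<pi> 0 e) = \<pi> 0 e"
    by (intro allI fibre_unit)
  then obtain e where e0: "\<forall>t. e t \<in> D t \<and> (\<forall>b\<in>D t. \<pi> 0 (e t) * \<pi> 0 b = \<pi> 0 b \<and> \<pi> 0 b * \<pi> 0 (e t) = \<pi> 0 b)
      \<and> mat_adjoint (\<pi> 0 (e t)) = \<pi> 0 (e t)"
    unfolding choice_iff by (rule exE)
  have e: "\<And>t. e t \<in> D t" "\<And>b t. b \<in> D t \<Longrightarrow> \<pi> 0 (e t) * \<pi> 0 b = \<pi> 0 b"
    "\<And>b t. b \<in> D t \<Longrightarrow> \<pi> 0 b * \<pi> 0 (e t) = \<pi> 0 b" "\<And>t. mat_adjoint (\<pi> 0 (e t)) = \<pi> 0 (e t)"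
    using e0 by simp_all
  define p where "p t = \<pi> 0 (e t)" for t
  define V where "V t = \<pi> t (e t)" for t
  have V [simp]: "V t \<in> carrier_mat d d" for t unfolding V_def by (rule rep_carrier[OF e(1)])
  have p [simp]: "p t \<in> carrier_mat d d" for t by (simp add: p_def)
  have assoc: "A * B * C = A * (B * C)"
    if "A \<in> carrier_mat d d" "B \<in> carrier_mat d d" "C \<in> carrier_mat d d" for A B C :: "complex mat"
    by (rule assoc_mult_mat[OF that])
  have V1: "\<pi> 0 a * V t = \<pi> t a" if a: "a \<in> D t" for a t
  proof -
    have "\<pi> 0 a * V t = \<pi> t (a * e t)" unfolding V_def by (rule rep0_mult[OF e(1)])
    also have "\<dots> = \<pi> t a"
      by (rule rep_eq_if_rep0_eq(1)) (use e(3)[OF a] a e(1) in \<open>simp_all add: ideal_simps rep0_mult\<close>)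
    finally show ?thesis .
  qed
  have pV: "p t * V t = V t" for t
    using V1[OF e(1)] by (simp add: p_def V_def)
  have V_star: "mat_adjoint (V t) = V (- t)" for t
  proof -
    \<comment> \<open>The adjoint of \<open>V t\<close> is \<open>\<pi> (- t) f\<close>. Since
      \<open>\<pi> 0 f\<close> is also a right unit for the image of \<open>D (- t)\<close>, it
      agrees with the image of \<open>e (- t)\<close>.\<close>
    define f where "f = \<alpha> (- t) (cstar (e t))"
    have f: "f \<in> D (- t)" unfolding f_def by (intro alpha_in' ideal_simps e)
    have bf: "\<pi> 0 b * \<pi> 0 f = \<pi> 0 b" if b: "b \<in> D (- t)" for b
    proof -
      have ab: "\<alpha> t b \<in> D t" by (rule alpha_in[OF b])
      have eq: "\<pi> 0 (\<alpha> t b * cstar (e t)) = \<pi> 0 (\<alpha> t b)"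
        using e(3)[OF ab] e(4)[of t] by (simp add: rep0_star rep0_mult[symmetric])
      have "\<pi> 0 (\<alpha> (- t) (\<alpha> t b * cstar (e t))) = \<pi> 0 (\<alpha> (- t) (\<alpha> t b))"
        by (rule rep_eq_if_rep0_eq(2)[OF _ ab eq]) (use ab in \<open>simp add: ideal_simps\<close>)
      then show ?thesis
        using b ab e(1) by (simp add: alpha_mult' ideal_simps alpha_inv f_def rep0_mult)
    qed
    have "\<pi> 0 f = \<pi> 0 (e (- t))"
      using bf[OF e(1)] e(2)[OF f] by simp
    then have "\<pi> (- t) f = \<pi> (- t) (e (- t))"
      by (rule rep_eq_if_rep0_eq(1)[OF f e(1)])
    then show ?thesis using rep_star[OF e(1)] by (simp add: V_def f_def)
  qed
  have VV: "V t * V (- t) = p t" for t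
  proof -
    have "V t * V (- t) = \<pi> t (e t) * \<pi> (- t) (\<alpha> (- t) (cstar (e t)))"
      unfolding V_star[symmetric] by (simp add: V_def rep_star[OF e(1)])
    also have "\<dots> = \<pi> 0 (e t * cstar (e t))"
      using rep_mult[OF e(1) alpha_in'[of "cstar (e t)" t], of t] e(1)
      by (simp add: ideal_simps alpha_mult'[symmetric] alpha_inv')
    also have "\<dots> = \<pi> 0 (e t) * mat_adjoint (\<pi> 0 (e t))" by (simp add: rep0_mult rep0_star)
    also have "\<dots> = p t" using e(2)[OF e(1)] by (simp add: e(4) p_def)
    finally show ?thesis .
  qed
  have VV': "V (- s) * V s = p (- s)" for s using VV[of "- s"] by simp
  have pVV: "p (- s) * V t = V (- s) * V (s + t)" for s t
  proof -
    \<comment> \<open>By the bundle product \<open>V (- s) * V (s + t)\<close> is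
      \<open>\<pi> t c\<close>, where \<open>c\<close> lies in both \<open>D (- s)\<close> and
      \<open>D t\<close>. Its image under \<open>\<pi> 0\<close> and the product
      \<open>p (- s) * p t\<close>, the image of \<open>g\<close>, are both units for the
      intersection of the two ideals, hence equal.\<close>
    define y where "y = \<alpha> s (e (- s)) * e (s + t)"
    have es: "\<alpha> s (e (- s)) \<in> D s" by (rule alpha_in[OF e(1)])
    have y: "y \<in> D s" "y \<in> D (s + t)" using es e(1) by (simp_all add: y_def ideal_simps)
    define c where "c = \<alpha> (- s) y"
    have c: "c \<in> D (- s)" "c \<in> D t"
      using alpha_in'[OF y(1)] alpha_cross(1)[of y "- s" "s + t"] y
      by (simp_all add: c_def add.assoc[symmetric])
    define g where "g = e (- s) * e t"
    have g: "g \<in> D (- s)" "g \<in> D t" using e(1) by (simp_all add: g_def ideal_simps)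
    have ag: "\<alpha> s g \<in> D s" "\<alpha> s g \<in> D (s + t)" using alpha_in[OF g(1)] alpha_cross(1)[OF g] by auto
    have "\<pi> 0 (y * \<alpha> s g) = \<pi> 0 (\<alpha> s (e (- s))) * (\<pi> 0 (e (s + t)) * \<pi> 0 (\<alpha> s g))"
      by (simp add: y_def rep0_mult mult.assoc)
    also have "\<dots> = \<pi> 0 (\<alpha> s (e (- s) * g))"
      using e(2)[OF ag(2)] g(1) e(1) by (simp add: rep0_mult alpha_mult)
    finally have eq: "\<pi> 0 (y * \<alpha> s g) = \<pi> 0 (\<alpha> s (e (- s) * g))" .
    have "\<pi> 0 (\<alpha> (- s) (y * \<alpha> s g)) = \<pi> 0 (\<alpha> (- s) (\<alpha> s (e (- s) * g)))"
      by (rule rep_eq_if_rep0_eq(2)[OF _ _ eq])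
        (use y ag alpha_in[of "e (- s) * g" s] g(1) in \<open>simp_all add: ideal_simps\<close>)
    then have cg: "\<pi> 0 c * \<pi> 0 g = \<pi> 0 g"
      using y(1) ag(1) g(1) e(2)[OF g(1)]
      by (simp add: alpha_mult' alpha_inv ideal_simps rep0_mult c_def)
    have "V (- s) * V (s + t) = \<pi> t c"
      using rep_mult[OF e(1) e(1), of "- s" "s + t"]
      by (simp add: V_def c_def y_def add.assoc[symmetric])
    also have "\<dots> = \<pi> 0 c * V t" by (rule V1[OF c(2), symmetric])
    also have "\<pi> 0 c = \<pi> 0 c * p (- s) * p t" using e(3)[OF c(1)] e(3)[OF c(2)] by (simp add: p_def)
    also have "\<dots> = \<pi> 0 c * \<pi> 0 g" by (simp add: assoc) (simp add: p_def g_def rep0_mult)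
    also have "\<dots> = p (- s) * p t" unfolding cg by (simp add: p_def g_def rep0_mult)
    also have "p (- s) * p t * V t = p (- s) * V t" by (simp add: assoc pV)
    finally show ?thesis ..
  qed
  have cov: "V t * \<pi> 0 a * V (- t) = \<pi> 0 (\<alpha> t a)" if a: "a \<in> D (- t)" for t a
  proof -
    have aa: "\<alpha> t a \<in> D t" by (rule alpha_in[OF a])
    have "V t * \<pi> 0 a = \<pi> t (e t * \<alpha> t a)"
      using rep_mult[OF e(1), of a 0 t] a e(1) alpha_in'[OF e(1)]
      by (simp add: V_def alpha_mult alpha_inv')
    also have "\<dots> = \<pi> t (\<alpha> t a)"
      by (rule rep_eq_if_rep0_eq(1)) (use e(2)[OF aa] aa e(1) in \<open>simp_all add: ideal_simps rep0_mult\<close>)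
    also have "\<dots> = \<pi> 0 (\<alpha> t a) * V t" by (rule V1[OF aa, symmetric])
    finally have "V t * \<pi> 0 a * V (- t) = \<pi> 0 (\<alpha> t a) * (V t * V (- t))" by (simp add: assoc)
    then show ?thesis using e(3)[OF aa] by (simp add: VV p_def)
  qed
  \<comment> \<open>\<open>\<pi> 0\<close> may be degenerate, and then \<open>V 0\<close> is a
    proper projection, whereas a partial representation must have the unit matrix at 0. Changing
    this single value requires a separate look at the cases in which 0 occurs as \<open>s\<close>,
    \<open>t\<close> or \<open>s + t\<close>.\<close>
  define v where "v t = (if t = 0 then 1\<^sub>m d else V t)" for t
  have v [simp]: "v t \<in> carrier_mat d d" for t by (simp add: v_def)
  have v_star: "v (- t) = mat_adjoint (v t)" for t by (simp add: v_def V_star)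
  have "v (- s) * v s * v t = v (- s) * v (s + t)" for s t
  proof (cases "s = 0 \<or> t = 0")
    case True
    then show ?thesis by (auto simp: v_def assoc right_mult_one_mat[OF V])
  next
    case False
    show ?thesis
    proof (cases "s + t = 0")
      case True
      then have t: "t = - s" by (simp add: eq_neg_iff_add_eq_0 neg_eq_iff_add_eq_0 minus_unique)
      show ?thesis using False pV[of "- s"] unfolding t by (simp add: v_def VV' right_mult_one_mat[OF V])
    next
      case False': False
      then show ?thesis using False by (simp add: v_def VV' pVV)
    qed
  qed
  moreover have "v t * \<pi> 0 a * mat_adjoint (v t) = \<pi> 0 (\<alpha> t a)" if "a \<in> D (- t)" for t a
    using cov[OF that] by (cases "t = 0") (auto simp: v_def V_star)
  ultimately have "covariant_rep D \<alpha> d (\<pi> 0) v"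
    unfolding covariant_rep_def partial_star_rep_def star_hom_mat_def type_star_alg_def
    using rep_add[of _ 0] rep_scale[of _ 0]
    by (simp add: v_star rep0_star rep0_mult) (simp add: v_def)
  then show ?thesis by blast
qed

end

context partial_system
begin

text \<open>From actions to bundles the norms of all fibres are controlled by \<open>\<phi>\<close>
  alone; from bundles to actions only the unit fibre is tested.\<close>

lemma rfd_action_iff_rfd_bundle: "rfd_action D \<alpha> \<longleftrightarrow> rfd_bundle (action_bundle D \<alpha>)"
proof
  assume rfd: "rfd_action D \<alpha>"
  show "rfd_bundle (action_bundle D \<alpha>)"
    unfolding rfd_bundle_def
  proof (intro allI impI)
    fix \<epsilon> :: real and \<Omega> :: "('g \<times> 'a) set"
    assume "\<epsilon> > 0" and \<Omega>: "finite \<Omega> \<and> \<Omega> \<subseteq> Sigma UNIV (fibre (action_bundle D \<alpha>))"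
    then obtain d \<phi> v where "0 < d" and cov: "covariant_rep D \<alpha> d \<phi> v"
      and ge: "\<forall>a\<in>snd ` \<Omega>. mat_norm (\<phi> a) \<ge> norm a - \<epsilon>"
      using rfd unfolding rfd_action_def by (meson finite_imageI)
    have "\<forall>(t, b)\<in>\<Omega>. mat_norm (\<phi> b * v t) \<ge> norm b - \<epsilon>"
    proof safe
      fix t b assume tb: "(t, b) \<in> \<Omega>"
      then have "b \<in> D t" using \<Omega> by auto
      then show "norm b - \<epsilon> \<le> mat_norm (\<phi> b * v t)"
        using bundle_rep_if_covariant_rep(2)[OF cov] ge tb by force
    qed
    then show "\<exists>d>0. \<exists>\<pi>. bundle_rep (action_bundle D \<alpha>) d \<pi> \<and> (\<forall>(t, b)\<in>\<Omega>. norm b - \<epsilon> \<le> mat_norm (\<pi> t b))"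
      using bundle_rep_if_covariant_rep(1)[OF cov] \<open>0 < d\<close> by blast
  qed
next
  assume rfd: "rfd_bundle (action_bundle D \<alpha>)"
  show "rfd_action D \<alpha>"
    unfolding rfd_action_def
  proof (intro allI impI)
    fix \<epsilon> :: real and \<Omega> :: "'a set"
    assume "\<epsilon> > 0" "finite \<Omega>"
    moreover have "finite (Pair 0 ` \<Omega>)" "Pair 0 ` \<Omega> \<subseteq> Sigma UNIV (fibre (action_bundle D \<alpha>))"
      using \<open>finite \<Omega>\<close> by auto
    ultimately obtain d \<pi> where "0 < d" and rep: "bundle_rep (action_bundle D \<alpha>) d \<pi>"
      and ge: "\<forall>(t, b)\<in>Pair 0 ` \<Omega>. mat_norm (\<pi> t b) \<ge> norm b - \<epsilon>"
      using rfd unfolding rfd_bundle_def by meson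
    interpret partial_system_rep D \<alpha> d \<pi> by unfold_locales (rule rep)
    show "\<exists>d>0. \<exists>\<phi> v. covariant_rep D \<alpha> d \<phi> v \<and> (\<forall>a\<in>\<Omega>. norm a - \<epsilon> \<le> mat_norm (\<phi> a))"
      using covariant_rep_exists \<open>0 < d\<close> ge by blast
  qed
qed

end

section \<open>Completions\<close>

text \<open>The addition of the record is that of the type, so subtraction is available for Cauchy
  sequences. The norm may vanish on nonzero elements.\<close>

locale seminormed =
  fixes V :: "('v::ab_group_add, 'm) normed_space_scheme"
  assumes nv_add: "nv_add V = (+)"
    and zero_in: "0 \<in> nv_carrier V"
    and add_in: "x \<in> nv_carrier V \<Longrightarrow> y \<in> nv_carrier V \<Longrightarrow> x + y \<in> nv_carrier V"
    and scale_in: "x \<in> nv_carrier V \<Longrightarrow> nv_scale V c x \<in> nv_carrier V"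
    and scale_minus_one: "x \<in> nv_carrier V \<Longrightarrow> nv_scale V (-1) x = - x"
    and scale_diff: "x \<in> nv_carrier V \<Longrightarrow> y \<in> nv_carrier V \<Longrightarrow>
      nv_scale V c (x - y) = nv_scale V c x - nv_scale V c y"
    and norm_nonneg: "x \<in> nv_carrier V \<Longrightarrow> 0 \<le> nv_norm V x"
    and norm_triangle: "x \<in> nv_carrier V \<Longrightarrow> y \<in> nv_carrier V \<Longrightarrow>
      nv_norm V (x + y) \<le> nv_norm V x + nv_norm V y"
    and norm_scale: "x \<in> nv_carrier V \<Longrightarrow> nv_norm V (nv_scale V c x) = cmod c * nv_norm V x"
begin

abbreviation "C \<equiv> nv_carrier V"
abbreviation "N \<equiv> nv_norm V"

lemma minus_in: "x \<in> C \<Longrightarrow> - x \<in> C"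
  using scale_in[of x "-1"] by (simp add: scale_minus_one)

lemma diff_in: "x \<in> C \<Longrightarrow> y \<in> C \<Longrightarrow> x - y \<in> C"
  using add_in[of x "- y"] by (simp add: minus_in)

lemma norm_minus: "x \<in> C \<Longrightarrow> N (- x) = N x"
  using norm_scale[of x "-1"] by (simp add: scale_minus_one)

lemma norm_zero [simp]: "N 0 = 0"
proof -
  have "nv_scale V 2 0 = 0" using scale_diff[OF zero_in zero_in, of 2] by simp
  then show ?thesis using norm_scale[OF zero_in, of 2] by simp
qed

lemma norm_diff_sym: "x \<in> C \<Longrightarrow> y \<in> C \<Longrightarrow> N (x - y) = N (y - x)"
  using norm_minus[of "x - y"] by (simp add: diff_in)

lemma norm_diff_triangle:
  assumes "x \<in> C" "y \<in> C" "z \<in> C"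
  shows "N (x - z) \<le> N (x - y) + N (y - z)"
  using norm_triangle[of "x - y" "y - z"] assms by (simp add: diff_in)

lemma norm_diff_ineq:
  assumes "x \<in> C" "y \<in> C"
  shows "\<bar>N x - N y\<bar> \<le> N (x - y)"
  using norm_triangle[of "x - y" y] norm_triangle[of "y - x" x] norm_diff_sym[OF assms] assms
  by (simp add: diff_in abs_le_iff)

lemma nv_dist_eq: "y \<in> C \<Longrightarrow> nv_dist V x y = N (x - y)"
  by (simp add: nv_dist_def nv_add scale_minus_one)

lemma cauchy_seqs_iff:
  "u \<in> cauchy_seqs V \<longleftrightarrow> (\<forall>n. u n \<in> C) \<and> (\<forall>e>0. \<exists>M. \<forall>m\<ge>M. \<forall>n\<ge>M. N (u m - u n) < e)"
  unfolding cauchy_seqs_def by (auto simp: nv_dist_eq)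

lemma cauchy_in: "u \<in> cauchy_seqs V \<Longrightarrow> u n \<in> C"
  by (simp add: cauchy_seqs_iff)

lemma cauchy_class_iff:
  "w \<in> cauchy_class V u \<longleftrightarrow> w \<in> cauchy_seqs V \<and> (\<lambda>n. N (u n - w n)) \<longlonglongrightarrow> 0"
  unfolding cauchy_class_def by (auto simp: nv_dist_eq cauchy_in)

lemma class_rep_class:
  assumes "u \<in> cauchy_seqs V"
  shows "class_rep (cauchy_class V u) \<in> cauchy_seqs V"
    and "(\<lambda>n. N (u n - class_rep (cauchy_class V u) n)) \<longlonglongrightarrow> 0"
proof -
  have "u \<in> cauchy_class V u" using assms by (simp add: cauchy_class_iff)
  then have "class_rep (cauchy_class V u) \<in> cauchy_class V u"
    unfolding class_rep_def by (rule someI[of "\<lambda>w. w \<in> cauchy_class V u"])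
  then show "class_rep (cauchy_class V u) \<in> cauchy_seqs V"
    "(\<lambda>n. N (u n - class_rep (cauchy_class V u) n)) \<longlonglongrightarrow> 0"
    by (simp_all add: cauchy_class_iff)
qed

lemma null_seq_le:
  assumes "g \<longlonglongrightarrow> (0::real)" "\<And>n. 0 \<le> f n" "\<And>n. f n \<le> g n"
  shows "f \<longlonglongrightarrow> 0"
  by (rule tendsto_sandwich[OF _ _ tendsto_const assms(1)]) (simp_all add: assms(2,3))

lemma class_eqI:
  assumes u: "u \<in> cauchy_seqs V" and w: "w \<in> cauchy_seqs V" and uw: "(\<lambda>n. N (u n - w n)) \<longlonglongrightarrow> 0"
  shows "cauchy_class V u = cauchy_class V w"
proof -
  have sub: "cauchy_class V u \<subseteq> cauchy_class V w"
    if u: "u \<in> cauchy_seqs V" and w: "w \<in> cauchy_seqs V" and uw: "(\<lambda>n. N (u n - w n)) \<longlonglongrightarrow> 0" for u w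
  proof
    fix v assume "v \<in> cauchy_class V u"
    then have v: "v \<in> cauchy_seqs V" "(\<lambda>n. N (u n - v n)) \<longlonglongrightarrow> 0" by (simp_all add: cauchy_class_iff)
    have "(\<lambda>n. N (w n - v n)) \<longlonglongrightarrow> 0"
    proof (rule null_seq_le)
      show "(\<lambda>n. N (u n - w n) + N (u n - v n)) \<longlonglongrightarrow> 0"
        using tendsto_add[OF uw v(2)] by simp
      show "N (w n - v n) \<le> N (u n - w n) + N (u n - v n)" for n
        using norm_diff_triangle[of "w n" "u n" "v n"] norm_diff_sym[of "u n" "w n"] u v(1) w
        by (simp add: cauchy_in)
    qed (use v(1) w in \<open>simp add: cauchy_in diff_in norm_nonneg\<close>)
    then show "v \<in> cauchy_class V w" by (simp add: cauchy_class_iff v(1))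
  qed
  have "(\<lambda>n. N (w n - u n)) \<longlonglongrightarrow> 0"
    using uw norm_diff_sym[OF cauchy_in[OF u] cauchy_in[OF w]] by simp
  then show ?thesis using sub[OF u w uw] sub[OF w u] by blast
qed

lemma cauchy_const: "x \<in> C \<Longrightarrow> (\<lambda>_. x) \<in> cauchy_seqs V"
  by (simp add: cauchy_seqs_iff)

lemma cauchy_map:
  assumes u: "u \<in> cauchy_seqs V" and T: "\<And>x. x \<in> C \<Longrightarrow> T x \<in> C"
    and K: "\<And>x y. x \<in> C \<Longrightarrow> y \<in> C \<Longrightarrow> N (T x - T y) \<le> K * N (x - y)"
  shows "(\<lambda>n. T (u n)) \<in> cauchy_seqs V"
  unfolding cauchy_seqs_iff
proof (intro conjI allI impI)
  fix e :: real assume "e > 0"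
  have pos: "0 < \<bar>K\<bar> + 1" by simp
  then obtain M where M: "\<And>m n. m \<ge> M \<Longrightarrow> n \<ge> M \<Longrightarrow> N (u m - u n) < e / (\<bar>K\<bar> + 1)"
    using u \<open>e > 0\<close> unfolding cauchy_seqs_iff by (meson divide_pos_pos)
  have "N (T (u m) - T (u n)) < e" if "m \<ge> M" "n \<ge> M" for m n
  proof -
    have nn: "0 \<le> N (u m - u n)" using u by (simp add: cauchy_in diff_in norm_nonneg)
    have "N (T (u m) - T (u n)) \<le> K * N (u m - u n)" using u by (intro K) (simp_all add: cauchy_in)
    also have "\<dots> \<le> (\<bar>K\<bar> + 1) * N (u m - u n)" using nn by (intro mult_right_mono) auto
    also have "\<dots> < e" using M[OF that] pos by (simp add: pos_less_divide_eq mult.commute)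
    finally show ?thesis .
  qed
  then show "\<exists>M. \<forall>m\<ge>M. \<forall>n\<ge>M. N (T (u m) - T (u n)) < e" by blast
qed (use u T in \<open>simp add: cauchy_in\<close>)

lemma cauchy_scale: "u \<in> cauchy_seqs V \<Longrightarrow> (\<lambda>n. nv_scale V c (u n)) \<in> cauchy_seqs V"
  by (rule cauchy_map[where K = "cmod c"]) (simp_all add: scale_in diff_in norm_scale flip: scale_diff)

lemma cauchy_add:
  assumes u: "u \<in> cauchy_seqs V" and w: "w \<in> cauchy_seqs V"
  shows "(\<lambda>n. u n + w n) \<in> cauchy_seqs V"
  unfolding cauchy_seqs_iff
proof (intro conjI allI impI)
  fix e :: real assume "e > 0"
  then have e2: "e / 2 > 0" by simp
  obtain M1 where M1: "\<And>m n. m \<ge> M1 \<Longrightarrow> n \<ge> M1 \<Longrightarrow> N (u m - u n) < e / 2"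
    using u e2 unfolding cauchy_seqs_iff by meson
  obtain M2 where M2: "\<And>m n. m \<ge> M2 \<Longrightarrow> n \<ge> M2 \<Longrightarrow> N (w m - w n) < e / 2"
    using w e2 unfolding cauchy_seqs_iff by meson
  have "N (u m + w m - (u n + w n)) < e" if "m \<ge> max M1 M2" "n \<ge> max M1 M2" for m n
  proof -
    have "N (u m + w m - (u n + w n)) = N ((u m - u n) + (w m - w n))" by (simp add: algebra_simps)
    also have "\<dots> \<le> N (u m - u n) + N (w m - w n)"
      using u w by (intro norm_triangle diff_in cauchy_in)
    also have "\<dots> < e" using M1[of m n] M2[of m n] that by simp
    finally show ?thesis .
  qed
  then show "\<exists>M. \<forall>m\<ge>M. \<forall>n\<ge>M. N (u m + w m - (u n + w n)) < e" by blast
qed (use u w in \<open>simp add: cauchy_in add_in\<close>)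

lemma norm_convergent: "u \<in> cauchy_seqs V \<Longrightarrow> convergent (\<lambda>n. N (u n))"
proof -
  assume u: "u \<in> cauchy_seqs V"
  have "Cauchy (\<lambda>n. N (u n))"
  proof (rule metric_CauchyI)
    fix e :: real assume "e > 0"
    then obtain M where M: "\<And>m n. m \<ge> M \<Longrightarrow> n \<ge> M \<Longrightarrow> N (u m - u n) < e"
      using u unfolding cauchy_seqs_iff by meson
    have "dist (N (u m)) (N (u n)) < e" if "m \<ge> M" "n \<ge> M" for m n
      using norm_diff_ineq[OF cauchy_in[OF u] cauchy_in[OF u], of m n] M[OF that] by (simp add: dist_real_def)
    then show "\<exists>M. \<forall>m\<ge>M. \<forall>n\<ge>M. dist (N (u m)) (N (u n)) < e" by blast
  qed
  then show ?thesis by (simp add: Cauchy_convergent_iff)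
qed

lemma norm_limits_eq:
  assumes "u \<in> cauchy_seqs V" "w \<in> cauchy_seqs V" "(\<lambda>n. N (u n - w n)) \<longlonglongrightarrow> 0" "(\<lambda>n. N (w n)) \<longlonglongrightarrow> l"
  shows "(\<lambda>n. N (u n)) \<longlonglongrightarrow> l"
proof -
  have "(\<lambda>n. N (u n) - N (w n)) \<longlonglongrightarrow> 0"
    by (rule Lim_null_comparison[OF always_eventually assms(3)])
       (use assms in \<open>simp add: norm_diff_ineq cauchy_in\<close>)
  from tendsto_add[OF this assms(4)] show ?thesis by simp
qed

lemma completion_carrier: "nv_carrier (completion V) = cauchy_class V ` cauchy_seqs V"
  by (simp add: completion_def)

lemma completion_norm:
  assumes u: "u \<in> cauchy_seqs V"
  shows "(\<lambda>n. N (u n)) \<longlonglongrightarrow> nv_norm (completion V) (cauchy_class V u)"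
proof -
  have "(\<lambda>n. N (class_rep (cauchy_class V u) n)) \<longlonglongrightarrow> nv_norm (completion V) (cauchy_class V u)"
    using norm_convergent[OF class_rep_class(1)[OF u]] by (simp add: completion_def convergent_LIMSEQ_iff)
  then show ?thesis by (rule norm_limits_eq[OF u class_rep_class[OF u]])
qed

lemma completion_norm_const: "x \<in> C \<Longrightarrow> nv_norm (completion V) (cauchy_class V (\<lambda>_. x)) = N x"
proof -
  assume "x \<in> C"
  from completion_norm[OF cauchy_const[OF this]] show ?thesis by (simp add: LIMSEQ_const_iff)
qed

lemma completion_add:
  assumes u: "u \<in> cauchy_seqs V" and w: "w \<in> cauchy_seqs V"
  shows "nv_add (completion V) (cauchy_class V u) (cauchy_class V w) = cauchy_class V (\<lambda>n. u n + w n)"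
proof -
  let ?u = "class_rep (cauchy_class V u)" and ?w = "class_rep (cauchy_class V w)"
  note u' = class_rep_class[OF u] and w' = class_rep_class[OF w]
  have "cauchy_class V (\<lambda>n. u n + w n) = cauchy_class V (\<lambda>n. ?u n + ?w n)"
  proof (rule class_eqI[OF cauchy_add[OF u w] cauchy_add[OF u'(1) w'(1)] null_seq_le])
    show "(\<lambda>n. N (u n - ?u n) + N (w n - ?w n)) \<longlonglongrightarrow> 0" using tendsto_add[OF u'(2) w'(2)] by simp
    fix n
    show "0 \<le> N (u n + w n - (?u n + ?w n))"
      by (intro norm_nonneg diff_in add_in cauchy_in u w u'(1) w'(1))
    have "N (u n + w n - (?u n + ?w n)) = N ((u n - ?u n) + (w n - ?w n))" by (simp add: algebra_simps)
    also have "\<dots> \<le> N (u n - ?u n) + N (w n - ?w n)"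
      by (intro norm_triangle diff_in cauchy_in u w u'(1) w'(1))
    finally show "N (u n + w n - (?u n + ?w n)) \<le> N (u n - ?u n) + N (w n - ?w n)" .
  qed
  then show ?thesis by (simp add: completion_def nv_add)
qed

lemma extend_op_class:
  assumes u: "u \<in> cauchy_seqs V" and T: "\<And>x. x \<in> C \<Longrightarrow> T x \<in> C"
    and K: "\<And>x y. x \<in> C \<Longrightarrow> y \<in> C \<Longrightarrow> N (T x - T y) \<le> K * N (x - y)"
  shows "extend_op V T (cauchy_class V u) = cauchy_class V (\<lambda>n. T (u n))"
proof -
  let ?u = "class_rep (cauchy_class V u)"
  note u' = class_rep_class[OF u]
  have "cauchy_class V (\<lambda>n. T (u n)) = cauchy_class V (\<lambda>n. T (?u n))"
  proof (rule class_eqI[OF cauchy_map[OF u T K] cauchy_map[OF u'(1) T K] null_seq_le])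
    show "(\<lambda>n. K * N (u n - ?u n)) \<longlonglongrightarrow> 0" using tendsto_mult_right_zero[OF u'(2)] .
  qed (use T K u u'(1) in \<open>simp_all add: cauchy_in norm_nonneg diff_in\<close>)
  then show ?thesis by (simp add: extend_op_def)
qed

lemma completion_scale:
  assumes u: "u \<in> cauchy_seqs V"
  shows "nv_scale (completion V) c (cauchy_class V u) = cauchy_class V (\<lambda>n. nv_scale V c (u n))"
proof -
  have "extend_op V (nv_scale V c) (cauchy_class V u) = cauchy_class V (\<lambda>n. nv_scale V c (u n))"
    by (rule extend_op_class[OF u, where K = "cmod c"])
       (simp_all add: scale_in diff_in norm_scale flip: scale_diff)
  then show ?thesis by (simp add: completion_def extend_op_def)
qed

text \<open>Constant sequences are dense in the completion, so the operator norm there is determined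
  by \<open>T\<close> itself. The bound \<open>K\<close> makes the supremum over the unit ball one
  of a bounded set.\<close>

lemma operator_norm_completion:
  assumes T: "\<And>x. x \<in> C \<Longrightarrow> T x \<in> C" and T_diff: "\<And>x y. x \<in> C \<Longrightarrow> y \<in> C \<Longrightarrow> T (x - y) = T x - T y"
    and T_scale: "\<And>x c. x \<in> C \<Longrightarrow> T (nv_scale V c x) = nv_scale V c (T x)"
    and K: "\<And>x. x \<in> C \<Longrightarrow> N (T x) \<le> K * N x"
  shows "0 \<le> K \<Longrightarrow> operator_norm (completion V) (extend_op V T) \<le> K"
    and "x \<in> C \<Longrightarrow> N (T x) \<le> operator_norm (completion V) (extend_op V T) * N x"
    and "0 \<le> operator_norm (completion V) (extend_op V T)"
proof -
  let ?U = "completion V" and ?S = "extend_op V T"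
  have K': "N (T x - T y) \<le> K * N (x - y)" if "x \<in> C" "y \<in> C" for x y
    unfolding T_diff[OF that, symmetric] by (rule K[OF diff_in[OF that]])
  have ext: "?S (cauchy_class V u) = cauchy_class V (\<lambda>n. T (u n))" if "u \<in> cauchy_seqs V" for u
    by (rule extend_op_class[OF that T K'])
  have ext_cauchy: "(\<lambda>n. T (u n)) \<in> cauchy_seqs V" if "u \<in> cauchy_seqs V" for u
    by (rule cauchy_map[OF that T K'])
  have le: "nv_norm ?U (?S P) \<le> K * nv_norm ?U P" if "P \<in> nv_carrier ?U" for P
  proof -
    obtain u where u: "u \<in> cauchy_seqs V" and P: "P = cauchy_class V u"
      using \<open>P \<in> nv_carrier ?U\<close> by (auto simp: completion_carrier)
    show ?thesis
      unfolding P ext[OF u]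
      by (rule LIMSEQ_le[OF completion_norm[OF ext_cauchy[OF u]] tendsto_mult[OF tendsto_const completion_norm[OF u]]])
         (use K u in \<open>auto simp: cauchy_in\<close>)
  qed
  have const: "cauchy_class V (\<lambda>_. x) \<in> {P \<in> nv_carrier ?U. nv_norm ?U P \<le> 1}" if "x \<in> C" "N x \<le> 1" for x
    using that by (simp add: completion_carrier cauchy_const completion_norm_const)
  have S_const: "nv_norm ?U (?S (cauchy_class V (\<lambda>_. x))) = N (T x)" if "x \<in> C" for x
    using that by (simp add: ext cauchy_const completion_norm_const T)
  have bdd: "bdd_above ((\<lambda>P. nv_norm ?U (?S P)) ` {P \<in> nv_carrier ?U. nv_norm ?U P \<le> 1})"
  proof (intro bdd_aboveI2)
    fix P assume "P \<in> {P \<in> nv_carrier ?U. nv_norm ?U P \<le> 1}"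
    then have P: "P \<in> nv_carrier ?U" "nv_norm ?U P \<le> 1" by auto
    obtain u where u: "u \<in> cauchy_seqs V" "P = cauchy_class V u" using P(1) by (auto simp: completion_carrier)
    have "0 \<le> nv_norm ?U P"
      unfolding u(2) by (rule LIMSEQ_le_const[OF completion_norm[OF u(1)]]) (use u(1) in \<open>auto simp: cauchy_in norm_nonneg\<close>)
    then have "K * nv_norm ?U P \<le> \<bar>K\<bar> * 1" using P(2) by (intro mult_mono) auto
    then show "nv_norm ?U (?S P) \<le> \<bar>K\<bar>" using le[OF P(1)] by simp
  qed
  have upper: "N (T x) \<le> operator_norm ?U ?S" if "x \<in> C" "N x \<le> 1" for x
    unfolding operator_norm_def S_const[OF that(1), symmetric] by (intro cSUP_upper bdd const that)
  have "T 0 = 0" using T_diff[OF zero_in zero_in] by simp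
  then show nonneg: "0 \<le> operator_norm ?U ?S" using upper[OF zero_in] by simp
  show "operator_norm ?U ?S \<le> K" if "0 \<le> K"
    unfolding operator_norm_def
  proof (rule cSUP_least)
    show "{P \<in> nv_carrier ?U. nv_norm ?U P \<le> 1} \<noteq> {}" using const[OF zero_in] by auto
    fix P assume "P \<in> {P \<in> nv_carrier ?U. nv_norm ?U P \<le> 1}"
    then have P: "P \<in> nv_carrier ?U" "nv_norm ?U P \<le> 1" by auto
    show "nv_norm ?U (?S P) \<le> K"
      using le[OF P(1)] mult_left_mono[OF P(2) that] by simp
  qed
  assume x: "x \<in> C"
  show "N (T x) \<le> operator_norm ?U ?S * N x"
  proof (cases "N x = 0")
    case True
    then show ?thesis using K[OF x] by simp
  next
    case False
    then have pos: "0 < N x" using norm_nonneg[OF x] by simp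
    let ?x = "nv_scale V (complex_of_real (1 / N x)) x"
    have "N (T ?x) \<le> operator_norm ?U ?S"
      using x pos by (intro upper scale_in) (simp_all add: norm_scale norm_divide)
    then show ?thesis using x pos by (simp add: T_scale norm_scale T norm_divide field_simps)
  qed
qed

end

section \<open>Matrix powers and homomorphisms of a completion into matrices\<close>

lemma pow_mat_add:
  assumes "A \<in> carrier_mat n n"
  shows "A ^\<^sub>m (a + b) = A ^\<^sub>m a * (A ^\<^sub>m b :: complex mat)"
proof (induction b)
  case 0
  then show ?case using assms by simp
next
  case (Suc b)
  then show ?case
    using assoc_mult_mat[OF pow_carrier_mat[OF assms] pow_carrier_mat[OF assms] assms, of a b] by simp
qed

text \<open>Each step squares the norm by the C*-inequality \<open>mat_norm_adjoint_mult\<close>.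
  Exponents that are powers of two are enough to see exponential growth.\<close>

lemma mat_norm_power_selfadjoint:
  assumes A: "A \<in> carrier_mat n n" and sa: "mat_adjoint A = A"
  shows "mat_norm A ^ 2 ^ k \<le> mat_norm (A ^\<^sub>m (2 ^ k))"
proof (induction k)
  case 0
  show ?case using A by simp
next
  case (Suc k)
  let ?B = "A ^\<^sub>m (2 ^ k)"
  have B: "?B \<in> carrier_mat n n" using A by simp
  have adj: "mat_adjoint (A ^\<^sub>m j) = A ^\<^sub>m j" for j
  proof (induction j)
    case 0
    then show ?case by simp
  next
    case (Suc j)
    have "mat_adjoint (A ^\<^sub>m Suc j) = A ^\<^sub>m 1 * A ^\<^sub>m j"
      using mat_adjoint_mult[OF pow_carrier_mat[OF A] A, of j] A by (simp add: Suc sa)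
    then show ?case unfolding pow_mat_add[OF A, symmetric] by simp
  qed
  have "mat_norm A ^ 2 ^ Suc k = (mat_norm A ^ 2 ^ k)\<^sup>2"
    by (simp add: power_mult[symmetric] mult.commute)
  also have "\<dots> \<le> (mat_norm ?B)\<^sup>2" by (intro power_mono Suc) simp
  also have "\<dots> \<le> mat_norm (?B * ?B)" using mat_norm_adjoint_mult[OF B] by (simp add: adj)
  also have "?B * ?B = A ^\<^sub>m (2 ^ Suc k)" by (simp add: pow_mat_add[OF A, symmetric] mult_2)
  finally show ?case .
qed

locale seminormed_algebra = seminormed X for X :: "'v::ab_group_add star_alg" +
  assumes mult_in: "x \<in> nv_carrier X \<Longrightarrow> y \<in> nv_carrier X \<Longrightarrow> sa_mult X x y \<in> nv_carrier X"
    and star_in: "x \<in> nv_carrier X \<Longrightarrow> sa_star X x \<in> nv_carrier X"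
    and mult_diff_left: "x \<in> nv_carrier X \<Longrightarrow> y \<in> nv_carrier X \<Longrightarrow> z \<in> nv_carrier X \<Longrightarrow>
      sa_mult X (x - y) z = sa_mult X x z - sa_mult X y z"
    and mult_diff_right: "x \<in> nv_carrier X \<Longrightarrow> y \<in> nv_carrier X \<Longrightarrow> z \<in> nv_carrier X \<Longrightarrow>
      sa_mult X x (y - z) = sa_mult X x y - sa_mult X x z"
    and star_diff: "x \<in> nv_carrier X \<Longrightarrow> y \<in> nv_carrier X \<Longrightarrow> sa_star X (x - y) = sa_star X x - sa_star X y"
    and norm_mult: "x \<in> nv_carrier X \<Longrightarrow> y \<in> nv_carrier X \<Longrightarrow>
      nv_norm X (sa_mult X x y) \<le> nv_norm X x * nv_norm X y"
    and norm_star: "x \<in> nv_carrier X \<Longrightarrow> nv_norm X (sa_star X x) = nv_norm X x"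
begin

lemma star_completion_simps:
  "nv_carrier (star_completion X) = nv_carrier (completion X)"
  "nv_add (star_completion X) = nv_add (completion X)"
  "nv_scale (star_completion X) = nv_scale (completion X)"
  "nv_norm (star_completion X) = nv_norm (completion X)"
  "sa_mult (star_completion X) P Q = cauchy_class X (\<lambda>n. sa_mult X (class_rep P n) (class_rep Q n))"
  "sa_star (star_completion X) P = cauchy_class X (\<lambda>n. sa_star X (class_rep P n))"
  by (simp_all add: star_completion_def normed_space.extend_def)

lemma cauchy_bounded:
  assumes "u \<in> cauchy_seqs X"
  obtains K where "0 \<le> K" "\<And>n. N (u n) \<le> K"
proof -
  obtain K where K: "\<And>n. norm (N (u n)) \<le> K"
    using convergent_imp_Bseq[OF norm_convergent[OF assms]] by (auto simp: Bseq_def)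
  have "0 \<le> K" using K[of 0] by (rule order.trans[OF norm_ge_zero])
  moreover have "N (u n) \<le> K" for n using K[of n] by simp
  ultimately show thesis by (rule that)
qed

lemma norm_mult_diff:
  assumes "x \<in> C" "y \<in> C" "x' \<in> C" "y' \<in> C"
  shows "N (sa_mult X x y - sa_mult X x' y') \<le> N (x - x') * N y + N x' * N (y - y')"
proof -
  have "sa_mult X x y - sa_mult X x' y' = sa_mult X (x - x') y + sa_mult X x' (y - y')"
    using assms by (simp add: mult_diff_left mult_diff_right)
  also have "N \<dots> \<le> N (sa_mult X (x - x') y) + N (sa_mult X x' (y - y'))"
    using assms by (intro norm_triangle mult_in diff_in)
  also have "\<dots> \<le> N (x - x') * N y + N x' * N (y - y')"
    using assms by (intro add_mono norm_mult diff_in)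
  finally show ?thesis .
qed

lemma cauchy_mult:
  assumes u: "u \<in> cauchy_seqs X" and w: "w \<in> cauchy_seqs X"
  shows "(\<lambda>n. sa_mult X (u n) (w n)) \<in> cauchy_seqs X"
  unfolding cauchy_seqs_iff
proof (intro conjI allI impI)
  fix e :: real assume "e > 0"
  obtain K where K: "0 \<le> K" "\<And>n. N (u n) \<le> K" using cauchy_bounded[OF u] by blast
  obtain L where L: "0 \<le> L" "\<And>n. N (w n) \<le> L" using cauchy_bounded[OF w] by blast
  define \<delta> where "\<delta> = e / (K + L + 1)"
  have \<delta>: "\<delta> > 0" using \<open>e > 0\<close> K(1) L(1) by (simp add: \<delta>_def)
  obtain M1 where M1: "\<And>m n. m \<ge> M1 \<Longrightarrow> n \<ge> M1 \<Longrightarrow> N (u m - u n) < \<delta>"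
    using u \<delta> unfolding cauchy_seqs_iff by meson
  obtain M2 where M2: "\<And>m n. m \<ge> M2 \<Longrightarrow> n \<ge> M2 \<Longrightarrow> N (w m - w n) < \<delta>"
    using w \<delta> unfolding cauchy_seqs_iff by meson
  have "N (sa_mult X (u m) (w m) - sa_mult X (u n) (w n)) < e" if "m \<ge> max M1 M2" "n \<ge> max M1 M2" for m n
  proof -
    have "N (sa_mult X (u m) (w m) - sa_mult X (u n) (w n))
        \<le> N (u m - u n) * N (w m) + N (u n) * N (w m - w n)"
      using u w by (intro norm_mult_diff cauchy_in)
    also have "\<dots> \<le> \<delta> * L + K * \<delta>"
      using M1[of m n] M2[of m n] that K L \<delta> u w
      by (intro add_mono mult_mono) (auto simp: cauchy_in diff_in norm_nonneg less_imp_le)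
    also have "\<dots> = (K + L) * \<delta>" by (simp add: algebra_simps)
    also have "\<dots> < (K + L + 1) * \<delta>" using \<delta> by (intro mult_strict_right_mono) auto
    also have "\<dots> = e" using K(1) L(1) by (simp add: \<delta>_def)
    finally show ?thesis .
  qed
  then show "\<exists>M. \<forall>m\<ge>M. \<forall>n\<ge>M. N (sa_mult X (u m) (w m) - sa_mult X (u n) (w n)) < e" by blast
qed (use u w in \<open>simp add: cauchy_in mult_in\<close>)

lemma star_completion_mult:
  assumes u: "u \<in> cauchy_seqs X" and w: "w \<in> cauchy_seqs X"
  shows "sa_mult (star_completion X) (cauchy_class X u) (cauchy_class X w)
    = cauchy_class X (\<lambda>n. sa_mult X (u n) (w n))"
proof -
  let ?u = "class_rep (cauchy_class X u)" and ?w = "class_rep (cauchy_class X w)"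
  note u' = class_rep_class[OF u] and w' = class_rep_class[OF w]
  obtain K where K: "0 \<le> K" "\<And>n. N (?u n) \<le> K" using cauchy_bounded[OF u'(1)] by blast
  obtain L where L: "0 \<le> L" "\<And>n. N (w n) \<le> L" using cauchy_bounded[OF w] by blast
  have "cauchy_class X (\<lambda>n. sa_mult X (u n) (w n)) = cauchy_class X (\<lambda>n. sa_mult X (?u n) (?w n))"
  proof (rule class_eqI[OF cauchy_mult[OF u w] cauchy_mult[OF u'(1) w'(1)] null_seq_le])
    show "(\<lambda>n. N (u n - ?u n) * L + K * N (w n - ?w n)) \<longlonglongrightarrow> 0"
      using tendsto_add[OF tendsto_mult_left_zero[OF u'(2)] tendsto_mult_right_zero[OF w'(2)], of L K] by simp
    fix n
    show "0 \<le> N (sa_mult X (u n) (w n) - sa_mult X (?u n) (?w n))"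
      by (intro norm_nonneg diff_in mult_in cauchy_in u w u'(1) w'(1))
    have "N (sa_mult X (u n) (w n) - sa_mult X (?u n) (?w n))
        \<le> N (u n - ?u n) * N (w n) + N (?u n) * N (w n - ?w n)"
      by (intro norm_mult_diff cauchy_in u w u'(1) w'(1))
    also have "\<dots> \<le> N (u n - ?u n) * L + K * N (w n - ?w n)"
      by (intro add_mono mult_mono K L order.refl norm_nonneg diff_in cauchy_in u w u'(1) w'(1))
    finally show "N (sa_mult X (u n) (w n) - sa_mult X (?u n) (?w n)) \<le> \<dots>" .
  qed
  then show ?thesis by (simp add: star_completion_simps)
qed

lemma star_completion_star:
  assumes u: "u \<in> cauchy_seqs X"
  shows "sa_star (star_completion X) (cauchy_class X u) = cauchy_class X (\<lambda>n. sa_star X (u n))"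
    and "(\<lambda>n. sa_star X (u n)) \<in> cauchy_seqs X"
proof -
  have "extend_op X (sa_star X) (cauchy_class X u) = cauchy_class X (\<lambda>n. sa_star X (u n))"
    by (rule extend_op_class[OF u, where K = 1]) (simp_all add: star_in diff_in norm_star flip: star_diff)
  then show "sa_star (star_completion X) (cauchy_class X u) = cauchy_class X (\<lambda>n. sa_star X (u n))"
    by (simp add: star_completion_simps extend_op_def)
  show "(\<lambda>n. sa_star X (u n)) \<in> cauchy_seqs X"
    by (rule cauchy_map[OF u, where K = 1]) (simp_all add: star_in diff_in norm_star flip: star_diff)
qed

abbreviation embed :: "'v \<Rightarrow> (nat \<Rightarrow> 'v) set" where
  "embed x \<equiv> cauchy_class X (\<lambda>_. x)"

text \<open>For \<open>N x < 1\<close> the completion contains the sum \<open>Q\<close> of the powers of \<open>x\<close>, which satisfies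
  \<open>Q = x + Q x\<close>.\<close>

lemma quasi_inverse_exists:
  assumes x: "x \<in> C" "N x < 1"
  obtains Q where "Q \<in> nv_carrier (star_completion X)"
    "Q = nv_add (star_completion X) (embed x) (sa_mult (star_completion X) Q (embed x))"
    "sa_mult (star_completion X) Q (embed x) \<in> nv_carrier (star_completion X)"
proof -
  define q where "q = rec_nat 0 (\<lambda>_ y. x + sa_mult X y x)"
  have q0: "q 0 = 0" and qS: "q (Suc n) = x + sa_mult X (q n) x" for n by (auto simp: q_def)
  have qC: "q n \<in> C" for n by (induction n) (auto simp: q0 qS zero_in add_in mult_in x)
  have N0: "0 \<le> N x" by (rule norm_nonneg[OF x(1)])
  have zero_mult: "sa_mult X 0 x = 0" using mult_diff_left[OF zero_in zero_in x(1)] by simp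
  have step: "N (q (Suc n) - q n) \<le> N x ^ n" for n
  proof (induction n)
    case 0
    then show ?case using x(2) by (simp add: q0 qS zero_mult)
  next
    case (Suc n)
    have "q (Suc (Suc n)) - q (Suc n) = sa_mult X (q (Suc n) - q n) x"
      unfolding mult_diff_left[OF qC qC x(1)] using qS[of "Suc n"] qS[of n] by simp
    then have "N (q (Suc (Suc n)) - q (Suc n)) \<le> N (q (Suc n) - q n) * N x"
      using norm_mult[OF diff_in[OF qC qC] x(1)] by simp
    also have "\<dots> \<le> N x ^ n * N x" by (intro mult_right_mono Suc N0)
    finally show ?case by (simp add: mult.commute)
  qed
  define s where "s n = (\<Sum>i<n. N x ^ i)" for n
  have dist_le: "N (q (n + k) - q n) \<le> s (n + k) - s n" for n k
  proof (induction k)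
    case (Suc k)
    have "N (q (n + Suc k) - q n) \<le> N (q (Suc (n + k)) - q (n + k)) + N (q (n + k) - q n)"
      using norm_diff_triangle[OF qC qC qC] by simp
    then show ?case using Suc step[of "n + k"] by (simp add: s_def)
  qed simp
  have "Cauchy s"
    unfolding s_def[abs_def] using summable_geometric[of "N x"] N0 x(2)
    by (simp add: summable_iff_convergent Cauchy_convergent_iff)
  have q: "q \<in> cauchy_seqs X"
    unfolding cauchy_seqs_iff
  proof (intro conjI allI impI qC)
    fix e :: real assume "e > 0"
    then obtain M where M: "\<And>m n. m \<ge> M \<Longrightarrow> n \<ge> M \<Longrightarrow> \<bar>s m - s n\<bar> < e"
      using \<open>Cauchy s\<close> unfolding Cauchy_def dist_real_def by metis
    have le: "N (q m - q n) < e" if "M \<le> n" "n \<le> m" for m n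
      using dist_le[of n "m - n"] M[of m n] that by auto
    have "N (q m - q n) < e" if "m \<ge> M" "n \<ge> M" for m n
    proof (cases "n \<le> m")
      case False
      then show ?thesis using le[of m n] that norm_diff_sym[OF qC qC, of m n] by simp
    qed (use le that in auto)
    then show "\<exists>M. \<forall>m\<ge>M. \<forall>n\<ge>M. N (q m - q n) < e" by blast
  qed
  let ?Q = "cauchy_class X q"
  note cx = cauchy_const[OF x(1)]
  have mult: "sa_mult (star_completion X) ?Q (embed x) = cauchy_class X (\<lambda>n. sa_mult X (q n) x)"
    by (rule star_completion_mult[OF q cx])
  have "nv_add (star_completion X) (embed x) (sa_mult (star_completion X) ?Q (embed x))
      = cauchy_class X (\<lambda>n. q (Suc n))"
    unfolding mult qS unfolding star_completion_simps(2) by (rule completion_add[OF cx cauchy_mult[OF q cx]])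
  also have "\<dots> = ?Q"
  proof (rule class_eqI)
    show "(\<lambda>n. q (Suc n)) \<in> cauchy_seqs X"
      unfolding qS by (intro cauchy_add cauchy_mult q cx)
    show "(\<lambda>n. N (q (Suc n) - q n)) \<longlonglongrightarrow> 0"
      by (rule null_seq_le[OF LIMSEQ_realpow_zero[OF N0 x(2)]]) (simp_all add: step norm_nonneg diff_in qC)
  qed (rule q)
  finally have eq: "nv_add (star_completion X) (embed x) (sa_mult (star_completion X) ?Q (embed x)) = ?Q" .
  show thesis
  proof (rule that)
    show "?Q \<in> nv_carrier (star_completion X)"
      unfolding star_completion_simps(1) completion_carrier by (rule imageI[OF q])
    show "?Q = nv_add (star_completion X) (embed x) (sa_mult (star_completion X) ?Q (embed x))"
      by (rule eq[symmetric])
    show "sa_mult (star_completion X) ?Q (embed x) \<in> nv_carrier (star_completion X)"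
      unfolding mult star_completion_simps(1) completion_carrier by (rule imageI[OF cauchy_mult[OF q cx]])
  qed
qed

lemma
  assumes hom: "star_hom_mat (star_completion X) k \<psi>"
  shows hom_embed_carrier: "x \<in> C \<Longrightarrow> \<psi> (embed x) \<in> carrier_mat k k"
    and hom_embed_add: "x \<in> C \<Longrightarrow> y \<in> C \<Longrightarrow> \<psi> (embed (x + y)) = \<psi> (embed x) + \<psi> (embed y)"
    and hom_embed_scale: "x \<in> C \<Longrightarrow> \<psi> (embed (nv_scale X c x)) = c \<cdot>\<^sub>m \<psi> (embed x)"
    and hom_embed_mult: "x \<in> C \<Longrightarrow> y \<in> C \<Longrightarrow> \<psi> (embed (sa_mult X x y)) = \<psi> (embed x) * \<psi> (embed y)"
    and hom_embed_star: "x \<in> C \<Longrightarrow> \<psi> (embed (sa_star X x)) = mat_adjoint (\<psi> (embed x))"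
proof -
  have cl: "embed x \<in> nv_carrier (star_completion X)" if "x \<in> C" for x
    using that by (simp add: star_completion_simps completion_carrier cauchy_const)
  show "x \<in> C \<Longrightarrow> \<psi> (embed x) \<in> carrier_mat k k" using hom cl by (simp add: star_hom_mat_def)
  show "\<psi> (embed (x + y)) = \<psi> (embed x) + \<psi> (embed y)" if "x \<in> C" "y \<in> C"
  proof -
    have "\<psi> (nv_add (star_completion X) (embed x) (embed y)) = \<psi> (embed x) + \<psi> (embed y)"
      using hom cl that by (simp add: star_hom_mat_def)
    then show ?thesis using that by (simp add: star_completion_simps completion_add cauchy_const)
  qed
  show "\<psi> (embed (nv_scale X c x)) = c \<cdot>\<^sub>m \<psi> (embed x)" if "x \<in> C"
  proof -
    have "\<psi> (nv_scale (star_completion X) c (embed x)) = c \<cdot>\<^sub>m \<psi> (embed x)"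
      using hom cl that by (simp add: star_hom_mat_def)
    then show ?thesis using that by (simp add: star_completion_simps completion_scale cauchy_const)
  qed
  show "\<psi> (embed (sa_mult X x y)) = \<psi> (embed x) * \<psi> (embed y)" if "x \<in> C" "y \<in> C"
  proof -
    have "\<psi> (sa_mult (star_completion X) (embed x) (embed y)) = \<psi> (embed x) * \<psi> (embed y)"
      using hom cl that by (simp add: star_hom_mat_def)
    then show ?thesis using that by (simp add: star_completion_mult cauchy_const)
  qed
  show "\<psi> (embed (sa_star X x)) = mat_adjoint (\<psi> (embed x))" if "x \<in> C"
  proof -
    have "\<psi> (sa_star (star_completion X) (embed x)) = mat_adjoint (\<psi> (embed x))"
      using hom cl that by (simp add: star_hom_mat_def)
    then show ?thesis using that by (simp add: star_completion_star cauchy_const)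
  qed
qed

text \<open>If \<open>v\<close> is an eigenvector for \<open>\<mu>\<close> of modulus at least 1,
  then \<open>y = x / \<mu>\<close> still has norm below 1 and its image fixes \<open>v\<close>. The
  relation \<open>Q = y + Q y\<close> evaluated at \<open>v\<close> reads
  \<open>M v = v + M v\<close> for the image \<open>M\<close> of \<open>Q\<close>, so
  \<open>v = 0\<close>. The unit of the matrix algebra never has to be an image.\<close>

lemma hom_embed_spectral_radius:
  assumes hom: "star_hom_mat (star_completion X) k \<psi>" and "0 < k" and x: "x \<in> C" "N x < 1"
  shows "spectral_radius (\<psi> (embed x)) < 1"
proof -
  let ?F = "\<psi> (embed x)"
  have F: "?F \<in> carrier_mat k k" by (rule hom_embed_carrier[OF hom x(1)])
  have "cmod \<mu> < 1" if \<mu>: "eigenvalue ?F \<mu>" for \<mu>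
  proof (rule ccontr)
    assume "\<not> cmod \<mu> < 1"
    then have \<mu>1: "1 \<le> cmod \<mu>" by simp
    then have \<mu>0: "\<mu> \<noteq> 0" by auto
    obtain v where v: "v \<in> carrier_vec k" "v \<noteq> 0\<^sub>v k" "mult_mat_vec ?F v = smult_vec \<mu> v"
      using \<mu> F unfolding eigenvalue_def eigenvector_def by auto
    define y where "y = nv_scale X (1 / \<mu>) x"
    have y: "y \<in> C" unfolding y_def by (rule scale_in[OF x(1)])
    have "N y = N x / cmod \<mu>" by (simp add: y_def norm_scale x norm_divide)
    also have "\<dots> \<le> N x / 1" using \<mu>1 norm_nonneg[OF x(1)] by (intro divide_left_mono) auto
    finally have "N y < 1" using x(2) by simp
    from y this obtain Q where Q: "Q \<in> nv_carrier (star_completion X)"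
      "Q = nv_add (star_completion X) (embed y) (sa_mult (star_completion X) Q (embed y))"
      "sa_mult (star_completion X) Q (embed y) \<in> nv_carrier (star_completion X)"
      by (rule quasi_inverse_exists)
    let ?G = "\<psi> (embed y)" and ?M = "\<psi> Q"
    have ey: "embed y \<in> nv_carrier (star_completion X)"
      using y by (simp add: star_completion_simps completion_carrier cauchy_const)
    have G: "?G \<in> carrier_mat k k" by (rule hom_embed_carrier[OF hom y])
    have M: "?M \<in> carrier_mat k k" using hom Q(1) by (simp add: star_hom_mat_def)
    have "?M = \<psi> (nv_add (star_completion X) (embed y) (sa_mult (star_completion X) Q (embed y)))"
      by (rule arg_cong[OF Q(2)])
    also have "\<dots> = ?G + \<psi> (sa_mult (star_completion X) Q (embed y))"
      using hom ey Q(3) by (simp add: star_hom_mat_def)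
    also have "\<psi> (sa_mult (star_completion X) Q (embed y)) = ?M * ?G"
      using hom ey Q(1) by (simp add: star_hom_mat_def)
    finally have MG: "?M = ?G + ?M * ?G" .
    have "?G = (1 / \<mu>) \<cdot>\<^sub>m ?F" unfolding y_def by (rule hom_embed_scale[OF hom x(1)])
    then have Gv: "mult_mat_vec ?G v = v"
      using smult_mat_mult_mat_vec[OF F v(1), of "1 / \<mu>"] v(3) \<mu>0 by (simp add: smult_smult_assoc)
    have "mult_mat_vec ?M v = mult_mat_vec (?G + ?M * ?G) v" by (rule arg_cong[OF MG])
    also have "\<dots> = mult_mat_vec ?G v + mult_mat_vec (?M * ?G) v"
      by (rule add_mult_distrib_mat_vec[OF G mult_carrier_mat[OF M G] v(1)])
    also have "mult_mat_vec (?M * ?G) v = mult_mat_vec ?M v"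
      unfolding assoc_mult_mat_vec[OF M G v(1)] Gv ..
    finally have eq: "mult_mat_vec ?M v = v + mult_mat_vec ?M v" unfolding Gv .
    have "v = 0\<^sub>v k"
    proof (rule eq_vecI)
      fix i assume i: "i < dim_vec (0\<^sub>v k :: complex Matrix.vec)"
      then have "vec_index (mult_mat_vec ?M v) i = vec_index v i + vec_index (mult_mat_vec ?M v) i"
        using arg_cong[OF eq, of "\<lambda>w. vec_index w i"] M v(1) by (simp del: index_mult_mat_vec)
      then show "vec_index v i = vec_index (0\<^sub>v k) i" using i by simp
    qed (use v(1) in simp)
    then show False using v(2) by simp
  qed
  moreover have "spectral_radius ?F \<in> cmod ` spectrum ?F"
    by (rule spectral_radius_mem_max(1)[OF F \<open>0 < k\<close>])
  ultimately show ?thesis by (auto simp: spectrum_def)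
qed

text \<open>For \<open>N x < 1\<close> the selfadjoint image \<open>?H\<close> of \<open>h\<close>
  has spectral radius below 1, so its powers stay bounded. A norm above 1 would make the powers with
  exponents \<open>2 ^ j\<close> grow without bound.\<close>

lemma hom_embed_contractive:
  assumes hom: "star_hom_mat (star_completion X) k \<psi>" and "0 < k" and x: "x \<in> C"
  shows "mat_norm (\<psi> (embed x)) \<le> N x"
proof -
  have small: "mat_norm (\<psi> (embed x)) \<le> 1" if x: "x \<in> C" "N x < 1" for x
  proof -
    let ?F = "\<psi> (embed x)"
    define h where "h = sa_mult X (sa_star X x) x"
    have h: "h \<in> C" unfolding h_def by (intro mult_in star_in x)
    have "N h \<le> N x * N x" unfolding h_def using norm_mult[OF star_in x(1)] x(1) by (simp add: norm_star)
    also have "\<dots> < 1" using x norm_nonneg[OF x(1)] mult_strict_mono[of "N x" 1 "N x" 1] by simp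
    finally have h1: "N h < 1" .
    let ?H = "\<psi> (embed h)"
    have F: "?F \<in> carrier_mat k k" and H: "?H \<in> carrier_mat k k" by (intro hom_embed_carrier[OF hom] x h)+
    have HF: "?H = mat_adjoint ?F * ?F"
      unfolding h_def hom_embed_mult[OF hom star_in[OF x(1)] x(1)] hom_embed_star[OF hom x(1)] ..
    have sa: "mat_adjoint ?H = ?H" unfolding HF using F by (simp add: mat_adjoint_mult_square[of _ k])
    obtain c where c: "\<And>j. norm_bound (?H ^\<^sub>m j) c"
      using spectral_radius_jnf_norm_bound_less_1_upper_triangular[OF H hom_embed_spectral_radius[OF hom \<open>0 < k\<close> h h1]]
      by blast
    have bound: "mat_norm ?H ^ 2 ^ j \<le> real k * (real k * c)" for j
    proof -
      have P: "?H ^\<^sub>m (2 ^ j) \<in> carrier_mat k k" by (rule pow_carrier_mat[OF H])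
      have "mat_norm ?H ^ 2 ^ j \<le> mat_norm (?H ^\<^sub>m (2 ^ j))" by (rule mat_norm_power_selfadjoint[OF H sa])
      also have "\<dots> \<le> (\<Sum>i<k. \<Sum>l<k. cmod ((?H ^\<^sub>m (2 ^ j)) $$ (i, l)))" by (rule mat_norm_le_sum[OF P])
      also have "\<dots> \<le> (\<Sum>i<k. \<Sum>l<k. c)"
        using c[of "2 ^ j"] carrier_matD[OF P] unfolding norm_bound_def by (intro sum_mono) simp
      finally show ?thesis by simp
    qed
    have "mat_norm ?H \<le> 1"
    proof (rule ccontr)
      assume "\<not> mat_norm ?H \<le> 1"
      then have gt: "1 < mat_norm ?H" by simp
      then obtain j where j: "real k * (real k * c) < mat_norm ?H ^ j" using real_arch_pow by blast
      also have "\<dots> \<le> mat_norm ?H ^ 2 ^ j"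
        using gt by (intro power_increasing) (auto intro: less_imp_le)
      finally show False using bound[of j] by simp
    qed
    then have "(mat_norm ?F)\<^sup>2 \<le> 1\<^sup>2" using mat_norm_adjoint_mult[OF F] HF by simp
    then show ?thesis by (rule power2_le_imp_le) simp
  qed
  show ?thesis
  proof (rule dense_ge)
    fix r assume r: "N x < r"
    then have r0: "0 < r" using norm_nonneg[OF x] by linarith
    define y where "y = nv_scale X (complex_of_real (1 / r)) x"
    have y: "y \<in> C" unfolding y_def by (rule scale_in[OF x])
    have "N y < 1" using r r0 by (simp add: y_def norm_scale x norm_divide)
    from small[OF y this] have y1: "mat_norm (\<psi> (embed y)) \<le> 1" .
    have X: "\<psi> (embed x) \<in> carrier_mat k k" by (rule hom_embed_carrier[OF hom x])
    have Y: "\<psi> (embed y) \<in> carrier_mat k k" by (rule hom_embed_carrier[OF hom y])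
    have Y_eq: "\<psi> (embed y) = complex_of_real (1 / r) \<cdot>\<^sub>m \<psi> (embed x)"
      unfolding y_def by (rule hom_embed_scale[OF hom x])
    show "mat_norm (\<psi> (embed x)) \<le> r"
    proof (rule mat_norm_leI[OF X])
      fix u :: "complex Matrix.vec" assume u: "u \<in> carrier_vec k"
      have "euclid_norm (mult_mat_vec (\<psi> (embed y)) u) \<le> 1 * euclid_norm u"
        by (rule order.trans[OF mult_mat_vec_mat_norm_le[OF Y u] mult_right_mono[OF y1]]) simp
      then show "euclid_norm (mult_mat_vec (\<psi> (embed x)) u) \<le> r * euclid_norm u"
        unfolding Y_eq smult_mat_mult_mat_vec[OF X u] euclid_norm_smult
        using r0 by (simp add: norm_divide field_simps)
    qed (use r0 in simp)
  qed
qed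

end

section \<open>Extension of homomorphisms to the completion\<close>

context seminormed_algebra
begin

lemma star_hom_extension:
  assumes hom: "star_hom_mat X d \<Psi>" and K: "\<And>x. x \<in> C \<Longrightarrow> mat_norm (\<Psi> x) \<le> K * N x"
  obtains \<Phi> where "star_hom_mat (star_completion X) d \<Phi>"
    "\<forall>u\<in>cauchy_seqs X. \<forall>i<d. \<forall>j<d.
      (\<lambda>n. \<Psi> (u n) $$ (i, j)) \<longlonglongrightarrow> \<Phi> (cauchy_class X u) $$ (i, j)"
proof -
  have \<Psi>: "\<Psi> x \<in> carrier_mat d d" "\<Psi> (x + y) = \<Psi> x + \<Psi> y" "\<Psi> (nv_scale X c x) = c \<cdot>\<^sub>m \<Psi> x"
    "\<Psi> (sa_mult X x y) = \<Psi> x * \<Psi> y" "\<Psi> (sa_star X x) = mat_adjoint (\<Psi> x)"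
    if "x \<in> C" "y \<in> C" for x y c
    using hom that by (simp_all add: star_hom_mat_def nv_add)
  have dim: "dim_row (\<Psi> x) = d" "dim_col (\<Psi> x) = d" if "x \<in> C" for x
    using \<Psi>(1)[OF that that] by auto
  have diff: "cmod (\<Psi> x $$ (i, j) - \<Psi> y $$ (i, j)) \<le> K * N (x - y)"
    if "x \<in> C" "y \<in> C" "i < d" "j < d" for x y i j
  proof -
    have "\<Psi> x = \<Psi> (x - y) + \<Psi> y" using \<Psi>(2)[OF diff_in[OF that(1,2)] that(2)] by simp
    then have "\<Psi> x $$ (i, j) = (\<Psi> (x - y) + \<Psi> y) $$ (i, j)" by (rule arg_cong)
    then have "\<Psi> x $$ (i, j) - \<Psi> y $$ (i, j) = \<Psi> (x - y) $$ (i, j)"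
      using that dim by simp
    also have "cmod \<dots> \<le> mat_norm (\<Psi> (x - y))"
      using that by (intro mat_entry_le_norm[of _ d d] \<Psi>(1) diff_in)
    also have "\<dots> \<le> K * N (x - y)" by (intro K diff_in that)
    finally show ?thesis .
  qed
  \<comment> \<open>Defined through the representative chosen for the class; the fact
    \<open>lim\<close> below shows that every Cauchy sequence in the class gives the same entries,
    and it is what proves the algebraic identities.\<close>
  define \<Phi> where "\<Phi> P = mat d d (\<lambda>(i, j). lim (\<lambda>n. \<Psi> (class_rep P n) $$ (i, j)))" for P
  have \<Phi>_carrier: "\<Phi> P \<in> carrier_mat d d" for P by (simp add: \<Phi>_def)
  have lim: "(\<lambda>n. \<Psi> (u n) $$ (i, j)) \<longlonglongrightarrow> \<Phi> (cauchy_class X u) $$ (i, j)"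
    if u: "u \<in> cauchy_seqs X" and ij: "i < d" "j < d" for u i j
  proof -
    let ?r = "class_rep (cauchy_class X u)"
    note r = class_rep_class[OF u]
    have "Cauchy (\<lambda>n. \<Psi> (?r n) $$ (i, j))"
    proof (rule metric_CauchyI)
      fix e :: real assume "e > 0"
      have pos: "0 < \<bar>K\<bar> + 1" by simp
      then obtain M where M: "\<And>m n. m \<ge> M \<Longrightarrow> n \<ge> M \<Longrightarrow> N (?r m - ?r n) < e / (\<bar>K\<bar> + 1)"
        using r(1) \<open>e > 0\<close> unfolding cauchy_seqs_iff by (meson divide_pos_pos)
      have "dist (\<Psi> (?r m) $$ (i, j)) (\<Psi> (?r n) $$ (i, j)) < e" if "m \<ge> M" "n \<ge> M" for m n
      proof -
        have nn: "0 \<le> N (?r m - ?r n)" by (intro norm_nonneg diff_in cauchy_in r)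
        have "dist (\<Psi> (?r m) $$ (i, j)) (\<Psi> (?r n) $$ (i, j)) \<le> K * N (?r m - ?r n)"
          unfolding dist_norm by (intro diff cauchy_in r ij)
        also have "\<dots> \<le> (\<bar>K\<bar> + 1) * N (?r m - ?r n)" using nn by (intro mult_right_mono) auto
        also have "\<dots> < e" using M[OF that] pos by (simp add: pos_less_divide_eq mult.commute)
        finally show ?thesis .
      qed
      then show "\<exists>M. \<forall>m\<ge>M. \<forall>n\<ge>M. dist (\<Psi> (?r m) $$ (i, j)) (\<Psi> (?r n) $$ (i, j)) < e" by blast
    qed
    then have "(\<lambda>n. \<Psi> (?r n) $$ (i, j)) \<longlonglongrightarrow> \<Phi> (cauchy_class X u) $$ (i, j)"
      using ij by (simp add: \<Phi>_def Cauchy_convergent_iff convergent_LIMSEQ_iff)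
    moreover have "(\<lambda>n. \<Psi> (u n) $$ (i, j) - \<Psi> (?r n) $$ (i, j)) \<longlonglongrightarrow> 0"
      by (rule Lim_null_comparison[OF always_eventually tendsto_mult_right_zero[OF r(2), of K]])
         (intro allI diff cauchy_in u r(1) ij)
    ultimately show ?thesis using tendsto_add by fastforce
  qed
  have "star_hom_mat (star_completion X) d \<Phi>"
    unfolding star_hom_mat_def star_completion_simps(1) completion_carrier
  proof (intro conjI ballI allI)
    show "\<Phi> P \<in> carrier_mat d d" for P by (rule \<Phi>_carrier)
  next
    fix P Q assume "P \<in> cauchy_class X ` cauchy_seqs X" "Q \<in> cauchy_class X ` cauchy_seqs X"
    then obtain u w where u: "u \<in> cauchy_seqs X" "P = cauchy_class X u"
      and w: "w \<in> cauchy_seqs X" "Q = cauchy_class X w" by blast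
    show "\<Phi> (nv_add (star_completion X) P Q) = \<Phi> P + \<Phi> Q"
    proof (rule eq_matI)
      fix i j assume "i < dim_row (\<Phi> P + \<Phi> Q)" "j < dim_col (\<Phi> P + \<Phi> Q)"
      then have ij: "i < d" "j < d" by (simp_all add: \<Phi>_def)
      have "(\<lambda>n. \<Psi> (u n + w n) $$ (i, j)) \<longlonglongrightarrow> \<Phi> P $$ (i, j) + \<Phi> Q $$ (i, j)"
        using tendsto_add[OF lim[OF u(1) ij] lim[OF w(1) ij]] u w ij
        by (simp add: \<Psi>(2) cauchy_in dim)
      moreover have "(\<lambda>n. \<Psi> (u n + w n) $$ (i, j)) \<longlonglongrightarrow> \<Phi> (nv_add (star_completion X) P Q) $$ (i, j)"
        using lim[OF cauchy_add[OF u(1) w(1)] ij] u w by (simp add: star_completion_simps(2) completion_add)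
      ultimately show "\<Phi> (nv_add (star_completion X) P Q) $$ (i, j) = (\<Phi> P + \<Phi> Q) $$ (i, j)"
        using LIMSEQ_unique ij \<Phi>_carrier[of P] \<Phi>_carrier[of Q] by auto
    qed (simp_all add: \<Phi>_def)
    show "\<Phi> (sa_mult (star_completion X) P Q) = \<Phi> P * \<Phi> Q"
    proof (rule eq_matI)
      fix i j assume "i < dim_row (\<Phi> P * \<Phi> Q)" "j < dim_col (\<Phi> P * \<Phi> Q)"
      then have ij: "i < d" "j < d" by (simp_all add: \<Phi>_def)
      have "(\<lambda>n. \<Sum>k<d. \<Psi> (u n) $$ (i, k) * \<Psi> (w n) $$ (k, j))
          \<longlonglongrightarrow> (\<Sum>k<d. \<Phi> P $$ (i, k) * \<Phi> Q $$ (k, j))"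
        unfolding u(2) w(2) by (intro tendsto_sum tendsto_mult lim u(1) w(1) ij) simp_all
      moreover have "(\<Sum>k<d. \<Psi> (u n) $$ (i, k) * \<Psi> (w n) $$ (k, j)) = \<Psi> (sa_mult X (u n) (w n)) $$ (i, j)" for n
        using index_mult_mat_sum[OF \<Psi>(1) \<Psi>(1) ij, of "u n" "u n" "w n" "w n"] u(1) w(1) by (simp add: \<Psi>(4) cauchy_in)
      moreover have "(\<Sum>k<d. \<Phi> P $$ (i, k) * \<Phi> Q $$ (k, j)) = (\<Phi> P * \<Phi> Q) $$ (i, j)"
        by (rule index_mult_mat_sum[OF \<Phi>_carrier \<Phi>_carrier ij, symmetric])
      moreover have "(\<lambda>n. \<Psi> (sa_mult X (u n) (w n)) $$ (i, j)) \<longlonglongrightarrow> \<Phi> (sa_mult (star_completion X) P Q) $$ (i, j)"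
        using lim[OF cauchy_mult[OF u(1) w(1)] ij] u w by (simp add: star_completion_mult)
      ultimately show "\<Phi> (sa_mult (star_completion X) P Q) $$ (i, j) = (\<Phi> P * \<Phi> Q) $$ (i, j)"
        using LIMSEQ_unique by simp
    qed (simp_all add: \<Phi>_def)
  next
    fix P assume "P \<in> cauchy_class X ` cauchy_seqs X"
    then obtain u where u: "u \<in> cauchy_seqs X" "P = cauchy_class X u" by blast
    show "\<Phi> (nv_scale (star_completion X) c P) = c \<cdot>\<^sub>m \<Phi> P" for c
    proof (rule eq_matI)
      fix i j assume "i < dim_row (c \<cdot>\<^sub>m \<Phi> P)" "j < dim_col (c \<cdot>\<^sub>m \<Phi> P)"
      then have ij: "i < d" "j < d" by (simp_all add: \<Phi>_def)
      have "(\<lambda>n. \<Psi> (nv_scale X c (u n)) $$ (i, j)) \<longlonglongrightarrow> c * \<Phi> P $$ (i, j)"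
        using tendsto_mult[OF tendsto_const lim[OF u(1) ij], of c] u ij
        by (simp add: \<Psi>(3)[OF cauchy_in cauchy_in] dim cauchy_in)
      moreover have "(\<lambda>n. \<Psi> (nv_scale X c (u n)) $$ (i, j)) \<longlonglongrightarrow> \<Phi> (nv_scale (star_completion X) c P) $$ (i, j)"
        using lim[OF cauchy_scale[OF u(1)] ij, of c] u by (simp add: star_completion_simps(3) completion_scale)
      ultimately show "\<Phi> (nv_scale (star_completion X) c P) $$ (i, j) = (c \<cdot>\<^sub>m \<Phi> P) $$ (i, j)"
        using LIMSEQ_unique ij \<Phi>_carrier[of P] by auto
    qed (simp_all add: \<Phi>_def)
    show "\<Phi> (sa_star (star_completion X) P) = mat_adjoint (\<Phi> P)"
    proof (rule eq_matI)
      fix i j assume "i < dim_row (mat_adjoint (\<Phi> P))" "j < dim_col (mat_adjoint (\<Phi> P))"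
      then have ij: "i < d" "j < d" by (simp_all add: \<Phi>_def)
      have "(\<lambda>n. \<Psi> (sa_star X (u n)) $$ (i, j)) \<longlonglongrightarrow> cnj (\<Phi> P $$ (j, i))"
        using tendsto_cnj[OF lim[OF u(1) ij(2,1)]] u ij
        by (simp add: \<Psi>(5)[OF cauchy_in cauchy_in] dim cauchy_in)
      moreover have "(\<lambda>n. \<Psi> (sa_star X (u n)) $$ (i, j)) \<longlonglongrightarrow> \<Phi> (sa_star (star_completion X) P) $$ (i, j)"
        using lim[OF star_completion_star(2)[OF u(1)] ij] u by (simp add: star_completion_star(1))
      moreover have "mat_adjoint (\<Phi> P) $$ (i, j) = cnj (\<Phi> P $$ (j, i))"
        using ij by (simp add: \<Phi>_def)
      ultimately show "\<Phi> (sa_star (star_completion X) P) $$ (i, j) = mat_adjoint (\<Phi> P) $$ (i, j)"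
        using LIMSEQ_unique by simp
    qed (simp_all add: \<Phi>_def)
  qed
  then show thesis by (rule that) (use lim in simp)
qed

text \<open>Each class is replaced by a term \<open>x P\<close> of a Cauchy sequence beyond which
  terms differ by less than \<open>e / 4\<close>. The four errors are: the norm of the class against
  that of \<open>x P\<close>, the hypothesis at \<open>x P\<close>, the image of \<open>x P\<close>
  against that of a later term, and that image against its limit.\<close>

lemma rfd_star_completionI:
  assumes approx: "\<And>e \<Omega>. e > 0 \<Longrightarrow> finite \<Omega> \<Longrightarrow> \<Omega> \<subseteq> C \<Longrightarrow> \<exists>d>0. \<exists>\<Psi> K. star_hom_mat X d \<Psi> \<and>
      (\<forall>x\<in>C. mat_norm (\<Psi> x) \<le> K * N x) \<and> (\<forall>x\<in>\<Omega>. mat_norm (\<Psi> x) \<ge> N x - e)"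
  shows "rfd_algebra (star_completion X)"
  unfolding rfd_algebra_def
proof (intro allI impI)
  fix e :: real and \<Omega>
  assume "e > 0" and \<Omega>: "finite \<Omega> \<and> \<Omega> \<subseteq> nv_carrier (star_completion X)"
  then have e4: "e / 4 > 0" by simp
  have "\<exists>q. fst q \<in> cauchy_seqs X \<and> P = cauchy_class X (fst q) \<and>
      (\<forall>m\<ge>snd q. \<forall>n\<ge>snd q. N (fst q m - fst q n) < e / 4)" if P: "P \<in> \<Omega>" for P
  proof -
    have "P \<in> cauchy_class X ` cauchy_seqs X"
      using \<Omega> P unfolding star_completion_simps(1) completion_carrier by blast
    then obtain u where u: "u \<in> cauchy_seqs X" "P = cauchy_class X u" by blast
    then obtain M where "\<forall>m\<ge>M. \<forall>n\<ge>M. N (u m - u n) < e / 4"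
      using e4 unfolding cauchy_seqs_iff by blast
    then show ?thesis using u by (intro exI[of _ "(u, M)"]) simp
  qed
  then have "\<forall>P\<in>\<Omega>. \<exists>q. fst q \<in> cauchy_seqs X \<and> P = cauchy_class X (fst q) \<and>
      (\<forall>m\<ge>snd q. \<forall>n\<ge>snd q. N (fst q m - fst q n) < e / 4)" by (rule ballI)
  from bchoice[OF this] obtain q where q: "\<forall>P\<in>\<Omega>. fst (q P) \<in> cauchy_seqs X \<and> P = cauchy_class X (fst (q P)) \<and>
      (\<forall>m\<ge>snd (q P). \<forall>n\<ge>snd (q P). N (fst (q P) m - fst (q P) n) < e / 4)" by (rule exE)
  define u where "u P = fst (q P)" for P
  define M where "M P = snd (q P)" for P
  have u: "u P \<in> cauchy_seqs X" "P = cauchy_class X (u P)" if "P \<in> \<Omega>" for P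
    using bspec[OF q that] unfolding u_def by blast+
  have M: "N (u P m - u P n) < e / 4" if "P \<in> \<Omega>" "m \<ge> M P" "n \<ge> M P" for P m n
    using bspec[OF q that(1)] that(2,3) unfolding u_def M_def by blast
  define x where "x P = u P (M P)" for P
  have xC: "x P \<in> C" if "P \<in> \<Omega>" for P unfolding x_def by (rule cauchy_in[OF u(1)[OF that]])
  have "finite (x ` \<Omega>)" "x ` \<Omega> \<subseteq> C" using \<Omega> xC by auto
  from approx[OF e4 this] obtain d \<Psi> K where d: "d > 0" and hom: "star_hom_mat X d \<Psi>"
    and K: "\<And>x. x \<in> C \<Longrightarrow> mat_norm (\<Psi> x) \<le> K * N x"
    and ge: "\<And>P. P \<in> \<Omega> \<Longrightarrow> mat_norm (\<Psi> (x P)) \<ge> N (x P) - e / 4" by blast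
  from hom K obtain \<Phi> where \<Phi>: "star_hom_mat (star_completion X) d \<Phi>"
    and lim0: "\<forall>u\<in>cauchy_seqs X. \<forall>i<d. \<forall>j<d.
      (\<lambda>n. \<Psi> (u n) $$ (i, j)) \<longlonglongrightarrow> \<Phi> (cauchy_class X u) $$ (i, j)"
    by (rule star_hom_extension)
  have lim: "(\<lambda>n. \<Psi> (u n) $$ (i, j)) \<longlonglongrightarrow> \<Phi> (cauchy_class X u) $$ (i, j)"
    if "u \<in> cauchy_seqs X" "i < d" "j < d" for u i j
    using lim0 that by simp
  have \<Psi>: "\<Psi> y \<in> carrier_mat d d" if "y \<in> C" for y using hom that by (simp add: star_hom_mat_def)
  have \<Psi>_add: "\<Psi> (y + z) = \<Psi> y + \<Psi> z" if "y \<in> C" "z \<in> C" for y z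
    using hom that by (simp add: star_hom_mat_def nv_add)
  have \<Psi>_embed: "\<Phi> (embed y) = \<Psi> y" if y: "y \<in> C" for y
  proof (rule eq_matI)
    show "\<Phi> (embed y) $$ (i, j) = \<Psi> y $$ (i, j)" if "i < dim_row (\<Psi> y)" "j < dim_col (\<Psi> y)" for i j
      using lim[OF cauchy_const[OF y], of i j] \<Psi>[OF y] that by (simp add: LIMSEQ_const_iff)
  qed (use hom_embed_carrier[OF \<Phi> y] \<Psi>[OF y] in auto)
  \<comment> \<open>The given bound \<open>K\<close> could be large and would spoil the third error;
    extending \<open>\<Psi>\<close> to the completion improves it to 1.\<close>
  have contr: "mat_norm (\<Psi> y) \<le> N y" if "y \<in> C" for y
    using hom_embed_contractive[OF \<Phi> d that] by (simp add: \<Psi>_embed that)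
  have "mat_norm (\<Phi> P) \<ge> nv_norm (star_completion X) P - e" if P: "P \<in> \<Omega>" for P
  proof -
    note uP = u(1)[OF P]
    have \<Phi>P: "\<Phi> P \<in> carrier_mat d d" using \<Phi> \<Omega> P by (auto simp: star_hom_mat_def)
    have uC: "u P n \<in> C" for n by (rule cauchy_in[OF uP])
    have "(\<lambda>n. \<Sum>i<d. \<Sum>j<d. cmod (\<Psi> (u P n) $$ (i, j) - \<Phi> P $$ (i, j))) \<longlonglongrightarrow> (\<Sum>i<d. \<Sum>j<d. 0)"
      by (intro tendsto_sum tendsto_norm_zero LIM_zero)
         (use lim[OF uP] u(2)[OF P] in simp_all)
    then have "(\<lambda>n. \<Sum>i<d. \<Sum>j<d. cmod (\<Psi> (u P n) $$ (i, j) - \<Phi> P $$ (i, j))) \<longlonglongrightarrow> 0" by simp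
    then have "\<forall>\<^sub>F n in sequentially. (\<Sum>i<d. \<Sum>j<d. cmod (\<Psi> (u P n) $$ (i, j) - \<Phi> P $$ (i, j))) < e / 4"
      using e4 by (rule order_tendstoD(2))
    then have "\<forall>\<^sub>F n in sequentially. (\<Sum>i<d. \<Sum>j<d. cmod (\<Psi> (u P n) $$ (i, j) - \<Phi> P $$ (i, j))) < e / 4 \<and> n \<ge> M P"
      using eventually_ge_at_top[of "M P"] by (rule eventually_conj)
    then obtain n where n: "(\<Sum>i<d. \<Sum>j<d. cmod (\<Psi> (u P n) $$ (i, j) - \<Phi> P $$ (i, j))) < e / 4" "n \<ge> M P"
      using eventually_happens'[OF sequentially_bot] by blast
    have le1: "mat_norm (\<Psi> (u P n)) \<le> mat_norm (\<Phi> P) + e / 4"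
    proof -
      let ?E = "\<Psi> (u P n) - \<Phi> P"
      have E: "?E \<in> carrier_mat d d" by (rule minus_carrier_mat[OF \<Phi>P])
      have "\<Psi> (u P n) = \<Phi> P + ?E"
        using \<Phi>P \<Psi>[OF uC[of n]] by (intro eq_matI) auto
      then have "mat_norm (\<Psi> (u P n)) \<le> mat_norm (\<Phi> P) + mat_norm ?E"
        using mat_norm_triangle[OF \<Phi>P E] by simp
      also have "mat_norm ?E \<le> (\<Sum>i<d. \<Sum>j<d. cmod (?E $$ (i, j)))" by (rule mat_norm_le_sum[OF E])
      also have "\<dots> = (\<Sum>i<d. \<Sum>j<d. cmod (\<Psi> (u P n) $$ (i, j) - \<Phi> P $$ (i, j)))"
        using \<Phi>P \<Psi>[OF uC[of n]] by (intro sum.cong refl) auto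
      finally show ?thesis using n(1) by simp
    qed
    have le2: "mat_norm (\<Psi> (x P)) \<le> mat_norm (\<Psi> (u P n)) + e / 4"
    proof -
      have "\<Psi> (x P) = \<Psi> (x P - u P n) + \<Psi> (u P n)"
        using \<Psi>_add[OF diff_in[OF xC[OF P] uC[of n]] uC[of n]] by simp
      then have "mat_norm (\<Psi> (x P)) \<le> mat_norm (\<Psi> (x P - u P n)) + mat_norm (\<Psi> (u P n))"
        using mat_norm_triangle[OF \<Psi> \<Psi>, OF diff_in[OF xC[OF P] uC[of n]] uC[of n]] by simp
      also have "mat_norm (\<Psi> (x P - u P n)) \<le> N (x P - u P n)" by (intro contr diff_in xC P uC)
      also have "\<dots> \<le> e / 4" using M[OF P order.refl n(2)] by (simp add: x_def)
      finally show ?thesis by simp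
    qed
    have "(\<lambda>n. N (u P n)) \<longlonglongrightarrow> nv_norm (star_completion X) P"
      using completion_norm[OF uP] u(2)[OF P] by (simp add: star_completion_simps(4))
    moreover have "N (u P n) \<le> N (x P) + e / 4" if "n \<ge> M P" for n
      using norm_diff_ineq[OF uC xC[OF P], of n] M[OF P that order.refl] by (simp add: x_def)
    ultimately have "nv_norm (star_completion X) P \<le> N (x P) + e / 4"
      by (intro LIMSEQ_le_const2) auto
    then show ?thesis using ge[OF P] le1 le2 by simp
  qed
  then show "\<exists>d>0. \<exists>\<phi>. star_hom_mat (star_completion X) d \<phi> \<and>
      (\<forall>P\<in>\<Omega>. nv_norm (star_completion X) P - e \<le> mat_norm (\<phi> P))"
    using d \<Phi> by blast
qed

end

section \<open>The algebra of finitely supported sections\<close>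

text \<open>The algebraic laws of a Fell bundle, from which the convolution algebra of sections is
  built. Norm estimates enter later, for action bundles.\<close>

locale fell =
  fixes B :: "('g::group_add, 'b::complex_normed_space) fell_bundle"
  assumes fibre_zero: "0 \<in> fibre B t"
    and fibre_add: "a \<in> fibre B t \<Longrightarrow> b \<in> fibre B t \<Longrightarrow> a + b \<in> fibre B t"
    and fibre_scale: "a \<in> fibre B t \<Longrightarrow> c *C a \<in> fibre B t"
    and bmult_in: "a \<in> fibre B s \<Longrightarrow> b \<in> fibre B t \<Longrightarrow> fb_mult B s t a b \<in> fibre B (s + t)"
    and bmult_add_left: "a \<in> fibre B s \<Longrightarrow> a' \<in> fibre B s \<Longrightarrow> b \<in> fibre B t \<Longrightarrow>
      fb_mult B s t (a + a') b = fb_mult B s t a b + fb_mult B s t a' b"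
    and bmult_add_right: "a \<in> fibre B s \<Longrightarrow> b \<in> fibre B t \<Longrightarrow> b' \<in> fibre B t \<Longrightarrow>
      fb_mult B s t a (b + b') = fb_mult B s t a b + fb_mult B s t a b'"
    and bmult_scale_left: "a \<in> fibre B s \<Longrightarrow> b \<in> fibre B t \<Longrightarrow>
      fb_mult B s t (c *C a) b = c *C fb_mult B s t a b"
    and bmult_scale_right: "a \<in> fibre B s \<Longrightarrow> b \<in> fibre B t \<Longrightarrow>
      fb_mult B s t a (c *C b) = c *C fb_mult B s t a b"
    and bmult_assoc: "a \<in> fibre B s \<Longrightarrow> b \<in> fibre B t \<Longrightarrow> b' \<in> fibre B r \<Longrightarrow>
      fb_mult B (s + t) r (fb_mult B s t a b) b' = fb_mult B s (t + r) a (fb_mult B t r b b')"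
    and bstar_in: "a \<in> fibre B s \<Longrightarrow> fb_star B s a \<in> fibre B (- s)"
    and bstar_add: "a \<in> fibre B s \<Longrightarrow> b \<in> fibre B s \<Longrightarrow> fb_star B s (a + b) = fb_star B s a + fb_star B s b"
    and bstar_scale: "a \<in> fibre B s \<Longrightarrow> fb_star B s (c *C a) = cnj c *C fb_star B s a"
    and bstar_star: "a \<in> fibre B s \<Longrightarrow> fb_star B (- s) (fb_star B s a) = a"
    and bstar_mult: "a \<in> fibre B s \<Longrightarrow> b \<in> fibre B t \<Longrightarrow>
      fb_star B (s + t) (fb_mult B s t a b) = fb_mult B (- t) (- s) (fb_star B t b) (fb_star B s a)"
begin

abbreviation "S \<equiv> finite_sections B"
abbreviation conv (infixl "\<star>" 70) where "x \<star> y \<equiv> sa_mult (section_algebra B) x y"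
abbreviation "inv_section \<equiv> sa_star (section_algebra B)"

definition scale_section :: "complex \<Rightarrow> ('g \<Rightarrow> 'b) \<Rightarrow> 'g \<Rightarrow> 'b" where
  "scale_section c x = (\<lambda>t. c *C x t)"

definition delta :: "'g \<Rightarrow> 'b \<Rightarrow> 'g \<Rightarrow> 'b" where
  "delta s b = (\<lambda>t. if t = s then b else 0)"

lemma section_algebra_simps:
  "nv_carrier (section_algebra B) = S"
  "nv_add (section_algebra B) = (+)"
  "nv_scale (section_algebra B) = scale_section"
  "nv_norm (section_algebra B) = reduced_norm B"
  by (simp_all add: section_algebra_def scale_section_def fun_eq_iff)

lemma conv_def: "(x \<star> y) s = (\<Sum>t\<in>supp x. fb_mult B t (- t + s) (x t) (y (- t + s)))"
  by (simp add: section_algebra_def)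

lemma inv_section_apply: "inv_section x s = fb_star B (- s) (x (- s))"
  by (simp add: section_algebra_def)

lemma fibre_sum: "(\<And>i. i \<in> I \<Longrightarrow> f i \<in> fibre B t) \<Longrightarrow> (\<Sum>i\<in>I. f i) \<in> fibre B t"
  by (induction I rule: infinite_finite_induct) (auto intro: fibre_zero fibre_add)

lemma bmult_zero_left [simp]: "b \<in> fibre B t \<Longrightarrow> fb_mult B s t 0 b = 0"
  using bmult_scale_left[OF fibre_zero, of b t s 0] by simp

lemma bmult_zero_right [simp]: "a \<in> fibre B s \<Longrightarrow> fb_mult B s t a 0 = 0"
  using bmult_scale_right[OF _ fibre_zero, of a s t 0] by simp

lemma bstar_zero [simp]: "fb_star B s 0 = 0"
  using bstar_scale[OF fibre_zero, of s 0] by simp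

lemma bmult_sum_left:
  "(\<And>i. i \<in> I \<Longrightarrow> f i \<in> fibre B s) \<Longrightarrow> b \<in> fibre B t \<Longrightarrow>
    fb_mult B s t (\<Sum>i\<in>I. f i) b = (\<Sum>i\<in>I. fb_mult B s t (f i) b)"
  by (induction I rule: infinite_finite_induct) (auto simp: bmult_add_left fibre_sum)

lemma bmult_sum_right:
  "a \<in> fibre B s \<Longrightarrow> (\<And>i. i \<in> I \<Longrightarrow> f i \<in> fibre B t) \<Longrightarrow>
    fb_mult B s t a (\<Sum>i\<in>I. f i) = (\<Sum>i\<in>I. fb_mult B s t a (f i))"
  by (induction I rule: infinite_finite_induct) (auto simp: bmult_add_right fibre_sum)

lemma bstar_sum:
  "(\<And>i. i \<in> I \<Longrightarrow> f i \<in> fibre B s) \<Longrightarrow> fb_star B s (\<Sum>i\<in>I. f i) = (\<Sum>i\<in>I. fb_star B s (f i))"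
  by (induction I rule: infinite_finite_induct) (auto simp: bstar_add fibre_sum)

lemma section_in: "x \<in> S \<Longrightarrow> x t \<in> fibre B t"
  by (simp add: finite_sections_def)

lemma section_supp: "x \<in> S \<Longrightarrow> finite (supp x)"
  by (simp add: finite_sections_def)

lemma not_supp: "t \<notin> supp x \<Longrightarrow> x t = 0"
  by (simp add: supp_def)

lemma sectionI: "finite F \<Longrightarrow> (\<And>t. t \<notin> F \<Longrightarrow> x t = 0) \<Longrightarrow> (\<And>t. x t \<in> fibre B t) \<Longrightarrow> x \<in> S"
  unfolding finite_sections_def supp_def by (auto intro: finite_subset)

lemma zero_section: "0 \<in> S"
  by (rule sectionI[of "{}"]) (auto simp: fibre_zero)

lemma add_section: "x \<in> S \<Longrightarrow> y \<in> S \<Longrightarrow> x + y \<in> S"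
  by (rule sectionI[of "supp x \<union> supp y"]) (auto simp: section_supp not_supp[where x = x] not_supp[where x = y] fibre_add section_in)

lemma scale_section_in: "x \<in> S \<Longrightarrow> scale_section c x \<in> S"
  by (rule sectionI[of "supp x"]) (auto simp: section_supp not_supp[where x = x] scale_section_def fibre_scale section_in)

lemma scale_section_minus_one: "scale_section (-1) x = - x"
  by (simp add: scale_section_def fun_eq_iff)

lemma minus_section: "x \<in> S \<Longrightarrow> - x \<in> S"
  using scale_section_in[of x "-1"] by (simp add: scale_section_minus_one)

lemma diff_section: "x \<in> S \<Longrightarrow> y \<in> S \<Longrightarrow> x - y \<in> S"
  using add_section[of x "- y"] by (simp add: minus_section)

lemma delta_in: "b \<in> fibre B s \<Longrightarrow> delta s b \<in> S"
  by (rule sectionI[of "{s}"]) (auto simp: delta_def fibre_zero)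

text \<open>Lets several convolutions be summed over one common finite set, since the supports of
  sums, multiples and shifts vary.\<close>

lemma conv_eq:
  assumes "finite F" "\<And>t. t \<notin> F \<Longrightarrow> x t = 0" "y \<in> S"
  shows "(x \<star> y) s = (\<Sum>t\<in>F. fb_mult B t (- t + s) (x t) (y (- t + s)))"
  unfolding conv_def using assms
  by (intro sum.mono_neutral_left) (auto simp: supp_def section_in)

lemma conv_term_in: "x \<in> S \<Longrightarrow> y \<in> S \<Longrightarrow> fb_mult B t (- t + s) (x t) (y (- t + s)) \<in> fibre B s"
  using bmult_in[OF section_in section_in, of x y t "- t + s"] by simp

lemma conv_in:
  assumes x: "x \<in> S" and y: "y \<in> S"
  shows "x \<star> y \<in> S"
proof (rule sectionI)
  show "finite ((\<lambda>(s, t). s + t) ` (supp x \<times> supp y))" using assms section_supp by auto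
  show "(x \<star> y) r = 0" if r: "r \<notin> (\<lambda>(s, t). s + t) ` (supp x \<times> supp y)" for r
    unfolding conv_def
  proof (rule sum.neutral, rule ballI)
    fix t assume t: "t \<in> supp x"
    have "- t + r \<notin> supp y"
    proof
      assume "- t + r \<in> supp y"
      then have "(\<lambda>(s, t). s + t) (t, - t + r) \<in> (\<lambda>(s, t). s + t) ` (supp x \<times> supp y)"
        using t by (intro imageI) simp
      then show False using r by simp
    qed
    then show "fb_mult B t (- t + r) (x t) (y (- t + r)) = 0"
      using x by (simp add: not_supp[where x = y] section_in)
  qed
  show "(x \<star> y) r \<in> fibre B r" for r
    unfolding conv_def by (intro fibre_sum conv_term_in assms)
qed

lemma conv_add_left:
  assumes "x \<in> S" "x' \<in> S" "y \<in> S"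
  shows "(x + x') \<star> y = x \<star> y + x' \<star> y"
proof
  fix s
  let ?F = "supp x \<union> supp x'"
  have F: "finite ?F" using assms section_supp by auto
  show "((x + x') \<star> y) s = (x \<star> y + x' \<star> y) s"
    unfolding plus_fun_apply
    by (subst (1 2 3) conv_eq[OF F])
       (use assms in \<open>auto simp: not_supp[where x = x] not_supp[where x = x'] bmult_add_left section_in sum.distrib\<close>)
qed

lemma conv_add_right:
  assumes "x \<in> S" "y \<in> S" "y' \<in> S"
  shows "x \<star> (y + y') = x \<star> y + x \<star> y'"
  using assms by (simp add: fun_eq_iff conv_def bmult_add_right section_in sum.distrib)

lemma conv_scale_left:
  assumes "x \<in> S" "y \<in> S"
  shows "scale_section c x \<star> y = scale_section c (x \<star> y)"
proof
  fix s
  have F: "finite (supp x)" using assms section_supp by auto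
  show "(scale_section c x \<star> y) s = scale_section c (x \<star> y) s"
    unfolding scale_section_def
    by (subst (1 2) conv_eq[OF F])
       (use assms in \<open>auto simp: not_supp[where x = x] bmult_scale_left section_in scaleC_sum_right\<close>)
qed

lemma conv_scale_right:
  assumes "x \<in> S" "y \<in> S"
  shows "x \<star> scale_section c y = scale_section c (x \<star> y)"
  using assms by (simp add: fun_eq_iff scale_section_def conv_def bmult_scale_right section_in scaleC_sum_right)

lemma conv_diff_left: "x \<in> S \<Longrightarrow> x' \<in> S \<Longrightarrow> y \<in> S \<Longrightarrow> (x - x') \<star> y = x \<star> y - x' \<star> y"
  using conv_add_left[of "x - x'" x' y] by (simp add: diff_section)

lemma conv_diff_right: "x \<in> S \<Longrightarrow> y \<in> S \<Longrightarrow> y' \<in> S \<Longrightarrow> x \<star> (y - y') = x \<star> y - x \<star> y'"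
  using conv_add_right[of x "y - y'" y'] by (simp add: diff_section)

lemma conv_assoc:
  assumes x: "x \<in> S" and y: "y \<in> S" and z: "z \<in> S"
  shows "(x \<star> y) \<star> z = x \<star> (y \<star> z)"
proof
  fix r
  define U where "U = (\<lambda>(s, t). s + t) ` (supp x \<times> supp y)"
  have U: "finite U" unfolding U_def using assms section_supp by auto
  have XY: "(x \<star> y) u = 0" if "u \<notin> U" for u
    unfolding conv_def
  proof (rule sum.neutral, rule ballI)
    fix t assume t: "t \<in> supp x"
    have "- t + u \<notin> supp y"
    proof
      assume "- t + u \<in> supp y"
      then have "(\<lambda>(s, t). s + t) (t, - t + u) \<in> U" unfolding U_def using t by (intro imageI) simp
      then show False using that by simp
    qed
    then show "fb_mult B t (- t + u) (x t) (y (- t + u)) = 0" using x by (simp add: not_supp[where x = y] section_in)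
  qed
  have "((x \<star> y) \<star> z) r = (\<Sum>u\<in>U. fb_mult B u (- u + r) ((x \<star> y) u) (z (- u + r)))"
    by (rule conv_eq[OF U XY z])
  also have "\<dots> = (\<Sum>u\<in>U. \<Sum>s\<in>supp x. fb_mult B s (- s + r) (x s)
      (fb_mult B (- s + u) (- u + r) (y (- s + u)) (z (- u + r))))"
  proof (rule sum.cong[OF refl])
    fix u
    have "fb_mult B u (- u + r) ((x \<star> y) u) (z (- u + r))
        = (\<Sum>s\<in>supp x. fb_mult B u (- u + r) (fb_mult B s (- s + u) (x s) (y (- s + u))) (z (- u + r)))"
      unfolding conv_def by (rule bmult_sum_left) (use assms in \<open>simp_all add: conv_term_in section_in\<close>)
    also have "\<dots> = (\<Sum>s\<in>supp x. fb_mult B s (- s + r) (x s)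
      (fb_mult B (- s + u) (- u + r) (y (- s + u)) (z (- u + r))))"
    proof (rule sum.cong[OF refl])
      fix s
      have "- s + u + (- u + r) = - s + r" by (simp add: add.assoc)
      then show "fb_mult B u (- u + r) (fb_mult B s (- s + u) (x s) (y (- s + u))) (z (- u + r))
        = fb_mult B s (- s + r) (x s) (fb_mult B (- s + u) (- u + r) (y (- s + u)) (z (- u + r)))"
        using bmult_assoc[of "x s" s "y (- s + u)" "- s + u" "z (- u + r)" "- u + r"] assms
        by (simp add: section_in)
    qed
    finally show "fb_mult B u (- u + r) ((x \<star> y) u) (z (- u + r)) = \<dots>" .
  qed
  also have "\<dots> = (\<Sum>s\<in>supp x. \<Sum>u\<in>U. fb_mult B s (- s + r) (x s)
      (fb_mult B (- s + u) (- u + r) (y (- s + u)) (z (- u + r))))"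
    by (rule sum.swap)
  also have "\<dots> = (\<Sum>s\<in>supp x. fb_mult B s (- s + r) (x s) ((y \<star> z) (- s + r)))"
  proof (rule sum.cong[OF refl])
    fix s assume s: "s \<in> supp x"
    \<comment> \<open>For fixed \<open>s\<close> the substitution \<open>u = s + t\<close> turns the
      inner sum over \<open>U\<close> into the convolution of \<open>y\<close> and \<open>z\<close>
      at \<open>- s + r\<close>.\<close>
    define g where "g t = fb_mult B t (- t + (- s + r)) (y t) (z (- t + (- s + r)))" for t
    have gin: "g t \<in> fibre B (- s + r)" for t unfolding g_def by (rule conv_term_in[OF y z])
    have g0: "g t = 0" if "t \<notin> supp y" for t
      using that z by (simp add: g_def not_supp[where x = y] section_in)
    have g: "fb_mult B (- s + u) (- u + r) (y (- s + u)) (z (- u + r)) = g (- s + u)" for u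
      unfolding g_def by (simp add: minus_add add.assoc)
    have "(\<Sum>u\<in>U. g (- s + u)) = (\<Sum>t\<in>(\<lambda>u. - s + u) ` U. g t)"
      by (rule sum.reindex_cong[symmetric, where l = "\<lambda>u. - s + u"]) (auto simp: inj_on_def)
    also have "\<dots> = (\<Sum>t\<in>supp y. g t)"
    proof (rule sum.mono_neutral_right)
      show "supp y \<subseteq> (\<lambda>u. - s + u) ` U"
      proof
        fix t assume "t \<in> supp y"
        then have "(\<lambda>(s, t). s + t) (s, t) \<in> U" unfolding U_def using s by (intro imageI) simp
        then have "- s + (s + t) \<in> (\<lambda>u. - s + u) ` U" by (intro imageI) simp
        then show "t \<in> (\<lambda>u. - s + u) ` U" by simp
      qed
    qed (use U g0 in auto)
    also have "\<dots> = (y \<star> z) (- s + r)" unfolding conv_def g_def ..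
    finally have sum: "(\<Sum>u\<in>U. g (- s + u)) = (y \<star> z) (- s + r)" .
    show "(\<Sum>u\<in>U. fb_mult B s (- s + r) (x s) (fb_mult B (- s + u) (- u + r) (y (- s + u)) (z (- u + r))))
        = fb_mult B s (- s + r) (x s) ((y \<star> z) (- s + r))"
      unfolding g sum[symmetric] by (rule bmult_sum_right[symmetric]) (use x gin in \<open>simp_all add: section_in\<close>)
  qed
  also have "\<dots> = (x \<star> (y \<star> z)) r" by (simp add: conv_def)
  finally show "((x \<star> y) \<star> z) r = (x \<star> (y \<star> z)) r" .
qed

lemma inv_section_in:
  assumes "x \<in> S"
  shows "inv_section x \<in> S"
proof (rule sectionI)
  show "finite (uminus ` supp x)" using assms section_supp by auto
  show "inv_section x t = 0" if "t \<notin> uminus ` supp x" for t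
  proof -
    have "- t \<notin> supp x" using that by (metis imageI minus_minus)
    then show ?thesis by (simp add: inv_section_apply not_supp[where x = x])
  qed
  show "inv_section x t \<in> fibre B t" for t
    unfolding inv_section_apply using bstar_in[OF section_in[OF assms], of "- t"] by simp
qed

lemma inv_section_add:
  "x \<in> S \<Longrightarrow> y \<in> S \<Longrightarrow> inv_section (x + y) = inv_section x + inv_section y"
  by (simp add: fun_eq_iff inv_section_apply bstar_add section_in)

lemma inv_section_diff:
  "x \<in> S \<Longrightarrow> y \<in> S \<Longrightarrow> inv_section (x - y) = inv_section x - inv_section y"
  using inv_section_add[of "x - y" y] by (simp add: diff_section)

lemma inv_section_scale:
  "x \<in> S \<Longrightarrow> inv_section (scale_section c x) = scale_section (cnj c) (inv_section x)"
  by (simp add: fun_eq_iff inv_section_apply bstar_scale scale_section_def section_in)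

lemma inv_section_inv: "x \<in> S \<Longrightarrow> inv_section (inv_section x) = x"
  using bstar_star[OF section_in, of x] by (auto simp: fun_eq_iff inv_section_apply)

lemma inv_section_conv:
  assumes x: "x \<in> S" and y: "y \<in> S"
  shows "inv_section (x \<star> y) = inv_section y \<star> inv_section x"
proof
  fix s
  \<comment> \<open>The term of the convolution of the adjoints at \<open>r\<close>. With
    \<open>r = s + t\<close> it is the adjoint of the term of \<open>x \<star> y\<close> at
    \<open>t\<close>, and it vanishes unless \<open>t\<close> is in the support of
    \<open>x\<close>.\<close>
  define h where "h r = fb_mult B r (- r + s) (inv_section y r) (inv_section x (- r + s))" for r
  have h0: "h r = 0" if "r \<notin> (\<lambda>t. s + t) ` supp x" for r
  proof -
    have "- s + r \<notin> supp x"
    proof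
      assume "- s + r \<in> supp x"
      then have "s + (- s + r) \<in> (\<lambda>t. s + t) ` supp x" by (rule imageI)
      then show False using that by simp
    qed
    then have "inv_section x (- r + s) = 0" by (simp add: inv_section_apply minus_add not_supp[where x = x])
    then show ?thesis by (simp add: h_def section_in inv_section_in y)
  qed
  have "inv_section (x \<star> y) s = (\<Sum>t\<in>supp x. fb_star B (- s) (fb_mult B t (- t + - s) (x t) (y (- t + - s))))"
    unfolding inv_section_apply conv_def by (rule bstar_sum) (rule conv_term_in[OF x y])
  also have "\<dots> = (\<Sum>t\<in>supp x. h (s + t))"
  proof (rule sum.cong[OF refl])
    fix t
    have eq: "fb_star B (t + (- t + - s)) (fb_mult B t (- t + - s) (x t) (y (- t + - s)))
        = fb_mult B (- (- t + - s)) (- t) (fb_star B (- t + - s) (y (- t + - s))) (fb_star B t (x t))"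
      by (rule bstar_mult) (simp_all add: section_in x y)
    show "fb_star B (- s) (fb_mult B t (- t + - s) (x t) (y (- t + - s))) = h (s + t)"
      using eq[unfolded add_minus_cancel] by (simp add: h_def inv_section_apply minus_add add.assoc)
  qed
  also have "\<dots> = (\<Sum>r\<in>(\<lambda>t. s + t) ` supp x. h r)"
    by (rule sum.reindex_cong[symmetric, where l = "\<lambda>t. s + t"]) (auto simp: inj_on_def)
  also have "\<dots> = (\<Sum>r\<in>(\<lambda>t. s + t) ` supp x \<union> supp (inv_section y). h r)"
    using h0 section_supp[OF x] section_supp[OF inv_section_in[OF y]] by (intro sum.mono_neutral_left) auto
  also have "\<dots> = (inv_section y \<star> inv_section x) s"
    unfolding h_def
    by (rule conv_eq[symmetric])
       (use section_supp[OF x] section_supp[OF inv_section_in[OF y]] inv_section_in[OF x] in \<open>auto simp: not_supp[where x = "inv_section y"]\<close>)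
  finally show "inv_section (x \<star> y) s = (inv_section y \<star> inv_section x) s" .
qed

text \<open>The inner product is the value at 0 of a convolution, so sesquilinearity and
  adjointability of left multiplication follow from the laws of the algebra of sections.\<close>

lemma section_inner_eq:
  assumes x: "x \<in> S" and y: "y \<in> S"
  shows "section_inner B x y = (inv_section x \<star> y) 0"
proof -
  have "(inv_section x \<star> y) 0 = (\<Sum>t\<in>uminus ` supp x. fb_mult B t (- t + 0) (inv_section x t) (y (- t + 0)))"
  proof (rule conv_eq)
    show "inv_section x t = 0" if "t \<notin> uminus ` supp x" for t
    proof -
      have "- t \<notin> supp x" using that by (metis imageI minus_minus)
      then show ?thesis by (simp add: inv_section_apply not_supp[where x = x])
    qed
  qed (use section_supp[OF x] y in auto)
  also have "\<dots> = section_inner B x y"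
    unfolding section_inner_def
    by (rule sum.reindex_cong[where l = uminus]) (auto simp: inj_on_def inv_section_apply)
  finally show ?thesis ..
qed

lemma section_inner_conv:
  assumes "x \<in> S" "y \<in> S" "z \<in> S"
  shows "section_inner B (x \<star> y) z = section_inner B y (inv_section x \<star> z)"
  using assms by (simp add: section_inner_eq conv_in inv_section_in inv_section_conv conv_assoc)

lemma reduced_norm_eq:
  "reduced_norm B x = operator_norm (completion (pre_l2 B)) (extend_op (pre_l2 B) (\<lambda>\<xi>. x \<star> \<xi>))"
proof -
  have "(\<lambda>\<xi> r. \<Sum>t\<in>supp x. lambda_op B t (x t) \<xi> r) = (\<lambda>\<xi>. x \<star> \<xi>)"
    by (simp add: fun_eq_iff conv_def lambda_op_def)
  then show ?thesis by (simp add: reduced_norm_def l2_bundle_def)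
qed

lemma conv_delta:
  assumes a: "a \<in> fibre B s" and b: "b \<in> fibre B t"
  shows "delta s a \<star> delta t b = delta (s + t) (fb_mult B s t a b)"
proof
  fix r
  have "(delta s a \<star> delta t b) r = (\<Sum>u\<in>{s}. fb_mult B u (- u + r) (delta s a u) (delta t b (- u + r)))"
    by (rule conv_eq) (use b in \<open>auto simp: delta_def intro: delta_in[unfolded delta_def]\<close>)
  also have "\<dots> = delta (s + t) (fb_mult B s t a b) r"
  proof (cases "r = s + t")
    case True
    then show ?thesis by (simp add: delta_def)
  next
    case False
    then have "- s + r \<noteq> t" by auto
    then show ?thesis using False a by (simp add: delta_def)
  qed
  finally show "(delta s a \<star> delta t b) r = delta (s + t) (fb_mult B s t a b) r" .
qed

lemma inv_section_delta: "inv_section (delta s a) = delta (- s) (fb_star B s a)"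
proof
  fix t
  have "- t = s \<longleftrightarrow> t = - s" by auto
  then show "inv_section (delta s a) t = delta (- s) (fb_star B s a) t"
    by (auto simp: inv_section_apply delta_def)
qed

lemma delta_add: "delta s (a + b) = delta s a + delta s b"
  by (simp add: fun_eq_iff delta_def)

lemma delta_scale: "delta s (c *C a) = scale_section c (delta s a)"
  by (simp add: fun_eq_iff delta_def scale_section_def)

lemma sum_section: "(\<And>i. i \<in> I \<Longrightarrow> y i \<in> S) \<Longrightarrow> (\<Sum>i\<in>I. y i) \<in> S"
  by (induction I rule: infinite_finite_induct) (auto intro: add_section zero_section)

lemma conv_zero_right: "x \<in> S \<Longrightarrow> sa_mult (section_algebra B) x 0 = 0"
  using conv_diff_right[of x 0 0] zero_section by simp

lemma conv_sum_right:
  "x \<in> S \<Longrightarrow> (\<And>i. i \<in> I \<Longrightarrow> y i \<in> S) \<Longrightarrow>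
    x \<star> (\<Sum>i\<in>I. y i) = (\<Sum>i\<in>I. sa_mult (section_algebra B) x (y i))"
proof (induction I rule: infinite_finite_induct)
  case (insert i I)
  have IH: "sa_mult (section_algebra B) x (sum y I) = (\<Sum>i\<in>I. sa_mult (section_algebra B) x (y i))"
    by (rule insert.IH) (simp_all add: insert.prems)
  show ?case unfolding sum.insert[OF insert.hyps] IH[symmetric]
    by (rule conv_add_right) (simp_all add: sum_section insert.prems)
qed (simp_all add: conv_zero_right)

lemma section_inner_add_left:
  "x \<in> S \<Longrightarrow> x' \<in> S \<Longrightarrow> y \<in> S \<Longrightarrow> section_inner B (x + x') y = section_inner B x y + section_inner B x' y"
  by (simp add: section_inner_eq add_section inv_section_in inv_section_add conv_add_left)

lemma section_inner_add_right:
  "x \<in> S \<Longrightarrow> y \<in> S \<Longrightarrow> y' \<in> S \<Longrightarrow> section_inner B x (y + y') = section_inner B x y + section_inner B x y'"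
  by (simp add: section_inner_eq add_section inv_section_in conv_add_right)

lemma section_inner_sum_left:
  assumes y: "y \<in> S"
  shows "(\<And>i. i \<in> I \<Longrightarrow> x i \<in> S) \<Longrightarrow> section_inner B (\<Sum>i\<in>I. x i) y = (\<Sum>i\<in>I. section_inner B (x i) y)"
proof (induction I rule: infinite_finite_induct)
  case (insert i I)
  have IH: "section_inner B (sum x I) y = (\<Sum>i\<in>I. section_inner B (x i) y)"
    by (rule insert.IH) (simp add: insert.prems)
  show ?case unfolding sum.insert[OF insert.hyps] IH[symmetric]
    by (rule section_inner_add_left) (simp_all add: sum_section insert.prems y)
qed (simp_all add: section_inner_def supp_def)

lemma section_inner_sum_right:
  assumes x: "x \<in> S"
  shows "(\<And>i. i \<in> I \<Longrightarrow> y i \<in> S) \<Longrightarrow> section_inner B x (\<Sum>i\<in>I. y i) = (\<Sum>i\<in>I. section_inner B x (y i))"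
proof (induction I rule: infinite_finite_induct)
  case (insert i I)
  have IH: "section_inner B x (sum y I) = (\<Sum>i\<in>I. section_inner B x (y i))"
    by (rule insert.IH) (simp add: insert.prems)
  show ?case unfolding sum.insert[OF insert.hyps] IH[symmetric]
    by (rule section_inner_add_right) (simp_all add: sum_section insert.prems x)
qed (simp_all add: section_inner_eq x zero_section inv_section_in conv_zero_right)

lemma conv_zero_left: "y \<in> S \<Longrightarrow> sa_mult (section_algebra B) 0 y = 0"
  using conv_diff_left[of 0 0 y] zero_section by simp

lemma conv_sum_left:
  assumes y: "y \<in> S"
  shows "(\<And>i. i \<in> I \<Longrightarrow> x i \<in> S) \<Longrightarrow>
    sa_mult (section_algebra B) (\<Sum>i\<in>I. x i) y = (\<Sum>i\<in>I. sa_mult (section_algebra B) (x i) y)"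
proof (induction I rule: infinite_finite_induct)
  case (insert i I)
  have IH: "sa_mult (section_algebra B) (sum x I) y = (\<Sum>i\<in>I. sa_mult (section_algebra B) (x i) y)"
    by (rule insert.IH) (simp add: insert.prems)
  show ?case unfolding sum.insert[OF insert.hyps] IH[symmetric]
    by (rule conv_add_left) (simp_all add: sum_section insert.prems y)
qed (simp_all add: conv_zero_left y)

text \<open>The index is one less than the exponent: \<open>conv_power h n\<close> is the power
  \<open>n + 1\<close> of \<open>h\<close>. The algebra of sections is not given a unit to serve as
  power 0.\<close>

primrec conv_power :: "('g \<Rightarrow> 'b) \<Rightarrow> nat \<Rightarrow> 'g \<Rightarrow> 'b" where
  "conv_power h 0 = h"
| "conv_power h (Suc n) = sa_mult (section_algebra B) h (conv_power h n)"

lemma conv_power_in: "h \<in> S \<Longrightarrow> conv_power h n \<in> S"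
  by (induction n) (simp_all add: conv_in)

end

section \<open>The reduced crossed product\<close>

context partial_system
begin

sublocale fell "action_bundle D \<alpha>"
proof (unfold_locales, unfold action_bundle_simps)
  fix s t r :: 'g and c :: complex and a a' b b' :: 'a
  show "0 \<in> D t" "a \<in> D t \<Longrightarrow> b \<in> D t \<Longrightarrow> a + b \<in> D t" "a \<in> D t \<Longrightarrow> c *C a \<in> D t"
    by (simp_all add: ideal_simps)
  show "a \<in> D s \<Longrightarrow> b \<in> D t \<Longrightarrow> bundle_mult s t a b \<in> D (s + t)" by (rule bundle_mult_in)
  show "bundle_mult s t (a + a') b = bundle_mult s t a b + bundle_mult s t a' b"
    if "a \<in> D s" "a' \<in> D s" "b \<in> D t"
  proof -
    have "\<alpha> s (\<alpha> (- s) a * b + \<alpha> (- s) a' * b) = bundle_mult s t a b + bundle_mult s t a' b"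
      by (rule alpha_add) (simp_all add: that ideal_simps alpha_in')
    then show ?thesis by (simp add: alpha_add' that distrib_right)
  qed
  show "bundle_mult s t a (b + b') = bundle_mult s t a b + bundle_mult s t a b'"
    if "a \<in> D s" "b \<in> D t" "b' \<in> D t"
    unfolding distrib_left by (rule alpha_add) (simp_all add: that ideal_simps alpha_in')
  show "bundle_mult s t (c *C a) b = c *C bundle_mult s t a b" if "a \<in> D s" "b \<in> D t"
    unfolding alpha_scale'[OF that(1)] mult_scaleC_left
    by (rule alpha_scale) (simp add: that ideal_simps alpha_in')
  show "bundle_mult s t a (c *C b) = c *C bundle_mult s t a b" if "a \<in> D s" "b \<in> D t"
    unfolding mult_scaleC_right by (rule alpha_scale) (simp add: that ideal_simps alpha_in')
  show "bundle_mult (s + t) r (bundle_mult s t a b) b' = bundle_mult s (t + r) a (bundle_mult t r b b')"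
    if "a \<in> D s" "b \<in> D t" "b' \<in> D r"
    by (rule bundle_mult_assoc[OF that(1,2)])
  show "\<alpha> (- s) (cstar a) \<in> D (- s)" if "a \<in> D s"
    by (intro alpha_in' ideal_simps that)
  show "\<alpha> (- s) (cstar (a + b)) = \<alpha> (- s) (cstar a) + \<alpha> (- s) (cstar b)" if "a \<in> D s" "b \<in> D s"
    unfolding cstar_add by (intro alpha_add' ideal_simps that)
  show "\<alpha> (- s) (cstar (c *C a)) = cnj c *C \<alpha> (- s) (cstar a)" if "a \<in> D s"
    unfolding cstar_scaleC by (intro alpha_scale' ideal_simps that)
  show "\<alpha> (- (- s)) (cstar (\<alpha> (- s) (cstar a))) = a" if "a \<in> D s"
    using that by (simp add: alpha_star'[symmetric] cstar_cstar alpha_inv' ideal_simps)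
  show "\<alpha> (- (s + t)) (cstar (bundle_mult s t a b))
      = bundle_mult (- t) (- s) (\<alpha> (- t) (cstar b)) (\<alpha> (- s) (cstar a))" if "a \<in> D s" "b \<in> D t"
    by (rule bundle_mult_star[OF that])
qed

notation conv (infixl "\<star>" 70)

abbreviation inner :: "('g \<Rightarrow> 'a) \<Rightarrow> ('g \<Rightarrow> 'a) \<Rightarrow> 'a" where
  "inner \<equiv> section_inner (action_bundle D \<alpha>)"

abbreviation l2_norm :: "('g \<Rightarrow> 'a) \<Rightarrow> real" where
  "l2_norm \<xi> \<equiv> sqrt (norm (inner \<xi> \<xi>))"

lemma section_in_ideal: "\<xi> \<in> S \<Longrightarrow> \<xi> t \<in> D t"
  using section_in by simp

text \<open>Moving the value at \<open>t\<close> by \<open>\<alpha> (- t)\<close> embeds the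
  sections into the finite families in \<open>A\<close> with their standard inner product, where
  Cauchy-Schwarz and monotonicity of sums of squares are available.\<close>

lemma inner_eq:
  assumes "finite T" "supp \<xi> \<subseteq> T" "\<xi> \<in> S" "\<eta> \<in> S"
  shows "inner \<xi> \<eta> = (\<Sum>t\<in>T. cstar (\<alpha> (- t) (\<xi> t)) * \<alpha> (- t) (\<eta> t))"
proof -
  have "inner \<xi> \<eta> = (\<Sum>t\<in>supp \<xi>. cstar (\<alpha> (- t) (\<xi> t)) * \<alpha> (- t) (\<eta> t))"
    unfolding section_inner_def action_bundle_simps
  proof (rule sum.cong[OF refl])
    fix t
    have \<xi>: "cstar (\<xi> t) \<in> D t" and \<eta>: "\<eta> t \<in> D t"
      using assms by (simp_all add: section_in_ideal ideal_simps)
    have "\<alpha> (- t) (\<alpha> (- (- t)) (\<alpha> (- t) (cstar (\<xi> t))) * \<eta> t) = \<alpha> (- t) (cstar (\<xi> t) * \<eta> t)"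
      using \<xi> by (simp add: alpha_inv')
    also have "\<dots> = \<alpha> (- t) (cstar (\<xi> t)) * \<alpha> (- t) (\<eta> t)" by (rule alpha_mult'[OF \<xi> \<eta>])
    finally show "\<alpha> (- t) (\<alpha> (- (- t)) (\<alpha> (- t) (cstar (\<xi> t))) * \<eta> t) = cstar (\<alpha> (- t) (\<xi> t)) * \<alpha> (- t) (\<eta> t)"
      using assms by (simp add: alpha_star' section_in_ideal)
  qed
  also have "\<dots> = (\<Sum>t\<in>T. cstar (\<alpha> (- t) (\<xi> t)) * \<alpha> (- t) (\<eta> t))"
    using assms by (intro sum.mono_neutral_left) (auto simp: supp_def)
  finally show ?thesis .
qed

lemma inner_cauchy_schwarz:
  assumes \<xi>: "\<xi> \<in> S" and \<eta>: "\<eta> \<in> S"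
  shows "norm (inner \<xi> \<eta>) \<le> l2_norm \<xi> * l2_norm \<eta>"
proof -
  let ?T = "supp \<xi> \<union> supp \<eta>"
  have T: "finite ?T" using assms section_supp by auto
  have sub: "supp \<xi> \<subseteq> ?T" "supp \<eta> \<subseteq> ?T" by auto
  have "(norm (inner \<xi> \<eta>))\<^sup>2 \<le> norm (inner \<xi> \<xi>) * norm (inner \<eta> \<eta>)"
    using norm_sum_star_mult[where S = ?T and a = "\<lambda>t. \<alpha> (- t) (\<xi> t)" and b = "\<lambda>t. \<alpha> (- t) (\<eta> t)"]
    by (simp only: inner_eq[OF T sub(1) \<xi> \<eta>] inner_eq[OF T sub(1) \<xi> \<xi>] inner_eq[OF T sub(2) \<eta> \<eta>])
  then have "(norm (inner \<xi> \<eta>))\<^sup>2 \<le> (l2_norm \<xi> * l2_norm \<eta>)\<^sup>2" by (simp add: power_mult_distrib)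
  then show ?thesis by (rule power2_le_imp_le) simp
qed

lemma l2_norm_sq: "(l2_norm \<xi>)\<^sup>2 = norm (inner \<xi> \<xi>)"
  by simp

lemma l2_norm_triangle:
  assumes \<xi>: "\<xi> \<in> S" and \<eta>: "\<eta> \<in> S"
  shows "l2_norm (\<xi> + \<eta>) \<le> l2_norm \<xi> + l2_norm \<eta>"
proof -
  have "inner (\<xi> + \<eta>) (\<xi> + \<eta>) = (inner \<xi> \<xi> + inner \<xi> \<eta>) + (inner \<eta> \<xi> + inner \<eta> \<eta>)"
    using assms by (simp add: section_inner_eq add_section inv_section_in inv_section_add conv_add_left conv_add_right)
  then have "norm (inner (\<xi> + \<eta>) (\<xi> + \<eta>)) \<le> (norm (inner \<xi> \<xi>) + norm (inner \<xi> \<eta>)) + (norm (inner \<eta> \<xi>) + norm (inner \<eta> \<eta>))"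
    by (simp only:) (intro norm_triangle_le add_mono order.refl)
  also have "\<dots> \<le> ((l2_norm \<xi>)\<^sup>2 + l2_norm \<xi> * l2_norm \<eta>) + (l2_norm \<eta> * l2_norm \<xi> + (l2_norm \<eta>)\<^sup>2)"
    unfolding l2_norm_sq by (intro add_mono order.refl inner_cauchy_schwarz assms)
  also have "\<dots> = (l2_norm \<xi> + l2_norm \<eta>)\<^sup>2" by (simp add: power2_eq_square algebra_simps)
  finally have "(l2_norm (\<xi> + \<eta>))\<^sup>2 \<le> (l2_norm \<xi> + l2_norm \<eta>)\<^sup>2" unfolding l2_norm_sq .
  then show ?thesis by (rule power2_le_imp_le) simp
qed

lemma l2_norm_scale:
  assumes "\<xi> \<in> S"
  shows "l2_norm (scale_section c \<xi>) = cmod c * l2_norm \<xi>"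
proof -
  have "inner (scale_section c \<xi>) (scale_section c \<xi>)
      = scale_section c (scale_section (cnj c) (inv_section \<xi> \<star> \<xi>)) 0"
    using assms by (simp add: section_inner_eq scale_section_in inv_section_in inv_section_scale
        conv_scale_left conv_scale_right conv_in)
  also have "\<dots> = c *C cnj c *C inner \<xi> \<xi>" using assms by (simp add: scale_section_def section_inner_eq)
  finally show ?thesis by (simp add: norm_scaleC real_sqrt_mult mult.assoc[symmetric])
qed

lemma pre_l2_simps:
  "nv_carrier (pre_l2 (action_bundle D \<alpha>)) = S" "nv_add (pre_l2 (action_bundle D \<alpha>)) = (+)"
  "nv_scale (pre_l2 (action_bundle D \<alpha>)) = scale_section"
  "nv_norm (pre_l2 (action_bundle D \<alpha>)) = l2_norm"
  by (simp_all add: pre_l2_def scale_section_def fun_eq_iff)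

sublocale l2: seminormed "pre_l2 (action_bundle D \<alpha>)"
proof (unfold_locales, unfold pre_l2_simps)
  fix \<xi> \<eta> c
  show "(+) = (+)" ..
  show "0 \<in> S" by (rule zero_section)
  show "\<xi> \<in> S \<Longrightarrow> \<eta> \<in> S \<Longrightarrow> \<xi> + \<eta> \<in> S" by (rule add_section)
  show "\<xi> \<in> S \<Longrightarrow> scale_section c \<xi> \<in> S" by (rule scale_section_in)
  show "scale_section (- 1) \<xi> = - \<xi>" by (rule scale_section_minus_one)
  show "scale_section c (\<xi> - \<eta>) = scale_section c \<xi> - scale_section c \<eta>"
    by (simp add: fun_eq_iff scale_section_def scaleC_diff_right)
  show "0 \<le> l2_norm \<xi>" by simp
  show "\<xi> \<in> S \<Longrightarrow> \<eta> \<in> S \<Longrightarrow> l2_norm (\<xi> + \<eta>) \<le> l2_norm \<xi> + l2_norm \<eta>" by (rule l2_norm_triangle)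
  show "\<xi> \<in> S \<Longrightarrow> l2_norm (scale_section c \<xi>) = cmod c * l2_norm \<xi>" by (rule l2_norm_scale)
qed

lemma conv_delta_left:
  assumes "b \<in> D s" "\<xi> \<in> S"
  shows "(delta s b \<star> \<xi>) r = \<alpha> s (\<alpha> (- s) b * \<xi> (- s + r))"
proof -
  have "(delta s b \<star> \<xi>) r = (\<Sum>t\<in>{s}. fb_mult (action_bundle D \<alpha>) t (- t + r) (delta s b t) (\<xi> (- t + r)))"
    by (rule conv_eq) (use assms in \<open>auto simp: delta_def\<close>)
  then show ?thesis by (simp add: delta_def)
qed

text \<open>With \<open>c = \<alpha> (- s) b\<close> and \<open>z\<close> as in
  \<open>quasi_sqrt_ideal\<close>, \<open>\<langle>\<xi>, \<xi>\<rangle>\<close> is the inner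
  product of the image with itself plus the sum of squares of the elements
  \<open>\<alpha> (- t) (\<xi> t - z * \<xi> t)\<close>. A sum of positive elements dominates each
  of them in norm.\<close>

lemma l2_norm_conv_delta_le_1:
  assumes b: "b \<in> D s" "norm b \<le> 1" and \<xi>: "\<xi> \<in> S"
  shows "l2_norm (delta s b \<star> \<xi>) \<le> l2_norm \<xi>"
proof -
  define c where "c = \<alpha> (- s) b"
  have c: "c \<in> D (- s)" "norm c \<le> 1"
    using alpha_norm[of b "- s"] b by (simp_all add: c_def alpha_in')
  from ideal c obtain z where z: "z \<in> D (- s)" "cstar z = z" "z + z - z * z = cstar c * c"
    by (rule quasi_sqrt_ideal)
  let ?\<eta> = "delta s b \<star> \<xi>"
  have \<eta>: "?\<eta> \<in> S" by (intro conv_in delta_in \<xi>) (simp add: b)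
  let ?T = "supp \<xi>"
  have T: "finite ?T" by (rule section_supp[OF \<xi>])
  have \<eta>_apply: "?\<eta> (s + t) = \<alpha> s (c * \<xi> t)" for t
    using conv_delta_left[OF b(1) \<xi>, of "s + t"] by (simp add: c_def)
  have "inner ?\<eta> ?\<eta> = (\<Sum>r\<in>(\<lambda>t. s + t) ` ?T. cstar (\<alpha> (- r) (?\<eta> r)) * \<alpha> (- r) (?\<eta> r))"
  proof (rule inner_eq[OF _ _ \<eta> \<eta>])
    show "finite ((\<lambda>t. s + t) ` ?T)" using T by simp
    show "supp ?\<eta> \<subseteq> (\<lambda>t. s + t) ` ?T"
    proof
      fix r assume "r \<in> supp ?\<eta>"
      then have "- s + r \<in> ?T"
        using conv_delta_left[OF b(1) \<xi>, of r] by (auto simp: supp_def)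
      then have "s + (- s + r) \<in> (\<lambda>t. s + t) ` ?T" by (rule imageI)
      then show "r \<in> (\<lambda>t. s + t) ` ?T" by simp
    qed
  qed
  also have "\<dots> = (\<Sum>t\<in>?T. cstar (\<alpha> (- t) (c * \<xi> t)) * \<alpha> (- t) (c * \<xi> t))"
  proof (rule sum.reindex_cong[where l = "\<lambda>t. s + t"])
    show "inj_on (\<lambda>t. s + t) ?T" by (simp add: inj_on_def)
    fix t
    have "\<alpha> (- (s + t)) (?\<eta> (s + t)) = \<alpha> (- t) (c * \<xi> t)"
      unfolding \<eta>_apply minus_add
      by (rule alpha_cross(2)) (simp_all add: ideal_simps c section_in_ideal[OF \<xi>])
    then show "cstar (\<alpha> (- (s + t)) (?\<eta> (s + t))) * \<alpha> (- (s + t)) (?\<eta> (s + t))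
        = cstar (\<alpha> (- t) (c * \<xi> t)) * \<alpha> (- t) (c * \<xi> t)" by simp
  qed simp
  finally have inner_\<eta>: "inner ?\<eta> ?\<eta> = (\<Sum>t\<in>?T. cstar (\<alpha> (- t) (c * \<xi> t)) * \<alpha> (- t) (c * \<xi> t))" .
  have split: "cstar (\<alpha> (- t) (\<xi> t)) * \<alpha> (- t) (\<xi> t) = cstar (\<alpha> (- t) (c * \<xi> t)) * \<alpha> (- t) (c * \<xi> t)
      + cstar (\<alpha> (- t) (\<xi> t - z * \<xi> t)) * \<alpha> (- t) (\<xi> t - z * \<xi> t)" for t
  proof -
    let ?x = "\<xi> t"
    have x: "?x \<in> D t" by (rule section_in_ideal[OF \<xi>])
    have sq: "cstar (\<alpha> (- t) y) * \<alpha> (- t) y = \<alpha> (- t) (cstar y * y)" if "y \<in> D t" for y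
      using that by (simp add: alpha_star'[symmetric] alpha_mult' ideal_simps)
    have "cstar (?x - z * ?x) * (?x - z * ?x) = cstar ?x * ?x - cstar ?x * (z + z - z * z) * ?x"
      by (simp add: cstar_diff cstar_mult z(2) algebra_simps)
    then have "cstar ?x * ?x = cstar (c * ?x) * (c * ?x) + cstar (?x - z * ?x) * (?x - z * ?x)"
      by (simp add: z(3) cstar_mult mult.assoc)
    then have "\<alpha> (- t) (cstar ?x * ?x)
        = \<alpha> (- t) (cstar (c * ?x) * (c * ?x)) + \<alpha> (- t) (cstar (?x - z * ?x) * (?x - z * ?x))"
      using x by (simp only: alpha_add' ideal_simps)
    then show ?thesis using x by (simp only: sq ideal_simps)
  qed
  have "norm (inner ?\<eta> ?\<eta>) \<le> norm (inner \<xi> \<xi>)"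
    unfolding inner_\<eta> inner_eq[OF T order.refl \<xi> \<xi>] split sum.distrib
    by (rule norm_sum_squares_mono)
  then show ?thesis by simp
qed

lemma l2_norm_conv_delta:
  assumes b: "b \<in> D s" and \<xi>: "\<xi> \<in> S"
  shows "l2_norm (delta s b \<star> \<xi>) \<le> norm b * l2_norm \<xi>"
proof (cases "b = 0")
  case True
  have zero: "delta s b \<star> \<xi> = 0" using conv_delta_left[OF b \<xi>] by (simp add: True fun_eq_iff)
  show ?thesis unfolding zero l2.norm_zero[unfolded pre_l2_simps] by simp
next
  case False
  let ?b = "complex_of_real (1 / norm b) *C b"
  have b1: "?b \<in> D s" "norm ?b \<le> 1" using b False by (simp_all add: ideal_simps norm_scaleC norm_divide)
  have "delta s b = scale_section (complex_of_real (norm b)) (delta s ?b)"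
    using False by (simp add: scaleC_scaleC flip: delta_scale)
  then have "l2_norm (delta s b \<star> \<xi>) = norm b * l2_norm (delta s ?b \<star> \<xi>)"
    using b1 \<xi> l2_norm_scale[of "delta s ?b \<star> \<xi>" "complex_of_real (norm b)"]
    by (simp add: conv_scale_left delta_in conv_in)
  also have "\<dots> \<le> norm b * l2_norm \<xi>"
    by (intro mult_left_mono l2_norm_conv_delta_le_1 b1 \<xi>) simp
  finally show ?thesis .
qed

text \<open>Induction on the support. Boundedness of left multiplication is what makes the supremum
  in the reduced norm meaningful.\<close>

lemma conv_bounded:
  assumes "x \<in> S"
  shows "\<exists>K\<ge>0. \<forall>\<xi>\<in>S. l2_norm (x \<star> \<xi>) \<le> K * l2_norm \<xi>"
proof -
  have "\<exists>K\<ge>0. \<forall>\<xi>\<in>S. l2_norm (x \<star> \<xi>) \<le> K * l2_norm \<xi>"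
    if "finite T" "x \<in> S" "\<And>t. t \<notin> T \<Longrightarrow> x t = 0" for T x
    using that
  proof (induction T arbitrary: x rule: finite_induct)
    case empty
    then have zero: "x \<star> \<xi> = 0" for \<xi> by (simp add: fun_eq_iff conv_def supp_def)
    show ?case
      unfolding zero l2.norm_zero[unfolded pre_l2_simps] by (intro exI[of _ 0]) simp
  next
    case (insert s T)
    define y where "y t = (if t = s then 0 else x t)" for t
    have xs: "x s \<in> D s" by (rule section_in_ideal[OF insert.prems(1)])
    have y: "y \<in> S"
      by (rule sectionI[OF insert.hyps(1)])
         (use insert.prems(2) section_in_ideal[OF insert.prems(1)] in \<open>auto simp: y_def ideal_simps\<close>)
    have y0: "y t = 0" if "t \<notin> T" for t using insert.prems(2)[of t] that by (auto simp: y_def)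
    have "\<exists>K\<ge>0. \<forall>\<xi>\<in>S. l2_norm (y \<star> \<xi>) \<le> K * l2_norm \<xi>"
      by (rule insert.IH[OF y]) (rule y0)
    then obtain K where K: "K \<ge> 0" "\<And>\<xi>. \<xi> \<in> S \<Longrightarrow> l2_norm (y \<star> \<xi>) \<le> K * l2_norm \<xi>"
      by blast
    have x: "x = delta s (x s) + y" by (auto simp: fun_eq_iff delta_def y_def)
    have d: "delta s (x s) \<in> S" by (rule delta_in) (simp add: xs)
    have "l2_norm (x \<star> \<xi>) \<le> (norm (x s) + K) * l2_norm \<xi>" if \<xi>: "\<xi> \<in> S" for \<xi>
    proof -
      have "x \<star> \<xi> = delta s (x s) \<star> \<xi> + y \<star> \<xi>"
        by (subst x) (rule conv_add_left[OF d y \<xi>])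
      then have "l2_norm (x \<star> \<xi>) \<le> l2_norm (delta s (x s) \<star> \<xi>) + l2_norm (y \<star> \<xi>)"
        using l2_norm_triangle[OF conv_in[OF d \<xi>] conv_in[OF y \<xi>]] by simp
      also have "\<dots> \<le> norm (x s) * l2_norm \<xi> + K * l2_norm \<xi>"
        by (intro add_mono l2_norm_conv_delta xs \<xi> K)
      finally show ?thesis by (simp add: distrib_right)
    qed
    then show ?case using K(1) by (intro exI[of _ "norm (x s) + K"]) simp
  qed
  note bound = this
  show ?thesis
    by (rule bound[OF section_supp[OF assms] assms]) (simp add: supp_def)
qed

section \<open>The reduced norm on finitely supported sections\<close>

abbreviation red_norm :: "('g \<Rightarrow> 'a) \<Rightarrow> real" where
  "red_norm \<equiv> reduced_norm (action_bundle D \<alpha>)"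

text \<open>These facts characterize the reduced norm of a finitely supported section as the least
  bound on finitely supported vectors, so that the completed module need not be mentioned.\<close>

lemma
  assumes x: "x \<in> S"
  shows red_norm_bound: "\<xi> \<in> S \<Longrightarrow> l2_norm (x \<star> \<xi>) \<le> red_norm x * l2_norm \<xi>"
    and red_norm_nonneg: "0 \<le> red_norm x"
    and red_norm_least: "0 \<le> K \<Longrightarrow> (\<And>\<xi>. \<xi> \<in> S \<Longrightarrow> l2_norm (x \<star> \<xi>) \<le> K * l2_norm \<xi>) \<Longrightarrow> red_norm x \<le> K"
proof -
  obtain K0 where K0: "\<And>\<xi>. \<xi> \<in> S \<Longrightarrow> l2_norm (x \<star> \<xi>) \<le> K0 * l2_norm \<xi>"
    using conv_bounded[OF x] by blast
  note op = l2.operator_norm_completion[unfolded pre_l2_simps, of "\<lambda>\<xi>. x \<star> \<xi>",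
      OF conv_in[OF x] conv_diff_right[OF x] conv_scale_right[OF x], folded reduced_norm_eq]
  show "l2_norm (x \<star> \<xi>) \<le> red_norm x * l2_norm \<xi>" if "\<xi> \<in> S"
    by (rule op(2)[where K = K0]) (simp_all add: K0 that)
  show "0 \<le> red_norm x" by (rule op(3)[where K = K0]) (simp_all add: K0)
  show "red_norm x \<le> K" if "0 \<le> K" "\<And>\<xi>. \<xi> \<in> S \<Longrightarrow> l2_norm (x \<star> \<xi>) \<le> K * l2_norm \<xi>"
    by (rule op(1)[where K = K]) (simp_all add: that)
qed

text \<open>Left multiplication by the adjoint section is the adjoint operator: the squared length
  of its value \<open>?\<eta>\<close> is the norm of the inner product of \<open>\<xi>\<close> with
  \<open>x \<star> ?\<eta>\<close>, and Cauchy-Schwarz leaves one factor to cancel.\<close>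

lemma red_norm_inv_section_le:
  assumes x: "x \<in> S"
  shows "red_norm (inv_section x) \<le> red_norm x"
proof (rule red_norm_least[OF inv_section_in[OF x] red_norm_nonneg[OF x]])
  fix \<xi> assume \<xi>: "\<xi> \<in> S"
  let ?\<eta> = "inv_section x \<star> \<xi>"
  have \<eta>: "?\<eta> \<in> S" by (intro conv_in inv_section_in x \<xi>)
  have "inner ?\<eta> ?\<eta> = inner \<xi> (x \<star> ?\<eta>)"
    using section_inner_conv[OF inv_section_in[OF x] \<xi> \<eta>] by (simp add: inv_section_inv x)
  then have "(l2_norm ?\<eta>)\<^sup>2 \<le> l2_norm \<xi> * l2_norm (x \<star> ?\<eta>)"
    unfolding l2_norm_sq using inner_cauchy_schwarz[OF \<xi> conv_in[OF x \<eta>]] by simp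
  also have "\<dots> \<le> l2_norm \<xi> * (red_norm x * l2_norm ?\<eta>)"
    by (intro mult_left_mono red_norm_bound x \<eta>) simp
  finally have le: "l2_norm ?\<eta> * l2_norm ?\<eta> \<le> (red_norm x * l2_norm \<xi>) * l2_norm ?\<eta>"
    by (simp add: power2_eq_square mult_ac)
  show "l2_norm ?\<eta> \<le> red_norm x * l2_norm \<xi>"
  proof (cases "l2_norm ?\<eta> = 0")
    case True
    then show ?thesis using red_norm_nonneg[OF x] by simp
  next
    case False
    moreover have "0 \<le> l2_norm ?\<eta>" by simp
    ultimately have "0 < l2_norm ?\<eta>" by linarith
    then show ?thesis by (rule mult_right_le_imp_le[OF le])
  qed
qed

lemma red_norm_conv:
  assumes x: "x \<in> S" and y: "y \<in> S"
  shows "red_norm (x \<star> y) \<le> red_norm x * red_norm y"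
proof (rule red_norm_least[OF conv_in[OF x y]])
  show "0 \<le> red_norm x * red_norm y" by (intro mult_nonneg_nonneg red_norm_nonneg x y)
  fix \<xi> assume \<xi>: "\<xi> \<in> S"
  have "l2_norm (x \<star> y \<star> \<xi>) \<le> red_norm x * l2_norm (y \<star> \<xi>)"
    unfolding conv_assoc[OF x y \<xi>] by (rule red_norm_bound[OF x conv_in[OF y \<xi>]])
  also have "\<dots> \<le> red_norm x * (red_norm y * l2_norm \<xi>)"
    by (intro mult_left_mono red_norm_bound y \<xi> red_norm_nonneg x)
  finally show "l2_norm (x \<star> y \<star> \<xi>) \<le> red_norm x * red_norm y * l2_norm \<xi>" by (simp add: mult.assoc)
qed

lemma red_norm_triangle:
  assumes x: "x \<in> S" and y: "y \<in> S"
  shows "red_norm (x + y) \<le> red_norm x + red_norm y"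
proof (rule red_norm_least[OF add_section[OF x y]])
  show "0 \<le> red_norm x + red_norm y" by (intro add_nonneg_nonneg red_norm_nonneg x y)
  fix \<xi> assume \<xi>: "\<xi> \<in> S"
  have "l2_norm ((x + y) \<star> \<xi>) \<le> l2_norm (x \<star> \<xi>) + l2_norm (y \<star> \<xi>)"
    unfolding conv_add_left[OF x y \<xi>] by (intro l2_norm_triangle conv_in x y \<xi>)
  also have "\<dots> \<le> red_norm x * l2_norm \<xi> + red_norm y * l2_norm \<xi>"
    by (intro add_mono red_norm_bound x y \<xi>)
  finally show "l2_norm ((x + y) \<star> \<xi>) \<le> (red_norm x + red_norm y) * l2_norm \<xi>"
    by (simp add: distrib_right)
qed

lemma red_norm_scale_le:
  assumes x: "x \<in> S"
  shows "red_norm (scale_section c x) \<le> cmod c * red_norm x"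
proof (rule red_norm_least[OF scale_section_in[OF x]])
  show "0 \<le> cmod c * red_norm x" by (intro mult_nonneg_nonneg red_norm_nonneg x) simp
  fix \<xi> assume \<xi>: "\<xi> \<in> S"
  show "l2_norm (scale_section c x \<star> \<xi>) \<le> cmod c * red_norm x * l2_norm \<xi>"
    unfolding conv_scale_left[OF x \<xi>] l2_norm_scale[OF conv_in[OF x \<xi>]] mult.assoc
    by (intro mult_left_mono red_norm_bound x \<xi>) simp
qed

lemma red_norm_scale:
  assumes x: "x \<in> S"
  shows "red_norm (scale_section c x) = cmod c * red_norm x"
proof (cases "c = 0")
  case True
  then show ?thesis
    using red_norm_scale_le[OF x, of c] red_norm_nonneg[OF scale_section_in[OF x], of c] by simp
next
  case False
  have "scale_section (1 / c) (scale_section c x) = x"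
    using False by (simp add: scale_section_def scaleC_scaleC)
  then have "cmod c * red_norm x \<le> cmod c * (cmod (1 / c) * red_norm (scale_section c x))"
    using red_norm_scale_le[OF scale_section_in[OF x, of c], of "1 / c"] by (intro mult_left_mono) auto
  also have "\<dots> = red_norm (scale_section c x)" using False by (simp add: norm_divide)
  finally show ?thesis using red_norm_scale_le[OF x, of c] by simp
qed

sublocale alg: seminormed_algebra "section_algebra (action_bundle D \<alpha>)"
proof (unfold_locales, unfold section_algebra_simps)
  fix x y z c
  show "(+) = (+)" ..
  show "0 \<in> S" by (rule zero_section)
  show "x \<in> S \<Longrightarrow> y \<in> S \<Longrightarrow> x + y \<in> S" by (rule add_section)
  show "x \<in> S \<Longrightarrow> scale_section c x \<in> S" by (rule scale_section_in)
  show "scale_section (- 1) x = - x" by (rule scale_section_minus_one)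
  show "scale_section c (x - y) = scale_section c x - scale_section c y"
    by (simp add: fun_eq_iff scale_section_def scaleC_diff_right)
  show "x \<in> S \<Longrightarrow> 0 \<le> red_norm x" by (rule red_norm_nonneg)
  show "x \<in> S \<Longrightarrow> y \<in> S \<Longrightarrow> red_norm (x + y) \<le> red_norm x + red_norm y" by (rule red_norm_triangle)
  show "x \<in> S \<Longrightarrow> red_norm (scale_section c x) = cmod c * red_norm x" by (rule red_norm_scale)
  show "x \<in> S \<Longrightarrow> y \<in> S \<Longrightarrow> x \<star> y \<in> S" by (rule conv_in)
  show "x \<in> S \<Longrightarrow> inv_section x \<in> S" by (rule inv_section_in)
  show "x \<in> S \<Longrightarrow> y \<in> S \<Longrightarrow> z \<in> S \<Longrightarrow> (x - y) \<star> z = x \<star> z - y \<star> z" by (rule conv_diff_left)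
  show "x \<in> S \<Longrightarrow> y \<in> S \<Longrightarrow> z \<in> S \<Longrightarrow> x \<star> (y - z) = x \<star> y - x \<star> z" by (rule conv_diff_right)
  show "x \<in> S \<Longrightarrow> y \<in> S \<Longrightarrow> inv_section (x - y) = inv_section x - inv_section y" by (rule inv_section_diff)
  show "x \<in> S \<Longrightarrow> y \<in> S \<Longrightarrow> red_norm (x \<star> y) \<le> red_norm x * red_norm y" by (rule red_norm_conv)
  show "red_norm (inv_section x) = red_norm x" if "x \<in> S"
    using red_norm_inv_section_le[OF that] red_norm_inv_section_le[OF inv_section_in[OF that]]
    by (simp add: inv_section_inv that)
qed

section \<open>From the crossed product to the fibres\<close>

lemma l2_norm_delta:
  assumes a: "a \<in> D t"
  shows "l2_norm (delta t a) = norm a"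
proof -
  have d: "delta t a \<in> S" by (rule delta_in) (simp add: a)
  have "inner (delta t a) (delta t a) = (\<Sum>r\<in>{t}. cstar (\<alpha> (- r) (delta t a r)) * \<alpha> (- r) (delta t a r))"
    by (rule inner_eq) (use d in \<open>auto simp: delta_def supp_def\<close>)
  then have "norm (inner (delta t a) (delta t a)) = (norm a)\<^sup>2"
    using alpha_norm[of a "- t"] a by (simp add: delta_def cstar_identity)
  then show ?thesis by simp
qed

text \<open>The test vector is \<open>cstar c\<close> at 0 for \<open>c = \<alpha> (- t) b\<close>:
  the image is isometrically \<open>c * cstar c\<close>, whose norm is the square of that of
  \<open>b\<close>.\<close>

lemma norm_le_red_norm_delta:
  assumes b: "b \<in> D t"
  shows "norm b \<le> red_norm (delta t b)"
proof -
  define c where "c = \<alpha> (- t) b"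
  have c: "c \<in> D (- t)" using b by (simp add: c_def alpha_in')
  have nc: "norm c = norm b" using alpha_norm[of b "- t"] b by (simp add: c_def)
  have d: "delta t b \<in> S" "delta 0 (cstar c) \<in> S" by (rule delta_in; simp add: b)+
  have cc: "c * cstar c \<in> D (- t)" using c by (simp add: ideal_simps)
  have "delta t b \<star> delta 0 (cstar c) = delta t (\<alpha> t (c * cstar c))"
    using conv_delta[of b t "cstar c" 0] b by (simp add: c_def)
  then have "norm (c * cstar c) \<le> red_norm (delta t b) * norm c"
    using red_norm_bound[OF d] l2_norm_delta[OF alpha_in[OF cc]] l2_norm_delta[of "cstar c" 0] alpha_norm[OF cc]
    by simp
  then have "norm b * norm b \<le> red_norm (delta t b) * norm b"
    using cstar_identity[of "cstar c"] by (simp add: cstar_cstar nc power2_eq_square)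
  then show ?thesis using red_norm_nonneg[OF d(1)] by (cases "b = 0") simp_all
qed

lemma rfd_bundle_if_rfd_crossed_product:
  assumes rfd: "rfd_algebra (reduced_crossed_product D \<alpha>)"
  shows "rfd_bundle (action_bundle D \<alpha>)"
  unfolding rfd_bundle_def
proof (intro allI impI)
  fix \<epsilon> :: real and \<Omega> :: "('g \<times> 'a) set"
  assume "\<epsilon> > 0" and \<Omega>: "finite \<Omega> \<and> \<Omega> \<subseteq> Sigma UNIV (fibre (action_bundle D \<alpha>))"
  let ?E = "\<lambda>(t, b). alg.embed (delta t b)"
  let ?A = "star_completion (section_algebra (action_bundle D \<alpha>))"
  have d: "delta t b \<in> S" if "b \<in> D t" for t b by (rule delta_in) (simp add: that)
  have "?E ` \<Omega> \<subseteq> nv_carrier ?A"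
    unfolding alg.star_completion_simps alg.completion_carrier section_algebra_simps
  proof safe
    fix t b assume "(t, b) \<in> \<Omega>"
    then have "b \<in> D t" using \<Omega> by auto
    then show "alg.embed (delta t b) \<in> cauchy_class (section_algebra (action_bundle D \<alpha>)) `
        cauchy_seqs (section_algebra (action_bundle D \<alpha>))"
      using alg.cauchy_const[unfolded section_algebra_simps, OF d] by blast
  qed
  then have "finite (?E ` \<Omega>) \<and> ?E ` \<Omega> \<subseteq> nv_carrier ?A" using \<Omega> by simp
  then obtain k \<phi> where "0 < k" and hom: "star_hom_mat ?A k \<phi>"
    and ge: "\<forall>P\<in>?E ` \<Omega>. mat_norm (\<phi> P) \<ge> nv_norm ?A P - \<epsilon>"
    using rfd \<open>\<epsilon> > 0\<close> unfolding reduced_crossed_product_def reduced_bundle_algebra_def rfd_algebra_def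
    by meson
  define \<pi> where "\<pi> t b = \<phi> (alg.embed (delta t b))" for t b
  note hom_simps = alg.hom_embed_carrier[OF hom, unfolded section_algebra_simps]
    alg.hom_embed_add[OF hom, unfolded section_algebra_simps]
    alg.hom_embed_scale[OF hom, unfolded section_algebra_simps]
    alg.hom_embed_mult[OF hom, unfolded section_algebra_simps]
    alg.hom_embed_star[OF hom, unfolded section_algebra_simps]
  have rep: "bundle_rep (action_bundle D \<alpha>) k \<pi>"
    unfolding bundle_rep_def
  proof (intro conjI allI ballI)
    fix s t c a b
    show "\<pi> t a \<in> carrier_mat k k" if "a \<in> fibre (action_bundle D \<alpha>) t"
      unfolding \<pi>_def by (intro hom_simps delta_in that)
    show "\<pi> t (a + b) = \<pi> t a + \<pi> t b" if "a \<in> fibre (action_bundle D \<alpha>) t" "b \<in> fibre (action_bundle D \<alpha>) t"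
      unfolding \<pi>_def delta_add by (intro hom_simps delta_in that)
    show "\<pi> t (c *C a) = c \<cdot>\<^sub>m \<pi> t a" if "a \<in> fibre (action_bundle D \<alpha>) t"
      unfolding \<pi>_def delta_scale by (intro hom_simps delta_in that)
    show "\<pi> s a * \<pi> t b = \<pi> (s + t) (fb_mult (action_bundle D \<alpha>) s t a b)"
      if "a \<in> fibre (action_bundle D \<alpha>) s" "b \<in> fibre (action_bundle D \<alpha>) t"
      unfolding \<pi>_def conv_delta[OF that, symmetric] by (intro hom_simps(4)[symmetric] delta_in that)
    show "mat_adjoint (\<pi> s a) = \<pi> (- s) (fb_star (action_bundle D \<alpha>) s a)"
      if "a \<in> fibre (action_bundle D \<alpha>) s"
      unfolding \<pi>_def inv_section_delta[symmetric] by (intro hom_simps(5)[symmetric] delta_in that)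
  qed
  have "\<forall>(t, b)\<in>\<Omega>. norm b - \<epsilon> \<le> mat_norm (\<pi> t b)"
  proof safe
    fix t b assume tb: "(t, b) \<in> \<Omega>"
    then have b: "b \<in> D t" using \<Omega> by auto
    have "nv_norm ?A (alg.embed (delta t b)) = red_norm (delta t b)"
      using alg.completion_norm_const[unfolded section_algebra_simps, OF d[OF b]]
      by (simp only: alg.star_completion_simps)
    then show "norm b - \<epsilon> \<le> mat_norm (\<pi> t b)"
      using bspec[OF ge imageI[OF tb]] norm_le_red_norm_delta[OF b] by (simp add: \<pi>_def)
  qed
  then show "\<exists>d>0. \<exists>\<pi>. bundle_rep (action_bundle D \<alpha>) d \<pi> \<and> (\<forall>(t, b)\<in>\<Omega>. norm b - \<epsilon> \<le> mat_norm (\<pi> t b))"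
    using rep \<open>0 < k\<close> by blast
qed

lemma l2_norm_sum:
  "(\<And>i. i \<in> I \<Longrightarrow> \<xi> i \<in> S) \<Longrightarrow> l2_norm (\<Sum>i\<in>I. \<xi> i) \<le> (\<Sum>i\<in>I. l2_norm (\<xi> i))"
proof (induction I rule: infinite_finite_induct)
  case (insert i I)
  have "l2_norm (\<xi> i + sum \<xi> I) \<le> l2_norm (\<xi> i) + l2_norm (sum \<xi> I)"
    by (rule l2_norm_triangle) (simp_all add: sum_section insert.prems)
  also have "\<dots> \<le> l2_norm (\<xi> i) + (\<Sum>i\<in>I. l2_norm (\<xi> i))"
    by (intro add_left_mono insert.IH insert.prems) simp
  finally show ?case unfolding sum.insert[OF insert.hyps] .
qed (simp_all only: sum.infinite sum.empty l2.norm_zero[unfolded pre_l2_simps] order.refl simp_thms)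

lemma l2_norm_conv_power:
  assumes h: "h \<in> S"
  shows "l2_norm (conv_power h n) \<le> red_norm h ^ n * l2_norm h"
proof (induction n)
  case (Suc n)
  have "l2_norm (conv_power h (Suc n)) \<le> red_norm h * l2_norm (conv_power h n)"
    unfolding conv_power.simps by (rule red_norm_bound[OF h conv_power_in[OF h]])
  also have "\<dots> \<le> red_norm h * (red_norm h ^ n * l2_norm h)"
    by (intro mult_left_mono Suc red_norm_nonneg h)
  finally show ?case by (simp only: power_Suc mult.assoc)
qed simp

lemma inv_section_square: "x \<in> S \<Longrightarrow> inv_section (inv_section x \<star> x)
    = inv_section x \<star> x"
  by (simp add: inv_section_conv inv_section_in inv_section_inv)

lemma square_in: "x \<in> S \<Longrightarrow> inv_section x \<star> x \<in> S"
  by (intro conv_in inv_section_in)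

end

section \<open>The group algebra as a crossed product\<close>

instantiation complex :: cstar_algebra
begin

definition scaleC_complex :: "complex \<Rightarrow> complex \<Rightarrow> complex" where "scaleC_complex c x = c * x"
definition cstar_complex :: "complex \<Rightarrow> complex" where "cstar_complex = cnj"

instance
  by standard
     (simp_all add: scaleC_complex_def cstar_complex_def algebra_simps scaleR_conv_of_real norm_mult
        complex_mod_cnj power2_eq_square)

end

lemma L2_set_mono_set: "finite B \<Longrightarrow> A \<subseteq> B \<Longrightarrow> L2_set f A \<le> L2_set f B"
  unfolding L2_set_def by (intro real_sqrt_le_mono sum_mono2) auto

lemma sum_fun_apply: "(\<Sum>i\<in>I. f i) t = (\<Sum>i\<in>I. f i t)"
  by (induction I rule: infinite_finite_induct) auto

text \<open>Over the complex numbers with trivial action the sections are functions on the group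
  with ordinary convolution. All estimates for reduced norms thereby apply to the group
  algebra.\<close>

abbreviation trivial_bundle :: "('g::group_add, complex) fell_bundle" where
  "trivial_bundle \<equiv> action_bundle (\<lambda>_. UNIV) (\<lambda>_ a. a)"

interpretation triv: partial_system "\<lambda>_::'g::group_add. UNIV :: complex set" "\<lambda>_ a. a"
  by unfold_locales
     (auto simp: partial_dynamical_system_def closed_ideal_def star_iso_on_def bij_betw_def inj_on_def)

text \<open>With the trivial action these become reflexive rewrite rules, on which the simplifier loops.\<close>

declare triv.alpha_zero_index [simp del] triv.D_zero [simp del] triv.alpha_zero [simp del]

lemma triv_S: "finite_sections (trivial_bundle :: ('g::group_add, complex) fell_bundle) = {f. finite (supp f)}"
  by (simp add: finite_sections_def)

lemma triv_inner_eq: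
  fixes f g :: "'g::group_add \<Rightarrow> complex"
  shows "triv.inner f g = (\<Sum>t\<in>supp f. cnj (f t) * g t)"
  by (simp add: section_inner_def cstar_complex_def)

lemma triv_inner_self:
  fixes f :: "'g::group_add \<Rightarrow> complex"
  shows "triv.inner f f = complex_of_real ((triv.l2_norm f)\<^sup>2)"
    and "triv.l2_norm f = L2_set (\<lambda>t. cmod (f t)) (supp f)"
proof -
  have *: "triv.inner f f = complex_of_real (\<Sum>t\<in>supp f. (cmod (f t))\<^sup>2)"
    unfolding triv_inner_eq of_real_sum
    by (intro sum.cong refl) (simp add: complex_norm_square mult.commute del: of_real_power)
  then have "norm (triv.inner f f) = (\<Sum>t\<in>supp f. (cmod (f t))\<^sup>2)"
    by (simp only: norm_of_real) (simp add: sum_nonneg)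
  then show "triv.inner f f = complex_of_real ((triv.l2_norm f)\<^sup>2)"
    and "triv.l2_norm f = L2_set (\<lambda>t. cmod (f t)) (supp f)"
    using * by (simp_all add: L2_set_def sum_nonneg flip: of_real_power)
qed

lemma triv_l2_norm_eq:
  fixes f :: "'g::group_add \<Rightarrow> complex"
  assumes "finite F" "supp f \<subseteq> F"
  shows "triv.l2_norm f = L2_set (\<lambda>t. cmod (f t)) F"
proof -
  have "(\<Sum>t\<in>supp f. (cmod (f t))\<^sup>2) = (\<Sum>t\<in>F. (cmod (f t))\<^sup>2)"
    using assms by (intro sum.mono_neutral_left) (auto simp: supp_def)
  then show ?thesis unfolding triv_inner_self(2) L2_set_def by simp
qed

lemma triv_conv: "triv.conv x f = convolve x f"
  by (simp add: fun_eq_iff triv.conv_def convolve_def)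

lemma triv_l2_norm_inv:
  fixes f :: "'g::group_add \<Rightarrow> complex"
  shows "triv.l2_norm (triv.inv_section f) = triv.l2_norm f"
proof -
  have inv: "triv.inv_section f t = cnj (f (- t))" for t
    by (simp add: triv.inv_section_apply cstar_complex_def)
  have "supp (triv.inv_section f) = uminus ` supp f"
  proof safe
    fix t assume "t \<in> supp (triv.inv_section f)"
    then have "- (- t) \<in> uminus ` supp f" by (intro imageI) (simp add: supp_def inv)
    then show "t \<in> uminus ` supp f" by simp
  qed (simp add: supp_def inv)
  then have "(\<Sum>t\<in>supp (triv.inv_section f). (cmod (triv.inv_section f t))\<^sup>2) = (\<Sum>t\<in>supp f. (cmod (f t))\<^sup>2)"
    by (simp add: sum.reindex inv)
  then show ?thesis unfolding triv_inner_self(2) L2_set_def by simp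
qed

lemma l2_group_simps:
  "nv_carrier l2_group = {\<xi>. (\<lambda>t. (cmod (\<xi> t))\<^sup>2) summable_on UNIV}"
  "nv_norm l2_group \<xi> = sqrt (\<Sum>\<^sub>\<infinity>t. (cmod (\<xi> t))\<^sup>2)"
  by (simp_all add: l2_group_def)

lemma l2_group_finite_le:
  assumes "\<xi> \<in> nv_carrier l2_group" "finite F"
  shows "L2_set (\<lambda>t. cmod (\<xi> t)) F \<le> nv_norm l2_group \<xi>"
  unfolding L2_set_def l2_group_simps
  by (intro real_sqrt_le_mono finite_sum_le_infsum) (use assms in \<open>auto simp: l2_group_simps\<close>)

lemma l2_groupI:
  assumes "0 \<le> K" "\<And>F. finite F \<Longrightarrow> L2_set (\<lambda>t. cmod (\<xi> t)) F \<le> K"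
  shows "\<xi> \<in> nv_carrier l2_group" "nv_norm l2_group \<xi> \<le> K"
proof -
  have le: "(\<Sum>t\<in>F. (cmod (\<xi> t))\<^sup>2) \<le> K\<^sup>2" if "finite F" for F
    using power_mono[OF assms(2)[OF that] L2_set_nonneg, of 2] by (simp add: L2_set_def sum_nonneg)
  have sum: "(\<lambda>t. (cmod (\<xi> t))\<^sup>2) summable_on UNIV"
    by (rule nonneg_bdd_above_summable_on) (auto intro!: bdd_aboveI2[where M = "K\<^sup>2"] le)
  then show "\<xi> \<in> nv_carrier l2_group" by (simp add: l2_group_simps)
  have "(\<Sum>\<^sub>\<infinity>t. (cmod (\<xi> t))\<^sup>2) \<le> K\<^sup>2"
    by (rule infsum_le_finite_sums[OF sum]) (use le in auto)
  then show "nv_norm l2_group \<xi> \<le> K"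
    unfolding l2_group_simps using assms(1) by (rule real_le_lsqrt[rotated])
qed

lemma l2_group_finite_supp:
  fixes f :: "'g::group_add \<Rightarrow> complex"
  assumes "finite (supp f)"
  shows "f \<in> nv_carrier l2_group" "nv_norm l2_group f = triv.l2_norm f"
proof -
  have le: "L2_set (\<lambda>t. cmod (f t)) F \<le> triv.l2_norm f" if "finite F" for F
    unfolding triv_l2_norm_eq[of "F \<union> supp f" f, OF finite_UnI[OF that assms] Un_upper2]
    by (rule L2_set_mono_set) (use that assms in auto)
  from l2_groupI[OF _ this] show f: "f \<in> nv_carrier l2_group" by simp
  from l2_groupI(2)[OF _ le] have "nv_norm l2_group f \<le> triv.l2_norm f" by simp
  moreover have "triv.l2_norm f \<le> nv_norm l2_group f"
    unfolding triv_inner_self(2) by (rule l2_group_finite_le[OF f assms])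
  ultimately show "nv_norm l2_group f = triv.l2_norm f" by simp
qed

text \<open>\<open>l2_group\<close> consists of all square summable functions, while
  \<open>triv.red_norm\<close> sees finitely supported ones. The values of
  \<open>convolve x \<xi>\<close> on a finite set \<open>F\<close> depend only on those of
  \<open>\<xi>\<close> on the finite set \<open>F'\<close>, so \<open>\<xi>\<close> may be cut off
  there.\<close>

lemma convolve_bounded:
  fixes x \<xi> :: "'g::group_add \<Rightarrow> complex"
  assumes x: "finite (supp x)" and \<xi>: "\<xi> \<in> nv_carrier l2_group"
  shows "nv_norm l2_group (convolve x \<xi>) \<le> triv.red_norm x * nv_norm l2_group \<xi>"
proof (rule l2_groupI(2))
  have xS: "x \<in> triv.S" using x by (simp add: triv_S)
  note nonneg = triv.red_norm_nonneg[OF xS]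
  have "0 \<le> nv_norm l2_group \<xi>" using order.trans[OF L2_set_nonneg l2_group_finite_le[OF \<xi>, of "{}"]] by simp
  then show "0 \<le> triv.red_norm x * nv_norm l2_group \<xi>" using nonneg by simp
  fix F :: "'g set" assume F: "finite F"
  define F' where "F' = (\<lambda>(t, s). - t + s) ` (supp x \<times> F)"
  have F': "finite F'" unfolding F'_def using x F by simp
  define f where "f t = (if t \<in> F' then \<xi> t else 0)" for t
  have f: "supp f \<subseteq> F'" by (auto simp: supp_def f_def)
  then have fS: "f \<in> triv.S" using F' finite_subset by (auto simp: triv_S)
  have "finite (supp (triv.conv x f))" using triv.conv_in[OF xS fS] by (simp add: triv_S)
  then have fin: "finite (supp (convolve x f))" by (simp only: triv_conv)
  have "L2_set (\<lambda>t. cmod (convolve x \<xi> t)) F = L2_set (\<lambda>t. cmod (convolve x f t)) F"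
  proof (rule L2_set_cong[OF refl])
    fix s assume s: "s \<in> F"
    have "- t + s \<in> F'" if "t \<in> supp x" for t
    proof -
      have "(\<lambda>(t, s). - t + s) (t, s) \<in> F'" unfolding F'_def using that s by (intro imageI) simp
      then show ?thesis by simp
    qed
    then show "cmod (convolve x \<xi> s) = cmod (convolve x f s)"
      unfolding convolve_def f_def by (intro arg_cong[where f = cmod] sum.cong) auto
  qed
  also have "\<dots> \<le> L2_set (\<lambda>t. cmod (convolve x f t)) (F \<union> supp (convolve x f))"
    by (rule L2_set_mono_set) (use F fin in auto)
  also have "\<dots> = triv.l2_norm (convolve x f)"
    by (rule triv_l2_norm_eq[symmetric]) (use F fin in auto)
  also have "\<dots> \<le> triv.red_norm x * triv.l2_norm f"
    using triv.red_norm_bound[OF xS fS] by (simp only: triv_conv)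
  also have "triv.l2_norm f = L2_set (\<lambda>t. cmod (\<xi> t)) F'"
    unfolding triv_l2_norm_eq[OF F' f] by (rule L2_set_cong) (auto simp: f_def)
  also have "triv.red_norm x * \<dots> \<le> triv.red_norm x * nv_norm l2_group \<xi>"
    by (intro mult_left_mono l2_group_finite_le \<xi> F' nonneg)
  finally show "L2_set (\<lambda>t. cmod (convolve x \<xi> t)) F \<le> triv.red_norm x * nv_norm l2_group \<xi>" .
qed

text \<open>Identifies the two constructions of the regular representation. It is stated for every
  function \<open>x\<close> because \<open>group_algebra_eq\<close> is an equality of records, whose
  norm fields are total functions.\<close>

lemma operator_norm_convolve:
  fixes x :: "'g::group_add \<Rightarrow> complex"
  shows "operator_norm l2_group (convolve x) = triv.red_norm x"
proof -
  have zero: "(\<lambda>_. 0) \<in> {\<xi> \<in> nv_carrier l2_group. nv_norm l2_group \<xi> \<le> 1}"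
    by (simp add: l2_group_simps)
  show ?thesis
  proof (cases "finite (supp x)")
    \<comment> \<open>For infinite support both convolution operators are zero, since a sum over an
      infinite set is 0 by convention, and both norms are 0.\<close>
    case False
    then have conv: "convolve x \<xi> = (\<lambda>_. 0)" for \<xi> by (simp add: convolve_def)
    have "operator_norm l2_group (convolve x)
        = (SUP \<xi>\<in>{\<xi> \<in> nv_carrier (l2_group :: ('g \<Rightarrow> complex) normed_space). nv_norm l2_group \<xi> \<le> 1}. 0)"
      unfolding operator_norm_def conv by (simp add: l2_group_simps)
    also have "\<dots> = 0" using zero by (intro cSUP_const) blast
    finally have lhs: "operator_norm l2_group (convolve x) = 0" .
    have z: "(\<lambda>\<xi>. triv.conv x \<xi>) = (\<lambda>_. 0)" by (simp add: fun_eq_iff triv_conv conv)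
    note op = triv.l2.operator_norm_completion[unfolded triv.pre_l2_simps, of "\<lambda>_. 0" 0]
    have z0: "triv.l2_norm (0 :: 'g \<Rightarrow> complex) = 0" by (rule triv.l2.norm_zero[unfolded triv.pre_l2_simps])
    have s0: "triv.scale_section c 0 = 0" for c by (simp add: triv.scale_section_def fun_eq_iff)
    have "triv.red_norm x \<le> 0" unfolding triv.reduced_norm_eq z
      by (rule op(1)) (simp_all only: triv.zero_section z0 s0 diff_self mult_zero_left order.refl)
    moreover have "0 \<le> triv.red_norm x" unfolding triv.reduced_norm_eq z
      by (rule op(3)) (simp_all only: triv.zero_section z0 s0 diff_self mult_zero_left order.refl)
    ultimately show ?thesis using lhs by simp
  next
    case True
    then have xS: "x \<in> triv.S" by (simp add: triv_S)
    note nonneg = triv.red_norm_nonneg[OF xS]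
    have le: "nv_norm l2_group (convolve x \<xi>) \<le> triv.red_norm x"
      if "\<xi> \<in> {\<xi> \<in> nv_carrier l2_group. nv_norm l2_group \<xi> \<le> 1}" for \<xi>
    proof -
      have "nv_norm l2_group (convolve x \<xi>) \<le> triv.red_norm x * nv_norm l2_group \<xi>"
        using that by (intro convolve_bounded True) simp
      also have "\<dots> \<le> triv.red_norm x * 1" using that by (intro mult_left_mono nonneg) simp
      finally show ?thesis by simp
    qed
    show ?thesis
    proof (rule antisym)
      show "operator_norm l2_group (convolve x) \<le> triv.red_norm x"
        unfolding operator_norm_def by (rule cSUP_least) (use zero le in blast)+
      have upper: "nv_norm l2_group (convolve x \<xi>) \<le> operator_norm l2_group (convolve x)"
        if "\<xi> \<in> {\<xi> \<in> nv_carrier l2_group. nv_norm l2_group \<xi> \<le> 1}" for \<xi>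
        unfolding operator_norm_def by (rule cSUP_upper[OF that]) (rule bdd_aboveI2, rule le)
      show "triv.red_norm x \<le> operator_norm l2_group (convolve x)"
      proof (rule triv.red_norm_least[OF xS])
        show "0 \<le> operator_norm l2_group (convolve x)"
          using upper[OF zero] by (simp add: convolve_def l2_group_simps)
        fix f :: "'g \<Rightarrow> complex" assume f: "f \<in> triv.S"
        show "triv.l2_norm (triv.conv x f) \<le> operator_norm l2_group (convolve x) * triv.l2_norm f"
        proof (cases "triv.l2_norm f = 0")
          case True
          then show ?thesis using triv.red_norm_bound[OF xS f] by simp
        next
          case False
          moreover have "0 \<le> triv.l2_norm f" by simp
          ultimately have pos: "0 < triv.l2_norm f" by linarith
          let ?c = "complex_of_real (1 / triv.l2_norm f)"
          let ?g = "triv.scale_section ?c f"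
          have g: "?g \<in> triv.S" by (rule triv.scale_section_in[OF f])
          then have fg: "finite (supp ?g)" by (simp add: triv_S)
          have cg: "triv.conv x ?g \<in> triv.S" by (rule triv.conv_in[OF xS g])
          then have fcg: "finite (supp (convolve x ?g))" by (simp add: triv_S triv_conv)
          have "triv.l2_norm ?g = 1"
            unfolding triv.l2_norm_scale[OF f] using pos by (simp add: norm_divide)
          then have "nv_norm l2_group (convolve x ?g) \<le> operator_norm l2_group (convolve x)"
            by (intro upper) (simp only: mem_Collect_eq l2_group_finite_supp[OF fg] order.refl simp_thms)
          then have "triv.l2_norm (triv.conv x ?g) \<le> operator_norm l2_group (convolve x)"
            unfolding l2_group_finite_supp(2)[OF fcg] triv_conv .
          also have "triv.conv x ?g = triv.scale_section ?c (triv.conv x f)"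
            by (rule triv.conv_scale_right[OF xS f])
          finally show ?thesis
            unfolding triv.l2_norm_scale[OF triv.conv_in[OF xS f]] using pos
            by (simp add: norm_divide field_simps)
        qed
      qed
    qed
  qed
qed

lemma group_algebra_eq: "group_algebra = section_algebra (trivial_bundle :: ('g::group_add, complex) fell_bundle)"
  unfolding group_algebra_def section_algebra_def operator_norm_convolve
  by (simp add: finite_sections_def convolve_def[abs_def] scaleC_complex_def cstar_complex_def)

text \<open>For scalar functions the involution preserves the 2-norm, so right convolution is as
  bounded as left convolution. This bounds a product by the 2-norm of its left factor, for which
  \<open>entry_l2_le\<close> is available before any operator bound.\<close>

lemma triv_l2_norm_conv_right:
  fixes f g :: "'g::group_add \<Rightarrow> complex"
  assumes g: "g \<in> triv.S" and f: "f \<in> triv.S"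
  shows "triv.l2_norm (triv.conv g f) \<le> triv.red_norm (triv.inv_section f) * triv.l2_norm g"
proof -
  have "triv.l2_norm (triv.conv g f) = triv.l2_norm (triv.inv_section (triv.conv g f))"
    by (rule triv_l2_norm_inv[symmetric])
  also have "\<dots> = triv.l2_norm (triv.conv (triv.inv_section f) (triv.inv_section g))"
    by (simp only: triv.inv_section_conv[OF g f])
  also have "\<dots> \<le> triv.red_norm (triv.inv_section f) * triv.l2_norm (triv.inv_section g)"
    by (intro triv.red_norm_bound triv.inv_section_in f g)
  also have "triv.l2_norm (triv.inv_section g) = triv.l2_norm g" by (rule triv_l2_norm_inv)
  finally show ?thesis .
qed

lemma triv_inner_delta: "triv.inner (triv.delta 0 c) f = cnj c * f (0 :: 'g::group_add)"
proof -
  have "triv.inner (triv.delta 0 c) f = (\<Sum>t\<in>supp (triv.delta (0 :: 'g) c). cnj (triv.delta 0 c t) * f t)"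
    by (rule triv_inner_eq)
  also have "\<dots> = (\<Sum>t\<in>{0}. cnj (triv.delta 0 c t) * f t)"
    by (rule sum.mono_neutral_left) (auto simp: supp_def triv.delta_def)
  finally show ?thesis by (simp add: triv.delta_def)
qed

lemma triv_conv_delta_0:
  fixes f :: "'g::group_add \<Rightarrow> complex"
  assumes "f \<in> triv.S"
  shows "(triv.conv f (triv.delta 0 c)) 0 = f 0 * c"
proof -
  have "(triv.conv f (triv.delta 0 c)) 0 = (\<Sum>t\<in>supp f. f t * triv.delta 0 c (- t + 0))"
    unfolding triv.conv_def by simp
  also have "\<dots> = (\<Sum>t\<in>supp f. if t = 0 then f 0 * c else 0)"
    by (rule sum.cong[OF refl]) (auto simp: triv.delta_def)
  also have "\<dots> = f 0 * c" using triv.section_supp[OF assms] by (simp add: supp_def)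
  finally show ?thesis .
qed

section \<open>Absorption of the regular representation\<close>

text \<open>The quotients of consecutive terms increase, so each is at least
  \<open>a 1 / a 0\<close>. The statement \<open>ratio\<close> is kept free of division because
  terms may vanish.\<close>

lemma log_convex_power_le:
  fixes a :: "nat \<Rightarrow> real"
  assumes "\<And>n. 0 \<le> a n" "\<And>n. (a (Suc n))\<^sup>2 \<le> a n * a (Suc (Suc n))"
  shows "a 1 ^ Suc n \<le> a 0 ^ n * a (Suc n)"
proof -
  have ratio: "a 1 * a n \<le> a 0 * a (Suc n)" for n
  proof (induction n)
    case (Suc n)
    show ?case
    proof (cases "a n = 0")
      case True
      then have "a (Suc n) = 0" using assms(2)[of n] by simp
      then show ?thesis using assms(1) by simp
    next
      case False
      then have pos: "0 < a n" using assms(1)[of n] by simp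
      have "(a 1 * a (Suc n)) * a n = (a 1 * a n) * a (Suc n)" by simp
      also have "\<dots> \<le> (a 0 * a (Suc n)) * a (Suc n)" by (intro mult_right_mono Suc assms(1))
      also have "\<dots> = a 0 * (a (Suc n))\<^sup>2" by (simp add: power2_eq_square)
      also have "\<dots> \<le> a 0 * (a n * a (Suc (Suc n)))" by (intro mult_left_mono assms)
      finally have "(a 1 * a (Suc n)) * a n \<le> (a 0 * a (Suc (Suc n))) * a n" by (simp add: mult_ac)
      then show ?thesis using pos by (rule mult_right_le_imp_le)
    qed
  qed simp
  show ?thesis
  proof (induction n)
    case (Suc n)
    have "a 1 ^ Suc (Suc n) = a 1 * a 1 ^ Suc n" by simp
    also have "\<dots> \<le> a 1 * (a 0 ^ n * a (Suc n))" by (intro mult_left_mono Suc assms(1))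
    also have "\<dots> = a 0 ^ n * (a 1 * a (Suc n))" by simp
    also have "\<dots> \<le> a 0 ^ n * (a 0 * a (Suc (Suc n)))" by (intro mult_left_mono ratio zero_le_power assms(1))
    finally show ?case by (simp add: mult_ac)
  qed simp
qed

text \<open>Taking roots of order \<open>n\<close> removes the constant \<open>K\<close>, however
  large.\<close>

lemma le_if_powers_le:
  fixes p q :: real
  assumes "0 \<le> p" "0 \<le> q" "\<And>n. p ^ Suc n \<le> K * q ^ n"
  shows "p \<le> q"
proof (rule ccontr)
  assume "\<not> p \<le> q"
  then have pq: "q < p" "0 < p" using assms by auto
  have "p \<le> K * (q / p) ^ n" for n
    using assms(3)[of n] pq by (simp add: field_simps power_divide)
  moreover have "(\<lambda>n. K * (q / p) ^ n) \<longlonglongrightarrow> K * 0"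
    using pq assms by (intro tendsto_intros LIMSEQ_realpow_zero) auto
  ultimately have "p \<le> 0" by (intro LIMSEQ_le_const[of _ _ p]) auto
  then show False using pq by simp
qed

lemma finite_pos_lower_bound:
  fixes f :: "'b \<Rightarrow> real"
  assumes "finite A" "\<forall>x\<in>A. 0 < f x"
  shows "\<exists>\<delta>>0. \<forall>x\<in>A. \<delta> \<le> f x"
  using assms
proof (induction A rule: finite_induct)
  case (insert a A)
  then obtain \<delta> where "\<delta> > 0" "\<forall>x\<in>A. \<delta> \<le> f x" by auto
  then show ?case using insert.prems by (intro exI[of _ "min \<delta> (f a)"]) auto
qed (auto intro: exI[of _ 1])

context partial_system_rep
begin

notation conv (infixl "\<star>" 70)
notation triv.conv (infixl "\<odot>" 70)

definition entry :: "nat \<Rightarrow> nat \<Rightarrow> ('g \<Rightarrow> 'a) \<Rightarrow> 'g \<Rightarrow> complex" where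
  "entry i j x = (\<lambda>t. \<pi> t (x t) $$ (i, j))"

lemma entry_in: "x \<in> S \<Longrightarrow> i < d \<Longrightarrow> j < d \<Longrightarrow> entry i j x \<in> triv.S"
proof -
  assume x: "x \<in> S" and ij: "i < d" "j < d"
  have "supp (entry i j x) \<subseteq> supp x"
    using ij by (auto simp: entry_def supp_def rep_zero)
  then show ?thesis using section_supp[OF x] finite_subset by (auto simp: triv_S)
qed

lemma rep_section: "x \<in> S \<Longrightarrow> \<pi> t (x t) \<in> carrier_mat d d"
  by (intro rep_carrier section_in_ideal)

lemma entry_add:
  assumes "x \<in> S" "y \<in> S" "i < d" "j < d"
  shows "entry i j (x + y) = entry i j x + entry i j y"
proof
  fix t show "entry i j (x + y) t = (entry i j x + entry i j y) t"
    using assms carrier_matD[OF rep_section[OF assms(2), of t]]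
    by (simp add: entry_def rep_add section_in_ideal)
qed

lemma entry_scale:
  assumes "x \<in> S" "i < d" "j < d"
  shows "entry i j (scale_section c x) = triv.scale_section c (entry i j x)"
proof
  fix t show "entry i j (scale_section c x) t = triv.scale_section c (entry i j x) t"
    using assms carrier_matD[OF rep_section[OF assms(1), of t]]
    by (simp add: entry_def scale_section_def triv.scale_section_def scaleC_complex_def rep_scale section_in_ideal)
qed

lemma entry_inv_section:
  assumes "x \<in> S" "i < d" "j < d"
  shows "entry i j (inv_section x) = triv.inv_section (entry j i x)"
proof
  fix t
  have "\<pi> t (inv_section x t) = mat_adjoint (\<pi> (- t) (x (- t)))"
    using rep_star[of "x (- t)" "- t"] section_in_ideal[OF assms(1), of "- t"]
    by (simp add: inv_section_apply)
  then show "entry i j (inv_section x) t = triv.inv_section (entry j i x) t"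
    using assms carrier_matD[OF rep_section[OF assms(1), of "- t"]]
    by (simp add: entry_def triv.inv_section_apply cstar_complex_def)
qed

lemma rep_sum_index:
  assumes "i < d" "j < d"
  shows "(\<And>k. k \<in> I \<Longrightarrow> f k \<in> D t) \<Longrightarrow> \<pi> t (\<Sum>k\<in>I. f k) $$ (i, j) = (\<Sum>k\<in>I. \<pi> t (f k) $$ (i, j))"
proof (induction I rule: infinite_finite_induct)
  case (insert k I)
  have s: "sum f I \<in> D t" using fibre_sum[of I f t] insert.prems by simp
  have "\<pi> t (f k + sum f I) = \<pi> t (f k) + \<pi> t (sum f I)"
    by (rule rep_add) (simp_all add: s insert.prems)
  then show ?case
    using insert carrier_matD[OF rep_carrier[OF s]] assms by simp
qed (simp_all add: rep_zero assms)

text \<open>Here the twist by the action disappears: \<open>\<pi>\<close> turns the products of the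
  bundle into matrix products, so the entries multiply by ordinary convolution on the group. This is
  the mechanism of Fell absorption.\<close>

lemma entry_conv:
  assumes x: "x \<in> S" and y: "y \<in> S" and ij: "i < d" "j < d"
  shows "entry i j (x \<star> y) = (\<Sum>l<d. entry i l x \<odot> entry l j y)"
proof
  fix s
  have "entry i j (x \<star> y) s = (\<Sum>t\<in>supp x. \<pi> s (bundle_mult t (- t + s) (x t) (y (- t + s))) $$ (i, j))"
    unfolding entry_def conv_def
    using rep_sum_index[OF ij, of "supp x"] conv_term_in[OF x y] by simp
  also have "\<dots> = (\<Sum>t\<in>supp x. \<Sum>l<d. entry i l x t * entry l j y (- t + s))"
  proof (rule sum.cong[OF refl])
    fix t
    have "\<pi> s (bundle_mult t (- t + s) (x t) (y (- t + s))) = \<pi> t (x t) * \<pi> (- t + s) (y (- t + s))"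
      using rep_mult[of "x t" t "y (- t + s)" "- t + s"] section_in_ideal[OF x] section_in_ideal[OF y] by simp
    then show "\<pi> s (bundle_mult t (- t + s) (x t) (y (- t + s))) $$ (i, j) = (\<Sum>l<d. entry i l x t * entry l j y (- t + s))"
      using index_mult_mat_sum[OF rep_section[OF x] rep_section[OF y] ij] by (simp add: entry_def)
  qed
  also have "\<dots> = (\<Sum>l<d. \<Sum>t\<in>supp x. entry i l x t * entry l j y (- t + s))"
    by (rule sum.swap)
  also have "\<dots> = (\<Sum>l<d. (entry i l x \<odot> entry l j y) s)"
  proof (rule sum.cong[OF refl])
    fix l assume "l \<in> {..<d}"
    then have l: "l < d" by simp
    have "(entry i l x \<odot> entry l j y) s
        = (\<Sum>t\<in>supp x. fb_mult trivial_bundle t (- t + s) (entry i l x t) (entry l j y (- t + s)))"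
      by (rule triv.conv_eq)
         (use section_supp[OF x] entry_in[OF y l ij(2)] ij l in \<open>auto simp: entry_def not_supp[where x = x] rep_zero\<close>)
    then show "(\<Sum>t\<in>supp x. entry i l x t * entry l j y (- t + s)) = (entry i l x \<odot> entry l j y) s" by simp
  qed
  finally show "entry i j (x \<star> y) s = (\<Sum>l<d. entry i l x \<odot> entry l j y) s"
    by (simp only: sum_fun_apply)
qed

section \<open>Matrices of functions acting on vectors of functions\<close>

definition vecs :: "(nat \<Rightarrow> 'g \<Rightarrow> complex) set" where
  "vecs = {F. \<forall>i<d. F i \<in> triv.S}"

definition vinner :: "(nat \<Rightarrow> 'g \<Rightarrow> complex) \<Rightarrow> (nat \<Rightarrow> 'g \<Rightarrow> complex) \<Rightarrow> complex" where
  "vinner F F' = (\<Sum>i<d. triv.inner (F i) (F' i))"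

definition vnorm :: "(nat \<Rightarrow> 'g \<Rightarrow> complex) \<Rightarrow> real" where
  "vnorm F = L2_set (\<lambda>i. triv.l2_norm (F i)) {..<d}"

text \<open>The value 0 from index \<open>d\<close> on makes \<open>act_conv\<close> an equality of
  functions, so that iterates can be rewritten by it.\<close>

definition act :: "('g \<Rightarrow> 'a) \<Rightarrow> (nat \<Rightarrow> 'g \<Rightarrow> complex) \<Rightarrow> nat \<Rightarrow> 'g \<Rightarrow> complex" where
  "act x F i = (if i < d then \<Sum>l<d. entry i l x \<odot> F l else 0)"

lemma vecsD: "F \<in> vecs \<Longrightarrow> i < d \<Longrightarrow> F i \<in> triv.S"
  by (simp add: vecs_def)

lemma act_in:
  assumes x: "x \<in> S" and F: "F \<in> vecs"
  shows "act x F \<in> vecs"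
  unfolding vecs_def
proof (rule CollectI, rule allI, rule impI)
  fix i assume i: "i < d"
  have "(\<Sum>l<d. entry i l x \<odot> F l) \<in> triv.S"
    by (rule triv.sum_section)
       (use F i x in \<open>simp_all only: vecsD triv.conv_in entry_in lessThan_iff\<close>)
  then show "act x F i \<in> triv.S" using i by (simp only: act_def if_True)
qed

lemma act_conv:
  assumes x: "x \<in> S" and y: "y \<in> S" and F: "F \<in> vecs"
  shows "act (x \<star> y) F = act x (act y F)"
proof
  fix i
  show "act (x \<star> y) F i = act x (act y F) i"
  proof (cases "i < d")
    case True
    have "(\<Sum>l<d. entry i l (x \<star> y) \<odot> F l) = (\<Sum>l<d. \<Sum>k<d. entry i k x \<odot> (entry k l y \<odot> F l))"
    proof (rule sum.cong[OF refl])
      fix l assume "l \<in> {..<d}"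
      then have l: "l < d" by simp
      have "entry i l (x \<star> y) \<odot> F l = (\<Sum>k<d. entry i k x \<odot> entry k l y \<odot> F l)"
        unfolding entry_conv[OF x y True l]
        by (rule triv.conv_sum_left) (use F l True x y in \<open>simp_all only: vecsD triv.conv_in entry_in lessThan_iff\<close>)
      also have "\<dots> = (\<Sum>k<d. entry i k x \<odot> (entry k l y \<odot> F l))"
        by (rule sum.cong[OF refl], rule triv.conv_assoc)
           (use F l True x y in \<open>simp_all only: vecsD entry_in lessThan_iff\<close>)
      finally show "entry i l (x \<star> y) \<odot> F l = (\<Sum>k<d. entry i k x \<odot> (entry k l y \<odot> F l))" .
    qed
    also have "\<dots> = (\<Sum>k<d. \<Sum>l<d. entry i k x \<odot> (entry k l y \<odot> F l))" by (rule sum.swap)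
    also have "\<dots> = (\<Sum>k<d. entry i k x \<odot> act y F k)"
    proof (rule sum.cong[OF refl])
      fix k assume "k \<in> {..<d}"
      then have k: "k < d" by simp
      have "entry i k x \<odot> (\<Sum>l<d. entry k l y \<odot> F l) = (\<Sum>l<d. entry i k x \<odot> (entry k l y \<odot> F l))"
        by (rule triv.conv_sum_right) (use F k True x y in \<open>simp_all only: vecsD triv.conv_in entry_in lessThan_iff\<close>)
      then show "(\<Sum>l<d. entry i k x \<odot> (entry k l y \<odot> F l)) = entry i k x \<odot> act y F k"
        using k by (simp only: act_def if_True)
    qed
    finally show ?thesis using True by (simp only: act_def[of "x \<star> y"] act_def[of x] if_True)
  qed (simp only: act_def if_False)
qed

lemma vinner_act:
  assumes x: "x \<in> S" and F: "F \<in> vecs" and F': "F' \<in> vecs"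
  shows "vinner (act x F) F' = vinner F (act (inv_section x) F')"
proof -
  have "vinner (act x F) F' = (\<Sum>i<d. \<Sum>l<d. triv.inner (entry i l x \<odot> F l) (F' i))"
    unfolding vinner_def
  proof (rule sum.cong[OF refl])
    fix i assume "i \<in> {..<d}"
    then have i: "i < d" by simp
    have "triv.inner (\<Sum>l<d. entry i l x \<odot> F l) (F' i) = (\<Sum>l<d. triv.inner (entry i l x \<odot> F l) (F' i))"
      by (rule triv.section_inner_sum_left)
         (use F F' i x in \<open>simp_all only: vecsD triv.conv_in entry_in lessThan_iff\<close>)
    then show "triv.inner (act x F i) (F' i) = (\<Sum>l<d. triv.inner (entry i l x \<odot> F l) (F' i))"
      using i by (simp only: act_def if_True)
  qed
  also have "\<dots> = (\<Sum>i<d. \<Sum>l<d. triv.inner (F l) (entry l i (inv_section x) \<odot> F' i))"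
  proof (intro sum.cong refl)
    fix i l assume "i \<in> {..<d}" "l \<in> {..<d}"
    then have il: "i < d" "l < d" by simp_all
    show "triv.inner (entry i l x \<odot> F l) (F' i) = triv.inner (F l) (entry l i (inv_section x) \<odot> F' i)"
      unfolding entry_inv_section[OF x il(2,1)]
      by (rule triv.section_inner_conv) (use F F' il x in \<open>simp_all only: vecsD entry_in\<close>)
  qed
  also have "\<dots> = (\<Sum>l<d. \<Sum>i<d. triv.inner (F l) (entry l i (inv_section x) \<odot> F' i))" by (rule sum.swap)
  also have "\<dots> = vinner F (act (inv_section x) F')"
    unfolding vinner_def
  proof (rule sum.cong[OF refl])
    fix l assume "l \<in> {..<d}"
    then have l: "l < d" by simp
    have "triv.inner (F l) (\<Sum>i<d. entry l i (inv_section x) \<odot> F' i)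
        = (\<Sum>i<d. triv.inner (F l) (entry l i (inv_section x) \<odot> F' i))"
      by (rule triv.section_inner_sum_right)
         (use F F' l inv_section_in[OF x] in \<open>simp_all only: vecsD triv.conv_in entry_in lessThan_iff\<close>)
    then show "(\<Sum>i<d. triv.inner (F l) (entry l i (inv_section x) \<odot> F' i)) = triv.inner (F l) (act (inv_section x) F' l)"
      using l by (simp only: act_def if_True)
  qed
  finally show ?thesis .
qed

lemma vnorm_nonneg [simp]: "0 \<le> vnorm F"
  by (simp add: vnorm_def)

lemma vinner_self: "vinner F F = complex_of_real ((vnorm F)\<^sup>2)"
proof -
  have "(vnorm F)\<^sup>2 = (\<Sum>i<d. (triv.l2_norm (F i))\<^sup>2)"
    unfolding vnorm_def L2_set_def by (rule real_sqrt_pow2) (rule sum_nonneg, rule zero_le_power2)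
  then have sq: "complex_of_real ((vnorm F)\<^sup>2) = (\<Sum>i<d. complex_of_real ((triv.l2_norm (F i))\<^sup>2))"
    by (simp only: of_real_sum)
  show ?thesis unfolding sq vinner_def by (rule sum.cong[OF refl], rule triv_inner_self(1))
qed

lemma vinner_le:
  assumes "F \<in> vecs" "F' \<in> vecs"
  shows "cmod (vinner F F') \<le> vnorm F * vnorm F'"
proof -
  have "cmod (vinner F F') \<le> (\<Sum>i<d. \<bar>triv.l2_norm (F i)\<bar> * \<bar>triv.l2_norm (F' i)\<bar>)"
    unfolding vinner_def
  proof (rule order.trans[OF norm_sum], rule sum_mono)
    fix i assume "i \<in> {..<d}"
    then have i: "i < d" by simp
    have "\<bar>triv.l2_norm (F i)\<bar> * \<bar>triv.l2_norm (F' i)\<bar> = triv.l2_norm (F i) * triv.l2_norm (F' i)"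
      by (simp only: real_sqrt_abs2 abs_of_nonneg real_sqrt_ge_zero norm_ge_zero)
    then show "cmod (triv.inner (F i) (F' i)) \<le> \<bar>triv.l2_norm (F i)\<bar> * \<bar>triv.l2_norm (F' i)\<bar>"
      using triv.inner_cauchy_schwarz[OF vecsD[OF assms(1) i] vecsD[OF assms(2) i]] by (simp only:)
  qed
  also have "\<dots> \<le> vnorm F * vnorm F'"
    unfolding vnorm_def by (rule L2_set_mult_ineq)
  finally show ?thesis .
qed

lemma vnorm_act_sq_le:
  assumes x: "x \<in> S" and F: "F \<in> vecs"
  shows "(vnorm (act x F))\<^sup>2 \<le> vnorm F * vnorm (act (inv_section x \<star> x) F)"
proof -
  have "complex_of_real ((vnorm (act x F))\<^sup>2) = vinner F (act (inv_section x \<star> x) F)"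
    unfolding vinner_self[symmetric] vinner_act[OF x F act_in[OF x F]] act_conv[OF inv_section_in[OF x] x F] ..
  then have "cmod (complex_of_real ((vnorm (act x F))\<^sup>2)) = cmod (vinner F (act (inv_section x \<star> x) F))"
    by (rule arg_cong)
  then show ?thesis
    using vinner_le[OF F act_in[OF conv_in[OF inv_section_in[OF x] x] F]] unfolding norm_of_real by simp
qed

text \<open>For selfadjoint \<open>h\<close> the squared norm of \<open>h G\<close> is the inner
  product of \<open>G\<close> with \<open>h h G\<close>, so the norms of the iterates on
  \<open>F\<close> are logarithmically convex. Recall that \<open>conv_power h n\<close> is the
  power \<open>n + 1\<close>, which makes both sides fit.\<close>

lemma vnorm_act_power:
  assumes h: "h \<in> S" "inv_section h = h" and F: "F \<in> vecs"
  shows "vnorm (act h F) ^ Suc n \<le> vnorm F ^ n * vnorm (act (conv_power h n) F)"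
proof -
  define G where "G n = (act h ^^ n) F" for n
  have G: "G n \<in> vecs" for n by (induction n) (simp_all add: G_def F act_in h)
  have G_Suc: "G (Suc n) = act h (G n)" for n by (simp add: G_def)
  have power: "G (Suc n) = act (conv_power h n) F" for n
  proof (induction n)
    case (Suc n)
    then show ?case
      unfolding G_Suc[of "Suc n"] by (simp only: conv_power.simps act_conv[OF h(1) conv_power_in[OF h(1)] F])
  qed (simp add: G_def)
  have convex: "(vnorm (G (Suc n)))\<^sup>2 \<le> vnorm (G n) * vnorm (G (Suc (Suc n)))" for n
    using vnorm_act_sq_le[OF h(1) G[of n]] unfolding h(2) act_conv[OF h(1) h(1) G] G_Suc .
  have "vnorm (G 1) ^ Suc n \<le> vnorm (G 0) ^ n * vnorm (G (Suc n))"
    by (rule log_convex_power_le[where a = "\<lambda>n. vnorm (G n)"]) (simp, rule convex)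
  then show ?thesis unfolding power by (simp add: G_def)
qed

text \<open>The \<open>j\<close>-th diagonal entry of the matrix \<open>\<pi> 0 (inner y y)\<close>
  is the sum of the squared 2-norms of column \<open>j\<close>, and \<open>\<pi> 0\<close> is
  contractive.\<close>

lemma entry_l2_le:
  assumes y: "y \<in> S" and lj: "l < d" "j < d"
  shows "triv.l2_norm (entry l j y) \<le> l2_norm y"
proof -
  let ?s = "\<Sum>l<d. (triv.l2_norm (entry l j y))\<^sup>2"
  have "\<pi> 0 (inner y y) $$ (j, j) = entry j j (inv_section y \<star> y) 0"
    unfolding section_inner_eq[OF y y] entry_def ..
  also have "\<dots> = (\<Sum>l<d. (entry j l (inv_section y) \<odot> entry l j y) 0)"
    unfolding entry_conv[OF inv_section_in[OF y] y lj(2,2)] sum_fun_apply ..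
  also have "\<dots> = (\<Sum>l<d. complex_of_real ((triv.l2_norm (entry l j y))\<^sup>2))"
  proof (rule sum.cong[OF refl])
    fix l assume "l \<in> {..<d}"
    then have l: "l < d" by simp
    have "(entry j l (inv_section y) \<odot> entry l j y) 0 = triv.inner (entry l j y) (entry l j y)"
      unfolding entry_inv_section[OF y lj(2) l]
      by (rule triv.section_inner_eq[symmetric]; rule entry_in[OF y l lj(2)])
    also have "\<dots> = complex_of_real ((triv.l2_norm (entry l j y))\<^sup>2)" by (rule triv_inner_self(1))
    finally show "(entry j l (inv_section y) \<odot> entry l j y) 0 = complex_of_real ((triv.l2_norm (entry l j y))\<^sup>2)" .
  qed
  also have "\<dots> = complex_of_real ?s" by (simp only: of_real_sum)
  finally have eq: "\<pi> 0 (inner y y) $$ (j, j) = complex_of_real ?s" .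
  have s: "0 \<le> ?s" by (rule sum_nonneg) (rule zero_le_power2)
  have "(triv.l2_norm (entry l j y))\<^sup>2 \<le> ?s"
    by (rule member_le_sum[of l "{..<d}" "\<lambda>l. (triv.l2_norm (entry l j y))\<^sup>2"]) (simp_all only: lj lessThan_iff zero_le_power2 finite_lessThan)
  also have "?s = cmod (\<pi> 0 (inner y y) $$ (j, j))" unfolding eq norm_of_real using s by (simp only: abs_of_nonneg)
  also have "\<dots> \<le> mat_norm (\<pi> 0 (inner y y))" by (rule mat_entry_le_norm[OF rep0 lj(2,2)])
  also have "\<dots> \<le> norm (inner y y)" by (rule rep_contractive)
  finally have "(triv.l2_norm (entry l j y))\<^sup>2 \<le> (l2_norm y)\<^sup>2" unfolding l2_norm_sq .
  then show ?thesis by (rule power2_le_imp_le) simp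
qed

lemma vnorm_act_le_sum:
  assumes x: "x \<in> S" and F: "F \<in> vecs"
  shows "vnorm (act x F) \<le> (\<Sum>i<d. \<Sum>l<d. triv.l2_norm (entry i l x \<odot> F l))"
proof -
  have "vnorm (act x F) \<le> (\<Sum>i<d. triv.l2_norm (act x F i))"
    unfolding vnorm_def by (rule L2_set_le_sum) (simp only: real_sqrt_ge_zero norm_ge_zero)
  also have "\<dots> \<le> (\<Sum>i<d. \<Sum>l<d. triv.l2_norm (entry i l x \<odot> F l))"
  proof (rule sum_mono)
    fix i assume "i \<in> {..<d}"
    then have i: "i < d" by simp
    have "triv.l2_norm (\<Sum>l<d. entry i l x \<odot> F l) \<le> (\<Sum>l<d. triv.l2_norm (entry i l x \<odot> F l))"
      by (rule triv.l2_norm_sum) (use F i x in \<open>simp_all only: vecsD triv.conv_in entry_in lessThan_iff\<close>)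
    then show "triv.l2_norm (act x F i) \<le> (\<Sum>l<d. triv.l2_norm (entry i l x \<odot> F l))"
      using i by (simp only: act_def if_True)
  qed
  finally show ?thesis .
qed

lemma vnorm_act_le:
  assumes x: "x \<in> S" and F: "F \<in> vecs"
  shows "vnorm (act x F) \<le> red_norm x * vnorm F"
proof -
  define h where "h = inv_section x \<star> x"
  have h: "h \<in> S" "inv_section h = h" unfolding h_def by (rule square_in[OF x], rule inv_section_square[OF x])
  let ?R = "\<lambda>l. triv.red_norm (triv.inv_section (F l))"
  have R: "0 \<le> ?R l" if "l < d" for l by (intro triv.red_norm_nonneg triv.inv_section_in vecsD[OF F that])
  \<comment> \<open>The constant depends on \<open>F\<close>, through right convolution by its
    components, and on \<open>h\<close>, but not on the exponent. \<open>le_if_powers_le\<close>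
    therefore removes it.\<close>
  define K where "K = (\<Sum>i<d. \<Sum>l<d. ?R l * l2_norm h)"
  have power: "vnorm (act (conv_power h n) F) \<le> K * red_norm h ^ n" for n
  proof -
    have "vnorm (act (conv_power h n) F) \<le> (\<Sum>i<d. \<Sum>l<d. triv.l2_norm (entry i l (conv_power h n) \<odot> F l))"
      by (rule vnorm_act_le_sum[OF conv_power_in[OF h(1)] F])
    also have "\<dots> \<le> (\<Sum>i<d. \<Sum>l<d. ?R l * l2_norm h * red_norm h ^ n)"
    proof (intro sum_mono)
      fix i l assume "i \<in> {..<d}" "l \<in> {..<d}"
      then have il: "i < d" "l < d" by simp_all
      have "triv.l2_norm (entry i l (conv_power h n) \<odot> F l) \<le> ?R l * triv.l2_norm (entry i l (conv_power h n))"
        by (rule triv_l2_norm_conv_right[OF entry_in[OF conv_power_in[OF h(1)] il] vecsD[OF F il(2)]])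
      also have "\<dots> \<le> ?R l * (red_norm h ^ n * l2_norm h)"
        using entry_l2_le[OF conv_power_in[OF h(1)] il] l2_norm_conv_power[OF h(1), of n]
        by (intro mult_left_mono R[OF il(2)]) (rule order.trans)
      finally show "triv.l2_norm (entry i l (conv_power h n) \<odot> F l) \<le> ?R l * l2_norm h * red_norm h ^ n"
        by (simp only: mult_ac)
    qed
    also have "\<dots> = K * red_norm h ^ n" unfolding K_def by (simp only: sum_distrib_right)
    finally show ?thesis .
  qed
  have hx: "red_norm h \<le> (red_norm x)\<^sup>2"
  proof -
    have "red_norm h \<le> red_norm (inv_section x) * red_norm x"
      unfolding h_def by (rule red_norm_conv[OF inv_section_in[OF x] x])
    also have "\<dots> \<le> red_norm x * red_norm x"
      by (intro mult_right_mono red_norm_inv_section_le red_norm_nonneg x)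
    finally show ?thesis by (simp only: power2_eq_square)
  qed
  have "vnorm (act h F) \<le> red_norm h * vnorm F"
  proof (rule le_if_powers_le)
    show "vnorm (act h F) ^ Suc n \<le> K * (red_norm h * vnorm F) ^ n" for n
    proof -
      have "vnorm (act h F) ^ Suc n \<le> vnorm F ^ n * vnorm (act (conv_power h n) F)"
        by (rule vnorm_act_power[OF h F])
      also have "\<dots> \<le> vnorm F ^ n * (K * red_norm h ^ n)"
        by (intro mult_left_mono power zero_le_power vnorm_nonneg)
      finally show ?thesis by (simp only: power_mult_distrib mult_ac)
    qed
  qed (simp_all add: red_norm_nonneg h)
  also have "\<dots> \<le> (red_norm x)\<^sup>2 * vnorm F" by (intro mult_right_mono hx vnorm_nonneg)
  finally have le: "vnorm (act h F) \<le> (red_norm x)\<^sup>2 * vnorm F" .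
  have "(vnorm (act x F))\<^sup>2 \<le> vnorm F * vnorm (act h F)" unfolding h_def by (rule vnorm_act_sq_le[OF x F])
  also have "\<dots> \<le> vnorm F * ((red_norm x)\<^sup>2 * vnorm F)" by (intro mult_left_mono le vnorm_nonneg)
  also have "\<dots> = (red_norm x * vnorm F)\<^sup>2" by (simp only: power2_eq_square mult_ac)
  finally show ?thesis
    by (rule power2_le_imp_le) (intro mult_nonneg_nonneg red_norm_nonneg x vnorm_nonneg)
qed

lemma vnorm_single:
  assumes "j < d"
  shows "vnorm (\<lambda>l. if l = j then f else 0) = triv.l2_norm f"
proof -
  have z: "triv.l2_norm (0 :: 'g \<Rightarrow> complex) = 0" by (rule triv.l2.norm_zero[unfolded triv.pre_l2_simps])
  have "(\<Sum>l<d. (triv.l2_norm (if l = j then f else 0))\<^sup>2) = (\<Sum>l<d. if l = j then (triv.l2_norm f)\<^sup>2 else 0)"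
    by (rule sum.cong[OF refl], rule trans[OF if_distrib[where f = "\<lambda>f. (triv.l2_norm f)\<^sup>2"]])
       (simp only: z zero_power2)
  also have "\<dots> = (triv.l2_norm f)\<^sup>2" using assms by (simp only: sum.delta finite_lessThan lessThan_iff if_True)
  finally show ?thesis
    unfolding vnorm_def L2_set_def by (simp only: real_sqrt_abs abs_of_nonneg real_sqrt_ge_zero norm_ge_zero)
qed

text \<open>Apply \<open>act x\<close> to the vector with \<open>f\<close> in place \<open>j\<close>
  and zero elsewhere, and look at the component \<open>i\<close>.\<close>

lemma red_norm_entry_le:
  assumes x: "x \<in> S" and ij: "i < d" "j < d"
  shows "triv.red_norm (entry i j x) \<le> red_norm x"
proof (rule triv.red_norm_least[OF entry_in[OF x ij] red_norm_nonneg[OF x]])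
  fix f :: "'g \<Rightarrow> complex" assume f: "f \<in> triv.S"
  let ?F = "\<lambda>l. if l = j then f else 0"
  have F: "?F \<in> vecs" unfolding vecs_def
  proof (rule CollectI, rule allI, rule impI)
    fix k show "?F k \<in> triv.S" by (cases "k = j") (simp_all only: simp_thms if_True if_False f triv.zero_section)
  qed
  have "act x ?F i = (\<Sum>l<d. if l = j then entry i j x \<odot> f else 0)"
    unfolding act_def using ij(1)
  proof (simp only: if_True, intro sum.cong refl)
    fix l assume "l \<in> {..<d}"
    then have l: "l < d" by simp
    show "entry i l x \<odot> (if l = j then f else 0) = (if l = j then entry i j x \<odot> f else 0)"
      using triv.conv_zero_right[OF entry_in[OF x ij(1) l]] by (cases "l = j") (simp_all only: if_True if_False simp_thms)
  qed
  then have act: "act x ?F i = entry i j x \<odot> f" using ij(2) by (simp only: sum.delta finite_lessThan lessThan_iff if_True)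
  have "triv.l2_norm (act x ?F i) \<le> vnorm (act x ?F)"
    unfolding vnorm_def
    by (rule member_le_L2_set[of "{..<d}" i]) (simp_all only: ij finite_lessThan lessThan_iff)
  also have "\<dots> \<le> red_norm x * vnorm ?F" by (rule vnorm_act_le[OF x F])
  finally show "triv.l2_norm (entry i j x \<odot> f) \<le> red_norm x * triv.l2_norm f"
    unfolding act vnorm_single[OF ij(2)] .
qed

section \<open>Vectors concentrated at the neutral element\<close>

definition const_vec :: "complex Matrix.vec \<Rightarrow> nat \<Rightarrow> 'g \<Rightarrow> complex" where
  "const_vec u i = triv.delta 0 (vec_index u i)"

lemma const_vec_in: "const_vec u \<in> vecs"
  unfolding vecs_def const_vec_def
  by (rule CollectI, rule allI, rule impI, rule triv.delta_in) simp

text \<open>Sending \<open>\<xi>\<close> and \<open>w\<close> to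
  \<open>act \<xi> (const_vec w)\<close> realizes the interior tensor product of the Hilbert module
  with the space on which \<open>\<pi> 0\<close> acts: inner products of such vectors are computed
  by \<open>\<pi> 0\<close> from those of the sections.\<close>

lemma vinner_act_const_vec:
  assumes \<xi>: "\<xi> \<in> S" and \<eta>: "\<eta> \<in> S" and w: "w \<in> carrier_vec d"
  shows "vinner (act \<xi> (const_vec u)) (act \<eta> (const_vec w))
    = (\<Sum>i<d. cnj (vec_index u i) * vec_index (mult_mat_vec (\<pi> 0 (inner \<xi> \<eta>)) w) i)"
proof -
  let ?z = "inv_section \<xi> \<star> \<eta>"
  have z: "?z \<in> S" by (intro conv_in inv_section_in \<xi> \<eta>)
  have "vinner (act \<xi> (const_vec u)) (act \<eta> (const_vec w)) = vinner (const_vec u) (act ?z (const_vec w))"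
    unfolding vinner_act[OF \<xi> const_vec_in act_in[OF \<eta> const_vec_in]] act_conv[OF inv_section_in[OF \<xi>] \<eta> const_vec_in] ..
  also have "\<dots> = (\<Sum>i<d. cnj (vec_index u i) * vec_index (mult_mat_vec (\<pi> 0 (inner \<xi> \<eta>)) w) i)"
    unfolding vinner_def
  proof (rule sum.cong[OF refl])
    fix i assume "i \<in> {..<d}"
    then have i: "i < d" by simp
    have "act ?z (const_vec w) i 0 = (\<Sum>l<d. (entry i l ?z \<odot> const_vec w l) 0)"
      using i by (simp only: act_def if_True sum_fun_apply)
    also have "\<dots> = (\<Sum>l<d. \<pi> 0 (inner \<xi> \<eta>) $$ (i, l) * vec_index w l)"
    proof (rule sum.cong[OF refl])
      fix l assume "l \<in> {..<d}"
      then have l: "l < d" by simp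
      show "(entry i l ?z \<odot> const_vec w l) 0 = \<pi> 0 (inner \<xi> \<eta>) $$ (i, l) * vec_index w l"
        unfolding const_vec_def triv_conv_delta_0[OF entry_in[OF z i l]] section_inner_eq[OF \<xi> \<eta>]
        by (simp only: entry_def)
    qed
    also have "\<dots> = vec_index (mult_mat_vec (\<pi> 0 (inner \<xi> \<eta>)) w) i"
      by (rule index_mult_mat_vec_sum[symmetric, OF rep0 w i])
    finally show "triv.inner (const_vec u i) (act ?z (const_vec w) i)
        = cnj (vec_index u i) * vec_index (mult_mat_vec (\<pi> 0 (inner \<xi> \<eta>)) w) i"
      unfolding const_vec_def triv_inner_delta by (simp only:)
  qed
  finally show ?thesis .
qed

lemma vnorm_act_const_vec_le:
  assumes \<xi>: "\<xi> \<in> S" and w: "w \<in> carrier_vec d"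
  shows "vnorm (act \<xi> (const_vec w)) \<le> l2_norm \<xi> * euclid_norm w"
proof -
  let ?M = "\<pi> 0 (inner \<xi> \<xi>)"
  have Mw: "mult_mat_vec ?M w \<in> carrier_vec d" using w by (intro mult_mat_vec_carrier[OF rep0])
  have "(vnorm (act \<xi> (const_vec w)))\<^sup>2 = cmod (complex_of_real ((vnorm (act \<xi> (const_vec w)))\<^sup>2))"
    unfolding norm_of_real by simp
  also have "\<dots> = cmod (\<Sum>i<d. cnj (vec_index w i) * vec_index (mult_mat_vec ?M w) i)"
    unfolding vinner_self[symmetric] vinner_act_const_vec[OF \<xi> \<xi> w] ..
  also have "\<dots> \<le> euclid_norm w * euclid_norm (mult_mat_vec ?M w)" by (rule cmod_sum_cnj_le[OF w Mw])
  also have "\<dots> \<le> euclid_norm w * (mat_norm ?M * euclid_norm w)"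
    by (intro mult_left_mono mult_mat_vec_mat_norm_le[OF rep0 w] euclid_norm_nonneg)
  also have "\<dots> \<le> euclid_norm w * ((l2_norm \<xi>)\<^sup>2 * euclid_norm w)"
    unfolding l2_norm_sq by (intro mult_left_mono mult_right_mono rep_contractive euclid_norm_nonneg)
  also have "\<dots> = (l2_norm \<xi> * euclid_norm w)\<^sup>2" by (simp only: power2_eq_square mult_ac)
  finally show ?thesis by (rule power2_le_imp_le) simp
qed

text \<open>With \<open>M = \<pi> 0 (inner \<eta> \<eta>)\<close> the squared length of
  \<open>u = M w\<close> is an inner product of the vectors belonging to \<open>u\<close> and
  \<open>w\<close>. The hypothesis is used for both, and one factor cancels.\<close>

lemma mat_norm_rep_inner_le:
  assumes \<eta>: "\<eta> \<in> S" and C: "0 \<le> C"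
    and le: "\<And>w. w \<in> carrier_vec d \<Longrightarrow> vnorm (act \<eta> (const_vec w)) \<le> C * euclid_norm w"
  shows "mat_norm (\<pi> 0 (inner \<eta> \<eta>)) \<le> C\<^sup>2"
proof (rule mat_norm_leI[OF rep0])
  let ?M = "\<pi> 0 (inner \<eta> \<eta>)"
  fix w :: "complex Matrix.vec" assume w: "w \<in> carrier_vec d"
  define u where "u = mult_mat_vec ?M w"
  have u: "u \<in> carrier_vec d" unfolding u_def using w by (intro mult_mat_vec_carrier[OF rep0])
  have "complex_of_real ((euclid_norm u)\<^sup>2) = (\<Sum>i<d. complex_of_real ((cmod (vec_index u i))\<^sup>2))"
    unfolding euclid_norm_sq[OF u] by (simp only: of_real_sum)
  also have "\<dots> = (\<Sum>i<d. cnj (vec_index u i) * vec_index u i)"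
    by (rule sum.cong[OF refl]) (simp add: complex_norm_square mult.commute del: of_real_power)
  also have "\<dots> = vinner (act \<eta> (const_vec u)) (act \<eta> (const_vec w))"
    unfolding vinner_act_const_vec[OF \<eta> \<eta> w] by (simp only: u_def)
  finally have "cmod (complex_of_real ((euclid_norm u)\<^sup>2)) = cmod (vinner (act \<eta> (const_vec u)) (act \<eta> (const_vec w)))"
    by (rule arg_cong)
  then have "(euclid_norm u)\<^sup>2 = cmod (vinner (act \<eta> (const_vec u)) (act \<eta> (const_vec w)))"
    unfolding norm_of_real by simp
  also have "\<dots> \<le> vnorm (act \<eta> (const_vec u)) * vnorm (act \<eta> (const_vec w))"
    by (intro vinner_le act_in \<eta> const_vec_in)
  also have "\<dots> \<le> (C * euclid_norm u) * (C * euclid_norm w)"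
    by (intro mult_mono le u w vnorm_nonneg mult_nonneg_nonneg C euclid_norm_nonneg)
  finally have sq: "euclid_norm u * euclid_norm u \<le> (C\<^sup>2 * euclid_norm w) * euclid_norm u"
    by (simp only: power2_eq_square mult_ac)
  show "euclid_norm (mult_mat_vec ?M w) \<le> C\<^sup>2 * euclid_norm w"
  proof (cases "euclid_norm u = 0")
    case True
    then show ?thesis by (simp add: u_def)
  next
    case False
    then have "0 < euclid_norm u" using euclid_norm_nonneg[of u] by linarith
    then show ?thesis unfolding u_def[symmetric] by (rule mult_right_le_imp_le[OF sq])
  qed
qed simp

lemma sum_red_norm_entry_ge:
  assumes x: "x \<in> S" and \<xi>: "\<xi> \<in> S" and c: "0 < c"
    and large: "(c * l2_norm \<xi>)\<^sup>2 < mat_norm (\<pi> 0 (inner (x \<star> \<xi>) (x \<star> \<xi>)))"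
  shows "(c\<^sup>2) ^ Suc n \<le> (\<Sum>i<d. \<Sum>l<d. triv.red_norm (entry i l (conv_power (inv_section x \<star> x) n)))"
proof -
  have "\<exists>F\<in>vecs. vnorm (act x F) > c * vnorm F"
  proof (rule ccontr)
    assume "\<not> (\<exists>F\<in>vecs. vnorm (act x F) > c * vnorm F)"
    then have le: "vnorm (act x F) \<le> c * vnorm F" if "F \<in> vecs" for F using that by (meson not_le)
    \<comment> \<open>It suffices to test vectors of the form
      \<open>act \<xi> (const_vec w)\<close>: a bound \<open>c\<close> for \<open>act x\<close> on
      them would bound the matrix of \<open>x \<star> \<xi>\<close> and contradict
      \<open>large\<close>.\<close>
    have "mat_norm (\<pi> 0 (inner (x \<star> \<xi>) (x \<star> \<xi>))) \<le> (c * l2_norm \<xi>)\<^sup>2"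
    proof (rule mat_norm_rep_inner_le[OF conv_in[OF x \<xi>]])
      show "0 \<le> c * l2_norm \<xi>" using c by simp
      fix w :: "complex Matrix.vec" assume w: "w \<in> carrier_vec d"
      have "vnorm (act (x \<star> \<xi>) (const_vec w)) \<le> c * vnorm (act \<xi> (const_vec w))"
        unfolding act_conv[OF x \<xi> const_vec_in] by (rule le[OF act_in[OF \<xi> const_vec_in]])
      also have "\<dots> \<le> c * (l2_norm \<xi> * euclid_norm w)"
        using c by (intro mult_left_mono vnorm_act_const_vec_le[OF \<xi> w]) simp
      finally show "vnorm (act (x \<star> \<xi>) (const_vec w)) \<le> c * l2_norm \<xi> * euclid_norm w"
        by (simp only: mult.assoc)
    qed
    then show False using large by simp
  qed
  then obtain F where F: "F \<in> vecs" "vnorm (act x F) > c * vnorm F" by blast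
  define h where "h = inv_section x \<star> x"
  have h: "h \<in> S" "inv_section h = h" unfolding h_def by (rule square_in[OF x], rule inv_section_square[OF x])
  define P where "P = conv_power h n"
  have P: "P \<in> S" unfolding P_def by (rule conv_power_in[OF h(1)])
  have "vnorm F \<noteq> 0"
  proof
    assume "vnorm F = 0"
    then show False using F(2) vnorm_act_le[OF x F(1)] by simp
  qed
  then have pos: "0 < vnorm F" using vnorm_nonneg[of F] by linarith
  have "(c * vnorm F)\<^sup>2 \<le> (vnorm (act x F))\<^sup>2" using F(2) c by (intro power_mono) auto
  also have "\<dots> \<le> vnorm F * vnorm (act h F)" unfolding h_def by (rule vnorm_act_sq_le[OF x F(1)])
  finally have "vnorm F * (c\<^sup>2 * vnorm F) \<le> vnorm F * vnorm (act h F)" by (simp only: power2_eq_square mult_ac)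
  then have ge: "c\<^sup>2 * vnorm F \<le> vnorm (act h F)" using pos by simp
  \<comment> \<open>The growth of the powers on the single vector \<open>F\<close> must be visible
    in the entries, because \<open>act P F\<close> is bounded by the sum of their reduced norms
    times \<open>vnorm F\<close>.\<close>
  have "vnorm (act P F) \<le> (\<Sum>i<d. \<Sum>l<d. triv.l2_norm (entry i l P \<odot> F l))"
    by (rule vnorm_act_le_sum[OF P F(1)])
  also have "\<dots> \<le> (\<Sum>i<d. \<Sum>l<d. triv.red_norm (entry i l P) * vnorm F)"
  proof (intro sum_mono)
    fix i l assume "i \<in> {..<d}" "l \<in> {..<d}"
    then have il: "i < d" "l < d" by simp_all
    have "triv.l2_norm (entry i l P \<odot> F l) \<le> triv.red_norm (entry i l P) * triv.l2_norm (F l)"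
      by (rule triv.red_norm_bound[OF entry_in[OF P il] vecsD[OF F(1) il(2)]])
    also have "triv.l2_norm (F l) \<le> vnorm F"
      unfolding vnorm_def
      by (rule member_le_L2_set[of "{..<d}" l]) (simp_all only: il finite_lessThan lessThan_iff)
    finally show "triv.l2_norm (entry i l P \<odot> F l) \<le> triv.red_norm (entry i l P) * vnorm F"
      by (simp add: mult_left_mono triv.red_norm_nonneg[OF entry_in[OF P il]])
  qed
  also have "\<dots> = (\<Sum>i<d. \<Sum>l<d. triv.red_norm (entry i l P)) * vnorm F" by (simp only: sum_distrib_right)
  finally have upper: "vnorm (act P F) \<le> (\<Sum>i<d. \<Sum>l<d. triv.red_norm (entry i l P)) * vnorm F" .
  have "(c\<^sup>2 * vnorm F) ^ Suc n \<le> vnorm (act h F) ^ Suc n" by (rule power_mono[OF ge]) simp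
  also have "\<dots> \<le> vnorm F ^ n * vnorm (act P F)" unfolding P_def by (rule vnorm_act_power[OF h F(1)])
  also have "\<dots> \<le> vnorm F ^ n * ((\<Sum>i<d. \<Sum>l<d. triv.red_norm (entry i l P)) * vnorm F)"
    by (intro mult_left_mono upper zero_le_power vnorm_nonneg)
  finally have "vnorm F ^ Suc n * (c\<^sup>2) ^ Suc n
      \<le> vnorm F ^ Suc n * (\<Sum>i<d. \<Sum>l<d. triv.red_norm (entry i l P))"
    by (simp only: power_mult_distrib power_Suc mult_ac)
  then show ?thesis using pos unfolding P_def h_def by (simp only: mult_le_cancel_left_pos zero_less_power)
qed

section \<open>Applying a representation of the group algebra entrywise\<close>

context
  fixes k :: nat and \<psi> :: "(nat \<Rightarrow> 'g \<Rightarrow> complex) set \<Rightarrow> complex mat"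
  assumes hom: "star_hom_mat (star_completion (section_algebra (trivial_bundle :: ('g, complex) fell_bundle))) k \<psi>"
    and k: "0 < k"
begin

lemmas hom_simps = triv.alg.hom_embed_carrier[OF hom, unfolded triv.section_algebra_simps]
    triv.alg.hom_embed_add[OF hom, unfolded triv.section_algebra_simps]
    triv.alg.hom_embed_scale[OF hom, unfolded triv.section_algebra_simps]
    triv.alg.hom_embed_mult[OF hom, unfolded triv.section_algebra_simps]
    triv.alg.hom_embed_star[OF hom, unfolded triv.section_algebra_simps]

text \<open>The amplification of \<open>\<psi>\<close> to \<open>d\<close> by \<open>d\<close>
  matrices, composed with the matrix of entries.\<close>

definition block_rep :: "('g \<Rightarrow> 'a) \<Rightarrow> complex mat" where
  "block_rep x = block_mat d k (\<lambda>i j. \<psi> (triv.alg.embed (entry i j x)))"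

lemma entry_hom: "x \<in> S \<Longrightarrow> i < d \<Longrightarrow> j < d \<Longrightarrow> \<psi> (triv.alg.embed (entry i j x)) \<in> carrier_mat k k"
  by (intro hom_simps entry_in)

lemma hom_sum_index:
  assumes ab: "a < k" "b < k"
  shows "(\<And>l. l \<in> I \<Longrightarrow> f l \<in> triv.S) \<Longrightarrow>
    \<psi> (triv.alg.embed (\<Sum>l\<in>I. f l)) $$ (a, b) = (\<Sum>l\<in>I. \<psi> (triv.alg.embed (f l)) $$ (a, b))"
proof (induction I rule: infinite_finite_induct)
  case (insert l I)
  have s: "sum f I \<in> triv.S" by (rule triv.sum_section) (simp only: insert.prems insertI2)
  have l: "f l \<in> triv.S" by (simp only: insert.prems insertI1)
  have IH: "\<psi> (triv.alg.embed (sum f I)) $$ (a, b) = (\<Sum>l\<in>I. \<psi> (triv.alg.embed (f l)) $$ (a, b))"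
    by (rule insert.IH) (simp only: insert.prems insertI2)
  have "\<psi> (triv.alg.embed (f l + sum f I)) $$ (a, b) = \<psi> (triv.alg.embed (f l)) $$ (a, b) + \<psi> (triv.alg.embed (sum f I)) $$ (a, b)"
    unfolding hom_simps(2)[OF l s] using carrier_matD[OF hom_simps(1)[OF s]] ab by simp
  then show ?case unfolding sum.insert[OF insert.hyps] IH .
next
  have z: "0 \<in> triv.S" by (rule triv.zero_section)
  have "\<psi> (triv.alg.embed (0 + 0)) $$ (a, b) = \<psi> (triv.alg.embed 0) $$ (a, b) + \<psi> (triv.alg.embed 0) $$ (a, b)"
    unfolding hom_simps(2)[OF z z] using carrier_matD[OF hom_simps(1)[OF z]] ab by simp
  then have zero: "\<psi> (triv.alg.embed 0) $$ (a, b) = 0" by simp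
  {
    case empty
    show ?case unfolding sum.empty zero ..
  next
    case (infinite A)
    show ?case unfolding sum.infinite[OF infinite(1)] zero ..
  }
qed

lemma block_rep_add:
  assumes "x \<in> S" "y \<in> S" shows "block_rep (x + y) = block_rep x + block_rep y"
  unfolding block_rep_def
proof (rule block_mat_eqI)
  fix I J assume I: "I < d * k" and J: "J < d * k"
  note b = block_index[OF I] block_index[OF J]
  show "\<psi> (triv.alg.embed (entry (I div k) (J div k) (x + y))) $$ (I mod k, J mod k)
      = (block_mat d k (\<lambda>i j. \<psi> (triv.alg.embed (entry i j x))) + block_mat d k (\<lambda>i j. \<psi> (triv.alg.embed (entry i j y)))) $$ (I, J)"
    unfolding entry_add[OF assms b(1,3)] hom_simps(2)[OF entry_in[OF assms(1) b(1,3)] entry_in[OF assms(2) b(1,3)]]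
    using carrier_matD[OF entry_hom[OF assms(2) b(1,3)]] b I J by (simp add: block_mat_index)
qed simp

lemma block_rep_scale:
  assumes "x \<in> S" shows "block_rep (scale_section c x) = c \<cdot>\<^sub>m block_rep x"
  unfolding block_rep_def
proof (rule block_mat_eqI)
  fix I J assume I: "I < d * k" and J: "J < d * k"
  note b = block_index[OF I] block_index[OF J]
  show "\<psi> (triv.alg.embed (entry (I div k) (J div k) (scale_section c x))) $$ (I mod k, J mod k)
      = (c \<cdot>\<^sub>m block_mat d k (\<lambda>i j. \<psi> (triv.alg.embed (entry i j x)))) $$ (I, J)"
    unfolding entry_scale[OF assms b(1,3)] hom_simps(3)[OF entry_in[OF assms(1) b(1,3)]]
    using carrier_matD[OF entry_hom[OF assms(1) b(1,3)]] b I J by (simp add: block_mat_index)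
qed simp

lemma block_rep_star:
  assumes "x \<in> S" shows "block_rep (inv_section x) = mat_adjoint (block_rep x)"
  unfolding block_rep_def
proof (rule block_mat_eqI)
  fix I J assume I: "I < d * k" and J: "J < d * k"
  note b = block_index[OF I] block_index[OF J]
  show "\<psi> (triv.alg.embed (entry (I div k) (J div k) (inv_section x))) $$ (I mod k, J mod k)
      = mat_adjoint (block_mat d k (\<lambda>i j. \<psi> (triv.alg.embed (entry i j x)))) $$ (I, J)"
    unfolding entry_inv_section[OF assms b(1,3)] hom_simps(5)[OF entry_in[OF assms(1) b(3,1)]]
    using carrier_matD[OF entry_hom[OF assms(1) b(3,1)]] b I J by (simp add: block_mat_index)
qed simp

lemma block_rep_conv:
  assumes x: "x \<in> S" and y: "y \<in> S" shows "block_rep (x \<star> y) = block_rep x * block_rep y"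
  unfolding block_rep_def
proof (rule block_mat_mult)
  fix i j assume ij: "i < d" "j < d"
  show "\<psi> (triv.alg.embed (entry i j x)) \<in> carrier_mat k k" by (rule entry_hom[OF x ij])
  show "\<psi> (triv.alg.embed (entry i j y)) \<in> carrier_mat k k" by (rule entry_hom[OF y ij])
  fix a b assume ab: "a < k" "b < k"
  have "\<psi> (triv.alg.embed (entry i j (x \<star> y))) $$ (a, b)
      = (\<Sum>l<d. \<psi> (triv.alg.embed (entry i l x \<odot> entry l j y)) $$ (a, b))"
    unfolding entry_conv[OF x y ij]
    by (rule hom_sum_index[OF ab]) (use ij x y in \<open>simp_all only: triv.conv_in entry_in lessThan_iff\<close>)
  also have "\<dots> = (\<Sum>l<d. (\<psi> (triv.alg.embed (entry i l x)) * \<psi> (triv.alg.embed (entry l j y))) $$ (a, b))"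
    by (rule sum.cong[OF refl]) (use ij x y in \<open>simp_all only: hom_simps(4) entry_in lessThan_iff\<close>)
  finally show "\<psi> (triv.alg.embed (entry i j (x \<star> y))) $$ (a, b)
      = (\<Sum>l<d. (\<psi> (triv.alg.embed (entry i l x)) * \<psi> (triv.alg.embed (entry l j y))) $$ (a, b))" .
qed

lemma block_rep_hom: "star_hom_mat (section_algebra (action_bundle D \<alpha>)) (d * k) block_rep"
  unfolding star_hom_mat_def section_algebra_simps
proof (intro conjI ballI allI)
  fix x y c assume x: "x \<in> S"
  show "block_rep x \<in> carrier_mat (d * k) (d * k)" by (simp add: block_rep_def)
  show "block_rep (scale_section c x) = c \<cdot>\<^sub>m block_rep x" by (rule block_rep_scale[OF x])
  show "block_rep (inv_section x) = mat_adjoint (block_rep x)" by (rule block_rep_star[OF x])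
  assume y: "y \<in> S"
  show "block_rep (x + y) = block_rep x + block_rep y" by (rule block_rep_add[OF x y])
  show "block_rep (x \<star> y) = block_rep x * block_rep y" by (rule block_rep_conv[OF x y])
qed

lemma block_rep_bounded:
  assumes x: "x \<in> S" shows "mat_norm (block_rep x) \<le> (real (d * k))\<^sup>2 * red_norm x"
  unfolding block_rep_def
proof (rule mat_norm_block_le_sum, rule conjI)
  fix i j assume ij: "i < d" "j < d"
  show "\<psi> (triv.alg.embed (entry i j x)) \<in> carrier_mat k k" by (rule entry_hom[OF x ij])
  have "mat_norm (\<psi> (triv.alg.embed (entry i j x))) \<le> triv.red_norm (entry i j x)"
    by (rule triv.alg.hom_embed_contractive[OF hom k, unfolded triv.section_algebra_simps, OF entry_in[OF x ij]])
  also have "\<dots> \<le> red_norm x" by (rule red_norm_entry_le[OF x ij])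
  finally show "mat_norm (\<psi> (triv.alg.embed (entry i j x))) \<le> red_norm x" .
qed

lemma mat_norm_block_rep_power:
  assumes x: "x \<in> S"
  shows "mat_norm (block_rep (conv_power (inv_section x \<star> x) n)) \<le> ((mat_norm (block_rep x))\<^sup>2) ^ Suc n"
proof -
  let ?h = "inv_section x \<star> x"
  have h: "?h \<in> S" by (rule square_in[OF x])
  have c: "block_rep y \<in> carrier_mat (d * k) (d * k)" for y by (simp add: block_rep_def)
  have "mat_norm (block_rep ?h) \<le> mat_norm (mat_adjoint (block_rep x)) * mat_norm (block_rep x)"
    unfolding block_rep_conv[OF inv_section_in[OF x] x] block_rep_star[OF x]
    by (rule mat_norm_mult[OF mat_adjoint_carrier[OF c] c])
  then have le: "mat_norm (block_rep ?h) \<le> (mat_norm (block_rep x))\<^sup>2"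
    unfolding mat_norm_adjoint[OF c] by (simp only: power2_eq_square)
  show ?thesis
  proof (induction n)
    case (Suc n)
    have "mat_norm (block_rep (conv_power ?h (Suc n))) \<le> mat_norm (block_rep ?h) * mat_norm (block_rep (conv_power ?h n))"
      unfolding conv_power.simps block_rep_conv[OF h conv_power_in[OF h]] by (rule mat_norm_mult[OF c c])
    also have "\<dots> \<le> (mat_norm (block_rep x))\<^sup>2 * ((mat_norm (block_rep x))\<^sup>2) ^ Suc n"
      by (intro mult_mono le Suc) simp_all
    finally show ?case by (simp only: power_Suc)
  qed (use le in simp)
qed

text \<open>Every entry of the image of the power is at most the norm of the whole block matrix, and
  there are \<open>d\<close> times \<open>d\<close> entries. The error \<open>\<delta>\<close> is so
  small that all of them together cost at most half of the left side; this is the origin of the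
  factor 2.\<close>

lemma mat_norm_block_rep_ge:
  assumes x: "x \<in> S" and \<xi>: "\<xi> \<in> S" and c: "0 < c"
    and large: "(c * l2_norm \<xi>)\<^sup>2 < mat_norm (\<pi> 0 (inner (x \<star> \<xi>) (x \<star> \<xi>)))"
    and near: "\<And>i l. i < d \<Longrightarrow> l < d \<Longrightarrow> triv.red_norm (entry i l (conv_power (inv_section x \<star> x) n)) - \<delta>
      \<le> mat_norm (\<psi> (triv.alg.embed (entry i l (conv_power (inv_section x \<star> x) n))))"
    and \<delta>: "\<delta> * (2 * (real d)\<^sup>2) \<le> (c\<^sup>2) ^ Suc n"
  shows "(c\<^sup>2) ^ Suc n \<le> 2 * (real d)\<^sup>2 * ((mat_norm (block_rep x))\<^sup>2) ^ Suc n"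
proof -
  let ?P = "conv_power (inv_section x \<star> x) n"
  have P: "?P \<in> S" by (rule conv_power_in[OF square_in[OF x]])
  have "(c\<^sup>2) ^ Suc n \<le> (\<Sum>i<d. \<Sum>l<d. triv.red_norm (entry i l ?P))"
    by (rule sum_red_norm_entry_ge[OF x \<xi> c large])
  also have "\<dots> \<le> (\<Sum>i<d. \<Sum>l<d. ((mat_norm (block_rep x))\<^sup>2) ^ Suc n + \<delta>)"
  proof (intro sum_mono)
    fix i l assume "i \<in> {..<d}" "l \<in> {..<d}"
    then have il: "i < d" "l < d" by simp_all
    have "triv.red_norm (entry i l ?P) - \<delta> \<le> mat_norm (\<psi> (triv.alg.embed (entry i l ?P)))" by (rule near[OF il])
    also have "\<dots> \<le> mat_norm (block_rep ?P)"
      unfolding block_rep_def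
      by (rule mat_norm_block_le[where M = "\<lambda>i j. \<psi> (triv.alg.embed (entry i j ?P))", OF entry_hom[OF P il] il])
    also have "\<dots> \<le> ((mat_norm (block_rep x))\<^sup>2) ^ Suc n" by (rule mat_norm_block_rep_power[OF x])
    finally show "triv.red_norm (entry i l ?P) \<le> ((mat_norm (block_rep x))\<^sup>2) ^ Suc n + \<delta>" by simp
  qed
  also have "\<dots> = (real d)\<^sup>2 * ((mat_norm (block_rep x))\<^sup>2) ^ Suc n + (real d)\<^sup>2 * \<delta>"
    by (simp only: sum_constant card_lessThan power2_eq_square distrib_left mult.assoc)
  finally show ?thesis using \<delta> by (simp add: algebra_simps)
qed

end

end

section \<open>From the action to the crossed product\<close>

context partial_system
begin

lemma rfd_crossed_product_if_rfd_action:
  assumes act: "rfd_action D \<alpha>"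
    and grp: "rfd_algebra (reduced_group_algebra :: (nat \<Rightarrow> 'g \<Rightarrow> complex) set star_alg)"
  shows "rfd_algebra (reduced_crossed_product D \<alpha>)"
  unfolding reduced_crossed_product_def reduced_bundle_algebra_def
proof (rule alg.rfd_star_completionI, unfold section_algebra_simps)
  fix e :: real and \<Omega> :: "('g \<Rightarrow> 'a) set"
  assume e: "0 < e" and fin: "finite \<Omega>" and \<Omega>: "\<Omega> \<subseteq> S"
  \<comment> \<open>Elements of norm at most \<open>e\<close> satisfy the estimate trivially. For
    the others \<open>b x\<close> is positive, as the quotient of \<open>c x\<close> and
    \<open>b x\<close> below requires.\<close>
  define \<Omega>' where "\<Omega>' = {x \<in> \<Omega>. e < red_norm x}"
  have fin': "finite \<Omega>'" unfolding \<Omega>'_def using fin by simp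
  have xS: "x \<in> S" if "x \<in> \<Omega>'" for x using that \<Omega> unfolding \<Omega>'_def by blast
  \<comment> \<open>The goal is the bound \<open>b x\<close>. The number \<open>c x\<close>,
    strictly between it and the reduced norm, is reached by the representation of the bundle; the
    gap between the two then absorbs the factor \<open>2 d^2\<close> in a high power.\<close>
  define c where "c x = red_norm x - e / 2" for x
  define b where "b x = red_norm x - e" for x
  have b: "0 < b x" "b x < c x" if "x \<in> \<Omega>'" for x using that e unfolding \<Omega>'_def b_def c_def by simp_all
  have c: "0 < c x" if "x \<in> \<Omega>'" for x using b[OF that] by simp
  \<comment> \<open>Since \<open>c x\<close> is below the reduced norm, it cannot be a bound on
    finitely supported vectors. These vectors are fixed before \<open>\<pi>\<close>, which has to
    respect the inner products \<open>p x\<close> formed from them.\<close>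
  have "\<forall>x\<in>\<Omega>'. \<exists>\<xi>. \<xi> \<in> S \<and> c x * l2_norm \<xi> < l2_norm (x \<star> \<xi>)"
  proof (rule ballI, rule ccontr)
    fix x assume x: "x \<in> \<Omega>'" and neg: "\<not> (\<exists>\<xi>. \<xi> \<in> S \<and> c x * l2_norm \<xi> < l2_norm (x \<star> \<xi>))"
    have "red_norm x \<le> c x"
    proof (rule red_norm_least[OF xS[OF x] less_imp_le[OF c[OF x]]])
      show "l2_norm (x \<star> \<xi>) \<le> c x * l2_norm \<xi>" if "\<xi> \<in> S" for \<xi>
        using neg that by (meson not_le)
    qed
    then show False using e unfolding c_def by simp
  qed
  from bchoice[OF this] obtain \<xi> where "\<forall>x\<in>\<Omega>'. \<xi> x \<in> S \<and> c x * l2_norm (\<xi> x) < l2_norm (x \<star> \<xi> x)" ..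
  then have \<xi>: "\<xi> x \<in> S" "c x * l2_norm (\<xi> x) < l2_norm (x \<star> \<xi> x)" if "x \<in> \<Omega>'" for x
    using that by blast+
  define p where "p x = inner (x \<star> \<xi> x) (x \<star> \<xi> x)" for x
  \<comment> \<open>Half of the strict inequality for \<open>\<xi> x\<close> is the loss that
    \<open>\<pi> 0\<close> may cause at \<open>p x\<close>; the other half keeps the inequality
    strict.\<close>
  have gap: "0 < (norm (p x) - (c x * l2_norm (\<xi> x))\<^sup>2) / 2" if x: "x \<in> \<Omega>'" for x
  proof -
    have "0 \<le> c x * l2_norm (\<xi> x)" using c[OF x] by (intro mult_nonneg_nonneg) simp_all
    then have "(c x * l2_norm (\<xi> x))\<^sup>2 < (l2_norm (x \<star> \<xi> x))\<^sup>2"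
      using \<xi>(2)[OF x] by (intro power_strict_mono) simp_all
    then show ?thesis unfolding p_def l2_norm_sq by simp
  qed
  have "\<forall>x\<in>\<Omega>'. 0 < (norm (p x) - (c x * l2_norm (\<xi> x))\<^sup>2) / 2" by (rule ballI) (rule gap)
  from finite_pos_lower_bound[OF fin' this]
  obtain \<epsilon> where \<epsilon>: "0 < \<epsilon>" "\<forall>x\<in>\<Omega>'. \<epsilon> \<le> (norm (p x) - (c x * l2_norm (\<xi> x))\<^sup>2) / 2"
    by blast
  have "finite ((\<lambda>x. (0, p x)) ` \<Omega>') \<and> (\<lambda>x. (0, p x)) ` \<Omega>' \<subseteq> Sigma UNIV (fibre (action_bundle D \<alpha>))"
    using fin' by auto
  from act[unfolded rfd_action_iff_rfd_bundle rfd_bundle_def, rule_format, OF \<epsilon>(1) this]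
  obtain d \<pi> where d: "0 < d" and rep: "bundle_rep (action_bundle D \<alpha>) d \<pi>"
    and ge0: "\<forall>(t, a)\<in>(\<lambda>x. (0, p x)) ` \<Omega>'. norm a - \<epsilon> \<le> mat_norm (\<pi> t a)"
    by blast
  interpret R: partial_system_rep D \<alpha> d \<pi> by unfold_locales (rule rep)
  have large: "(c x * l2_norm (\<xi> x))\<^sup>2 < mat_norm (\<pi> 0 (inner (x \<star> \<xi> x) (x \<star> \<xi> x)))" if x: "x \<in> \<Omega>'" for x
  proof -
    have "norm (p x) - \<epsilon> \<le> mat_norm (\<pi> 0 (p x))" using ge0 x by simp
    then show ?thesis using bspec[OF \<epsilon>(2) x] gap[OF x] unfolding p_def[symmetric] by simp
  qed
  \<comment> \<open>Only now is \<open>d\<close> known. As \<open>c x\<close> exceeds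
    \<open>b x\<close>, a high power of their quotient exceeds \<open>2 d^2\<close>.\<close>
  have "\<forall>x\<in>\<Omega>'. \<exists>n. 2 * (real d)\<^sup>2 * ((b x)\<^sup>2) ^ Suc n < ((c x)\<^sup>2) ^ Suc n"
  proof
    fix x assume x: "x \<in> \<Omega>'"
    let ?q = "(c x)\<^sup>2 / (b x)\<^sup>2"
    have "(b x)\<^sup>2 < (c x)\<^sup>2" using b[OF x] by (intro power_strict_mono) simp_all
    then have q: "1 < ?q" using b[OF x] by simp
    from real_arch_pow[OF q] obtain n where "2 * (real d)\<^sup>2 < ?q ^ n" by blast
    also have "\<dots> \<le> ?q ^ Suc n" using q by (intro power_increasing) simp_all
    finally have "2 * (real d)\<^sup>2 * ((b x)\<^sup>2) ^ Suc n < ?q ^ Suc n * ((b x)\<^sup>2) ^ Suc n"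
      using b[OF x] by (intro mult_strict_right_mono) simp_all
    also have "\<dots> = ((c x)\<^sup>2) ^ Suc n" unfolding power_mult_distrib[symmetric] using b[OF x] by simp
    finally show "\<exists>n. 2 * (real d)\<^sup>2 * ((b x)\<^sup>2) ^ Suc n < ((c x)\<^sup>2) ^ Suc n" ..
  qed
  from bchoice[OF this] obtain n where "\<forall>x\<in>\<Omega>'. 2 * (real d)\<^sup>2 * ((b x)\<^sup>2) ^ Suc (n x) < ((c x)\<^sup>2) ^ Suc (n x)" ..
  then have n: "2 * (real d)\<^sup>2 * ((b x)\<^sup>2) ^ Suc (n x) < ((c x)\<^sup>2) ^ Suc (n x)" if "x \<in> \<Omega>'" for x
    using that by blast
  \<comment> \<open>One tolerance for all entries of all the chosen powers: the hypothesis on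
    \<open>\<delta>\<close> in \<open>mat_norm_block_rep_ge\<close>, solved for
    \<open>\<delta>\<close>.\<close>
  have "\<forall>x\<in>\<Omega>'. 0 < ((c x)\<^sup>2) ^ Suc (n x) / (2 * (real d)\<^sup>2)"
  proof (rule ballI)
    fix x assume "x \<in> \<Omega>'"
    from c[OF this] show "0 < ((c x)\<^sup>2) ^ Suc (n x) / (2 * (real d)\<^sup>2)" using d by simp
  qed
  from finite_pos_lower_bound[OF fin' this]
  obtain \<delta> where \<delta>: "0 < \<delta>" "\<forall>x\<in>\<Omega>'. \<delta> \<le> ((c x)\<^sup>2) ^ Suc (n x) / (2 * (real d)\<^sup>2)" by blast
  define P where "P x = conv_power (inv_section x \<star> x) (n x)" for x
  have P: "P x \<in> S" if "x \<in> \<Omega>'" for x unfolding P_def by (rule conv_power_in[OF square_in[OF xS[OF that]]])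
  let ?A = "star_completion (section_algebra (trivial_bundle :: ('g, complex) fell_bundle))"
  let ?E = "\<lambda>(x, i, l). triv.alg.embed (R.entry i l (P x))"
  let ?I = "\<Omega>' \<times> {..<d} \<times> {..<d}"
  have "?E q \<in> nv_carrier ?A" if "q \<in> ?I" for q
  proof -
    obtain x i l where q: "q = (x, i, l)" by (cases q)
    then have "R.entry i l (P x) \<in> triv.S" using that by (intro R.entry_in P) simp_all
    then have "triv.alg.embed (R.entry i l (P x)) \<in> nv_carrier ?A"
      unfolding triv.alg.star_completion_simps triv.alg.completion_carrier
      by (intro imageI triv.alg.cauchy_const[unfolded triv.section_algebra_simps])
    then show ?thesis unfolding q by simp
  qed
  then have "?E ` ?I \<subseteq> nv_carrier ?A" by (rule image_subsetI)
  then have "finite (?E ` ?I) \<and> ?E ` ?I \<subseteq> nv_carrier ?A" using fin' by simp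
  from grp[unfolded reduced_group_algebra_def group_algebra_eq rfd_algebra_def, rule_format, OF \<delta>(1) this]
  obtain k \<psi> where k: "0 < k" and hom: "star_hom_mat ?A k \<psi>"
    and ge: "\<forall>a\<in>?E ` ?I. nv_norm ?A a - \<delta> \<le> mat_norm (\<psi> a)"
    by blast
  have "red_norm x - e \<le> mat_norm (R.block_rep k \<psi> x)" if x: "x \<in> \<Omega>" for x
  proof (cases "x \<in> \<Omega>'")
    case False
    then have "red_norm x \<le> e" using x by (simp add: \<Omega>'_def)
    then show ?thesis using mat_norm_nonneg[of "R.block_rep k \<psi> x"] by linarith
  next
    case True
    have main: "((c x)\<^sup>2) ^ Suc (n x) \<le> 2 * (real d)\<^sup>2 * ((mat_norm (R.block_rep k \<psi> x))\<^sup>2) ^ Suc (n x)"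
    proof (rule R.mat_norm_block_rep_ge[where n = "n x" and \<delta> = \<delta>, OF hom k xS[OF True] \<xi>(1)[OF True] c[OF True] large[OF True], folded P_def])
      fix i l assume il: "i < d" "l < d"
      then have "?E (x, i, l) \<in> ?E ` ?I" using True by (intro imageI) simp
      from bspec[OF ge this]
      have "nv_norm ?A (triv.alg.embed (R.entry i l (P x))) - \<delta> \<le> mat_norm (\<psi> (triv.alg.embed (R.entry i l (P x))))" by simp
      moreover have "nv_norm ?A (triv.alg.embed (R.entry i l (P x))) = triv.red_norm (R.entry i l (P x))"
        using triv.alg.completion_norm_const[unfolded triv.section_algebra_simps, OF R.entry_in[OF P[OF True] il]]
        by (simp only: triv.alg.star_completion_simps)
      ultimately show "triv.red_norm (R.entry i l (P x)) - \<delta> \<le> mat_norm (\<psi> (triv.alg.embed (R.entry i l (P x))))"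
        by (simp only:)
    next
      show "\<delta> * (2 * (real d)\<^sup>2) \<le> ((c x)\<^sup>2) ^ Suc (n x)"
        using bspec[OF \<delta>(2) True] d by (simp only: pos_le_divide_eq zero_less_mult_iff zero_less_power of_nat_0_less_iff zero_less_numeral simp_thms)
    qed
    \<comment> \<open>If the block matrix had norm below \<open>b x\<close>, then
      \<open>main\<close> would bound the power of \<open>c x\<close> by \<open>2 d^2\<close> times
      that of \<open>b x\<close>, against the choice of \<open>n x\<close>.\<close>
    have "b x \<le> mat_norm (R.block_rep k \<psi> x)"
    proof (rule ccontr)
      assume "\<not> b x \<le> mat_norm (R.block_rep k \<psi> x)"
      then have "((mat_norm (R.block_rep k \<psi> x))\<^sup>2) ^ Suc (n x) \<le> ((b x)\<^sup>2) ^ Suc (n x)"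
        by (intro power_mono) simp_all
      then have "2 * (real d)\<^sup>2 * ((mat_norm (R.block_rep k \<psi> x))\<^sup>2) ^ Suc (n x) \<le> 2 * (real d)\<^sup>2 * ((b x)\<^sup>2) ^ Suc (n x)"
        by (intro mult_left_mono) simp_all
      then show False using main n[OF True] by linarith
    qed
    then show ?thesis by (simp only: b_def)
  qed
  moreover have "star_hom_mat (section_algebra (action_bundle D \<alpha>)) (d * k) (R.block_rep k \<psi>)"
    by (rule R.block_rep_hom[OF hom k])
  moreover have "mat_norm (R.block_rep k \<psi> x) \<le> (real (d * k))\<^sup>2 * red_norm x" if "x \<in> S" for x
    by (rule R.block_rep_bounded[OF hom k that])
  moreover have "0 < d * k" by (rule mult_pos_pos[OF d k])
  ultimately show "\<exists>d>0. \<exists>\<Psi> K. star_hom_mat (section_algebra (action_bundle D \<alpha>)) d \<Psi> \<and>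
      (\<forall>x\<in>S. mat_norm (\<Psi> x) \<le> K * red_norm x) \<and> (\<forall>x\<in>\<Omega>. red_norm x - e \<le> mat_norm (\<Psi> x))"
    by blast
qed

end

theorem proposition4p4:
  fixes D :: "'g::group_add \<Rightarrow> 'a::cstar_algebra set"
    and \<alpha> :: "'g \<Rightarrow> 'a \<Rightarrow> 'a"
  assumes "partial_dynamical_system D \<alpha>"
  shows "(rfd_action D \<alpha> \<longleftrightarrow> rfd_bundle (action_bundle D \<alpha>)) \<and>
    (rfd_algebra (reduced_crossed_product D \<alpha>) \<longrightarrow> rfd_action D \<alpha>) \<and>
    (separable_space (euclidean :: 'a topology) \<and> countable (UNIV :: 'g set) \<and>
      rfd_action D \<alpha> \<and>
      rfd_algebra (reduced_group_algebra :: (nat \<Rightarrow> 'g \<Rightarrow> complex) set star_alg) \<longrightarrow>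
      rfd_algebra (reduced_crossed_product D \<alpha>))"
proof -
  interpret partial_system D \<alpha> by unfold_locales (rule assms)
  show ?thesis
    using rfd_action_iff_rfd_bundle rfd_bundle_if_rfd_crossed_product rfd_crossed_product_if_rfd_action by blast
qed

end
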